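(* Grant the well-posedness assumption and the noise-scaling assumption (stated in the context). Fix $0<t\le T$ and a bounded non-empty (non-degenerate) interval $A\subset\mathbb R$. Define the occupation time and the occupation measure of $(X_t(y))_{y\in\Gamma}$ at $A$ by $$M(A)=\int_\Gamma\mathbf 1_A(X_t(y))\,\mathrm dy,\qquad\mu(A)=\mathrm E[M(A)]=\int_\Gamma\mathrm P(X_t(y)\in A)\,\mathrm dy.$$ Then $\mu(A)\sim|A|$ and $$\frac{M(A)}{\mu(A)}\xrightarrow{\mathrm P}1$$ as $\nu\to0$.
   Context: Setting. Fix $T>0$, $d\in\mathbb N$, $\bar\nu>0$ and an open bounded $\Lambda\subset\mathbb R^d$ with Lipschitz boundary; $\mathcal H=L^2(\Lambda)$ has inner product $\langle\cdot,\cdot\rangle$ and norm $\|\cdot\|$. $B$ is a bounded linear operator on $\mathcal H$ with operator norm $\|B\|$, $Q=BB^*$, $\mathbb H$ is the closure of $\mathcal H$ under the norm induced by $\langle\cdot,\cdot\rangle_{\mathbb H}=\langle Q\,\cdot,\cdot\rangle$, and $\mathfrak H=L^2([0,T],\mathbb H)$. $(W_t)_{t\in[0,T]}$ is a cylindrical $Q$-Wiener process with natural filtration $(\mathcal F_t)$; its formal time derivative is regarded as an isonormal Gaussian process $\mathcal W$ on $\mathfrak H$. For diffusivity $0<\nu\le\bar\nu$ and noise level $\sigma=\sigma(\nu)>0$ consider on $\Lambda$, with Dirichlet or Neumann boundary conditions and deterministic bounded initial condition $X_0\in C(\Lambda)$, the SPDE $$\mathrm dX_t=\nu A_tX_t\,\mathrm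 dt+F(X_t)\,\mathrm dt+\sigma\,\mathrm dW_t,\quad 0\le t\le T,\qquad F(z)=f\circ z,\ f:\mathbb R\to\mathbb R,$$ where $(A_t)_{t\in[0,T]}$ are unbounded linear operators on $\mathcal H$. The observation window $\Gamma\subset\Lambda$ is bounded and connected with Lebesgue measure $|\Gamma|>0$. Well-posedness assumption: (i) $f$ is globally Lipschitz with a.e. derivative $f'$ and Lipschitz constant $\|f'\|_\infty<\infty$. (ii) $\mathrm{dom}(A_t)=\mathrm{dom}(A_0)$, $\mathrm{dom}(A_t^* )=\mathrm{dom}(A_0^* )$ for all $t\in[0,T]$, and $C_c^\infty(\Lambda)\subset\mathrm{dom}(A_0^* )$. For every $0<\nu\le\bar\nu$, the equation $\partial_tu_t=\nu A_tu_t$, $0\le\underline t\le t\le T$, $u_{\underline t}=\xi\in\mathrm{dom}(A_0)$, is solved by $u_t=\mathcal S_{\nu,t,\underline t}\xi=\int_\Lambda G_{\nu,t,\underline t}(\cdot,\eta)\xi(\eta)\,\mathrm d\eta$, $\underline t<t\le T$, for a non-negative Green function $G_{\nu,\cdot,\underline t}(\cdot,\cdot):(\underline t,T]\times\Lambda\times\Lambda\to[0,\infty)$. There is $C_0>0$ with $\max(\|\mathcal S_{\nu,t,\underline t}\|,\|G_{\nu,t,\underline t}(y,\cdot)\|_{L^1(\Lambda)})\le C_0$ for all $0\le\underline t<t\le T$, $y\in\Lambda$, $0<\nu\le\bar\nu$, and $\partial_t\mathcal S^*_{\nu,t,\underline t}\xi=\nu A_t^*\mathcal S^*_{\nu,t,\underline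 t}\xi=\nu\mathcal S^*_{\nu,t,\underline t}A_t^*\xi$ for $\xi\in\mathrm{dom}(A_0^* )$, $0\le\underline t<t\le T$, $0<\nu\le\bar\nu$. (iii) $\sup_{y\in\Lambda}\int_0^t\|G_{\nu,t,s}(y,\cdot)\|_{\mathbb H}^2\,\mathrm ds<\infty$ for all $t\ge0$, $0<\nu\le\bar\nu$. Solution. $X$ is the random field solution $X_t(y)=\int_\Lambda G_{\nu,t,0}(y,\eta)X_0(\eta)\,\mathrm d\eta+\int_0^t\int_\Lambda G_{\nu,t,s}(y,\eta)f(X_s(\eta))\,\mathrm d\eta\,\mathrm ds+\sigma\int_0^t\int_\Lambda G_{\nu,t,s}(y,\eta)\,\mathcal W(\mathrm d\eta,\mathrm ds)$; $\mathrm P$ denotes its law and $\mathrm E$ the expectation. Noise-scaling assumption: $\sigma=\sigma(\nu)\to0$ as $\nu\to0$ and there are constants $0<\underline C\le\bar C<\infty$, $0<\alpha<1$ such that for all $0\le\underline t<T$, $0\le t\le T-\underline t$, $0<\nu\le\bar\nu$: $\sigma(\nu)^2\int_0^t\|G_{\nu,\underline t+t,\underline t+s}(y,\cdot)\|_{\mathbb H}^2\,\mathrm ds\le\bar Ct^\alpha$ for all $y\in\Lambda$, and $\ge\underline Ct^\alpha$ for all $y\in\Gamma$. Notation: $|A|$ is Lebesgue measure; $a\lesssim b$ means $a\le Cb$ with $C$ depending only on non-asymptotic quantities (in particular not on $\nu,\sigma$), and $a\sim b$ means $a\lesssim b$ and $b\lesssim a$. *)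

theory Defs
  imports "HOL-Probability.Probability"
begin

section \<open>Domains and test functions\<close>

text \<open>Near every boundary point, \<open>S\<close> is the part of a ball lying strictly above the graph of a
  Lipschitz function \<open>g\<close> over the hyperplane orthogonal to a unit vector \<open>e\<close>.\<close>

definition lipschitz_boundary :: "'a::euclidean_space set \<Rightarrow> bool" where
  "lipschitz_boundary S \<longleftrightarrow>
     (\<forall>x\<in>frontier S. \<exists>r>0. \<exists>e g L. norm e = 1 \<and> L-lipschitz_on {z. z \<bullet> e = 0} g \<and>
        S \<inter> ball x r = {z \<in> ball x r. g (z - (z \<bullet> e) *\<^sub>R e) < z \<bullet> e})"

fun C_k :: "nat \<Rightarrow> ('a::euclidean_space \<Rightarrow> real) \<Rightarrow> bool" where
  "C_k 0 f \<longleftrightarrow> continuous_on UNIV f"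
| "C_k (Suc k) f \<longleftrightarrow> (\<forall>x. f differentiable (at x)) \<and>
     (\<forall>b\<in>Basis. C_k k (\<lambda>x. frechet_derivative f (at x) b))"

definition test_functions :: "'a::euclidean_space set \<Rightarrow> ('a \<Rightarrow> real) set" where
  "test_functions S =
     {f. (\<forall>k. C_k k f) \<and> compact (closure {x. f x \<noteq> 0}) \<and> closure {x. f x \<noteq> 0} \<subseteq> S}"

section \<open>The space \<open>L\<^sup>2\<close> and its operators\<close>

text \<open>Elements of \<open>L\<^sup>2(S)\<close> are represented by functions; equality in \<open>L\<^sup>2(S)\<close> is \<open>L2_eq\<close>.\<close>

definition L2 :: "'a::euclidean_space set \<Rightarrow> ('a \<Rightarrow> real) set" where
  "L2 S = {u \<in> borel_measurable (lebesgue_on S). integrable (lebesgue_on S) (\<lambda>x. (u x)\<^sup>2)}"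

definition L2_eq :: "'a::euclidean_space set \<Rightarrow> ('a \<Rightarrow> real) \<Rightarrow> ('a \<Rightarrow> real) \<Rightarrow> bool" where
  "L2_eq S u v \<longleftrightarrow> (AE x in lebesgue_on S. u x = v x)"

definition L2_inner :: "'a::euclidean_space set \<Rightarrow> ('a \<Rightarrow> real) \<Rightarrow> ('a \<Rightarrow> real) \<Rightarrow> real" where
  "L2_inner S u v = (LINT x|lebesgue_on S. u x * v x)"

definition L2_norm :: "'a::euclidean_space set \<Rightarrow> ('a \<Rightarrow> real) \<Rightarrow> real" where
  "L2_norm S u = sqrt (L2_inner S u u)"

text \<open>A (possibly unbounded) linear operator \<open>A\<close> on \<open>L\<^sup>2(S)\<close> with domain \<open>D\<close>.\<close>

definition linear_operator ::
  "'a::euclidean_space set \<Rightarrow> ('a \<Rightarrow> real) set \<Rightarrow> (('a \<Rightarrow> real) \<Rightarrow> 'a \<Rightarrow> real) \<Rightarrow> bool" where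
  "linear_operator S D A \<longleftrightarrow>
     D \<subseteq> L2 S \<and> (\<lambda>x. 0) \<in> D \<and>
     (\<forall>u\<in>D. A u \<in> L2 S) \<and>
     (\<forall>u\<in>D. \<forall>v\<in>L2 S. L2_eq S u v \<longrightarrow> v \<in> D \<and> L2_eq S (A u) (A v)) \<and>
     (\<forall>u\<in>D. \<forall>v\<in>D. \<forall>c. (\<lambda>x. u x + c * v x) \<in> D \<and>
        L2_eq S (A (\<lambda>x. u x + c * v x)) (\<lambda>x. A u x + c * A v x))"

definition densely_defined :: "'a::euclidean_space set \<Rightarrow> ('a \<Rightarrow> real) set \<Rightarrow> bool" where
  "densely_defined S D \<longleftrightarrow> (\<forall>u\<in>L2 S. \<forall>\<epsilon>>0. \<exists>v\<in>D. L2_norm S (\<lambda>x. u x - v x) < \<epsilon>)"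

definition bounded_operator ::
  "'a::euclidean_space set \<Rightarrow> (('a \<Rightarrow> real) \<Rightarrow> 'a \<Rightarrow> real) \<Rightarrow> bool" where
  "bounded_operator S B \<longleftrightarrow>
     linear_operator S (L2 S) B \<and> (\<exists>K. \<forall>u\<in>L2 S. L2_norm S (B u) \<le> K * L2_norm S u)"

text \<open>The graph of the adjoint: \<open>v \<in> dom(A\<^sup>*)\<close> and \<open>A\<^sup>* v = w\<close>. For densely defined \<open>A\<close> the
  element \<open>w\<close> of \<open>L\<^sup>2(S)\<close> is unique.\<close>

definition adjoint_graph :: "'a::euclidean_space set \<Rightarrow> ('a \<Rightarrow> real) set \<Rightarrow>
    (('a \<Rightarrow> real) \<Rightarrow> 'a \<Rightarrow> real) \<Rightarrow> ('a \<Rightarrow> real) \<Rightarrow> ('a \<Rightarrow> real) \<Rightarrow> bool" where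
  "adjoint_graph S D A v w \<longleftrightarrow>
     v \<in> L2 S \<and> w \<in> L2 S \<and> (\<forall>u\<in>D. L2_inner S (A u) v = L2_inner S u w)"

definition adjoint_dom :: "'a::euclidean_space set \<Rightarrow> ('a \<Rightarrow> real) set \<Rightarrow>
    (('a \<Rightarrow> real) \<Rightarrow> 'a \<Rightarrow> real) \<Rightarrow> ('a \<Rightarrow> real) set" where
  "adjoint_dom S D A = {v. \<exists>w. adjoint_graph S D A v w}"

text \<open>\<open>Q = B B\<^sup>*\<close>\<close>

definition is_BB_adjoint :: "'a::euclidean_space set \<Rightarrow> (('a \<Rightarrow> real) \<Rightarrow> 'a \<Rightarrow> real) \<Rightarrow>
    (('a \<Rightarrow> real) \<Rightarrow> 'a \<Rightarrow> real) \<Rightarrow> bool" where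
  "is_BB_adjoint S B Q \<longleftrightarrow>
     (\<forall>u\<in>L2 S. \<exists>w. adjoint_graph S (L2 S) B u w \<and> Q u \<in> L2 S \<and> L2_eq S (Q u) (B w))"

text \<open>The curve \<open>u\<close> in \<open>L\<^sup>2(S)\<close> has the norm derivative \<open>v\<close> at \<open>t\<close> relative to the time set \<open>I\<close>.\<close>

definition L2_has_derivative :: "'a::euclidean_space set \<Rightarrow> (real \<Rightarrow> 'a \<Rightarrow> real) \<Rightarrow>
    ('a \<Rightarrow> real) \<Rightarrow> real \<Rightarrow> real set \<Rightarrow> bool" where
  "L2_has_derivative S u v t I \<longleftrightarrow>
     ((\<lambda>s. L2_norm S (\<lambda>x. (u s x - u t x) / (s - t) - v x)) \<longlongrightarrow> 0) (at t within I)"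

section \<open>The noise\<close>

text \<open>The closure of \<open>L\<^sup>2(S)\<close> under the (semi-)norm induced by \<open>\<langle>Q \<cdot>, \<cdot>\<rangle>\<close> is the Hilbert space type
  \<open>'h\<close>, with canonical map \<open>\<iota>\<close>. Being separable, it carries the class
  \<open>second_countable_topology\<close>.\<close>

definition is_completion :: "'a::euclidean_space set \<Rightarrow> (('a \<Rightarrow> real) \<Rightarrow> 'a \<Rightarrow> real) \<Rightarrow>
    (('a \<Rightarrow> real) \<Rightarrow> 'h::{real_inner,banach,second_countable_topology}) \<Rightarrow> bool" where
  "is_completion S Q \<iota> \<longleftrightarrow>
     (\<forall>u\<in>L2 S. \<forall>v\<in>L2 S. \<forall>c. \<iota> (\<lambda>x. u x + c * v x) = \<iota> u + c *\<^sub>R \<iota> v) \<and>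
     (\<forall>u\<in>L2 S. \<forall>v\<in>L2 S. \<iota> u \<bullet> \<iota> v = L2_inner S (Q u) v) \<and>
     closure (\<iota> ` L2 S) = UNIV"

text \<open>A function \<open>g\<close> on \<open>S\<close> that need not be square integrable is identified with \<open>h\<close> in the
  completion if \<open>\<langle>h, u\<rangle> = \<integral> g Q u\<close> for all \<open>u \<in> L\<^sup>2(S)\<close>. By density \<open>h\<close> is unique, and it is \<open>\<iota> g\<close>
  if \<open>g \<in> L\<^sup>2(S)\<close>.\<close>

definition represents :: "'a::euclidean_space set \<Rightarrow> (('a \<Rightarrow> real) \<Rightarrow> 'a \<Rightarrow> real) \<Rightarrow>
    (('a \<Rightarrow> real) \<Rightarrow> 'h::{real_inner,banach,second_countable_topology}) \<Rightarrow>
    ('a \<Rightarrow> real) \<Rightarrow> 'h \<Rightarrow> bool" where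
  "represents S Q \<iota> g h \<longleftrightarrow>
     g \<in> borel_measurable (lebesgue_on S) \<and>
     (\<forall>u\<in>L2 S. integrable (lebesgue_on S) (\<lambda>x. g x * Q u x) \<and>
        h \<bullet> \<iota> u = (LINT x|lebesgue_on S. g x * Q u x))"

definition to_H :: "'a::euclidean_space set \<Rightarrow> (('a \<Rightarrow> real) \<Rightarrow> 'a \<Rightarrow> real) \<Rightarrow>
    (('a \<Rightarrow> real) \<Rightarrow> 'h::{real_inner,banach,second_countable_topology}) \<Rightarrow>
    ('a \<Rightarrow> real) \<Rightarrow> 'h" where
  "to_H S Q \<iota> g = (THE h. represents S Q \<iota> g h)"

lemma represents_unique:
  assumes "is_completion S Q \<iota>" "represents S Q \<iota> g h" "represents S Q \<iota> g k"
  shows "h = k"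
proof -
  have "closed {z. (h - k) \<bullet> z = 0}"
    by (intro closed_Collect_eq continuous_intros)
  moreover have "\<iota> ` L2 S \<subseteq> {z. (h - k) \<bullet> z = 0}"
    using assms(2,3) by (auto simp: represents_def inner_diff_left)
  ultimately have "closure (\<iota> ` L2 S) \<subseteq> {z. (h - k) \<bullet> z = 0}"
    by (intro closure_minimal)
  then have "(h - k) \<bullet> (h - k) = 0"
    using assms(1) unfolding is_completion_def by blast
  then show ?thesis by simp
qed

lemma to_H_L2:
  assumes C: "is_completion S Q \<iota>" and Q: "\<And>u. u \<in> L2 S \<Longrightarrow> Q u \<in> L2 S" and g: "g \<in> L2 S"
  shows "to_H S Q \<iota> g = \<iota> g"
proof -
  have "represents S Q \<iota> g (\<iota> g)"
    unfolding represents_def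
  proof (intro conjI ballI)
    show "g \<in> borel_measurable (lebesgue_on S)"
      using g by (simp add: L2_def)
    fix u assume u: "u \<in> L2 S"
    have m: "integrable (lebesgue_on S) (\<lambda>x. (g x)\<^sup>2 + (Q u x)\<^sup>2)"
      using g Q[OF u] by (simp add: L2_def)
    show "integrable (lebesgue_on S) (\<lambda>x. g x * Q u x)"
    proof (rule Bochner_Integration.integrable_bound[OF m])
      show "(\<lambda>x. g x * Q u x) \<in> borel_measurable (lebesgue_on S)"
        using g Q[OF u] by (intro borel_measurable_times) (auto simp: L2_def)
      have "\<bar>a * b\<bar> \<le> a\<^sup>2 + b\<^sup>2" for a b :: real
      proof -
        have "2 * (\<bar>a\<bar> * \<bar>b\<bar>) \<le> a\<^sup>2 + b\<^sup>2"
          using sum_squares_bound[of "\<bar>a\<bar>" "\<bar>b\<bar>"] by (simp add: mult.assoc)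
        moreover have "0 \<le> \<bar>a\<bar> * \<bar>b\<bar>" by simp
        ultimately show ?thesis unfolding abs_mult by linarith
      qed
      then show "AE x in lebesgue_on S. norm (g x * Q u x) \<le> norm ((g x)\<^sup>2 + (Q u x)\<^sup>2)"
        by auto
    qed
    have "\<iota> g \<bullet> \<iota> u = L2_inner S (Q u) g"
      using C g u by (simp add: is_completion_def inner_commute[of "\<iota> g"])
    then show "\<iota> g \<bullet> \<iota> u = (LINT x|lebesgue_on S. g x * Q u x)"
      by (simp add: L2_inner_def mult.commute)
  qed
  then show ?thesis
    unfolding to_H_def using represents_unique[OF C] by blast
qed

text \<open>The space \<open>L\<^sup>2([0,T], 'h)\<close>.\<close>

definition L2_time ::
  "real \<Rightarrow> (real \<Rightarrow> 'h::{real_inner,banach,second_countable_topology}) set" where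
  "L2_time T = {h \<in> borel_measurable (lebesgue_on {0..T}).
     integrable (lebesgue_on {0..T}) (\<lambda>s. (norm (h s))\<^sup>2)}"

definition centred_gaussian :: "'w measure \<Rightarrow> ('w \<Rightarrow> real) \<Rightarrow> real \<Rightarrow> bool" where
  "centred_gaussian P Y v \<longleftrightarrow> Y \<in> borel_measurable P \<and> 0 \<le> v \<and>
     distr P borel Y =
       (if v = 0 then return borel 0 else density lborel (normal_density 0 (sqrt v)))"

text \<open>\<open>W\<close> is a centred Gaussian family indexed by \<open>L\<^sup>2([0,T], 'h)\<close> with covariance the inner
  product. The underlying cylindrical Wiener process is \<open>\<langle>W\<^sub>t, u\<rangle> = W (1\<^bsub>[0,t]\<^esub> \<iota> u)\<close>.\<close>

definition isonormal :: "'w measure \<Rightarrow> real \<Rightarrow>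
    ((real \<Rightarrow> 'h::{real_inner,banach,second_countable_topology}) \<Rightarrow> 'w \<Rightarrow> real) \<Rightarrow> bool" where
  "isonormal P T W \<longleftrightarrow>
     (\<forall>I c. finite I \<and> I \<subseteq> L2_time T \<longrightarrow>
        (\<exists>v. centred_gaussian P (\<lambda>\<omega>. \<Sum>h\<in>I. c h * W h \<omega>) v)) \<and>
     (\<forall>h\<in>L2_time T. \<forall>k\<in>L2_time T.
        (LINT \<omega>|P. W h \<omega> * W k \<omega>) = (LINT s|lebesgue_on {0..T}. h s \<bullet> k s))"

section \<open>The semi-linear SPDE\<close>

text \<open>\<open>G \<nu> t s y \<eta>\<close> is the Green function with final time \<open>t\<close> and initial time \<open>s < t\<close>.\<close>

type_synonym 'a green = "real \<Rightarrow> real \<Rightarrow> real \<Rightarrow> 'a \<Rightarrow> 'a \<Rightarrow> real"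

definition evolution :: "'a::euclidean_space set \<Rightarrow> 'a green \<Rightarrow> real \<Rightarrow> real \<Rightarrow> real \<Rightarrow>
    ('a \<Rightarrow> real) \<Rightarrow> 'a \<Rightarrow> real" where
  "evolution S G \<nu> t s u = (\<lambda>y. LINT \<eta>|lebesgue_on S. G \<nu> t s y \<eta> * u \<eta>)"

text \<open>\<open>A t\<close> has domain \<open>D t\<close>. The boundary conditions are part of these domains.\<close>

definition well_posed :: "'a::euclidean_space set \<Rightarrow> real \<Rightarrow> real \<Rightarrow>
    (('a \<Rightarrow> real) \<Rightarrow> 'a \<Rightarrow> real) \<Rightarrow>
    (('a \<Rightarrow> real) \<Rightarrow> 'h::{real_inner,banach,second_countable_topology}) \<Rightarrow>
    (real \<Rightarrow> ('a \<Rightarrow> real) set) \<Rightarrow> (real \<Rightarrow> ('a \<Rightarrow> real) \<Rightarrow> 'a \<Rightarrow> real) \<Rightarrow>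
    'a green \<Rightarrow> (real \<Rightarrow> real) \<Rightarrow> bool" where
  "well_posed \<Lambda> T \<nu>max Q \<iota> D A G f \<longleftrightarrow>
     \<comment> \<open>(i)\<close>
     (\<exists>L. L-lipschitz_on UNIV f) \<and>
     \<comment> \<open>(ii)\<close>
     (\<forall>t\<in>{0..T}. linear_operator \<Lambda> (D t) (A t) \<and> densely_defined \<Lambda> (D t) \<and> D t = D 0 \<and>
        adjoint_dom \<Lambda> (D t) (A t) = adjoint_dom \<Lambda> (D 0) (A 0)) \<and>
     test_functions \<Lambda> \<subseteq> adjoint_dom \<Lambda> (D 0) (A 0) \<and>
     (\<forall>\<nu>\<in>{0<..\<nu>max}.
        (\<lambda>(t, s, y, \<eta>). G \<nu> t s y \<eta>) \<in> borel_measurable (restrict_space borel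
           {(t, s, y, \<eta>). 0 \<le> s \<and> s < t \<and> t \<le> T \<and> y \<in> \<Lambda> \<and> \<eta> \<in> \<Lambda>})) \<and>
     (\<forall>\<nu>\<in>{0<..\<nu>max}. \<forall>s t. 0 \<le> s \<and> s < t \<and> t \<le> T \<longrightarrow>
        (\<forall>y\<in>\<Lambda>. \<forall>\<eta>\<in>\<Lambda>. 0 \<le> G \<nu> t s y \<eta>)) \<and>
     (\<forall>\<nu>\<in>{0<..\<nu>max}. \<forall>s\<in>{0..<T}. \<forall>\<xi>\<in>D 0.
        let u = (\<lambda>t. if t = s then \<xi> else evolution \<Lambda> G \<nu> t s \<xi>)
        in \<forall>t\<in>{s..T}. u t \<in> D t \<and>
             L2_has_derivative \<Lambda> u (\<lambda>x. \<nu> * A t (u t) x) t {s..T}) \<and>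
     (\<exists>C0>0. \<forall>\<nu>\<in>{0<..\<nu>max}. \<forall>s t. 0 \<le> s \<and> s < t \<and> t \<le> T \<longrightarrow>
        (\<forall>u\<in>L2 \<Lambda>.
           (AE y in lebesgue_on \<Lambda>. integrable (lebesgue_on \<Lambda>) (\<lambda>\<eta>. G \<nu> t s y \<eta> * u \<eta>)) \<and>
           evolution \<Lambda> G \<nu> t s u \<in> L2 \<Lambda> \<and>
           L2_norm \<Lambda> (evolution \<Lambda> G \<nu> t s u) \<le> C0 * L2_norm \<Lambda> u) \<and>
        (\<forall>y\<in>\<Lambda>. integrable (lebesgue_on \<Lambda>) (G \<nu> t s y) \<and>
           (LINT \<eta>|lebesgue_on \<Lambda>. \<bar>G \<nu> t s y \<eta>\<bar>) \<le> C0)) \<and>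
     \<comment> \<open>below, \<open>U t\<close> is the adjoint of the evolution operator applied to \<open>\<xi>\<close>, and \<open>w\<close> is
        both \<open>A\<^sup>*\<close> of it and the adjoint evolution of \<open>z = A\<^sup>* \<xi>\<close>\<close>
     (\<forall>\<nu>\<in>{0<..\<nu>max}. \<forall>s\<in>{0..<T}. \<forall>\<xi>\<in>adjoint_dom \<Lambda> (D 0) (A 0).
        \<exists>U. \<forall>t\<in>{s<..T}. adjoint_graph \<Lambda> (L2 \<Lambda>) (evolution \<Lambda> G \<nu> t s) \<xi> (U t) \<and>
          (\<exists>z w. adjoint_graph \<Lambda> (D t) (A t) (U t) w \<and>
             adjoint_graph \<Lambda> (D t) (A t) \<xi> z \<and>
             adjoint_graph \<Lambda> (L2 \<Lambda>) (evolution \<Lambda> G \<nu> t s) z w \<and>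
             L2_has_derivative \<Lambda> U (\<lambda>x. \<nu> * w x) t {s<..T})) \<and>
     \<comment> \<open>(iii), including that the Green function takes values in the completion\<close>
     (\<forall>\<nu>\<in>{0<..\<nu>max}. \<forall>t\<in>{0..T}.
        (\<forall>y\<in>\<Lambda>. AE s in lebesgue_on {0..t}. \<exists>h. represents \<Lambda> Q \<iota> (G \<nu> t s y) h) \<and>
        (SUP y\<in>\<Lambda>. \<integral>\<^sup>+s. ennreal ((norm (to_H \<Lambda> Q \<iota> (G \<nu> t s y)))\<^sup>2) \<partial>lebesgue_on {0..t}) < \<infinity>)"

definition noise_scaling :: "'a::euclidean_space set \<Rightarrow> 'a set \<Rightarrow> real \<Rightarrow> real \<Rightarrow>
    (('a \<Rightarrow> real) \<Rightarrow> 'a \<Rightarrow> real) \<Rightarrow>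
    (('a \<Rightarrow> real) \<Rightarrow> 'h::{real_inner,banach,second_countable_topology}) \<Rightarrow>
    'a green \<Rightarrow> (real \<Rightarrow> real) \<Rightarrow> bool" where
  "noise_scaling \<Lambda> \<Gamma> T \<nu>max Q \<iota> G \<sigma> \<longleftrightarrow>
     (\<sigma> \<longlongrightarrow> 0) (at_right 0) \<and>
     (\<exists>Cl Cu \<alpha>. 0 < Cl \<and> Cl \<le> Cu \<and> 0 < \<alpha> \<and> \<alpha> < 1 \<and>
       (\<forall>r\<in>{0..<T}. \<forall>t\<in>{0..T - r}. \<forall>\<nu>\<in>{0<..\<nu>max}.
         let V = (\<lambda>y. ennreal ((\<sigma> \<nu>)\<^sup>2) *
           (\<integral>\<^sup>+s. ennreal ((norm (to_H \<Lambda> Q \<iota> (G \<nu> (r + t) (r + s) y)))\<^sup>2) \<partial>lebesgue_on {0..t}))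
         in (\<forall>y\<in>\<Lambda>. V y \<le> ennreal (Cu * t powr \<alpha>)) \<and>
            (\<forall>y\<in>\<Gamma>. ennreal (Cl * t powr \<alpha>) \<le> V y)))"

text \<open>\<open>X t y\<close> is a random variable. The integrand of the stochastic integral is deterministic, so
  that the integral is \<open>W\<close> applied to it. Bounded second moments are part of the notion of a random
  field solution: they make the drift integral well-defined and the solution unique up to
  modification.\<close>

definition random_field_solution :: "'w measure \<Rightarrow> 'a::euclidean_space set \<Rightarrow> real \<Rightarrow>
    (('a \<Rightarrow> real) \<Rightarrow> 'a \<Rightarrow> real) \<Rightarrow>
    (('a \<Rightarrow> real) \<Rightarrow> 'h::{real_inner,banach,second_countable_topology}) \<Rightarrow>
    ((real \<Rightarrow> 'h) \<Rightarrow> 'w \<Rightarrow> real) \<Rightarrow>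
    'a green \<Rightarrow> (real \<Rightarrow> real) \<Rightarrow> ('a \<Rightarrow> real) \<Rightarrow> real \<Rightarrow> real \<Rightarrow>
    (real \<Rightarrow> 'a \<Rightarrow> 'w \<Rightarrow> real) \<Rightarrow> bool" where
  "random_field_solution P \<Lambda> T Q \<iota> W G f X0 \<nu> \<sigma>\<nu> X \<longleftrightarrow>
     (\<lambda>(\<omega>, t, y). X t y \<omega>) \<in> borel_measurable (P \<Otimes>\<^sub>M restrict_space borel ({0..T} \<times> \<Lambda>)) \<and>
     (\<exists>K. \<forall>t\<in>{0..T}. \<forall>y\<in>\<Lambda>.
        integrable P (\<lambda>\<omega>. (X t y \<omega>)\<^sup>2) \<and> (LINT \<omega>|P. (X t y \<omega>)\<^sup>2) \<le> K) \<and>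
     (\<forall>y\<in>\<Lambda>. AE \<omega> in P. X 0 y \<omega> = X0 y) \<and>
     (\<forall>t\<in>{0<..T}. \<forall>y\<in>\<Lambda>. AE \<omega> in P.
        X t y \<omega> =
          (LINT \<eta>|lebesgue_on \<Lambda>. G \<nu> t 0 y \<eta> * X0 \<eta>) +
          (LINT s|lebesgue_on {0..t}. LINT \<eta>|lebesgue_on \<Lambda>. G \<nu> t s y \<eta> * f (X s \<eta> \<omega>)) +
          \<sigma>\<nu> * W (\<lambda>s. if 0 \<le> s \<and> s < t then to_H \<Lambda> Q \<iota> (G \<nu> t s y) else 0) \<omega>)"

section \<open>Occupation time and occupation measure\<close>

definition occupation_time :: "'a::euclidean_space set \<Rightarrow> ('a \<Rightarrow> 'w \<Rightarrow> real) \<Rightarrow> real set \<Rightarrow>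
    'w \<Rightarrow> real" where
  "occupation_time \<Gamma> Y A \<omega> = (LINT y|lebesgue_on \<Gamma>. indicator A (Y y \<omega>))"

definition occupation_measure :: "'w measure \<Rightarrow> 'a::euclidean_space set \<Rightarrow>
    ('a \<Rightarrow> 'w \<Rightarrow> real) \<Rightarrow> real set \<Rightarrow> real" where
  "occupation_measure P \<Gamma> Y A = (LINT \<omega>|P. occupation_time \<Gamma> Y A \<omega>)"

definition nondegenerate_interval :: "real set \<Rightarrow> bool" where
  "nondegenerate_interval A \<longleftrightarrow> is_interval A \<and> bounded A \<and> interior A \<noteq> {}"

end

theory Submission
  imports Defs
begin

text \<open>Write the solution at a point as the Volterra fixed point driven by the Gaussian field
  \<open>W (g (t, y))\<close>. Projecting the noise onto finitely many orthonormal directions turns the solution into a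
  function of finitely many independent standard normals, and the error of this approximation tends to zero.

  The bounds on the occupation measure come from a single direction: the part of \<open>g (t, y)\<close> living on
  \<open>[t - \<delta>, t)\<close>, normalised. By the noise scaling it shifts the field by \<open>\<delta>\<^sup>\<alpha>\<^sup>/\<^sup>2\<close> up to constants, while the
  drift answers with at most \<open>\<delta>\<close> times that. For small \<open>\<delta>\<close>, chosen independently of the diffusivity, the
  field at \<open>(t, y)\<close> is therefore bi-Lipschitz in this coordinate, and its law is comparable with Lebesgue measure.

  The convergence comes from Gaussian concentration. As an \<open>L\<^sup>2(\<Lambda>)\<close>-valued function of all coordinates the
  solution is Lipschitz with a constant of order \<open>\<sigma>\<close>, because \<open>h \<mapsto> \<langle>g (t, \<cdot>), h\<rangle>\<close> has operator norm of
  order \<open>\<sigma>\<close>. Hence occupation functionals with a Lipschitz weight in place of the indicator deviate from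
  their mean by \<open>O(\<sigma>)\<close>, and the upper bound on the law controls the error made by the weight.
  Concentration is obtained from the Prekopa--Leindler inequality through Maurey's property \<open>(\<tau>)\<close>.\<close>

\<comment> \<open>The variance of the field at a point stays of order one as the noise level
  vanishes, so nothing becomes deterministic pointwise; the limit rests on decorrelation across
  space. Hence every constant has to be free of the diffusivity, and a locale for one fixed
  diffusivity takes the shared constants as parameters. Hence also the concentration bound has to be
  free of the dimension, since the approximation uses an unbounded number of Gaussian coordinates.
  The kernels \<open>g a\<close> carry no regularity in \<open>a\<close> that could feed a
  compactness argument. The finite families are found by nearly minimising the total unexplained
  variance over all finite orthonormal families: if the residual covariance were not small, an
  enlargement with a smaller total would exist. Measurability in \<open>a\<close> is read off from
  covariances with a jointly measurable version of the noise. An approximation in mean square over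
  space and time does not see a single point. There the family is enlarged until it explains the
  noise at that point exactly, which leaves only the drift, whose kernel is merely
  integrable.\<close>
syntax "_nint" :: "pttrn => 'a measure => ennreal => ennreal" ("NINT (1_)/|(_)./ _" [0, 110, 60] 60)
translations "NINT x|M. f" == "CONST nn_integral M (%x. f)"

abbreviation bm :: "'a measure => ('a => 'b::topological_space) set" where
  "bm M \<equiv> M \<rightarrow>\<^sub>M borel"

section \<open>The Prekopa--Leindler inequality\<close>

text \<open>Inner regularity is used for finite measures, hence the cut-off to the windows
  \<open>{- real n..real n}\<close>, which exhaust the line.\<close>

lemma emeasure_lborel_inner_compact:
  fixes A :: "real set"
  assumes A: "A \<in> sets borel"
  shows "emeasure lborel A <= (SUP K\<in>{K. K \<subseteq> A \<and> compact K}. emeasure lborel K)"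
proof -
  define M where "M n = density lborel (indicator {- real n..real n} :: real => ennreal)" for n :: nat
  have M: "emeasure (M n) B = emeasure lborel (B \<inter> {- real n..real n})" if "B \<in> sets borel" for n B
    using that unfolding M_def by (subst emeasure_density) (auto simp: Int_commute simp flip: indicator_inter_arith)
  have "emeasure lborel (A \<inter> {- real n..real n}) <= (SUP K\<in>{K. K \<subseteq> A \<and> compact K}. emeasure lborel K)" for n
  proof -
    have "emeasure (M n) A = (SUP K\<in>{K. K \<subseteq> A \<and> compact K}. emeasure (M n) K)"
      by (rule inner_regular) (use A M[of UNIV n] in \<open>auto simp: M_def\<close>)
    also have "... <= (SUP K\<in>{K. K \<subseteq> A \<and> compact K}. emeasure lborel K)"
    proof (rule SUP_mono)
      fix K assume K: "K \<in> {K. K \<subseteq> A \<and> compact K}"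
      then have "K \<in> sets borel" by (auto intro: compact_imp_closed borel_closed)
      then have "emeasure (M n) K <= emeasure lborel K"
        by (subst M) (auto intro!: emeasure_mono)
      then show "\<exists>m\<in>{K. K \<subseteq> A \<and> compact K}. emeasure (M n) K <= emeasure lborel m" using K by blast
    qed
    finally show ?thesis using M[OF A] by simp
  qed
  moreover have "emeasure lborel A = (SUP n. emeasure lborel (A \<inter> {- real n..real n}))"
  proof -
    have "(SUP n. emeasure lborel (A \<inter> {- real n..real n})) = emeasure lborel (\<Union>n. A \<inter> {- real n..real n})"
      by (rule SUP_emeasure_incseq) (use A in \<open>auto simp: incseq_def\<close>)
    also have "(\<Union>n. A \<inter> {- real n..real n}) = A"
    proof -
      have "\<exists>n. x \<in> {- real n..real n}" for x
        using real_arch_simple[of "\<bar>x\<bar>"] by (auto simp: abs_le_iff minus_le_iff)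
      then show ?thesis by blast
    qed
    finally show ?thesis by simp
  qed
  ultimately show ?thesis by (auto intro: SUP_least)
qed

text \<open>The one-dimensional Brunn--Minkowski inequality. With \<open>p\<close> the maximum of
  \<open>A\<close> and \<open>q\<close> the minimum of \<open>B\<close>, the half-scaled copies of
  \<open>A\<close> towards \<open>q\<close> and of \<open>B\<close> towards \<open>p\<close> lie in
  \<open>C\<close> on opposite sides of \<open>(p + q) / 2\<close>. They overlap in at most one
  point, so their measures add up.\<close>

lemma emeasure_midpoints_compact:
  fixes A B C :: "real set"
  assumes A: "compact A" "A \<noteq> {}" and B: "compact B" "B \<noteq> {}" and C: "C \<in> sets borel"
    and m: "!!x y. x \<in> A ==> y \<in> B ==> (x + y) / 2 \<in> C"
  shows "emeasure lborel A + emeasure lborel B <= 2 * emeasure lborel C"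
proof -
  obtain p where p: "p \<in> A" "!!x. x \<in> A ==> x <= p" using compact_attains_sup[OF A] by blast
  obtain q where q: "q \<in> B" "!!x. x \<in> B ==> q <= x" using compact_attains_inf[OF B] by blast
  have [measurable]: "A \<in> sets borel" "B \<in> sets borel" "C \<in> sets borel"
    using A B C by (auto intro: compact_imp_closed borel_closed)
  have aff: "emeasure lborel S = 2 * emeasure lborel {z. 2 * z - c \<in> S}" if [measurable]: "S \<in> sets borel" for S and c :: real
  proof -
    have "emeasure lborel S = (NINT x|lborel. indicator S x)" by simp
    also have "... = 2 * (NINT x|lborel. indicator S (- c + 2 * x))"
      by (subst nn_integral_real_affine[where c=2 and t="-c"]) auto
    also have "(NINT x|lborel. indicator S (- c + 2 * x)) = (NINT x|lborel. indicator {z. 2 * z - c \<in> S} x)"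
      by (intro nn_integral_cong) (auto simp: indicator_def algebra_simps)
    also have "... = emeasure lborel {z. 2 * z - c \<in> S}"
      by (intro nn_integral_indicator) simp
    finally show ?thesis .
  qed
  define A' where "A' = {z. 2 * z - q \<in> A}"
  define B' where "B' = {z. 2 * z - p \<in> B}"
  have [measurable]: "A' \<in> sets borel" "B' \<in> sets borel" unfolding A'_def B'_def by measurable
  have sub: "A' \<union> B' \<subseteq> C"
  proof
    fix z assume "z \<in> A' \<union> B'"
    then show "z \<in> C"
    proof
      assume "z \<in> A'" then show ?thesis using m[of "2*z-q" q] q by (simp add: A'_def)
    next
      assume "z \<in> B'" then show ?thesis using m[of p "2*z-p"] p by (simp add: B'_def)
    qed
  qed
  have "A' \<inter> B' \<subseteq> {(p + q)/2}"
  proof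
    fix z assume "z \<in> A' \<inter> B'"
    then have "2*z - q <= p" "q <= 2*z - p" using p(2) q(2) by (auto simp: A'_def B'_def)
    then show "z \<in> {(p + q)/2}" by simp
  qed
  then have "emeasure lborel (A' \<inter> B') <= emeasure lborel {(p+q)/2}"
    by (intro emeasure_mono) auto
  then have 0: "emeasure lborel (A' \<inter> B') = 0" by simp
  have "emeasure lborel A' + emeasure lborel B' = emeasure lborel (A' \<union> B') + emeasure lborel (A' \<inter> B')"
    by (rule emeasure_Un_Int) auto
  also have "... <= emeasure lborel C" unfolding 0 using sub by (auto intro: emeasure_mono)
  finally have "2 * (emeasure lborel A' + emeasure lborel B') <= 2 * emeasure lborel C"
    by (rule mult_left_mono) simp
  then show ?thesis
    using aff[of A q] aff[of B p] by (simp add: A'_def B'_def distrib_left)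
qed

lemma emeasure_midpoints:
  fixes A B C :: "real set"
  assumes A: "A \<in> sets borel" "A \<noteq> {}" and B: "B \<in> sets borel" "B \<noteq> {}" and C: "C \<in> sets borel"
    and m: "!!x y. x \<in> A ==> y \<in> B ==> (x + y) / 2 \<in> C"
  shows "emeasure lborel A + emeasure lborel B <= 2 * emeasure lborel C"
proof -
  obtain a b where ab: "a \<in> A" "b \<in> B" using A B by blast
  let ?K = "%A. {K. K \<subseteq> A \<and> compact (K::real set)}"
  have 1: "emeasure lborel K + emeasure lborel K' <= 2 * emeasure lborel C" if "K \<in> ?K A" "K' \<in> ?K B" for K K'
  proof -
    have [measurable]: "K \<in> sets borel" "K' \<in> sets borel"
      using that by (auto intro: compact_imp_closed borel_closed)
    \<comment> \<open>A compact subset may be empty, and then there are no midpoints; one point of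
      \<open>A\<close> and one of \<open>B\<close> are adjoined.\<close>
    have "emeasure lborel K + emeasure lborel K' <= emeasure lborel (insert a K) + emeasure lborel (insert b K')"
      by (intro add_mono emeasure_mono) auto
    also have "... <= 2 * emeasure lborel C"
      by (rule emeasure_midpoints_compact) (use that ab C in \<open>auto intro!: m\<close>)
    finally show ?thesis .
  qed
  have ne: "?K S \<noteq> {}" for S by auto
  have "emeasure lborel A + emeasure lborel B <= (SUP K\<in>?K A. emeasure lborel K) + (SUP K\<in>?K B. emeasure lborel K)"
    using A B by (intro add_mono emeasure_lborel_inner_compact)
  also have "... = (SUP K\<in>?K A. SUP K'\<in>?K B. emeasure lborel K + emeasure lborel K')"
    using ne by (subst ennreal_SUP_add_left[symmetric]) (auto simp: ennreal_SUP_add_right)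
  also have "... <= 2 * emeasure lborel C" by (intro SUP_least 1)
  finally show ?thesis .
qed

lemma nn_integral_layer_cake:
  fixes u :: "real => real"
  assumes [measurable]: "u \<in> bm borel"
  shows "(NINT x|lborel. ennreal (u x)) = (NINT l|lborel. indicator {0<..} l * emeasure lborel {x. l < u x})"
proof -
  have "(NINT x|lborel. ennreal (u x)) = (NINT x|lborel. NINT l|lborel. indicator {0<..<u x} l)"
  proof (intro nn_integral_cong)
    fix x show "ennreal (u x) = (NINT l|lborel. indicator {0<..<u x} l)"
      by (cases "0 <= u x") (simp_all add: ennreal_neg)
  qed
  also have "... = (NINT x|lborel. NINT l|lborel. indicator {0<..} l * indicator {x. l < u x} x)"
    by (intro nn_integral_cong) (auto simp: indicator_def)
  also have "... = (NINT l|lborel. NINT x|lborel. indicator {0<..} l * indicator {x. l < u x} x)"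
    by (rule lborel_pair.Fubini'[symmetric]) (simp add: indicator_def case_prod_beta)
  also have "... = (NINT l|lborel. indicator {0<..} l * emeasure lborel {x. l < u x})"
    by (intro nn_integral_cong) (simp add: nn_integral_cmult)
  finally show ?thesis .
qed

text \<open>Scaled by their suprema, \<open>u\<close> and \<open>v\<close> have non-empty superlevel
  sets exactly at the positive levels below 1, so the midpoint inequality applies at every level
  that contributes. Integrating over the levels bounds the sum of the normalised integrals; the
  arithmetic-geometric mean inequality then gives the product.\<close>

lemma prekopa_leindler:
  fixes u v w :: "real => real"
  assumes [measurable]: "u \<in> bm borel" "v \<in> bm borel" "w \<in> bm borel"
    and nn: "!!x. 0 <= u x" "!!x. 0 <= v x" "!!x. 0 <= w x"
    and bd: "!!x. u x <= b" "!!x. v x <= b"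
    and le: "!!x y. u x * v y <= (w ((x + y) / 2))^2"
    and fin: "(NINT x|lborel. u x) < \<infinity>" "(NINT x|lborel. v x) < \<infinity>" "(NINT x|lborel. w x) < \<infinity>"
  shows "(NINT x|lborel. u x) * (NINT x|lborel. v x) <= (NINT x|lborel. w x)^2"
proof -
  define p where "p = (SUP x. u x)"
  define q where "q = (SUP x. v x)"
  have bdd: "bdd_above (range u)" "bdd_above (range v)" using bd by (auto intro!: bdd_aboveI)
  have pq: "u x <= p" "v x <= q" for x
    unfolding p_def q_def using bdd by (auto intro: cSUP_upper)
  show ?thesis
  proof (cases "p <= 0 \<or> q <= 0")
    case True
    then have "(\<forall>x. u x = 0) \<or> (\<forall>x. v x = 0)"
      using pq nn by (meson dual_order.trans order_antisym)
    then show ?thesis by auto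
  next
    case False
    then have pos: "0 < p" "0 < q" by auto
    have key: "emeasure lborel {x. l < u x / p} + emeasure lborel {x. l < v x / q}
        <= 2 * emeasure lborel {x. l < w x / sqrt (p * q)}" if l: "0 < l" for l
    proof (cases "l < 1")
      case True
      have "l * p < p" "l * q < q" using True pos by auto
      then obtain x y where "l * p < u x" "l * q < v y"
        using less_cSUP_iff[OF _ bdd(1), of "l*p"] less_cSUP_iff[OF _ bdd(2), of "l*q"] unfolding p_def q_def by auto
      then have ne: "{x. l < u x / p} \<noteq> {}" "{x. l < v x / q} \<noteq> {}"
        using pos by (auto simp: field_simps)
      show ?thesis
      proof (rule emeasure_midpoints)
        fix x y assume "x \<in> {x. l < u x / p}" "y \<in> {x. l < v x / q}"
        then have "l * p < u x" "l * q < v y" using pos by (auto simp: field_simps)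
        then have "(l * p) * (l * q) < u x * v y"
          using pos l nn by (intro mult_strict_mono) (auto intro: le_less_trans[of 0 "l*p"])
        also have "... <= (w ((x + y) / 2))^2" by (rule le)
        finally have "(l * sqrt (p * q))\<^sup>2 < (w ((x + y) / 2))^2"
          using pos by (simp add: power_mult_distrib power2_eq_square algebra_simps)
        then have "l * sqrt (p * q) < w ((x + y) / 2)" using nn(3) power_less_imp_less_base by blast
        then show "(x + y) / 2 \<in> {x. l < w x / sqrt (p * q)}" using pos by (simp add: field_simps)
      qed (use ne in auto)
    next
      case False
      have "u x / p <= 1" "v x / q <= 1" for x using pq pos by auto
      then have "{x. l < u x / p} = {}" "{x. l < v x / q} = {}"
        using False by (auto simp: not_less intro: order_trans)
      then show ?thesis by simp
    qed
    have m1: "(%l. indicator {0<..} l * emeasure lborel {x. l < h x}) \<in> bm lborel"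
      if [measurable]: "h \<in> bm borel" for h :: "real => real"
    proof -
      have "(%l. NINT x|lborel. indicator {0<..} l * indicator {x. l < h x} x) \<in> bm lborel"
        by (rule lborel.borel_measurable_nn_integral) (simp add: indicator_def case_prod_beta)
      then show ?thesis by (simp add: nn_integral_cmult)
    qed
    have "(NINT x|lborel. u x / p) + (NINT x|lborel. v x / q) <= 2 * (NINT x|lborel. w x / sqrt (p * q))"
      unfolding nn_integral_layer_cake[of "%x. u x / p", simplified] nn_integral_layer_cake[of "%x. v x / q", simplified]
        nn_integral_layer_cake[of "%x. w x / sqrt (p*q)", simplified]
      apply (subst nn_integral_add[symmetric])
      subgoal by (rule m1) simp
      subgoal by (rule m1) simp
      apply (subst nn_integral_cmult[symmetric])
      subgoal by (rule m1) simp
      by (intro nn_integral_mono) (use key in \<open>auto simp: indicator_def distrib_left\<close>)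
    moreover obtain U where U: "(NINT x|lborel. u x) = ennreal U" "0 <= U" using fin(1) by (auto simp: less_top_ennreal)
    moreover obtain V where V: "(NINT x|lborel. v x) = ennreal V" "0 <= V" using fin(2) by (auto simp: less_top_ennreal)
    moreover obtain W where W: "(NINT x|lborel. w x) = ennreal W" "0 <= W" using fin(3) by (auto simp: less_top_ennreal)
    moreover have div: "(NINT x|lborel. h x / c) = (NINT x|lborel. h x) / ennreal c"
      if [measurable]: "h \<in> bm borel" and "0 < c" "!!x. 0 <= h x" for h :: "real => real" and c
    proof -
      have "(NINT x|lborel. h x / c) = (NINT x|lborel. ennreal (h x) / ennreal c)"
        using that by (intro nn_integral_cong) (simp add: divide_ennreal)
      then show ?thesis by (simp add: nn_integral_divide)
    qed
    ultimately have "ennreal U / ennreal p + ennreal V / ennreal q <= 2 * (ennreal W / ennreal (sqrt (p*q)))"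
      using pos nn by simp
    then have "ennreal (U / p + V / q) <= ennreal (2 * (W / sqrt (p*q)))"
      using pos U V W by (simp add: divide_ennreal ennreal_plus[symmetric] ennreal_mult' flip: times_divide_eq_right del: ennreal_plus)
    then have "U / p + V / q <= 2 * (W / sqrt (p*q))"
      using W pos by (subst (asm) ennreal_le_iff) auto
    then have "(U / p + V / q)^2 <= (2 * (W / sqrt (p*q)))^2"
      using U V pos by (intro power_mono) auto
    also have "... = 4 * W\<^sup>2 / (p * q)" using pos by (simp add: power_mult_distrib power_divide)
    finally have a: "(U / p + V / q)^2 <= 4 * W\<^sup>2 / (p * q)" .
    \<comment> \<open>The arithmetic-geometric mean inequality; afterwards the suprema
      \<open>p\<close> and \<open>q\<close> cancel on both sides.\<close>
    have "4 * ((U / p) * (V / q)) <= (U / p + V / q)^2"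
      using zero_le_power2[of "U / p - V / q"] unfolding power2_sum power2_diff by linarith
    with a have "4 * ((U / p) * (V / q)) <= 4 * W\<^sup>2 / (p * q)" by linarith
    then have "4 * (U * V) / (p * q) <= 4 * W\<^sup>2 / (p * q)" by simp
    then have "4 * (U * V) <= 4 * W\<^sup>2" using pos by (subst (asm) divide_le_cancel) auto
    then have "U * V <= W\<^sup>2" by simp
    then show ?thesis unfolding U V W using U V W by (simp add: ennreal_power flip: ennreal_mult)
  qed
qed

section \<open>Concentration of the standard Gaussian measure\<close>

lemma prob_space_std_normal: "prob_space std_normal_distribution"
  by (rule prob_space_normal_density) simp

lemma product_prob_space_std_normal: "product_prob_space (%_. std_normal_distribution)"
  by (simp add: product_prob_space_def product_prob_space_axioms_def product_sigma_finite_def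
      prob_space_std_normal prob_space_imp_sigma_finite)

text \<open>Property \<open>(\<tau>)\<close> in dimension one, written without infimum convolution:
  the hypothesis on \<open>p\<close> and \<open>q\<close> is the one satisfied by the exponentials
  of an infimum convolution and of the negative of the function. The product of two normal densities
  equals the squared density at the midpoint times \<open>exp (- ((x - y)\<^sup>2 / 4))\<close>, so
  Prekopa--Leindler applies with the density itself as \<open>w\<close>.\<close>

lemma std_normal_tau:
  fixes p q :: "real => real"
  assumes [measurable]: "p \<in> bm borel" "q \<in> bm borel"
    and nn: "!!x. 0 <= p x" "!!x. 0 <= q x" and bd: "!!x. p x <= b" "!!x. q x <= b"
    and le: "!!x y. p x * q y <= exp ((x - y)\<^sup>2 / 4)"
  shows "(NINT x|std_normal_distribution. p x) * (NINT x|std_normal_distribution. q x) <= 1"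
proof -
  let ?d = std_normal_density
  have d: "?d x * ?d y = (?d ((x + y) / 2))^2 * exp (- ((x - y)\<^sup>2 / 4))" for x y
  proof -
    have "exp (- x\<^sup>2 / 2) * exp (- y\<^sup>2 / 2) = exp (- ((x + y) / 2)\<^sup>2 / 2) * exp (- ((x + y) / 2)\<^sup>2 / 2) * exp (- ((x - y)\<^sup>2 / 4))"
      unfolding exp_add[symmetric] by (rule arg_cong[where f=exp]) (simp add: power2_eq_square field_simps)
    then show ?thesis by (simp add: std_normal_density_def power2_eq_square)
  qed
  have dn: "0 <= ?d x" for x by simp
  have d1: "?d x <= 1" for x
  proof -
    have "exp (- x\<^sup>2 / 2) <= 1" by simp
    moreover have "1 / sqrt (2 * pi) <= 1" using pi_ge_two by (simp add: real_le_rsqrt)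
    ultimately have "1 / sqrt (2 * pi) * exp (- x\<^sup>2 / 2) <= 1 * 1" by (intro mult_mono) auto
    then show ?thesis by (simp add: std_normal_density_def)
  qed
  have b: "0 <= b" using nn(1)[of 0] bd(1)[of 0] by linarith
  interpret prob_space std_normal_distribution by (rule prob_space_std_normal)
  have one: "(NINT x|lborel. ?d x) = 1"
    using emeasure_space_1 by (simp add: emeasure_density)
  have fin: "(NINT x|lborel. ennreal (h x * ?d x)) < \<infinity>" if "h \<in> bm borel" "!!x. h x <= b" for h
  proof -
    have "(NINT x|lborel. ennreal (h x * ?d x)) <= (NINT x|lborel. ennreal b * ennreal (?d x))"
      by (intro nn_integral_mono) (auto simp: ennreal_mult'[symmetric] b intro!: ennreal_leI mult_right_mono that)
    also have "... = ennreal b" by (simp add: nn_integral_cmult one)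
    finally show ?thesis by (simp add: le_less_trans)
  qed
  have "(NINT x|lborel. p x * ?d x) * (NINT x|lborel. q x * ?d x) <= (NINT x|lborel. ?d x)^2"
  proof (rule prekopa_leindler[where b=b])
    fix x y
    have "(p x * ?d x) * (q y * ?d y) = (p x * q y) * (?d x * ?d y)" by simp
    also have "... <= exp ((x - y)\<^sup>2 / 4) * (?d x * ?d y)"
      by (intro mult_right_mono le) simp
    also have "... = (?d ((x + y) / 2))^2"
      unfolding d by (simp add: exp_minus)
    finally show "(p x * ?d x) * (q y * ?d y) <= (?d ((x + y) / 2))^2" .
  next
    fix x show "p x * ?d x <= b" "q x * ?d x <= b"
      using mult_mono[OF bd(1) d1 b dn, of x x] mult_mono[OF bd(2) d1 b dn, of x x] by auto
  qed (use fin bd one in \<open>auto simp: nn\<close>)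
  moreover have "(NINT x|std_normal_distribution. h x) = (NINT x|lborel. h x * ?d x)"
    if [measurable]: "h \<in> bm borel" and "!!x. 0 <= h x" for h :: "real => real"
    by (subst nn_integral_density) (simp_all add: that ennreal_mult mult.commute)
  ultimately show ?thesis using assms(1,2) nn by (simp only: one power_one)
qed

text \<open>Tensorisation. Integrating out the old coordinates, with the new one frozen at
  \<open>r\<close> and at \<open>r'\<close>, leaves two functions of one variable that satisfy the
  hypothesis of the one-dimensional case.\<close>

lemma std_normal_PiM_tau:
  fixes p q :: "('i => real) => real"
  assumes "finite I"
    and "p \<in> bm (Pi\<^sub>M I (%_. borel))" "q \<in> bm (Pi\<^sub>M I (%_. borel))"
    and "!!x. 0 <= p x" "!!x. 0 <= q x" and "!!x. p x <= b" "!!x. q x <= b"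
    and "!!x y. p x * q y <= exp ((\<Sum>i\<in>I. (x i - y i)^2) / 4)"
  shows "(NINT x|(Pi\<^sub>M I (%_. std_normal_distribution)). p x) *
    (NINT x|(Pi\<^sub>M I (%_. std_normal_distribution)). q x) <= 1"
  using assms
proof (induction I arbitrary: p q b rule: finite_induct)
  case empty
  then have "p (%x. undefined) * q (%x. undefined) <= 1" by (metis div_0 exp_zero sum.empty)
  then show ?case using empty by (simp add: PiM_empty nn_integral_count_space_finite flip: ennreal_mult)
next
  case (insert i I)
  interpret product_prob_space "%_::'i. std_normal_distribution" by (rule product_prob_space_std_normal)
  interpret PI: prob_space "Pi\<^sub>M I (%_. std_normal_distribution)" by (rule prob_space_PiM) (rule prob_space_std_normal)
  note [measurable] = insert.prems(1,2)
  have s: "sets (Pi\<^sub>M J (%_::'i. std_normal_distribution)) = sets (Pi\<^sub>M J (%_. borel))" for J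
    by (rule sets_PiM_cong) auto
  have mc: "bm (Pi\<^sub>M J (%_::'i. std_normal_distribution)) = bm (Pi\<^sub>M J (%_. borel))" for J
    by (rule measurable_cong_sets[OF s refl])
  have b: "0 <= b" using insert.prems(3,5) order_trans by blast
  have sec: "(%(r, x). h (x(i := r))) \<in> bm (borel \<Otimes>\<^sub>M Pi\<^sub>M I (%_. std_normal_distribution))"
    if [measurable]: "h \<in> bm (Pi\<^sub>M (insert i I) (%_. borel))" for h :: "('i => real) => real"
  proof -
    have "(%(r, x). x(i := r)) \<in> borel \<Otimes>\<^sub>M Pi\<^sub>M I (%_. borel) \<rightarrow>\<^sub>M Pi\<^sub>M (insert i I) (%_::'i. borel :: real measure)"
      by (simp add: case_prod_beta) measurable
    from measurable_compose[OF this that] have "(%(r, x). h (x(i := r))) \<in> bm (borel \<Otimes>\<^sub>M Pi\<^sub>M I (%_. borel))"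
      by (simp add: case_prod_beta)
    then show ?thesis by (subst measurable_cong_sets[OF sets_pair_measure_cong[OF refl s] refl])
  qed
  have sec1: "(%x. h (x(i := r))) \<in> bm (Pi\<^sub>M I (%_. borel))"
    if "h \<in> bm (Pi\<^sub>M (insert i I) (%_. borel))" for h :: "('i => real) => real" and r
    using measurable_compose[OF measurable_Pair1'[of r borel "Pi\<^sub>M I (%_. std_normal_distribution)"] sec[OF that]]
    by (simp add: mc)
  define A :: "(('i => real) => real) => real => ennreal" where "A h r = (NINT x|(Pi\<^sub>M I (%_. std_normal_distribution)). ennreal (h (x(i := r))))" for h r
  have Am: "A h \<in> bm borel" if "h \<in> bm (Pi\<^sub>M (insert i I) (%_. borel))" for h
    unfolding A_def by (rule PI.borel_measurable_nn_integral) (use sec[OF that] in measurable)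
  have Ab: "A h r <= ennreal b" if hb: "\<forall>x. h x <= b" for h r
  proof -
    have "A h r <= (NINT x|(Pi\<^sub>M I (%_. std_normal_distribution)). ennreal b)"
      unfolding A_def by (intro nn_integral_mono ennreal_leI) (simp add: hb)
    then show ?thesis by (simp add: PI.emeasure_space_1)
  qed
  have Ae: "ennreal (enn2real (A h r)) = A h r" if hb: "\<forall>x. h x <= b" for h r
    using Ab[OF hb, of r] by (intro ennreal_enn2real) (auto simp: le_less_trans)
  have AA: "A p r * A q r' <= ennreal (exp ((r - r')\<^sup>2 / 4))" for r r'
  proof -
    \<comment> \<open>The part of the quadratic cost that belongs to the new coordinate is split
      evenly: each function receives one factor \<open>?c\<close>, and \<open>?c * ?c\<close>
      cancels \<open>exp ((r - r')\<^sup>2 / 4)\<close>.\<close>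
    let ?c = "exp (- ((r - r')\<^sup>2 / 8))"
    have cc: "?c * ?c = exp (- ((r - r')\<^sup>2 / 4))" by (simp flip: exp_add)
    have "(NINT x|(Pi\<^sub>M I (%_. std_normal_distribution)). ennreal (p (x(i := r)) * ?c)) *
      (NINT x|(Pi\<^sub>M I (%_. std_normal_distribution)). ennreal (q (x(i := r')) * ?c)) <= 1"
    proof (rule insert.IH[where b=b])
      show "(%x. p (x(i := r)) * ?c) \<in> bm (Pi\<^sub>M I (%_. borel))"
        "(%x. q (x(i := r')) * ?c) \<in> bm (Pi\<^sub>M I (%_. borel))"
        using sec1[OF insert.prems(1), of r] sec1[OF insert.prems(2), of r'] insert.prems by auto
      fix x
      have "p (x(i := r)) * ?c <= b * 1" "q (x(i := r')) * ?c <= b * 1"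
        using insert.prems(5,6) b by (intro mult_mono; simp)+
      then show "p (x(i := r)) * ?c <= b" "q (x(i := r')) * ?c <= b" by auto
      show "0 <= p (x(i := r)) * ?c" "0 <= q (x(i := r')) * ?c" using insert.prems by auto
      fix y
      have "(\<Sum>j\<in>insert i I. ((x(i := r)) j - (y(i := r')) j)^2) = (r - r')^2 + (\<Sum>j\<in>I. (x j - y j)^2)"
        using insert.hyps by (auto intro!: sum.cong)
      then have "p (x(i := r)) * q (y(i := r')) <= exp (((r - r')^2 + (\<Sum>j\<in>I. (x j - y j)^2)) / 4)"
        using insert.prems(7)[of "x(i := r)" "y(i := r')"] by (simp only:)
      then have "(p (x(i := r)) * q (y(i := r'))) * (?c * ?c) <= exp (((r - r')^2 + (\<Sum>j\<in>I. (x j - y j)^2)) / 4) * (?c * ?c)"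
        by (rule mult_right_mono) simp
      also have "... = exp ((\<Sum>j\<in>I. (x j - y j)^2) / 4)"
        unfolding cc exp_add[symmetric] by (simp add: field_simps)
      finally show "p (x(i := r)) * ?c * (q (y(i := r')) * ?c) <= exp ((\<Sum>j\<in>I. (x j - y j)^2) / 4)"
        by (simp add: mult_ac)
    qed
    then have "(A p r * ?c) * (A q r' * ?c) <= 1"
      unfolding A_def using insert.prems sec1[OF insert.prems(1), of r] sec1[OF insert.prems(2), of r']
      by (subst (asm) ennreal_mult, simp, simp, subst (asm) ennreal_mult, simp, simp) (simp add: nn_integral_multc mc)
    moreover have "(A p r * ?c) * (A q r' * ?c) = (A p r * A q r') * ennreal (exp (- ((r - r')\<^sup>2 / 4)))"
      by (simp add: cc[symmetric] ennreal_mult mult_ac)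
    ultimately have "(A p r * A q r') * ennreal (exp (- ((r - r')\<^sup>2 / 4))) * ennreal (exp ((r - r')\<^sup>2 / 4)) <= 1 * ennreal (exp ((r - r')\<^sup>2 / 4))"
      by (intro mult_right_mono) auto
    then show ?thesis by (simp add: mult.assoc flip: ennreal_mult exp_add)
  qed
  have "(NINT r|std_normal_distribution. enn2real (A p r)) * (NINT r|std_normal_distribution. enn2real (A q r)) <= 1"
  proof (rule std_normal_tau[where b=b])
    show "(%r. enn2real (A p r)) \<in> bm borel" "(%r. enn2real (A q r)) \<in> bm borel"
      using Am insert.prems by auto
    show "enn2real (A p r) <= b" "enn2real (A q r) <= b" for r
      using Ab[of p r] Ab[of q r] insert.prems b by (auto intro!: enn2real_leI)
    fix r r'
    have "ennreal (enn2real (A p r) * enn2real (A q r')) <= ennreal (exp ((r - r')\<^sup>2 / 4))"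
      using AA[of r r'] insert.prems by (simp add: ennreal_mult Ae)
    then show "enn2real (A p r) * enn2real (A q r') <= exp ((r - r')\<^sup>2 / 4)"
      by (simp add: ennreal_le_iff)
  qed auto
  moreover have "(NINT x|(Pi\<^sub>M (insert i I) (%_. std_normal_distribution)). h x) = (NINT r|std_normal_distribution. enn2real (A h r))"
    if "h \<in> bm (Pi\<^sub>M (insert i I) (%_. borel))" "\<forall>x. h x <= b" for h
    using insert.hyps that unfolding Ae[OF that(2)] unfolding A_def
    by (subst product_nn_integral_insert_rev) (auto simp: mc)
  ultimately show ?case using insert.prems by simp
qed

text \<open>Applied to \<open>exp (h - 1)\<close> and \<open>exp (- h)\<close> for the centred and
  scaled function \<open>h\<close>, property \<open>(\<tau>)\<close> bounds the product of the two
  Laplace transforms by \<open>exp 1\<close>, whatever the number of coordinates. Both factors are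
  at least 1 because \<open>h\<close> has mean zero, so each is at most \<open>exp 1\<close>, which
  controls the second moment of \<open>h\<close>.\<close>

theorem std_normal_PiM_lipschitz_deviation:
  fixes F :: "('i => real) => real"
  assumes I: "finite I" and F[measurable]: "F \<in> bm (Pi\<^sub>M I (%_. borel))"
    and bd: "!!x. \<bar>F x\<bar> <= b" and c: "0 < c"
    and lip: "!!x y. (F x - F y)^2 <= c\<^sup>2 * (\<Sum>i\<in>I. (x i - y i)^2)"
  defines "M \<equiv> Pi\<^sub>M I (%_. std_normal_distribution)"
  shows "(LINT x|M. \<bar>F x - (LINT y|M. F y)\<bar>) <= 3 * c"
proof -
  interpret M: prob_space M unfolding M_def by (rule prob_space_PiM) (rule prob_space_std_normal)
  have sM: "sets M = sets (Pi\<^sub>M I (%_. borel))" unfolding M_def by (rule sets_PiM_cong) auto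
  have [measurable]: "F \<in> bm M" by (subst measurable_cong_sets[OF sM refl]) (rule F)
  define m where "m = (LINT y|M. F y)"
  have iF: "integrable M F" by (rule M.integrable_const_bound[where B=b]) (use bd in auto)
  have m: "\<bar>m\<bar> <= b"
  proof -
    have "\<bar>m\<bar> <= (LINT y|M. \<bar>F y\<bar>)" unfolding m_def by (rule integral_abs_bound)
    also have "... <= b" by (rule M.integral_le_const) (use iF bd in auto)
    finally show ?thesis .
  qed
  define h where "h x = (F x - m) / c" for x
  define B where "B = 2 * b / c"
  have hm[measurable]: "h \<in> bm M" unfolding h_def by simp
  have hB: "\<bar>h x\<bar> <= B" for x
    using bd[of x] m c unfolding h_def B_def by (simp add: abs_divide divide_right_mono)
  have iB: "integrable M (%x. g (h x))" if "continuous_on {-B..B} g" "g \<in> bm borel" for g :: "real => real"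
  proof -
    have "bounded (g ` {-B..B})" using that(1) by (intro compact_imp_bounded compact_continuous_image) auto
    then obtain K where "\<forall>y\<in>g ` {-B..B}. norm y <= K" unfolding bounded_iff by blast
    then have K: "!!x. x \<in> {-B..B} ==> norm (g x) <= K" by blast
    show ?thesis
    proof (rule M.integrable_const_bound)
      show "AE x in M. norm (g (h x)) <= K"
        using hB by (intro AE_I2 K) (auto simp: abs_le_iff minus_le_iff)
    qed (use that(2) in measurable)
  qed
  have ih: "integrable M h" using iB[of "%x. x"] by simp
  have ie: "integrable M (%x. exp (h x))" "integrable M (%x. exp (- h x))" "integrable M (%x. (h x)^2)"
    using iB[of exp] iB[of "%x. exp (- x)"] iB[of "%x. x\<^sup>2"] by (auto simp: continuous_on_exp continuous_on_minus continuous_on_power)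
  have Eh: "(LINT x|M. h x) = 0"
    unfolding h_def using iF by (simp add: m_def M.prob_space)
  have ge1: "1 <= (LINT x|M. exp (s * h x))" if "integrable M (%x. exp (s * h x))" for s
  proof -
    have "(LINT x|M. 1 + s * h x) <= (LINT x|M. exp (s * h x))"
      using that ih by (intro integral_mono) auto
    then show ?thesis using ih Eh by (simp add: M.prob_space)
  qed
  have "(NINT x|M. exp (h x - 1)) * (NINT x|M. exp (- h x)) <= 1"
    unfolding M_def
  proof (rule std_normal_PiM_tau[OF I, where b="exp B"])
    have "h \<in> bm (Pi\<^sub>M I (%_. borel))" unfolding h_def by simp
    then show "(%x. exp (h x - 1)) \<in> bm (Pi\<^sub>M I (%_. borel))"
      "(%x. exp (- h x)) \<in> bm (Pi\<^sub>M I (%_. borel))" by auto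
    show "exp (h x - 1) <= exp B" "exp (- h x) <= exp B" for x using hB[of x] by auto
    fix x y :: "'i => real"
    define s where "s = (\<Sum>i\<in>I. (x i - y i)^2)"
    have s: "0 <= s" unfolding s_def by (simp add: sum_nonneg)
    have "(h x - h y)^2 = (F x - F y)\<^sup>2 / c\<^sup>2" unfolding h_def by (simp add: power_divide flip: diff_divide_distrib)
    also have "... <= s" using lip[of x y] c by (simp add: s_def field_simps)
    finally have "(h x - h y)^2 <= s" .
    \<comment> \<open>The shift by 1 in \<open>exp (h - 1)\<close> is what turns the increment,
      linear in the distance, into the quadratic cost.\<close>
    moreover have "d - 1 <= d\<^sup>2 / 4" for d :: real
      using zero_le_power2[of "d - 2"] by (simp add: power2_eq_square algebra_simps)
    then have "h x - h y - 1 <= (h x - h y)\<^sup>2 / 4" .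
    ultimately have "(h x - 1) + (- h y) <= s / 4" by linarith
    then show "exp (h x - 1) * exp (- h y) <= exp ((\<Sum>i\<in>I. (x i - y i)^2) / 4)"
      unfolding exp_add[symmetric] s_def[symmetric] by simp
  qed auto
  moreover have "(NINT x|M. exp (h x - 1)) = ennreal (exp (-1) * (LINT x|M. exp (h x)))"
    using ie by (subst nn_integral_eq_integral) (auto simp: exp_diff exp_minus divide_inverse mult.commute)
  moreover have "(NINT x|M. exp (- h x)) = ennreal (LINT x|M. exp (- h x))"
    using ie by (subst nn_integral_eq_integral) auto
  ultimately have "ennreal (exp (-1) * (LINT x|M. exp (h x)) * (LINT x|M. exp (- h x))) <= 1"
    by (subst ennreal_mult) auto
  then have "exp (-1) * (LINT x|M. exp (h x)) * (LINT x|M. exp (- h x)) <= 1"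
    by (subst (asm) ennreal_le_1)
  then have prod: "(LINT x|M. exp (h x)) * (LINT x|M. exp (- h x)) <= exp 1"
    by (simp add: exp_minus field_simps)
  have "(LINT x|M. exp (h x)) * 1 <= (LINT x|M. exp (h x)) * (LINT x|M. exp (- h x))"
    using ge1[of "-1"] ie by (intro mult_left_mono) auto
  moreover have "1 * (LINT x|M. exp (- h x)) <= (LINT x|M. exp (h x)) * (LINT x|M. exp (- h x))"
    using ge1[of 1] ie by (intro mult_right_mono) auto
  ultimately have two: "(LINT x|M. exp (h x)) + (LINT x|M. exp (- h x)) <= 2 * exp 1"
    using prod by simp
  have ch: "2 + x\<^sup>2 / 2 <= exp x + exp (- x)" for x :: real
  proof -
    have "2 + y\<^sup>2 / 2 <= exp y + exp (- y)" if "0 <= y" for y :: real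
      using exp_lower_Taylor_quadratic[OF that] exp_ge_add_one_self[of "-y"] by linarith
    from this[of x] this[of "-x"] show ?thesis by (cases "0 <= x") auto
  qed
  have "(LINT x|M. 2 + (h x)\<^sup>2 / 2) <= (LINT x|M. exp (h x) + exp (- h x))"
    using ie by (intro integral_mono ch) auto
  then have "2 + (LINT x|M. (h x)^2) / 2 <= 2 * exp 1"
    using ie two by (simp add: M.prob_space)
  moreover have "exp 1 <= (3::real)" by (rule exp_le)
  ultimately have h2: "(LINT x|M. (h x)^2) <= 8" by simp
  \<comment> \<open>With the second moment at most 8, a consequence of \<open>exp 1 <= 3\<close>,
    the right side is at most 17/6; this is the origin of the constant 3.\<close>
  have "(LINT x|M. \<bar>h x\<bar>) <= (LINT x|M. (3/2) + (h x)\<^sup>2 / 6)"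
  proof (rule integral_mono)
    fix x
    have "0 <= (\<bar>h x\<bar> - 3)^2" by simp
    then show "\<bar>h x\<bar> <= 3/2 + (h x)\<^sup>2 / 6" by (simp add: power2_diff)
  qed (use ih ie in auto)
  also have "... <= 3" using h2 ie by (simp add: M.prob_space)
  finally have "(LINT x|M. \<bar>h x\<bar>) <= 3" .
  moreover have "\<bar>F x - m\<bar> = c * \<bar>h x\<bar>" for x using c by (simp add: h_def abs_divide)
  ultimately show ?thesis unfolding m_def[symmetric] using c by simp
qed

section \<open>A Cramer--Wold criterion\<close>

text \<open>Law of \<open>Y\<close> under the probability with density \<open>U / m\<close>, where
  \<open>m\<close> will be the mean of \<open>U\<close>. Weights carry the information about further
  coordinates, so that uniqueness of characteristic functions on the line is enough for joint
  laws.\<close>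

definition weighted_law :: "'a measure => ('a => real) => ('a => real) => real => real measure" where
  "weighted_law M U Y m = distr (density M (%x. ennreal (U x / m))) borel Y"

lemma weighted_law:
  fixes U Y :: "'a => real"
  assumes M: "prob_space M" and [measurable]: "U \<in> bm M" "Y \<in> bm M"
    and U: "!!x. 0 <= U x" "!!x. U x <= 2" and mU: "m = (LINT x|M. U x)" and m: "0 < m"
  shows "real_distribution (weighted_law M U Y m)"
    and "char (weighted_law M U Y m) t =
      Complex ((LINT x|M. U x * cos (t * Y x)) / m) ((LINT x|M. U x * sin (t * Y x)) / m)"
    and "B \<in> sets borel ==> measure (weighted_law M U Y m) B = (LINT x|M. U x * indicator B (Y x)) / m"
proof -
  interpret M: prob_space M by fact
  have bi: "integrable M (%x. U x * g (Y x))" if [measurable]: "g \<in> bm borel" and "!!x. \<bar>g x\<bar> <= 1" for g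
  proof (rule M.integrable_const_bound[where B="2 * 1"])
    show "AE x in M. norm (U x * g (Y x)) <= 2 * 1"
      unfolding real_norm_def abs_mult using U that by (intro AE_I2 mult_mono) auto
  qed simp
  have iU: "integrable M U" using bi[of "%_. 1"] by simp
  have em: "emeasure (weighted_law M U Y m) B = ennreal ((LINT x|M. U x * indicator B (Y x)) / m)"
    if [measurable]: "B \<in> sets borel" for B
  proof -
    have "emeasure (weighted_law M U Y m) B = (NINT x|M. ennreal (U x / m) * indicator (Y -` B \<inter> space M) x)"
      unfolding weighted_law_def by (subst emeasure_distr) (auto simp: emeasure_density)
    also have "... = (NINT x|M. ennreal (U x * indicator B (Y x) / m))"
      by (intro nn_integral_cong) (auto simp: indicator_def)
    also have "... = ennreal (LINT x|M. U x * indicator B (Y x) / m)"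
      using U m bi[of "indicator B"] by (intro nn_integral_eq_integral) (auto simp: indicator_def)
    finally show ?thesis by simp
  qed
  show "measure (weighted_law M U Y m) B = (LINT x|M. U x * indicator B (Y x)) / m" if "B \<in> sets borel"
    using em[OF that] U m unfolding measure_def by (simp add: indicator_def)
  show "real_distribution (weighted_law M U Y m)"
  proof (intro real_distribution.intro prob_spaceI real_distribution_axioms.intro)
    show "emeasure (weighted_law M U Y m) (space (weighted_law M U Y m)) = 1"
      using em[of UNIV] mU m by (simp add: weighted_law_def)
  qed (auto simp: weighted_law_def)
  have "char (weighted_law M U Y m) t = (CLINT x|M. (U x / m) *\<^sub>R iexp (t * Y x))"
    unfolding char_def weighted_law_def using U m
    by (subst integral_distr) (auto simp: integral_density)
  also have "... = (CLINT x|M. complex_of_real (U x * cos (t * Y x) / m) + \<i> * complex_of_real (U x * sin (t * Y x) / m))"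
    by (intro Bochner_Integration.integral_cong) (simp_all add: exp_Euler scaleR_conv_of_real add_divide_distrib distrib_left mult_ac flip: cos_of_real sin_of_real)
  also have "... = complex_of_real (LINT x|M. U x * cos (t * Y x) / m) + \<i> * complex_of_real (LINT x|M. U x * sin (t * Y x) / m)"
    using bi[of "%y. cos (t * y)"] bi[of "%y. sin (t * y)"]
    by (subst Bochner_Integration.integral_add) (auto simp del: of_real_divide of_real_mult)
  finally show "char (weighted_law M U Y m) t =
      Complex ((LINT x|M. U x * cos (t * Y x)) / m) ((LINT x|M. U x * sin (t * Y x)) / m)"
    by (simp add: complex_eq_iff)
qed

text \<open>The case \<open>a = 0\<close> shows that both weights have the same mass. After
  normalisation the weighted laws have equal characteristic functions, and Levy uniqueness applies.
  If the mass is zero there is nothing to normalise, but both sides vanish.\<close>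

lemma trig_determines_law:
  fixes U1 :: "'a => real" and U2 :: "'b => real"
  assumes M: "prob_space M1" "prob_space M2"
    and [measurable]: "U1 \<in> bm M1" "Y1 \<in> bm M1" "U2 \<in> bm M2" "Y2 \<in> bm M2"
    and U: "!!x. 0 <= U1 x" "!!x. U1 x <= 2" "!!x. 0 <= U2 x" "!!x. U2 x <= 2"
    and tr: "!!a. (LINT x|M1. U1 x * cos (a * Y1 x)) = (LINT x|M2. U2 x * cos (a * Y2 x))"
      "!!a. (LINT x|M1. U1 x * sin (a * Y1 x)) = (LINT x|M2. U2 x * sin (a * Y2 x))"
    and B: "B \<in> sets borel"
  shows "(LINT x|M1. U1 x * indicator B (Y1 x)) = (LINT x|M2. U2 x * indicator B (Y2 x))"
proof -
  interpret M1: prob_space M1 by fact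
  interpret M2: prob_space M2 by fact
  define m where "m = (LINT x|M1. U1 x)"
  have i1: "integrable M1 U1" by (rule M1.integrable_const_bound[where B=2]) (use U in auto)
  have i2: "integrable M2 U2" by (rule M2.integrable_const_bound[where B=2]) (use U in auto)
  have m2: "m = (LINT x|M2. U2 x)" using tr(1)[of 0] by (simp add: m_def)
  have m0: "0 <= m" unfolding m_def using U by simp
  show ?thesis
  proof (cases "m = 0")
    case True
    then have "AE x in M1. U1 x = 0" "AE x in M2. U2 x = 0"
      using integral_nonneg_eq_0_iff_AE[OF i1] integral_nonneg_eq_0_iff_AE[OF i2] U m2 by (auto simp: m_def)
    then have "AE x in M1. U1 x * indicator B (Y1 x) = 0" "AE x in M2. U2 x * indicator B (Y2 x) = 0"
      by auto
    then show ?thesis by (simp add: integral_eq_zero_AE)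
  next
    case False
    then have m: "0 < m" using m0 by simp
    note w1 = weighted_law[OF M(1) assms(3,4) U(1,2) m_def m]
    note w2 = weighted_law[OF M(2) assms(5,6) U(3,4) m2 m]
    have "weighted_law M1 U1 Y1 m = weighted_law M2 U2 Y2 m"
      by (rule Levy_uniqueness[OF w1(1) w2(1)]) (simp add: fun_eq_iff w1(2) w2(2) tr)
    then show ?thesis using w1(3)[OF B] w2(3)[OF B] m by simp
  qed
qed

text \<open>Indicators are introduced one coordinate at a time, while the rest of the information
  stays encoded in a cosine. The coefficients \<open>c\<close> and the phase \<open>b\<close> must
  remain free in the induction, since trigonometric factors in the new coordinate are absorbed by
  changing them.\<close>

lemma linear_combinations_determine_law:
  fixes Y1 :: "'i => 'a => real" and Y2 :: "'i => 'b => real"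
  assumes M: "prob_space M1" "prob_space M2" and I: "finite I"
    and Y1[measurable]: "!!i. i \<in> I ==> Y1 i \<in> bm M1"
    and Y2[measurable]: "!!i. i \<in> I ==> Y2 i \<in> bm M2"
    and tr: "!!c b. (LINT x|M1. cos ((\<Sum>i\<in>I. c i * Y1 i x) + b)) = (LINT x|M2. cos ((\<Sum>i\<in>I. c i * Y2 i x) + b))"
    and B: "!!i. i \<in> I ==> B i \<in> sets borel" and J: "J \<subseteq> I"
  shows "(LINT x|M1. (\<Prod>i\<in>J. indicator (B i) (Y1 i x)) * cos ((\<Sum>i\<in>I. c i * Y1 i x) + b)) =
    (LINT x|M2. (\<Prod>i\<in>J. indicator (B i) (Y2 i x)) * cos ((\<Sum>i\<in>I. c i * Y2 i x) + b))"
  using finite_subset[OF J I] J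
proof (induction J arbitrary: c b rule: finite_induct)
  case empty
  then show ?case using tr by simp
next
  case (insert j J)
  then have j: "j \<in> I" and J: "J \<subseteq> I" by auto
  interpret M1: prob_space M1 by fact
  interpret M2: prob_space M2 by fact
  have BJ: "i \<in> J ==> B i \<in> sets borel" "i \<in> J ==> Y1 i \<in> bm M1" "i \<in> J ==> Y2 i \<in> bm M2" for i
    using J B Y1 Y2 by auto
  note [measurable] = BJ Y1[OF j] Y2[OF j] B[OF j]
  define V1 where "V1 x = (\<Prod>i\<in>J. indicator (B i) (Y1 i x) :: real)" for x
  define V2 where "V2 x = (\<Prod>i\<in>J. indicator (B i) (Y2 i x) :: real)" for x
  define S1 where "S1 c x = (\<Sum>i\<in>I. c i * Y1 i x)" for c x
  define S2 where "S2 c x = (\<Sum>i\<in>I. c i * Y2 i x)" for c x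
  have [measurable]: "V1 \<in> bm M1" "V2 \<in> bm M2"
    unfolding V1_def V2_def by measurable
  have [measurable]: "S1 c \<in> bm M1" "S2 c \<in> bm M2" for c
    unfolding S1_def S2_def by measurable
  have V: "0 <= V1 x" "V1 x <= 1" "0 <= V2 y" "V2 y <= 1" for x y
    unfolding V1_def V2_def by (auto intro!: prod_nonneg prod_le_1)
  have IH: "(LINT x|M1. V1 x * cos (S1 c x + b)) = (LINT x|M2. V2 x * cos (S2 c x + b))" for c b
    using insert.IH[OF J] unfolding V1_def V2_def S1_def S2_def by simp
  have int1: "integrable M1 (%x. V1 x * cos (S1 c x + b))" for c b
    by (rule M1.integrable_const_bound[where B=1])
      (use V in \<open>auto simp: abs_mult mult_le_one\<close>)
  have int2: "integrable M2 (%x. V2 x * cos (S2 c x + b))" for c b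
    by (rule M2.integrable_const_bound[where B=1])
      (use V in \<open>auto simp: abs_mult mult_le_one\<close>)
  define ej where "ej a = (%i. if i = j then a else 0::real)" for a
  have ej1: "a * Y1 j x = S1 (ej a) x" for a x
    unfolding S1_def ej_def using I j by (simp add: if_distrib[of "%z. z * _"] cong: if_cong)
  have ej2: "a * Y2 j x = S2 (ej a) x" for a x
    unfolding S2_def ej_def using I j by (simp add: if_distrib[of "%z. z * _"] cong: if_cong)
  have add1: "S1 c x + S1 d x = S1 (%i. c i + d i) x" "S1 c x - S1 d x = S1 (%i. c i - d i) x" for c d x
    unfolding S1_def by (simp_all add: algebra_simps sum.distrib sum_subtractf)
  have add2: "S2 c x + S2 d x = S2 (%i. c i + d i) x" "S2 c x - S2 d x = S2 (%i. c i - d i) x" for c d x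
    unfolding S2_def by (simp_all add: algebra_simps sum.distrib sum_subtractf)
  have cc: "cos u * cos v = (cos (u - v) + cos (u + v)) / 2" for u v :: real
    by (rule cos_times_cos)
  \<comment> \<open>A weight has to be non-negative, hence \<open>1 + cos\<close> in place of the
    cosine. The product-to-sum formula reduces its trigonometric moments in coordinate
    \<open>j\<close> to the induction hypothesis; a phase shift by \<open>pi/2\<close> turns the
    cosine moments into sine moments.\<close>
  have main: "(LINT x|M1. (V1 x * (1 + cos (S1 c x + b))) * indicator (B j) (Y1 j x)) =
      (LINT x|M2. (V2 x * (1 + cos (S2 c x + b))) * indicator (B j) (Y2 j x))" for c b
  proof (rule trig_determines_law[OF M])
    have c2: "0 <= 1 + cos t" "1 + cos t <= 2" for t :: real using cos_ge_minus_one[of t] cos_le_one[of t] by linarith+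
    show "0 <= V1 x * (1 + cos (S1 c x + b))" "0 <= V2 y * (1 + cos (S2 c y + b))" for x y
      using V c2 by auto
    show "V1 x * (1 + cos (S1 c x + b)) <= 2" "V2 y * (1 + cos (S2 c y + b)) <= 2" for x y
      using mult_mono[OF V(2) c2(2), of "S1 c x + b" x] mult_mono[OF V(4) c2(2), of "S2 c y + b" y] V c2 by auto
    have cos_minus_pi_half: "cos (u - pi / 2) = sin u" for u :: real
      by (simp add: cos_diff)
    have gen: "(LINT x|M1. V1 x * (1 + cos (S1 c x + b)) * cos (S1 (ej a) x + d)) =
        (LINT x|M2. V2 x * (1 + cos (S2 c x + b)) * cos (S2 (ej a) x + d))" for a d
    proof -
      have e1: "V1 x * (1 + cos (S1 c x + b)) * cos (S1 (ej a) x + d) =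
          V1 x * cos (S1 (ej a) x + d) + (V1 x * cos (S1 (%i. c i - ej a i) x + (b - d)) + V1 x * cos (S1 (%i. c i + ej a i) x + (b + d))) / 2" for x
        using cc[of "S1 c x + b" "S1 (ej a) x + d"] unfolding add1[symmetric] by (simp add: algebra_simps)
      have e2: "V2 x * (1 + cos (S2 c x + b)) * cos (S2 (ej a) x + d) =
          V2 x * cos (S2 (ej a) x + d) + (V2 x * cos (S2 (%i. c i - ej a i) x + (b - d)) + V2 x * cos (S2 (%i. c i + ej a i) x + (b + d))) / 2" for x
        using cc[of "S2 c x + b" "S2 (ej a) x + d"] unfolding add2[symmetric] by (simp add: algebra_simps)
      show ?thesis unfolding e1 e2 using int1 int2 by (simp add: IH)
    qed
    show "(LINT x|M1. V1 x * (1 + cos (S1 c x + b)) * cos (a * Y1 j x)) =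
        (LINT x|M2. V2 x * (1 + cos (S2 c x + b)) * cos (a * Y2 j x))" for a
      using gen[of a 0] by (simp add: ej1 ej2)
    show "(LINT x|M1. V1 x * (1 + cos (S1 c x + b)) * sin (a * Y1 j x)) =
        (LINT x|M2. V2 x * (1 + cos (S2 c x + b)) * sin (a * Y2 j x))" for a
      using gen[of a "- (pi/2)"] by (simp add: ej1 ej2 cos_minus_pi_half)
  qed auto
  have i1: "integrable M1 (%x. V1 x * indicator (B j) (Y1 j x) * cos (S1 c x + b))" for c b
    by (rule M1.integrable_const_bound[where B=1])
      (use V in \<open>auto simp: abs_mult mult_le_one indicator_def\<close>)
  have i2: "integrable M2 (%x. V2 x * indicator (B j) (Y2 j x) * cos (S2 c x + b))" for c b
    by (rule M2.integrable_const_bound[where B=1])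
      (use V in \<open>auto simp: abs_mult mult_le_one indicator_def\<close>)
  have z: "S1 (%_. 0) x = 0" "S2 (%_. 0) y = 0" for x y by (simp_all add: S1_def S2_def)
  have "(LINT x|M1. V1 x * indicator (B j) (Y1 j x) * cos (S1 c x + b)) =
     (LINT x|M2. V2 x * indicator (B j) (Y2 j x) * cos (S2 c x + b))" for c b
  proof -
    have "(LINT x|M1. V1 x * indicator (B j) (Y1 j x)) + (LINT x|M1. V1 x * indicator (B j) (Y1 j x) * cos (S1 c x + b)) =
       (LINT x|M2. V2 x * indicator (B j) (Y2 j x)) + (LINT x|M2. V2 x * indicator (B j) (Y2 j x) * cos (S2 c x + b))"
      using main[of c b] i1[of "%_. 0" 0] i2[of "%_. 0" 0] i1[of c b] i2[of c b]
      by (subst (1 2) Bochner_Integration.integral_add[symmetric]) (auto simp: z algebra_simps)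
    \<comment> \<open>At zero coefficients and phase \<open>pi/2\<close> the cosine in the weight
      vanishes, so the same identity supplies the term to be subtracted.\<close>
    moreover have "(LINT x|M1. V1 x * indicator (B j) (Y1 j x)) = (LINT x|M2. V2 x * indicator (B j) (Y2 j x))"
      using main[of "%_. 0" "pi/2"] by (simp add: z)
    ultimately show ?thesis by simp
  qed
  then show ?case using insert.hyps unfolding V1_def V2_def S1_def S2_def by (simp add: mult_ac)
qed

text \<open>The Cramer--Wold device: laws of linear combinations fix all cosine moments, these fix
  the probabilities of rectangles, and rectangles generate the product sigma-algebra.\<close>

lemma distr_PiM_eqI:
  fixes Y1 :: "'i => 'a => real" and Y2 :: "'i => 'b => real"
  assumes M: "prob_space M1" "prob_space M2" and I: "finite I"
    and Y1[measurable]: "!!i. i \<in> I ==> Y1 i \<in> bm M1"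
    and Y2[measurable]: "!!i. i \<in> I ==> Y2 i \<in> bm M2"
    and tr: "!!c. distr M1 borel (%x. \<Sum>i\<in>I. c i * Y1 i x) = distr M2 borel (%x. \<Sum>i\<in>I. c i * Y2 i x)"
  shows "distr M1 (Pi\<^sub>M I (%_. borel)) (%x. \<lambda>i\<in>I. Y1 i x) = distr M2 (Pi\<^sub>M I (%_. borel)) (%x. \<lambda>i\<in>I. Y2 i x)"
proof (rule measure_eqI_PiM_finite[OF I])
  interpret M1: prob_space M1 by fact
  interpret M2: prob_space M2 by fact
  show "sets (distr M1 (Pi\<^sub>M I (%_. borel)) (%x. \<lambda>i\<in>I. Y1 i x)) = sets (Pi\<^sub>M I (%_. borel))"
    "sets (distr M2 (Pi\<^sub>M I (%_. borel)) (%x. \<lambda>i\<in>I. Y2 i x)) = sets (Pi\<^sub>M I (%_. borel))" by auto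
  have tr': "(LINT x|M1. cos ((\<Sum>i\<in>I. c i * Y1 i x) + b)) = (LINT x|M2. cos ((\<Sum>i\<in>I. c i * Y2 i x) + b))" for c b
    using arg_cong[OF tr[of c], of "%D. LINT y|D. cos (y + b)"] by (simp add: integral_distr)
  fix A assume A: "!!i. i \<in> I ==> A i \<in> sets (borel :: real measure)"
  have pr: "(\<Prod>i\<in>I. indicator (A i) (y i)) = (indicator (Pi\<^sub>E I A) (\<lambda>i\<in>I. y i) :: real)" for y :: "'i => real"
    using I by (auto simp: indicator_def PiE_iff prod_zero_iff)
  have "(LINT x|M1. (\<Prod>i\<in>I. indicator (A i) (Y1 i x)) * cos ((\<Sum>i\<in>I. 0 * Y1 i x) + 0)) =
    (LINT x|M2. (\<Prod>i\<in>I. indicator (A i) (Y2 i x)) * cos ((\<Sum>i\<in>I. 0 * Y2 i x) + 0))"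
    by (rule linear_combinations_determine_law[OF M I Y1 Y2 tr' A order_refl])
  then have "(LINT x|M1. indicator (Pi\<^sub>E I A) (\<lambda>i\<in>I. Y1 i x) :: real) = (LINT x|M2. indicator (Pi\<^sub>E I A) (\<lambda>i\<in>I. Y2 i x))"
    by (simp add: pr)
  moreover have s: "Pi\<^sub>E I A \<in> sets (Pi\<^sub>M I (%_. borel))" using I A by (auto intro!: sets_PiM_I_finite)
  have "(LINT x|M1. indicator (Pi\<^sub>E I A) (\<lambda>i\<in>I. Y1 i x) :: real) = measure (distr M1 (Pi\<^sub>M I (%_. borel)) (%x. \<lambda>i\<in>I. Y1 i x)) (Pi\<^sub>E I A)"
    using s by (subst integral_distr[symmetric, where N="Pi\<^sub>M I (%_. borel)" and f="indicator (Pi\<^sub>E I A)"]) auto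
  moreover have "(LINT x|M2. indicator (Pi\<^sub>E I A) (\<lambda>i\<in>I. Y2 i x) :: real) = measure (distr M2 (Pi\<^sub>M I (%_. borel)) (%x. \<lambda>i\<in>I. Y2 i x)) (Pi\<^sub>E I A)"
    using s by (subst integral_distr[symmetric, where N="Pi\<^sub>M I (%_. borel)" and f="indicator (Pi\<^sub>E I A)"]) auto
  moreover have "prob_space (distr M1 (Pi\<^sub>M I (%_. borel)) (%x. \<lambda>i\<in>I. Y1 i x))" by (rule M1.prob_space_distr) measurable
  moreover have "prob_space (distr M2 (Pi\<^sub>M I (%_. borel)) (%x. \<lambda>i\<in>I. Y2 i x))" by (rule M2.prob_space_distr) measurable
  ultimately show "emeasure (distr M1 (Pi\<^sub>M I (%_. borel)) (%x. \<lambda>i\<in>I. Y1 i x)) (Pi\<^sub>E I A) = emeasure (distr M2 (Pi\<^sub>M I (%_. borel)) (%x. \<lambda>i\<in>I. Y2 i x)) (Pi\<^sub>E I A)"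
    by (simp add: prob_space.finite_measure finite_measure.emeasure_eq_measure)
next
  interpret M1: prob_space M1 by fact
  interpret D: prob_space "distr M1 (Pi\<^sub>M I (%_. borel)) (%x. \<lambda>i\<in>I. Y1 i x)" by (rule M1.prob_space_distr) measurable
  show "range (%n::nat. \<Pi>\<^sub>E i\<in>I. UNIV) \<subseteq> prod_algebra I (%_. borel::real measure)"
    using I by (auto intro!: prod_algebraI_finite)
  show "(\<Union>n::nat. \<Pi>\<^sub>E i\<in>I. UNIV) = space (Pi\<^sub>M I (%_. borel::real measure))" by (auto simp: space_PiM)
  show "emeasure (distr M1 (Pi\<^sub>M I (%_. borel)) (%x. \<lambda>i\<in>I. Y1 i x)) (\<Pi>\<^sub>E i\<in>I. UNIV) \<noteq> \<infinity>" for n :: nat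
    using D.emeasure_finite by simp
qed

section \<open>Volterra equations with a Green kernel\<close>

lemma nn_integral_exp_le:
  fixes l s :: real
  assumes "0 < l" "0 <= s"
  shows "(NINT r|lborel. ennreal (exp (l * r)) * indicator {0..s} r) <= ennreal (exp (l * s) / l)"
proof -
  have "(NINT r|lborel. ennreal (exp (l * r)) * indicator {0..s} r) = ennreal (exp (l * s) / l - exp (l * 0) / l)"
    by (rule nn_integral_FTC_Icc) (use assms in \<open>auto intro!: derivative_eq_intros\<close>)
  also have "... <= ennreal (exp (l * s) / l)" using assms by (intro ennreal_leI) auto
  finally show ?thesis .
qed

lemma nn_integral_exp_minus_le:
  fixes l r t :: real
  assumes "0 < l" "r <= t"
  shows "(NINT s|lborel. ennreal (exp (- l * s)) * indicator {r..t} s) <= ennreal (exp (- l * r) / l)"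
proof -
  have "(NINT s|lborel. ennreal (exp (- l * s)) * indicator {r..t} s) = ennreal ((- exp (- l * t) / l) - (- exp (- l * r) / l))"
    by (rule nn_integral_FTC_Icc) (use assms in \<open>auto intro!: derivative_eq_intros\<close>)
  also have "... <= ennreal (exp (- l * r) / l)" using assms by (intro ennreal_leI) (auto simp: field_simps)
  finally show ?thesis .
qed

text \<open>The weight \<open>exp (-l s)\<close> with \<open>l = 2 K + 1\<close> absorbs half of the integral term.\<close>

lemma gronwall_integrated:
  fixes D A :: "real => ennreal" and T K :: real
  assumes T: "0 <= T" and K: "0 <= K" and [measurable]: "D \<in> bm borel" "A \<in> bm borel"
    and B: "!!s. s \<in> {0..T} ==> D s <= ennreal B"
    and le: "!!s. s \<in> {0..T} ==> D s <= A s + ennreal K * (NINT r|lborel. D r * indicator {0..s} r)"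
  shows "(NINT r|lborel. D r * indicator {0..T} r) <=
    ennreal (2 * exp ((2 * K + 1) * T)) * (NINT r|lborel. A r * indicator {0..T} r)"
proof -
  define l where "l = 2 * K + 1"
  have l: "0 < l" "K / l <= 1/2" using K by (auto simp: l_def field_simps)
  define e where "e s = ennreal (exp (- l * s))" for s
  have [measurable]: "e \<in> bm borel" unfolding e_def by measurable
  have e1: "e s <= 1" if "0 <= s" for s using that l by (simp add: e_def)
  define P where "P = (NINT s|lborel. e s * D s * indicator {0..T} s)"
  define R where "R = (NINT s|lborel. A s * indicator {0..T} s)"
  have "P <= (NINT s|lborel. ennreal B * indicator {0..T} s)"
    unfolding P_def using B e1 by (intro nn_integral_mono) (auto simp: indicator_def intro: order_trans[OF mult_mono[of _ 1]])
  also have "... < \<infinity>" using T by (simp add: nn_integral_cmult ennreal_mult_less_top)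
  finally have Pfin: "P < \<infinity>" .
  have "P <= (NINT s|lborel. A s * indicator {0..T} s + ennreal K * (NINT r|lborel. e s * indicator {0..T} s * (D r * indicator {0..s} r)))"
    unfolding P_def
  proof (rule nn_integral_mono)
    fix s
    show "e s * D s * indicator {0..T} s <= A s * indicator {0..T} s + ennreal K * (NINT r|lborel. e s * indicator {0..T} s * (D r * indicator {0..s} r))"
    proof (cases "s \<in> {0..T}")
      case True
      have "e s * D s <= e s * (A s + ennreal K * (NINT r|lborel. D r * indicator {0..s} r))"
        using le[OF True] by (rule mult_left_mono) simp
      also have "... = e s * A s + ennreal K * (NINT r|lborel. e s * (D r * indicator {0..s} r))"
        by (subst nn_integral_cmult) (auto simp: distrib_left mult_ac)
      also have "... <= 1 * A s + ennreal K * (NINT r|lborel. e s * (D r * indicator {0..s} r))"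
        using True by (intro add_right_mono mult_right_mono e1) auto
      finally show ?thesis using True by simp
    qed simp
  qed
  also have "... = R + ennreal K * (NINT s|lborel. NINT r|lborel. e s * indicator {0..T} s * (D r * indicator {0..s} r))"
    unfolding R_def by (subst nn_integral_add) (auto simp: nn_integral_cmult indicator_def)
  also have "(NINT s|lborel. NINT r|lborel. e s * indicator {0..T} s * (D r * indicator {0..s} r)) =
      (NINT r|lborel. NINT s|lborel. e s * indicator {0..T} s * (D r * indicator {0..s} r))"
    by (rule lborel_pair.Fubini'[symmetric]) (simp add: indicator_def case_prod_beta)
  also have "... <= (NINT r|lborel. ennreal (1/l) * (e r * D r * indicator {0..T} r))"
  proof (rule nn_integral_mono)
    fix r
    show "(NINT s|lborel. e s * indicator {0..T} s * (D r * indicator {0..s} r)) <= ennreal (1/l) * (e r * D r * indicator {0..T} r)"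
    proof (cases "r \<in> {0..T}")
      case True
      have "(NINT s|lborel. e s * indicator {0..T} s * (D r * indicator {0..s} r)) = (NINT s|lborel. D r * (e s * indicator {r..T} s))"
        using True by (intro nn_integral_cong) (auto simp: indicator_def mult_ac)
      also have "... = D r * (NINT s|lborel. e s * indicator {r..T} s)"
        by (rule nn_integral_cmult) simp
      also have "... <= D r * ennreal (exp (- l * r) / l)"
        unfolding e_def using True l by (intro mult_left_mono nn_integral_exp_minus_le) auto
      also have "... = ennreal (1/l) * (e r * D r)"
      proof -
        have "ennreal (exp (- l * r) / l) = ennreal (1/l) * e r"
          using l by (simp add: e_def flip: ennreal_mult')
        then show ?thesis by (simp only: mult_ac)
      qed
      finally show ?thesis using True by simp
    next
      case False
      then have "(NINT s|lborel. e s * indicator {0..T} s * (D r * indicator {0..s} r)) = (NINT (s::real)|lborel. 0)"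
        by (intro nn_integral_cong) (auto split: split_indicator)
      then show ?thesis by simp
    qed
  qed
  also have "... = ennreal (1/l) * P" unfolding P_def by (rule nn_integral_cmult) simp
  also have "ennreal K * (ennreal (1/l) * P) = ennreal (K / l) * P"
  proof -
    have "ennreal (K / l) = ennreal K * ennreal (1/l)" using K by (simp flip: ennreal_mult')
    then show ?thesis by (simp only: mult.assoc)
  qed
  also have "ennreal (K / l) * P <= ennreal (1/2) * P"
    using l by (intro mult_right_mono ennreal_leI) auto
  finally have PR: "P <= R + ennreal (1/2) * P" by (simp add: add_left_mono mult_left_mono)
  \<comment> \<open>Half of \<open>P\<close> is absorbed on the left, which is legitimate because
    the a priori bound \<open>B\<close> makes \<open>P\<close> finite.\<close>
  have P2: "P <= 2 * R"
  proof (cases "R = \<infinity>")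
    case False
    then obtain r where r: "R = ennreal r" "0 <= r" by (cases R) auto
    obtain p where p: "P = ennreal p" "0 <= p" using Pfin by (cases P) auto
    have "ennreal (r + (1/2) * p) = R + ennreal (1/2) * P"
      unfolding p(1) r(1) using p(2) r(2) by (simp only: ennreal_plus[of r "1/2 * p"] ennreal_mult'[of "1/2" p] mult_nonneg_nonneg[of "1/2" p] zero_le_divide_1_iff zero_le_numeral)
    with PR have "ennreal p <= ennreal (r + (1/2) * p)" unfolding p(1) by simp
    then have "p <= r + (1/2) * p" using p(2) r(2) by (subst (asm) ennreal_le_iff) auto
    then have "p <= 2 * r" by simp
    then show ?thesis unfolding p(1) r(1) by (metis ennreal_leI ennreal_mult' ennreal_numeral zero_le_numeral)
  qed (simp add: ennreal_mult_top)
  have "(NINT r|lborel. D r * indicator {0..T} r) <= (NINT r|lborel. ennreal (exp (l * T)) * (e r * D r * indicator {0..T} r))"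
  proof (rule nn_integral_mono)
    fix r
    have "1 <= ennreal (exp (l * T)) * e r" if "r <= T"
      using that l by (auto simp: e_def algebra_simps simp flip: ennreal_mult exp_add)
    then have "1 * D r <= ennreal (exp (l * T)) * e r * D r" if "r <= T"
      using that by (intro mult_right_mono) auto
    then show "D r * indicator {0..T} r <= ennreal (exp (l * T)) * (e r * D r * indicator {0..T} r)"
      by (auto simp: indicator_def mult_ac)
  qed
  also have "... = ennreal (exp (l * T)) * P" unfolding P_def by (rule nn_integral_cmult) simp
  also have "... <= ennreal (exp (l * T)) * (2 * R)" by (intro mult_left_mono P2) simp
  also have "... = ennreal (2 * exp (l * T)) * R"
  proof -
    have "ennreal (2 * exp (l * T)) = 2 * ennreal (exp (l * T))" by (simp add: ennreal_mult')
    then show ?thesis by (simp only: mult_ac)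
  qed
  finally show ?thesis unfolding l_def R_def .
qed

lemma nn_integral_restrict_le_cmult:
  assumes "f \<in> bm M" "!!x. x \<in> space M ==> g x <= c * f x"
  shows "(NINT x|M. g x) <= c * (NINT x|M. f x)"
proof -
  have "(NINT x|M. g x) <= (NINT x|M. c * f x)" by (rule nn_integral_mono) (rule assms(2))
  also have "... = c * (NINT x|M. f x)" by (rule nn_integral_cmult) (rule assms(1))
  finally show ?thesis .
qed

text \<open>The equation reduced to what the estimates use. A point of \<open>S\<close> is a pair of
  time and place, and \<open>\<kappa>\<close> stands for the Green function extended by zero where
  the times are not in causal order. \<open>\<kappa>_L1\<close> serves bounds at every point,
  \<open>\<kappa>_L2\<close> serves bounds in mean square over space; the latter is stated for
  extended non-negative \<open>u\<close>, so that it can be applied before integrability is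
  known.\<close>

locale volterra =
  fixes N :: "'a measure" and T C0 L :: real and \<kappa> :: "real \<times> 'a => real \<times> 'a => real" and f :: "real => real"
    and S :: "(real \<times> 'a) measure"
  assumes finite_N: "finite_measure N" and T: "0 < T" and C0: "0 < C0" and L: "0 <= L"
    and S_eq: "S = restrict_space lborel {0..T} \<Otimes>\<^sub>M N"
    and \<kappa>_measurable: "(%(a, b). \<kappa> a b) \<in> bm (S \<Otimes>\<^sub>M S)"
    and \<kappa>_nonneg: "0 <= \<kappa> a b"
    and \<kappa>_causal: "fst a <= fst b ==> \<kappa> a b = 0"
    and \<kappa>_L1: "!!s r y. s \<in> {0..T} ==> r \<in> {0..T} ==> y \<in> space N ==> (NINT \<eta>|N. ennreal (\<kappa> (s, y) (r, \<eta>))) <= ennreal C0"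
    and \<kappa>_L2: "!!s r u. s \<in> {0..T} ==> r \<in> {0..T} ==> u \<in> bm N ==>
       (NINT y|N. (NINT \<eta>|N. ennreal (\<kappa> (s, y) (r, \<eta>)) * u \<eta>)^2) <= ennreal (C0\<^sup>2) * (NINT y|N. (u y)^2)"
    and f_lip: "\<bar>f x - f y\<bar> <= L * \<bar>x - y\<bar>"
begin

abbreviation "TT \<equiv> restrict_space lborel {0..T}"

lemma finite_TT: "finite_measure TT"
  using T by (intro finite_measureI) (simp add: emeasure_restrict_space space_restrict_space)

sublocale N: finite_measure N by (rule finite_N)
sublocale TT: finite_measure TT by (rule finite_TT)
sublocale TN: pair_sigma_finite TT N ..
sublocale S: finite_measure S
  unfolding S_eq by (rule finite_measure_pair_measure[OF finite_N finite_TT])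

lemma space_S: "space S = {0..T} \<times> space N"
  by (simp add: S_eq space_pair_measure space_restrict_space)

lemma f_measurable[measurable]: "f \<in> bm borel"
proof (rule borel_measurable_continuous_onI, rule uniformly_continuous_imp_continuous)
  have "L-lipschitz_on UNIV f" using f_lip L by (auto intro!: lipschitz_onI simp: dist_real_def)
  then show "uniformly_continuous_on UNIV f" by (rule lipschitz_on_uniformly_continuous)
qed

lemma \<kappa>_meas[measurable (raw)]:
  "g \<in> M \<rightarrow>\<^sub>M S ==> h \<in> M \<rightarrow>\<^sub>M S ==> (%x. \<kappa> (g x) (h x)) \<in> bm M"
  using measurable_compose[OF measurable_Pair \<kappa>_measurable, of g M h] by simp

lemma fst_S[measurable]: "fst \<in> S \<rightarrow>\<^sub>M borel"
proof -
  have "fst \<in> S \<rightarrow>\<^sub>M TT" unfolding S_eq by simp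
  then show ?thesis by (rule measurable_restrict_space2_iff[THEN iffD1, THEN conjunct1, unfolded measurable_lborel1] | simp add: measurable_restrict_space2_iff)+
qed

lemma nn_integral_S:
  assumes "h \<in> bm S"
  shows "(NINT b|S. h b) = (NINT r|lborel. (NINT \<eta>|N. h (r, \<eta>)) * indicator {0..T} r)"
  using assms unfolding S_eq
  by (subst N.nn_integral_fst[symmetric]) (auto simp: nn_integral_restrict_space)

text \<open>For a weight that depends on time alone, the spatial integral of the kernel is at most
  \<open>C0\<close> and causality ends the time integral at \<open>fst a\<close>; what remains is a
  scalar Volterra operator.\<close>

lemma kernel_time:
  assumes [measurable]: "w \<in> bm borel" and a: "a \<in> space S"
  shows "(NINT b|S. ennreal (\<kappa> a b) * w (fst b)) <= ennreal C0 * (NINT r|lborel. w r * indicator {0..fst a} r)"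
proof -
  obtain s y where sy: "a = (s, y)" "s \<in> {0..T}" "y \<in> space N" using a by (auto simp: space_S)
  have "(NINT b|S. ennreal (\<kappa> a b) * w (fst b)) = (NINT r|lborel. (NINT \<eta>|N. ennreal (\<kappa> (s, y) (r, \<eta>)) * w r) * indicator {0..T} r)"
    using a sy(1) by (subst nn_integral_S) auto
  also have "... <= (NINT r|lborel. ennreal C0 * (w r * indicator {0..fst a} r))"
  proof (rule nn_integral_mono)
    fix r
    show "(NINT \<eta>|N. ennreal (\<kappa> (s, y) (r, \<eta>)) * w r) * indicator {0..T} r <= ennreal C0 * (w r * indicator {0..fst a} r)"
    proof (cases "r \<in> {0..T}")
      case True
      have m: "(%\<eta>. \<kappa> (s, y) (r, \<eta>)) \<in> bm N"
        using True a sy(1) by (intro \<kappa>_meas) (auto simp: S_eq space_pair_measure space_restrict_space)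
      show ?thesis
      proof (cases "r <= s")
        case True
        have "(NINT \<eta>|N. ennreal (\<kappa> (s, y) (r, \<eta>)) * w r) = (NINT \<eta>|N. ennreal (\<kappa> (s, y) (r, \<eta>))) * w r"
          using m by (intro nn_integral_multc) auto
        also have "... <= ennreal C0 * w r"
          using sy \<open>r \<in> {0..T}\<close> by (intro mult_right_mono \<kappa>_L1) auto
        finally show ?thesis using \<open>r \<in> {0..T}\<close> True sy by simp
      next
        case False
        then show ?thesis using \<kappa>_causal[of "(s, y)" "(r, _)"] by simp
      qed
    qed simp
  qed
  also have "... = ennreal C0 * (NINT r|lborel. w r * indicator {0..fst a} r)" by (rule nn_integral_cmult) simp
  finally show ?thesis .
qed

text \<open>Growth rate of the weight \<open>E\<close>. It makes the Lipschitz majorant of the drift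
  a contraction by 1/2 in the supremum norm with weight \<open>E\<close>, since
  \<open>C0 * L / rate <= 1/2\<close>; the summand 1 keeps it positive when
  \<open>L = 0\<close>.\<close>

definition rate :: real where "rate = 2 * (C0 * L) + 1"
definition E :: "real => real" where "E s = exp (rate * s)"

lemma rate: "0 < rate" using C0 L by (simp add: rate_def add_nonneg_pos)
lemma E_pos[simp]: "0 < E s" "0 <= E s" by (simp_all add: E_def)
lemma E_mono: "s <= t ==> E s <= E t" using rate by (simp add: E_def)
lemma E_ge1: "0 <= s ==> 1 <= E s" using rate by (simp add: E_def)
lemma E_measurable[measurable]: "E \<in> bm borel" unfolding E_def[abs_def] by measurable

lemma kernel_weight:
  assumes a: "a \<in> space S"
  shows "(NINT b|S. ennreal (\<kappa> a b) * (ennreal L * ennreal (E (fst b)))) <= ennreal (E (fst a) / 2)"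
proof -
  have s: "0 <= fst a" using a by (auto simp: space_S)
  have "(NINT b|S. ennreal (\<kappa> a b) * (ennreal L * ennreal (E (fst b)))) <= ennreal C0 * (NINT r|lborel. (ennreal L * ennreal (E r)) * indicator {0..fst a} r)"
    using a by (intro kernel_time[where w="%r. ennreal L * ennreal (E r)"]) auto
  also have "... = ennreal C0 * (ennreal L * (NINT r|lborel. ennreal (E r) * indicator {0..fst a} r))"
    by (subst nn_integral_cmult[symmetric]) (auto simp: mult_ac)
  also have "... <= ennreal C0 * (ennreal L * ennreal (E (fst a) / rate))"
    unfolding E_def using rate s by (intro mult_left_mono nn_integral_exp_le) auto
  also have "... = ennreal (C0 * L * (E (fst a) / rate))"
    using C0 L by (simp only: mult.assoc ennreal_mult' less_imp_le)
  also have "... <= ennreal (E (fst a) / 2)"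
  proof (rule ennreal_leI)
    have "C0 * L / rate <= 1 / 2" using rate by (simp add: divide_le_eq) (simp add: rate_def)
    then have "C0 * L / rate * E (fst a) <= 1/2 * E (fst a)" by (intro mult_right_mono) auto
    then show "C0 * L * (E (fst a) / rate) <= E (fst a) / 2" by simp
  qed
  finally show ?thesis .
qed

lemma kernel_mass:
  assumes a: "a \<in> space S"
  shows "(NINT b|S. ennreal (\<kappa> a b)) <= ennreal (C0 * T)"
proof -
  have "(NINT b|S. ennreal (\<kappa> a b) * 1) <= ennreal C0 * (NINT r|lborel. 1 * indicator {0..fst a} r)"
    using a by (intro kernel_time[where w="%_. 1"]) auto
  also have "... <= ennreal C0 * ennreal T" using a by (intro mult_left_mono) (auto simp: space_S)
  finally show ?thesis using C0 T by (simp add: ennreal_mult)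
qed

text \<open>Control up to the horizon \<open>\<tau>\<close> suffices, because the kernel does not
  look past \<open>fst a\<close>.\<close>

lemma kernel_weight_le:
  assumes a: "a \<in> space S" "fst a <= \<tau>" and [measurable]: "h \<in> bm S"
    and h: "!!b. b \<in> space S ==> fst b <= \<tau> ==> h b <= ennreal (c * E (fst b))" and c: "0 <= c"
  shows "(NINT b|S. ennreal (\<kappa> a b) * (ennreal L * h b)) <= ennreal (c * E (fst a) / 2)"
proof -
  have "(NINT b|S. ennreal (\<kappa> a b) * (ennreal L * h b)) <= ennreal c * (NINT b|S. ennreal (\<kappa> a b) * (ennreal L * ennreal (E (fst b))))"
  proof (rule nn_integral_restrict_le_cmult)
    fix b assume b: "b \<in> space S"
    show "ennreal (\<kappa> a b) * (ennreal L * h b) <= ennreal c * (ennreal (\<kappa> a b) * (ennreal L * ennreal (E (fst b))))"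
    proof (cases "fst a <= fst b")
      case True then show ?thesis by (simp add: \<kappa>_causal)
    next
      case False
      then have "h b <= ennreal c * ennreal (E (fst b))" using h[OF b] a c by (simp add: ennreal_mult)
      then have "ennreal (\<kappa> a b) * (ennreal L * h b) <= ennreal (\<kappa> a b) * (ennreal L * (ennreal c * ennreal (E (fst b))))"
        by (intro mult_left_mono) auto
      then show ?thesis by (simp add: mult_ac)
    qed
  qed (use a in measurable)
  also have "... <= ennreal c * ennreal (E (fst a) / 2)"
    using a by (intro mult_left_mono kernel_weight) auto
  finally show ?thesis using c by (simp add: ennreal_mult'[symmetric])
qed

text \<open>Inserting a bound into the inequality halves the part that stems from the a priori bound
  \<open>B\<close> and leaves \<open>2 * A\<close>, the fixed point of
  \<open>x \<mapsto> A + x / 2\<close>. The horizon \<open>\<tau>\<close> permits conclusions about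
  early times from forcing at early times only.\<close>

lemma gronwall_kernel:
  assumes [measurable]: "h \<in> bm S"
    and B: "!!a. a \<in> space S ==> fst a <= \<tau> ==> h a <= ennreal B" and A: "0 <= A"
    and le: "!!a. a \<in> space S ==> fst a <= \<tau> ==> h a <= ennreal A + (NINT b|S. ennreal (\<kappa> a b) * (ennreal L * h b))"
    and a: "a \<in> space S" "fst a <= \<tau>"
  shows "h a <= ennreal (2 * A * E (fst a))"
proof -
  define B' where "B' = max 0 B"
  have B': "0 <= B'" "ennreal B <= ennreal B'" by (auto simp: B'_def intro: ennreal_leI)
  have step: "h a <= ennreal ((2 * A + B' / 2 ^ n) * E (fst a))" if "a \<in> space S" "fst a <= \<tau>" for n a
    using that
  proof (induction n arbitrary: a)
    case 0
    have "0 <= fst a" using 0 by (auto simp: space_S)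
    then have "B' * 1 <= (2 * A + B') * E (fst a)" using A B' E_ge1 by (intro mult_mono) auto
    then show ?case using B[OF 0] B'(2) by (simp add: order_trans ennreal_leI)
  next
    case (Suc n)
    have E1: "1 <= E (fst a)" using Suc.prems by (auto simp: space_S intro!: E_ge1)
    have "h a <= ennreal A + (NINT b|S. ennreal (\<kappa> a b) * (ennreal L * h b))" by (rule le[OF Suc.prems])
    also have "... <= ennreal A + ennreal ((2 * A + B' / 2 ^ n) * E (fst a) / 2)"
      using A B' Suc by (intro add_left_mono kernel_weight_le[where \<tau>=\<tau>]) auto
    also have "... = ennreal (A + (2 * A + B' / 2 ^ n) * E (fst a) / 2)"
      using A B' by (simp add: ennreal_plus)
    also have "... <= ennreal ((2 * A + B' / 2 ^ Suc n) * E (fst a))"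
    proof (rule ennreal_leI)
      have "A * 1 <= A * E (fst a)" using A E1 by (intro mult_left_mono) auto
      then show "A + (2 * A + B' / 2 ^ n) * E (fst a) / 2 <= (2 * A + B' / 2 ^ Suc n) * E (fst a)"
        by (simp add: algebra_simps add_divide_distrib)
    qed
    finally show ?case .
  qed
  have "(%n. (2 * A + B' * (1/2) ^ n) * E (fst a)) \<longlonglongrightarrow> (2 * A + B' * 0) * E (fst a)"
    by (intro tendsto_intros LIMSEQ_realpow_zero) auto
  then have "(%n. ennreal ((2 * A + B' / 2 ^ n) * E (fst a))) \<longlonglongrightarrow> ennreal (2 * A * E (fst a))"
    by (auto dest!: tendsto_ennrealI simp: power_one_over)
  then show ?thesis by (rule LIMSEQ_le_const) (use step[OF a] in auto)
qed

end

section \<open>Picard iteration and the solution map\<close>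

context volterra begin

definition V :: "(real \<times> 'a => real) => real \<times> 'a => real" where
  "V h a = (LINT b|S. \<kappa> a b * h b)"

lemma V_measurable:
  assumes h: "(%(om, b). h om b) \<in> bm (M \<Otimes>\<^sub>M S)"
  shows "(%(om, a). V (h om) a) \<in> bm (M \<Otimes>\<^sub>M S)"
proof -
  have "(%x. h (fst (fst x)) (snd x)) \<in> bm ((M \<Otimes>\<^sub>M S) \<Otimes>\<^sub>M S)"
    using measurable_compose[OF _ h, of "%x. (fst (fst x), snd x)" "(M \<Otimes>\<^sub>M S) \<Otimes>\<^sub>M S"] by simp
  then have "(%x. \<kappa> (snd (fst x)) (snd x) * h (fst (fst x)) (snd x)) \<in> bm ((M \<Otimes>\<^sub>M S) \<Otimes>\<^sub>M S)"
    by measurable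
  then have "(%(p, b). \<kappa> (snd p) b * h (fst p) b) \<in> bm ((M \<Otimes>\<^sub>M S) \<Otimes>\<^sub>M S)"
    by (simp add: case_prod_beta)
  from S.borel_measurable_lebesgue_integral[OF this] show ?thesis
    by (simp add: V_def case_prod_beta)
qed

lemma integrable_kernel:
  assumes a: "a \<in> space S" and [measurable]: "h \<in> bm S"
    and B: "!!b. b \<in> space S ==> \<bar>h b\<bar> <= B"
  shows "integrable S (%b. \<kappa> a b * h b)"
proof (rule integrableI_bounded)
  show "(%b. \<kappa> a b * h b) \<in> bm S" using a by measurable
  have "(NINT b|S. ennreal (norm (\<kappa> a b * h b))) <= ennreal \<bar>B\<bar> * (NINT b|S. ennreal (\<kappa> a b))"
  proof (rule nn_integral_restrict_le_cmult)
    fix b assume "b \<in> space S"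
    then have "\<bar>h b\<bar> <= \<bar>B\<bar>" using B[of b] abs_ge_self[of B] by linarith
    then have "\<kappa> a b * \<bar>h b\<bar> <= \<bar>B\<bar> * \<kappa> a b" using \<kappa>_nonneg by (simp add: mult.commute[of "\<kappa> a b"] mult_right_mono)
    then show "ennreal (norm (\<kappa> a b * h b)) <= ennreal \<bar>B\<bar> * ennreal (\<kappa> a b)"
      using \<kappa>_nonneg by (simp add: abs_mult ennreal_leI flip: ennreal_mult)
  qed (use a in measurable)
  also have "... <= ennreal \<bar>B\<bar> * ennreal (C0 * T)" using a by (intro mult_left_mono kernel_mass) auto
  also have "... < \<infinity>" by (simp add: ennreal_mult_less_top)
  finally show "(NINT b|S. ennreal (norm (\<kappa> a b * h b))) < \<infinity>" .
qed

lemma V_diff: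
  assumes "integrable S (%b. \<kappa> a b * f (x b))" "integrable S (%b. \<kappa> a b * f (y b))"
  shows "ennreal \<bar>V (%b. f (x b)) a - V (%b. f (y b)) a\<bar> <= (NINT b|S. ennreal (\<kappa> a b) * (ennreal L * ennreal \<bar>x b - y b\<bar>))"
proof -
  have "V (%b. f (x b)) a - V (%b. f (y b)) a = (LINT b|S. \<kappa> a b * f (x b) - \<kappa> a b * f (y b))"
    unfolding V_def using assms by simp
  also have "ennreal (norm ...) <= (NINT b|S. ennreal (norm (\<kappa> a b * f (x b) - \<kappa> a b * f (y b))))"
    using assms by (intro integral_norm_bound_ennreal) auto
  also have "... <= (NINT b|S. ennreal (\<kappa> a b) * (ennreal L * ennreal \<bar>x b - y b\<bar>))"
  proof (rule nn_integral_mono)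
    fix b
    have "norm (\<kappa> a b * f (x b) - \<kappa> a b * f (y b)) = \<kappa> a b * \<bar>f (x b) - f (y b)\<bar>"
      using \<kappa>_nonneg by (simp add: abs_mult flip: right_diff_distrib)
    also have "... <= \<kappa> a b * (L * \<bar>x b - y b\<bar>)" using \<kappa>_nonneg f_lip by (intro mult_left_mono) auto
    finally show "ennreal (norm (\<kappa> a b * f (x b) - \<kappa> a b * f (y b))) <= ennreal (\<kappa> a b) * (ennreal L * ennreal \<bar>x b - y b\<bar>)"
      using L \<kappa>_nonneg by (simp add: ennreal_leI flip: ennreal_mult)
  qed
  finally show ?thesis by simp
qed

lemma V_f0: "a \<in> space S ==> \<bar>V (%b. f 0) a\<bar> <= \<bar>f 0\<bar> * (C0 * T)"
proof -
  assume a: "a \<in> space S"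
  have i: "integrable S (%b. \<kappa> a b * 1)" by (rule integrable_kernel[OF a, where B=1]) auto
  have "V (%b. f 0) a = f 0 * (LINT b|S. \<kappa> a b)" unfolding V_def by (simp add: mult.commute)
  moreover have "ennreal (LINT b|S. \<kappa> a b) <= ennreal (C0 * T)"
    using kernel_mass[OF a] i \<kappa>_nonneg by (subst nn_integral_eq_integral[symmetric]) auto
  then have "(LINT b|S. \<kappa> a b) <= C0 * T" using C0 T by (subst (asm) ennreal_le_iff) auto
  moreover have "0 <= (LINT b|S. \<kappa> a b)" using \<kappa>_nonneg by simp
  ultimately show ?thesis by (simp add: abs_mult mult_left_mono)
qed

lemma V_bound:
  assumes a: "a \<in> space S" and "integrable S (%b. \<kappa> a b * f (x b))"
  shows "ennreal \<bar>V (%b. f (x b)) a\<bar> <= ennreal (\<bar>f 0\<bar> * (C0 * T)) + (NINT b|S. ennreal (\<kappa> a b) * (ennreal L * ennreal \<bar>x b\<bar>))"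
proof -
  have i: "integrable S (%b. \<kappa> a b * f 0)" by (rule integrable_kernel[OF a, where B="\<bar>f 0\<bar>"]) auto
  have "\<bar>V (%b. f (x b)) a\<bar> <= \<bar>V (%b. f 0) a\<bar> + \<bar>V (%b. f (x b)) a - V (%b. f 0) a\<bar>" by simp
  then have "ennreal \<bar>V (%b. f (x b)) a\<bar> <= ennreal \<bar>V (%b. f 0) a\<bar> + ennreal \<bar>V (%b. f (x b)) a - V (%b. f 0) a\<bar>"
    by (simp flip: ennreal_plus add: ennreal_leI)
  also have "... <= ennreal (\<bar>f 0\<bar> * (C0 * T)) + (NINT b|S. ennreal (\<kappa> a b) * (ennreal L * ennreal \<bar>x b - 0\<bar>))"
    using a assms i by (intro add_mono ennreal_leI V_f0 V_diff[where y="%_. 0"]) auto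
  finally show ?thesis by simp
qed

primrec pic :: "(real \<times> 'a => real) => nat => real \<times> 'a => real" where
  "pic z 0 = (%a. 0)"
| "pic z (Suc k) = (%a. z a + V (%b. f (pic z k b)) a)"

text \<open>Defined as a limit of iterates, not by choice, so that measurability jointly in the
  noise is inherited from the iterates. For bounded measurable \<open>z\<close> it solves the
  equation.\<close>

definition sol :: "(real \<times> 'a => real) => real \<times> 'a => real" where
  "sol z a = lim (%k. pic z k a)"

lemma pic_measurable:
  assumes [measurable]: "(%(om, b). z om b) \<in> bm (M \<Otimes>\<^sub>M S)"
  shows "(%(om, b). pic (z om) k b) \<in> bm (M \<Otimes>\<^sub>M S)"
proof (induction k)
  case (Suc k)
  then have "(%p. f (case p of (om, b) => pic (z om) k b)) \<in> bm (M \<Otimes>\<^sub>M S)" by measurable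
  then have [measurable]: "(%(om, a). V (%b. f (pic (z om) k b)) a) \<in> bm (M \<Otimes>\<^sub>M S)"
    by (intro V_measurable) (simp add: case_prod_beta)
  have "(%p. (case p of (om, b) => z om b) + (case p of (om, a) => V (%b. f (pic (z om) k b)) a)) \<in> bm (M \<Otimes>\<^sub>M S)"
    by measurable
  then show ?case by (simp add: case_prod_beta)
qed simp

lemma sol_measurable:
  assumes "(%(om, b). z om b) \<in> bm (M \<Otimes>\<^sub>M S)"
  shows "(%(om, b). sol (z om) b) \<in> bm (M \<Otimes>\<^sub>M S)"
proof -
  have "(%p. lim (%k. (case p of (om, b) => pic (z om) k b))) \<in> bm (M \<Otimes>\<^sub>M S)"
    by (intro borel_measurable_lim_metric pic_measurable assms)
  then show ?thesis by (simp add: sol_def case_prod_beta)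
qed

text \<open>A one-point parameter space turns joint measurability into measurability of a single
  path.\<close>

lemma pic_measurable1:
  assumes z: "z \<in> bm S"
  shows "pic z k \<in> bm S"
proof -
  have "(%p. z (snd p)) \<in> bm (count_space {()} \<Otimes>\<^sub>M S)" using z by measurable
  then have "(%(om, a). pic z k a) \<in> bm (count_space {()} \<Otimes>\<^sub>M S)"
    by (intro pic_measurable[where z="%_. z"]) (simp add: case_prod_beta)
  from measurable_compose[OF measurable_Pair1'[of "()"] this] show ?thesis by simp
qed

lemma sol_measurable1:
  assumes z: "z \<in> bm S"
  shows "sol z \<in> bm S"
proof -
  have "(%p. z (snd p)) \<in> bm (count_space {()} \<Otimes>\<^sub>M S)" using z by measurable
  then have "(%(om, a). sol z a) \<in> bm (count_space {()} \<Otimes>\<^sub>M S)"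
    by (intro sol_measurable[where z="%_. z"]) (simp add: case_prod_beta)
  from measurable_compose[OF measurable_Pair1'[of "()"] this] show ?thesis by simp
qed

context
  fixes z :: "real \<times> 'a => real" and \<beta> :: real
  assumes z[measurable]: "z \<in> bm S" and \<beta>: "!!a. a \<in> space S ==> \<bar>z a\<bar> <= \<beta>" "0 <= \<beta>"
begin

text \<open>Bounds the first Picard iterate and thereby sets the scale of all later
  increments.\<close>

definition cc :: real where "cc = \<beta> + \<bar>f 0\<bar> * (C0 * T)"

lemma cc: "0 <= cc" using \<beta> C0 T by (simp add: cc_def)

lemma f_bounded: "\<bar>x\<bar> <= B ==> \<bar>f x\<bar> <= \<bar>f 0\<bar> + L * B"
  using f_lip[of x 0] mult_left_mono[of "\<bar>x\<bar>" B L] L by auto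

lemma E_le_ET: "a \<in> space S ==> E (fst a) <= E T"
  by (intro E_mono) (auto simp: space_S)

text \<open>The two bounds need each other: the size of the iterates makes the kernel integrals
  finite, and adding up the increments, which halve in the weighted norm, gives the size of the next
  iterate.\<close>

lemma pic_step:
  "(\<forall>b\<in>space S. \<bar>pic z k b\<bar> <= 2 * cc * (1 - (1/2)^k) * E (fst b)) \<and>
   (\<forall>b\<in>space S. \<bar>pic z (Suc k) b - pic z k b\<bar> <= cc * (1/2)^k * E (fst b))"
proof (induction k)
  case 0
  have "\<bar>z b + V (%b. f 0) b\<bar> <= cc * E (fst b)" if b: "b \<in> space S" for b
  proof -
    have "\<bar>z b + V (%b. f 0) b\<bar> <= cc * 1" using \<beta>(1)[OF b] V_f0[OF b] by (simp add: cc_def)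
    also have "... <= cc * E (fst b)" using cc b by (intro mult_left_mono E_ge1) (auto simp: space_S)
    finally show ?thesis .
  qed
  then show ?case by simp
next
  case (Suc k)
  have int: "integrable S (%b. \<kappa> a b * f (pic z j b))" if a: "a \<in> space S"
     and B: "!!b. b \<in> space S ==> \<bar>pic z j b\<bar> <= B * E (fst b)" "0 <= B" for a j B
  proof (rule integrable_kernel[OF a])
    show "(%b. f (pic z j b)) \<in> bm S" using pic_measurable1[OF z] by measurable
    show "\<bar>f (pic z j b)\<bar> <= \<bar>f 0\<bar> + L * (B * E T)" if b: "b \<in> space S" for b
      using B(1)[OF b] mult_left_mono[OF E_le_ET[OF b] B(2)] by (intro f_bounded) simp
  qed
  have 1: "\<bar>pic z (Suc k) b\<bar> <= 2 * cc * (1 - (1/2)^Suc k) * E (fst b)" if "b \<in> space S" for b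
  proof -
    have "\<bar>pic z (Suc k) b\<bar> <= \<bar>pic z k b\<bar> + \<bar>pic z (Suc k) b - pic z k b\<bar>" by linarith
    also have "... <= 2 * cc * (1 - (1/2)^k) * E (fst b) + cc * (1/2)^k * E (fst b)"
      using Suc that by (intro add_mono) blast+
    also have "... = 2 * cc * (1 - (1/2)^Suc k) * E (fst b)" by (simp add: algebra_simps)
    finally show ?thesis .
  qed
  moreover have "\<bar>pic z (Suc (Suc k)) a - pic z (Suc k) a\<bar> <= cc * (1/2)^Suc k * E (fst a)" if a: "a \<in> space S" for a
  proof -
    have "ennreal \<bar>pic z (Suc (Suc k)) a - pic z (Suc k) a\<bar> = ennreal \<bar>V (%b. f (pic z (Suc k) b)) a - V (%b. f (pic z k b)) a\<bar>"
      by simp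
    also have "... <= (NINT b|S. ennreal (\<kappa> a b) * (ennreal L * ennreal \<bar>pic z (Suc k) b - pic z k b\<bar>))"
      using 1 Suc cc power_le_one[of "1/2::real"]
      by (intro V_diff int[OF a, where B="2 * cc * (1 - (1/2)^Suc k)"] int[OF a, where B="2 * cc * (1 - (1/2)^k)"])
        (auto simp del: pic.simps power_Suc intro!: mult_nonneg_nonneg)
    also have "... <= ennreal (cc * (1/2)^k * E (fst a) / 2)"
    proof (rule kernel_weight_le[OF a order_refl])
      show "(%b. ennreal \<bar>pic z (Suc k) b - pic z k b\<bar>) \<in> bm S"
        using pic_measurable1[OF z] by measurable
      show "ennreal \<bar>pic z (Suc k) b - pic z k b\<bar> <= ennreal (cc * (1/2)^k * E (fst b))" if "b \<in> space S" for b
        using Suc that by (intro ennreal_leI) blast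
    qed (use cc in auto)
    finally show ?thesis using cc by (subst (asm) ennreal_le_iff) (auto simp del: pic.simps)
  qed
  ultimately show ?case by blast
qed

lemma pic_bound: "a \<in> space S ==> \<bar>pic z k a\<bar> <= 2 * cc * E (fst a)"
proof -
  assume a: "a \<in> space S"
  have "\<bar>pic z k a\<bar> <= 2 * cc * (1 - (1/2)^k) * E (fst a)" using pic_step a by blast
  also have "... <= 2 * cc * 1 * E (fst a)" using cc by (intro mult_right_mono mult_left_mono) auto
  finally show ?thesis by simp
qed

lemma pic_tendsto: assumes a: "a \<in> space S" shows "(%k. pic z k a) \<longlonglongrightarrow> sol z a"
proof -
  have "summable (%k. pic z (Suc k) a - pic z k a)"
  proof (rule summable_comparison_test')
    show "summable (%k. cc * E (fst a) * (1/2)^k)" by (intro summable_mult summable_geometric) simp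
    show "norm (pic z (Suc k) a - pic z k a) <= cc * E (fst a) * (1/2)^k" for k
      using pic_step[of k] a by (auto simp: mult_ac simp del: pic.simps)
  qed
  then have "convergent (%n. \<Sum>k<n. pic z (Suc k) a - pic z k a)" by (simp add: summable_iff_convergent)
  moreover have "(\<Sum>k<n. pic z (Suc k) a - pic z k a) = pic z n a" for n
    by (subst sum_lessThan_telescope) simp
  ultimately show ?thesis by (simp add: sol_def convergent_LIMSEQ_iff)
qed

lemma sol_bound: assumes a: "a \<in> space S" shows "\<bar>sol z a\<bar> <= 2 * cc * E (fst a)"
  by (rule LIMSEQ_le_const2[OF tendsto_rabs[OF pic_tendsto[OF a]]]) (use pic_bound[OF a] in auto)

lemma sol_bound_T: assumes a: "a \<in> space S" shows "\<bar>sol z a\<bar> <= 2 * cc * E T"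
  using sol_bound[OF a] mult_left_mono[OF E_le_ET[OF a], of "2 * cc"] cc by simp

lemma integrable_sol: assumes a: "a \<in> space S" shows "integrable S (%b. \<kappa> a b * f (sol z b))"
proof (rule integrable_kernel[OF a])
  show "(%b. f (sol z b)) \<in> bm S" using sol_measurable1[OF z] by measurable
  show "\<bar>f (sol z b)\<bar> <= \<bar>f 0\<bar> + L * (2 * cc * E T)" if b: "b \<in> space S" for b
    using sol_bound_T[OF b] by (rule f_bounded)
qed

lemma sol_eq: assumes a: "a \<in> space S" shows "sol z a = z a + V (%b. f (sol z b)) a"
proof -
  have "(%k. V (%b. f (pic z k b)) a) \<longlonglongrightarrow> V (%b. f (sol z b)) a"
    unfolding V_def
  proof (rule integral_dominated_convergence)
    show "integrable S (%b. \<kappa> a b * (\<bar>f 0\<bar> + L * (2 * cc * E T)))"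
      by (rule integrable_kernel[OF a, where B="\<bar>\<bar>f 0\<bar> + L * (2 * cc * E T)\<bar>"]) auto
    show "AE b in S. (%k. \<kappa> a b * f (pic z k b)) \<longlonglongrightarrow> \<kappa> a b * f (sol z b)"
    proof (rule AE_I2)
      fix b assume b: "b \<in> space S"
      have "continuous_on UNIV f"
        by (rule lipschitz_on_continuous_on[where L=L]) (use f_lip L in \<open>auto intro!: lipschitz_onI simp: dist_real_def\<close>)
      then have "(%k. f (pic z k b)) \<longlonglongrightarrow> f (sol z b)"
        using pic_tendsto[OF b] by (intro continuous_on_tendsto_compose[of UNIV f]) auto
      then show "(%k. \<kappa> a b * f (pic z k b)) \<longlonglongrightarrow> \<kappa> a b * f (sol z b)" by (intro tendsto_intros)
    qed
    show "AE b in S. norm (\<kappa> a b * f (pic z k b)) <= \<kappa> a b * (\<bar>f 0\<bar> + L * (2 * cc * E T))" for k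
    proof (rule AE_I2)
      fix b assume b: "b \<in> space S"
      have "\<bar>pic z k b\<bar> <= 2 * cc * E T"
        using pic_bound[OF b, of k] mult_left_mono[OF E_le_ET[OF b], of "2 * cc"] cc by simp
      then have "\<bar>f (pic z k b)\<bar> <= \<bar>f 0\<bar> + L * (2 * cc * E T)" by (rule f_bounded)
      then show "norm (\<kappa> a b * f (pic z k b)) <= \<kappa> a b * (\<bar>f 0\<bar> + L * (2 * cc * E T))"
        using \<kappa>_nonneg by (simp add: abs_mult mult_left_mono)
    qed
    show "(%b. \<kappa> a b * f (sol z b)) \<in> bm S" using sol_measurable1[OF z] a by measurable
    show "(%b. \<kappa> a b * f (pic z k b)) \<in> bm S" for k using pic_measurable1[OF z] a by measurable
  qed
  then have "(%k. z a + V (%b. f (pic z k b)) a) \<longlonglongrightarrow> z a + V (%b. f (sol z b)) a" by (intro tendsto_intros)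
  moreover have "(%k. pic z (Suc k) a) \<longlonglongrightarrow> sol z a" using pic_tendsto[OF a] by (rule LIMSEQ_Suc)
  ultimately show ?thesis using LIMSEQ_unique by fastforce
qed

end

lemma sol_bound':
  assumes "z \<in> bm S" "!!a. a \<in> space S ==> \<bar>z a\<bar> <= \<beta>" "0 <= \<beta>" "a \<in> space S"
  shows "\<bar>sol z a\<bar> <= 2 * (\<beta> + \<bar>f 0\<bar> * (C0 * T)) * E T"
  using sol_bound_T[OF assms] cc_def[OF assms(1-3)] by simp

end

section \<open>First moments and mean square stability\<close>

lemma ennreal_square_add_le: "(x + y)^2 <= 2 * x\<^sup>2 + 2 * y\<^sup>2" for x y :: ennreal
proof (cases "x = \<infinity> \<or> y = \<infinity>")
  case True then show ?thesis by (auto simp: power2_eq_square ennreal_mult_top ennreal_top_mult)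
next
  case False
  then obtain a b where ab: "x = ennreal a" "0 <= a" "y = ennreal b" "0 <= b" by (cases x; cases y) auto
  have "(a + b)^2 <= 2 * a\<^sup>2 + 2 * b\<^sup>2" using sum_squares_bound[of a b] by (simp add: power2_sum)
  then have "ennreal ((a + b)^2) <= ennreal (2 * a\<^sup>2 + 2 * b\<^sup>2)" by (rule ennreal_leI)
  moreover have "ennreal ((a + b)^2) = (x + y)^2" using ab by (simp add: ennreal_power flip: ennreal_plus)
  moreover have "ennreal (2 * a\<^sup>2 + 2 * b\<^sup>2) = 2 * x\<^sup>2 + 2 * y\<^sup>2"
    using ab by (simp add: ennreal_power ennreal_mult' ennreal_plus)
  ultimately show ?thesis by simp
qed

context volterra begin

lemma section_S:
  assumes "(%(om, b). z om b) \<in> bm (M \<Otimes>\<^sub>M S)" "om \<in> space M"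
  shows "z om \<in> bm S"
  using measurable_compose[OF measurable_Pair1'[OF assms(2)] assms(1)] by simp

lemma section_M:
  assumes "(%(om, b). z om b) \<in> bm (M \<Otimes>\<^sub>M S)" "a \<in> space S"
  shows "(%om. z om a) \<in> bm M"
  using measurable_compose[OF measurable_Pair2'[OF assms(2)] assms(1)] by simp

text \<open>The pathwise bound \<open>\<beta>\<close> may grow with the number of Gaussian
  coordinates. Taking expectations inside the integral inequality and applying Gronwall to the first
  absolute moment as a function of \<open>a\<close> replaces it by \<open>q\<close>; the mean of
  \<open>\<beta>\<close> enters as the finite a priori bound.\<close>

lemma sol_expectation:
  assumes M: "prob_space M" and z: "(%(om, b). z om b) \<in> bm (M \<Otimes>\<^sub>M S)"
    and [measurable]: "\<beta> \<in> bm M" and \<beta>: "!!om a. om \<in> space M ==> a \<in> space S ==> \<bar>z om a\<bar> <= \<beta> om" "!!om. 0 <= \<beta> om"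
    and fin: "(NINT om|M. ennreal (\<beta> om)) < \<infinity>"
    and q: "!!a. a \<in> space S ==> (NINT om|M. ennreal \<bar>z om a\<bar>) <= ennreal q" "0 <= q"
    and a: "a \<in> space S"
  shows "(NINT om|M. ennreal \<bar>sol (z om) a\<bar>) <= ennreal (2 * (q + \<bar>f 0\<bar> * (C0 * T)) * E (fst a))"
proof -
  interpret M: prob_space M by fact
  interpret MS: pair_sigma_finite M S ..
  define c where "c = \<bar>f 0\<bar> * (C0 * T)"
  have c: "0 <= c" using C0 T by (simp add: c_def)
  note sm = sol_measurable[OF z]
  have zs: "z om \<in> bm S" if "om \<in> space M" for om by (rule section_S[OF z that])
  have sm2[measurable]: "(%p. ennreal \<bar>sol (z (fst p)) (snd p)\<bar>) \<in> bm (M \<Otimes>\<^sub>M S)"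
    using sm by (simp add: case_prod_beta)
  have sm3: "(%p. ennreal \<bar>sol (z (snd p)) (fst p)\<bar>) \<in> bm (S \<Otimes>\<^sub>M M)"
    using measurable_compose[OF measurable_pair_swap' sm2] by (simp add: case_prod_beta)
  have z1[measurable]: "(%om. z om a) \<in> bm M" if "a \<in> space S" for a by (rule section_M[OF z that])
  show ?thesis
    unfolding c_def[symmetric]
  proof (rule gronwall_kernel[where \<tau>=T and B="2 * (enn2real (NINT om|M. ennreal (\<beta> om)) + c) * E T"])
    show "(%a. NINT om|M. ennreal \<bar>sol (z om) a\<bar>) \<in> bm S"
      using sm3 by (intro M.borel_measurable_nn_integral) (simp add: case_prod_beta)
    fix a assume a: "a \<in> space S"
    have "(NINT om|M. ennreal \<bar>sol (z om) a\<bar>) <= (NINT om|M. ennreal (2 * E T) * (ennreal (\<beta> om) + ennreal c))"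
    proof (rule nn_integral_mono)
      fix om assume w: "om \<in> space M"
      have "\<bar>sol (z om) a\<bar> <= 2 * (\<beta> om + c) * E T"
        unfolding c_def by (rule sol_bound'[OF zs[OF w]]) (use \<beta> w a in auto)
      then have "ennreal \<bar>sol (z om) a\<bar> <= ennreal (2 * (\<beta> om + c) * E T)" by (rule ennreal_leI)
      also have "... = ennreal ((2 * E T) * (\<beta> om + c))" by (simp only: mult_ac)
      also have "... = ennreal (2 * E T) * (ennreal (\<beta> om) + ennreal c)"
        using \<beta>(2)[of om] c by (subst ennreal_mult) auto
      finally show "ennreal \<bar>sol (z om) a\<bar> <= ennreal (2 * E T) * (ennreal (\<beta> om) + ennreal c)" .
    qed
    also have "... = ennreal (2 * E T) * ((NINT om|M. ennreal (\<beta> om)) + ennreal c)"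
      by (subst nn_integral_cmult) (auto simp: nn_integral_add M.emeasure_space_1)
    also have "... = ennreal (2 * (enn2real (NINT om|M. ennreal (\<beta> om)) + c) * E T)"
    proof -
      have "(NINT om|M. ennreal (\<beta> om)) = ennreal (enn2real (NINT om|M. ennreal (\<beta> om)))"
        using fin by (simp add: ennreal_enn2real)
      moreover have "ennreal (2 * E T) * (ennreal u + ennreal c) = ennreal (2 * (u + c) * E T)" if "0 <= u" for u
        using that c by (simp add: mult_ac flip: ennreal_plus ennreal_mult)
      ultimately show ?thesis by (metis enn2real_nonneg)
    qed
    finally show "(NINT om|M. ennreal \<bar>sol (z om) a\<bar>) <= ennreal (2 * (enn2real (NINT om|M. ennreal (\<beta> om)) + c) * E T)" .
    have "(NINT om|M. ennreal \<bar>sol (z om) a\<bar>) <=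
      (NINT om|M. (ennreal \<bar>z om a\<bar> + ennreal c) + (NINT b|S. ennreal (\<kappa> a b) * (ennreal L * ennreal \<bar>sol (z om) b\<bar>)))"
    proof (rule nn_integral_mono)
      fix om assume w: "om \<in> space M"
      note ss = zs[OF w] \<beta>(1)[OF w] \<beta>(2)[of om]
      have "\<bar>sol (z om) a\<bar> <= \<bar>z om a\<bar> + \<bar>V (%b. f (sol (z om) b)) a\<bar>"
        by (subst sol_eq[OF ss a]) auto
      then have "ennreal \<bar>sol (z om) a\<bar> <= ennreal \<bar>z om a\<bar> + ennreal \<bar>V (%b. f (sol (z om) b)) a\<bar>"
        by (simp flip: ennreal_plus add: ennreal_leI)
      also have "... <= ennreal \<bar>z om a\<bar> + (ennreal c + (NINT b|S. ennreal (\<kappa> a b) * (ennreal L * ennreal \<bar>sol (z om) b\<bar>)))"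
        unfolding c_def by (intro add_left_mono V_bound a integrable_sol[OF ss])
      finally show "ennreal \<bar>sol (z om) a\<bar> <= (ennreal \<bar>z om a\<bar> + ennreal c) + (NINT b|S. ennreal (\<kappa> a b) * (ennreal L * ennreal \<bar>sol (z om) b\<bar>))"
        by (simp add: add.assoc)
    qed
    also have "... = ((NINT om|M. ennreal \<bar>z om a\<bar>) + ennreal c) + (NINT om|M. NINT b|S. ennreal (\<kappa> a b) * (ennreal L * ennreal \<bar>sol (z om) b\<bar>))"
    proof (subst nn_integral_add)
      have "(%(om, b). ennreal (\<kappa> a b) * (ennreal L * ennreal \<bar>sol (z om) b\<bar>)) \<in> bm (M \<Otimes>\<^sub>M S)"
        using a by (simp add: case_prod_beta)
      then show "(%om. NINT b|S. ennreal (\<kappa> a b) * (ennreal L * ennreal \<bar>sol (z om) b\<bar>)) \<in> bm M"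
        by (rule S.borel_measurable_nn_integral)
      have [measurable]: "(%om. z om a) \<in> bm M" using a by measurable
      show "(%om. ennreal \<bar>z om a\<bar> + ennreal c) \<in> bm M" by measurable
      show "(NINT om|M. ennreal \<bar>z om a\<bar> + ennreal c) + (NINT om|M. NINT b|S. ennreal (\<kappa> a b) * (ennreal L * ennreal \<bar>sol (z om) b\<bar>)) =
        ((NINT om|M. ennreal \<bar>z om a\<bar>) + ennreal c) + (NINT om|M. NINT b|S. ennreal (\<kappa> a b) * (ennreal L * ennreal \<bar>sol (z om) b\<bar>))"
        by (simp add: nn_integral_add M.emeasure_space_1)
    qed
    also have "(NINT om|M. NINT b|S. ennreal (\<kappa> a b) * (ennreal L * ennreal \<bar>sol (z om) b\<bar>)) =
       (NINT b|S. NINT om|M. ennreal (\<kappa> a b) * (ennreal L * ennreal \<bar>sol (z om) b\<bar>))"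
      using a by (intro MS.Fubini'[symmetric]) (simp add: case_prod_beta)
    also have "... = (NINT b|S. ennreal (\<kappa> a b) * (ennreal L * (NINT om|M. ennreal \<bar>sol (z om) b\<bar>)))"
    proof (rule nn_integral_cong)
      fix b assume "b \<in> space S"
      then have "(%om. ennreal \<bar>sol (z om) b\<bar>) \<in> bm M" using section_M[OF sm] by simp
      then show "(NINT om|M. ennreal (\<kappa> a b) * (ennreal L * ennreal \<bar>sol (z om) b\<bar>)) = ennreal (\<kappa> a b) * (ennreal L * (NINT om|M. ennreal \<bar>sol (z om) b\<bar>))"
        by (simp add: nn_integral_cmult)
    qed
    also have "((NINT om|M. ennreal \<bar>z om a\<bar>) + ennreal c) <= ennreal (q + c)"
      using q(1)[OF a] q(2) c by (simp add: ennreal_plus add_right_mono)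
    finally show "(NINT om|M. ennreal \<bar>sol (z om) a\<bar>) <= ennreal (q + c) + (NINT b|S. ennreal (\<kappa> a b) * (ennreal L * (NINT om|M. ennreal \<bar>sol (z om) b\<bar>)))"
      by (simp add: add_right_mono)
  qed (use q c a in \<open>auto simp: space_S\<close>)
qed

lemma pair_S[measurable]: "(%x. (g x, h x)) \<in> M \<rightarrow>\<^sub>M S" if "g \<in> M \<rightarrow>\<^sub>M TT" "h \<in> M \<rightarrow>\<^sub>M N" for g h
  unfolding S_eq using that by measurable

text \<open>Cauchy--Schwarz in time costs the factor \<open>T\<close>; for each pair of times the
  spatial operator contributes \<open>C0\<^sup>2\<close>. The indicator preserves causality, on
  which the later Gronwall argument depends.\<close>

lemma kernel_L2:
  assumes [measurable]: "h \<in> bm S" and s: "s \<in> {0..T}"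
  shows "(NINT y|N. (NINT b|S. ennreal (\<kappa> (s, y) b) * h b)^2) <=
    ennreal (T * C0\<^sup>2) * (NINT b|S. (h b)^2 * indicator {0..s} (fst b))"
proof -
  have sT[simp]: "s \<in> space TT" using s by (simp add: space_restrict_space)
  define \<phi> where "\<phi> r y = (NINT \<eta>|N. ennreal (\<kappa> (s, y) (r, \<eta>)) * h (r, \<eta>))" for r y
  have p1: "(%p. (s, snd (fst p))) \<in> (TT \<Otimes>\<^sub>M N) \<Otimes>\<^sub>M N \<rightarrow>\<^sub>M S"
    by (rule pair_S[OF measurable_const[OF sT]]) measurable
  have p2: "(%p. (fst (fst p), snd p)) \<in> (TT \<Otimes>\<^sub>M N) \<Otimes>\<^sub>M N \<rightarrow>\<^sub>M S"
    by (rule pair_S) measurable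
  note [measurable] = \<kappa>_meas[OF p1 p2] measurable_compose[OF p2 assms(1)]
  have "(%p. ennreal (\<kappa> (s, snd (fst p)) (fst (fst p), snd p)) * h (fst (fst p), snd p)) \<in> bm ((TT \<Otimes>\<^sub>M N) \<Otimes>\<^sub>M N)"
    by measurable
  then have \<phi>m[measurable]: "(%p. \<phi> (fst p) (snd p)) \<in> bm (TT \<Otimes>\<^sub>M N)"
    unfolding \<phi>_def by (intro N.borel_measurable_nn_integral) (simp add: case_prod_beta)
  have ind[measurable]: "(%r. indicator {0..s} r :: ennreal) \<in> bm TT"
    by (rule measurable_restrict_space1) simp
  have 1: "(NINT b|S. ennreal (\<kappa> (s, y) b) * h b) = (NINT r|TT. \<phi> r y * indicator {0..s} r)" if y: "y \<in> space N" for y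
  proof -
    have "(s, y) \<in> space S" using s y by (simp add: space_S)
    then have "(%b. ennreal (\<kappa> (s, y) b) * h b) \<in> bm (TT \<Otimes>\<^sub>M N)"
      unfolding S_eq[symmetric] by measurable
    from N.nn_integral_fst[OF this] have "(NINT b|S. ennreal (\<kappa> (s, y) b) * h b) = (NINT r|TT. \<phi> r y)"
      unfolding S_eq[symmetric] \<phi>_def by simp
    also have "... = (NINT r|TT. \<phi> r y * indicator {0..s} r)"
    proof (rule nn_integral_cong)
      fix r assume "r \<in> space TT"
      moreover have "\<phi> r y = 0" if "s < r" using that \<kappa>_causal[of "(s, y)" "(r, _)"] by (simp add: \<phi>_def)
      ultimately show "\<phi> r y = \<phi> r y * indicator {0..s} r" by (auto simp: space_restrict_space indicator_def)
    qed
    finally show ?thesis .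
  qed
  have "(NINT y|N. (NINT b|S. ennreal (\<kappa> (s, y) b) * h b)^2) <= (NINT y|N. ennreal T * (NINT r|TT. (\<phi> r y)^2 * indicator {0..s} r))"
  proof (rule nn_integral_mono)
    fix y assume y: "y \<in> space N"
    have [measurable]: "(%r. \<phi> r y) \<in> bm TT"
      using measurable_compose[OF measurable_Pair2'[OF y] \<phi>m] by simp
    have "(NINT b|S. ennreal (\<kappa> (s, y) b) * h b)^2 = (NINT r|TT. (\<phi> r y * indicator {0..s} r) * 1)^2"
      using 1[OF y] by simp
    also have "... <= (NINT r|TT. (\<phi> r y * indicator {0..s} r)^2) * (NINT r|TT. 1\<^sup>2)"
      by (rule Cauchy_Schwarz_nn_integral) auto
    also have "(NINT r|TT. 1\<^sup>2) = ennreal T" using T by (simp add: emeasure_restrict_space space_restrict_space)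
    also have "(NINT r|TT. (\<phi> r y * indicator {0..s} r)^2) = (NINT r|TT. (\<phi> r y)^2 * indicator {0..s} r)"
      by (intro nn_integral_cong) (auto simp: indicator_def)
    finally show "(NINT b|S. ennreal (\<kappa> (s, y) b) * h b)^2 <= ennreal T * (NINT r|TT. (\<phi> r y)^2 * indicator {0..s} r)"
      by (simp add: mult.commute)
  qed
  also have "... = ennreal T * (NINT y|N. NINT r|TT. (\<phi> r y)^2 * indicator {0..s} r)"
  proof (rule nn_integral_cmult)
    have "(%p. (\<phi> (snd p) (fst p))^2 * indicator {0..s} (snd p)) \<in> bm (N \<Otimes>\<^sub>M TT)"
      using measurable_compose[OF measurable_pair_swap' \<phi>m] by (simp add: case_prod_beta)
    then show "(%y. NINT r|TT. (\<phi> r y)^2 * indicator {0..s} r) \<in> bm N"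
      by (intro TT.borel_measurable_nn_integral) (simp add: case_prod_beta)
  qed
  also have "(NINT y|N. NINT r|TT. (\<phi> r y)^2 * indicator {0..s} r) = (NINT r|TT. NINT y|N. (\<phi> r y)^2 * indicator {0..s} r)"
    by (rule TN.Fubini') (simp add: case_prod_beta)
  also have "... <= (NINT r|TT. ennreal (C0\<^sup>2) * (NINT \<eta>|N. (h (r, \<eta>))^2 * indicator {0..s} r))"
  proof (rule nn_integral_mono)
    fix r assume r: "r \<in> space TT"
    have [measurable]: "(%\<eta>. h (r, \<eta>)) \<in> bm N" "(%y. \<phi> r y) \<in> bm N"
      using r measurable_compose[OF measurable_Pair1'[OF r] \<phi>m] by auto
    have "(NINT y|N. (\<phi> r y)^2) <= ennreal (C0\<^sup>2) * (NINT \<eta>|N. (h (r, \<eta>))^2)"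
      unfolding \<phi>_def using s r by (intro \<kappa>_L2) (auto simp: space_restrict_space)
    then have "(NINT y|N. (\<phi> r y)^2) * indicator {0..s} r <= (ennreal (C0\<^sup>2) * (NINT \<eta>|N. (h (r, \<eta>))^2)) * indicator {0..s} r"
      by (rule mult_right_mono) simp
    then show "(NINT y|N. (\<phi> r y)^2 * indicator {0..s} r) <= ennreal (C0\<^sup>2) * (NINT \<eta>|N. (h (r, \<eta>))^2 * indicator {0..s} r)"
      by (simp add: nn_integral_multc mult.assoc)
  qed
  also have "... = ennreal (C0\<^sup>2) * (NINT r|TT. NINT \<eta>|N. (h (r, \<eta>))^2 * indicator {0..s} r)"
    by (rule nn_integral_cmult) (intro N.borel_measurable_nn_integral, simp add: case_prod_beta)
  also have "(NINT r|TT. NINT \<eta>|N. (h (r, \<eta>))^2 * indicator {0..s} r) = (NINT b|S. (h b)^2 * indicator {0..s} (fst b))"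
  proof -
    have "(%b. (h b)^2 * indicator {0..s} (fst b)) \<in> bm (TT \<Otimes>\<^sub>M N)"
      unfolding S_eq[symmetric] by measurable
    from N.nn_integral_fst[OF this] show ?thesis by (simp add: S_eq)
  qed
  finally show ?thesis
    using T by (simp add: ennreal_mult' mult.assoc mult_left_mono)
qed

end

context volterra begin

text \<open>Gronwall constant for squared slice norms: \<open>L\<^sup>2 * (T * C0\<^sup>2)\<close>
  from the drift, doubled by \<open>(x + y)^2 <= 2 * x\<^sup>2 + 2 * y\<^sup>2\<close>.\<close>

definition KK :: real where "KK = 2 * (L\<^sup>2 * (T * C0\<^sup>2))"

lemma KK: "0 <= KK" using T by (simp add: KK_def)

context
  fixes M :: "'w measure" and d \<zeta> :: "'w => real \<times> 'a => ennreal" and B :: real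
  assumes M: "sigma_finite_measure M"
    and d: "(%(om, a). d om a) \<in> bm (M \<Otimes>\<^sub>M S)" and \<zeta>: "(%(om, a). \<zeta> om a) \<in> bm (M \<Otimes>\<^sub>M S)"
    and le: "!!a. a \<in> space S ==> AE om in M. d om a <= \<zeta> om a + (NINT b|S. ennreal (\<kappa> a b) * (ennreal L * d om b))"
    and bound: "!!a. a \<in> space S ==> (NINT om|M. (d om a)^2) <= ennreal B"
begin

interpretation M: sigma_finite_measure M by (rule M)
interpretation MS: pair_sigma_finite M S ..
interpretation MN: pair_sigma_finite M N ..

definition msq where "msq a = (NINT om|M. (d om a)^2)"
definition zsq where "zsq a = (NINT om|M. (\<zeta> om a)^2)"

lemma swap_measurable:
  assumes "(%(om, a). (g om a :: ennreal)) \<in> bm (M \<Otimes>\<^sub>M S)"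
  shows "(%p. g (snd p) (fst p)) \<in> bm (S \<Otimes>\<^sub>M M)"
  using measurable_compose[OF measurable_pair_swap' assms] by (simp add: case_prod_beta)

lemma msq_measurable[measurable]: "msq \<in> bm S" "zsq \<in> bm S"
  unfolding msq_def[abs_def] zsq_def[abs_def] using swap_measurable[OF d] swap_measurable[OF \<zeta>]
  by (auto intro!: M.borel_measurable_nn_integral simp: case_prod_beta)

lemma Pair_S: "s \<in> {0..T} ==> Pair s \<in> N \<rightarrow>\<^sub>M S"
  unfolding S_eq by (rule measurable_Pair1') (simp add: space_restrict_space)

text \<open>The inequality for \<open>d\<close> holds almost everywhere in \<open>M\<close> for each
  fixed \<open>a\<close>, with an exceptional set that may vary with \<open>a\<close>. It is
  therefore squared and integrated over \<open>M\<close> before any integration over space.\<close>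

lemma msq_slice_indicator:
  assumes s: "s \<in> {0..T}"
  shows "(NINT y|N. msq (s, y)) <= 2 * (NINT y|N. zsq (s, y)) + ennreal KK * (NINT b|S. msq b * indicator {0..s} (fst b))"
proof -
  note P = Pair_S[OF s]
  have ms: "(%y. msq (s, y)) \<in> bm N" "(%y. zsq (s, y)) \<in> bm N"
    using measurable_compose[OF P msq_measurable(1)] measurable_compose[OF P msq_measurable(2)] .
  define W where "W om a = (NINT b|S. ennreal (\<kappa> a b) * d om b)" for om a
  have dsec: "d om \<in> bm S" if "om \<in> space M" for om
    using measurable_compose[OF measurable_Pair1'[OF that] d] by simp
  have d1: "(%om. d om a) \<in> bm M" "(%om. \<zeta> om a) \<in> bm M" if "a \<in> space S" for a
    using measurable_compose[OF measurable_Pair2'[OF that] d] measurable_compose[OF measurable_Pair2'[OF that] \<zeta>] by auto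
  have Wm: "(%p. W (fst p) (snd p)) \<in> bm (M \<Otimes>\<^sub>M S)"
  proof -
    have "(%x. d (fst (fst x)) (snd x)) \<in> bm ((M \<Otimes>\<^sub>M S) \<Otimes>\<^sub>M S)"
      using measurable_compose[OF _ d, of "%x. (fst (fst x), snd x)" "(M \<Otimes>\<^sub>M S) \<Otimes>\<^sub>M S"] by simp
    then have "(%x. ennreal (\<kappa> (snd (fst x)) (snd x)) * d (fst (fst x)) (snd x)) \<in> bm ((M \<Otimes>\<^sub>M S) \<Otimes>\<^sub>M S)"
      by measurable
    then show ?thesis unfolding W_def
      by (intro S.borel_measurable_nn_integral) (simp add: case_prod_beta)
  qed
  have W1: "(%om. W om a) \<in> bm M" if "a \<in> space S" for a
    using measurable_compose[OF measurable_Pair2'[OF that] Wm] by simp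
  have pw: "msq (s, y) <= 2 * zsq (s, y) + ennreal (2 * L\<^sup>2) * (NINT om|M. (W om (s, y))^2)" if y: "y \<in> space N" for y
  proof -
    have a: "(s, y) \<in> space S" using s y by (simp add: space_S)
    note [measurable] = d1[OF a] W1[OF a]
    have "msq (s, y) <= (NINT om|M. 2 * (\<zeta> om (s, y))^2 + ennreal (2 * L\<^sup>2) * (W om (s, y))^2)"
      unfolding msq_def
    proof (rule nn_integral_mono_AE)
      show "AE om in M. (d om (s, y))^2 <= 2 * (\<zeta> om (s, y))^2 + ennreal (2 * L\<^sup>2) * (W om (s, y))^2"
        using le[OF a] AE_space
      proof eventually_elim
        case (elim om)
        have "(NINT b|S. ennreal (\<kappa> (s, y) b) * (ennreal L * d om b)) = (NINT b|S. ennreal L * (ennreal (\<kappa> (s, y) b) * d om b))"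
          by (simp only: mult_ac)
        also have "... = ennreal L * W om (s, y)"
          unfolding W_def using dsec[OF elim(2)] a by (intro nn_integral_cmult) measurable
        finally have "d om (s, y) <= \<zeta> om (s, y) + ennreal L * W om (s, y)" using elim(1) by simp
        then have "(d om (s, y))^2 <= (\<zeta> om (s, y) + ennreal L * W om (s, y))^2" by (simp add: power2_eq_square mult_mono)
        also have "... <= 2 * (\<zeta> om (s, y))^2 + 2 * (ennreal L * W om (s, y))^2" by (rule ennreal_square_add_le)
        also have "2 * (ennreal L * W om (s, y))^2 = ennreal (2 * L\<^sup>2) * (W om (s, y))^2"
          using L by (simp add: ennreal_mult' power_mult_distrib mult.assoc flip: ennreal_power)
        finally show ?case .
      qed
    qed
    also have "... = 2 * zsq (s, y) + ennreal (2 * L\<^sup>2) * (NINT om|M. (W om (s, y))^2)"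
      unfolding zsq_def by (simp add: nn_integral_add nn_integral_cmult)
    finally show ?thesis .
  qed
  have Wp[measurable]: "(%p. W (fst p) (s, snd p)) \<in> bm (M \<Otimes>\<^sub>M N)"
  proof -
    have "(%p. (fst p, (s, snd p))) \<in> M \<Otimes>\<^sub>M N \<rightarrow>\<^sub>M M \<Otimes>\<^sub>M S"
      using measurable_compose[OF measurable_snd P] by (intro measurable_Pair) auto
    from measurable_compose[OF this Wm] show ?thesis by simp
  qed
  have Wint: "(%y. NINT om|M. (W om (s, y))^2) \<in> bm N"
  proof -
    have "(%p. (W (snd p) (s, fst p))^2) \<in> bm (N \<Otimes>\<^sub>M M)"
      using measurable_compose[OF measurable_pair_swap' Wp] by (simp add: case_prod_beta)
    then show ?thesis by (intro M.borel_measurable_nn_integral) (simp add: case_prod_beta)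
  qed
  have "(NINT y|N. msq (s, y)) <= (NINT y|N. 2 * zsq (s, y) + ennreal (2 * L\<^sup>2) * (NINT om|M. (W om (s, y))^2))"
    by (intro nn_integral_mono pw)
  also have "... = 2 * (NINT y|N. zsq (s, y)) + ennreal (2 * L\<^sup>2) * (NINT y|N. NINT om|M. (W om (s, y))^2)"
    using ms Wint by (simp add: nn_integral_add nn_integral_cmult)
  also have "(NINT y|N. NINT om|M. (W om (s, y))^2) = (NINT om|M. NINT y|N. (W om (s, y))^2)"
    by (rule MN.Fubini') (simp add: case_prod_beta)
  also have "... <= (NINT om|M. ennreal (T * C0\<^sup>2) * (NINT b|S. (d om b)^2 * indicator {0..s} (fst b)))"
    unfolding W_def by (intro nn_integral_mono kernel_L2 dsec s)
  also have "... = ennreal (T * C0\<^sup>2) * (NINT om|M. NINT b|S. (d om b)^2 * indicator {0..s} (fst b))"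
    by (rule nn_integral_cmult) (use d in \<open>auto intro!: S.borel_measurable_nn_integral simp: case_prod_beta\<close>)
  also have "(NINT om|M. NINT b|S. (d om b)^2 * indicator {0..s} (fst b)) = (NINT b|S. NINT om|M. (d om b)^2 * indicator {0..s} (fst b))"
    by (rule MS.Fubini'[symmetric]) (use d in \<open>simp add: case_prod_beta\<close>)
  also have "... = (NINT b|S. msq b * indicator {0..s} (fst b))"
    unfolding msq_def using d1 by (intro nn_integral_cong nn_integral_multc) simp
  finally have "(NINT y|N. msq (s, y)) <= 2 * (NINT y|N. zsq (s, y)) + ennreal (2 * L\<^sup>2) * (ennreal (T * C0\<^sup>2) * (NINT b|S. msq b * indicator {0..s} (fst b)))"
    by (simp add: add_left_mono mult_left_mono)
  also have "ennreal (2 * L\<^sup>2) * (ennreal (T * C0\<^sup>2) * (NINT b|S. msq b * indicator {0..s} (fst b))) = ennreal KK * (NINT b|S. msq b * indicator {0..s} (fst b))"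
  proof -
    have "ennreal KK = ennreal (2 * L\<^sup>2) * ennreal (T * C0\<^sup>2)" by (simp add: KK_def mult.assoc flip: ennreal_mult')
    then show ?thesis by (simp only: mult.assoc)
  qed
  finally show ?thesis .
qed

text \<open>Gronwall in time for the squared slice norms; the factor 4 is 2 from Gronwall times 2
  from squaring a sum.\<close>

lemma msq_total: "(NINT a|S. msq a) <= ennreal (4 * exp ((2 * KK + 1) * T)) * (NINT a|S. zsq a)"
proof -
  have m: "(%r. (NINT y|N. g (r, y)) * indicator {0..T} r) \<in> bm borel" if [measurable]: "g \<in> bm S" for g :: "real \<times> 'a => ennreal"
  proof -
    have "(%r. NINT y|N. g (r, y)) \<in> bm TT"
      using that unfolding S_eq by (intro N.borel_measurable_nn_integral) simp
    then have "(%r. (NINT y|N. g (r, y)) * indicator {0..T} r) \<in> bm lborel"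
      by (subst borel_measurable_restrict_space_iff_ennreal[symmetric]) auto
    then show ?thesis by simp
  qed
  define D where "D r = (NINT y|N. msq (r, y)) * indicator {0..T} r" for r
  define A where "A r = 2 * ((NINT y|N. zsq (r, y)) * indicator {0..T} r)" for r
  have "(NINT r|lborel. D r * indicator {0..T} r) <= ennreal (2 * exp ((2 * KK + 1) * T)) * (NINT r|lborel. A r * indicator {0..T} r)"
  proof (rule gronwall_integrated[where B="\<bar>B\<bar> * measure N (space N)"])
    show "D \<in> bm borel" "A \<in> bm borel" unfolding D_def A_def using m by auto
    fix s assume s: "s \<in> {0..T}"
    have "(NINT y|N. msq (s, y)) <= (NINT y|N. ennreal \<bar>B\<bar>)"
    proof (rule nn_integral_mono)
      fix y assume "y \<in> space N"
      then have "msq (s, y) <= ennreal B" unfolding msq_def using s by (intro bound) (simp add: space_S)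
      also have "... <= ennreal \<bar>B\<bar>" by (rule ennreal_leI) simp
      finally show "msq (s, y) <= ennreal \<bar>B\<bar>" .
    qed
    then have "D s <= (NINT y|N. ennreal \<bar>B\<bar>)" using s by (simp add: D_def)
    then show "D s <= ennreal (\<bar>B\<bar> * measure N (space N))"
      by (simp add: ennreal_mult N.emeasure_eq_measure)
    have "D s <= A s + ennreal KK * (NINT b|S. msq b * indicator {0..s} (fst b))"
      using msq_slice_indicator[OF s] s by (simp add: D_def A_def)
    also have "(NINT b|S. msq b * indicator {0..s} (fst b)) = (NINT r|lborel. D r * indicator {0..s} r)"
    proof (subst nn_integral_S)
      show "(NINT r|lborel. (NINT \<eta>|N. msq (r, \<eta>) * indicator {0..s} (fst (r, \<eta>))) * indicator {0..T} r) = (NINT r|lborel. D r * indicator {0..s} r)"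
        unfolding D_def by (intro nn_integral_cong) (auto simp: indicator_def)
    qed simp
    finally show "D s <= A s + ennreal KK * (NINT r|lborel. D r * indicator {0..s} r)" .
  qed (use T KK in auto)
  also have "(NINT r|lborel. D r * indicator {0..T} r) = (NINT a|S. msq a)"
    by (subst nn_integral_S) (auto simp: D_def intro!: nn_integral_cong simp: indicator_def)
  also have "(NINT r|lborel. A r * indicator {0..T} r) = 2 * (NINT a|S. zsq a)"
    using m[of zsq] by (subst nn_integral_S, simp, subst nn_integral_cmult[symmetric]) (auto simp: A_def intro!: nn_integral_cong simp: indicator_def)
  finally have "(NINT a|S. msq a) <= ennreal (2 * exp ((2 * KK + 1) * T)) * (2 * (NINT a|S. zsq a))" .
  also have "... = ennreal (4 * exp ((2 * KK + 1) * T)) * (NINT a|S. zsq a)"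
  proof -
    have "ennreal (4 * exp ((2 * KK + 1) * T)) = ennreal (2 * exp ((2 * KK + 1) * T)) * 2"
      using ennreal_mult''[of 2 "2 * exp ((2 * KK + 1) * T)"] by simp
    then show ?thesis by (simp only: mult.assoc)
  qed
  finally show ?thesis .
qed

text \<open>A bound over space and time says nothing about one time slice, and the field is observed
  at one time. The slice bound results from inserting the total bound once more into the slice
  inequality.\<close>

lemma L2_stability:
  shows "(NINT a|S. NINT om|M. (d om a)^2) <= ennreal (4 * exp ((2 * KK + 1) * T)) * (NINT a|S. NINT om|M. (\<zeta> om a)^2)" (is ?total)
    and "s \<in> {0..T} ==> (NINT y|N. NINT om|M. (d om (s, y))^2) <=
      2 * (NINT y|N. NINT om|M. (\<zeta> om (s, y))^2) +
      ennreal (KK * (4 * exp ((2 * KK + 1) * T))) * (NINT a|S. NINT om|M. (\<zeta> om a)^2)" (is "_ ==> ?slice")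
proof -
  show ?total using msq_total by (simp add: msq_def zsq_def)
  assume s: "s \<in> {0..T}"
  have "(NINT b|S. msq b * indicator {0..s} (fst b)) <= (NINT b|S. msq b)"
    by (intro nn_integral_mono) (auto simp: indicator_def)
  also note msq_total
  finally have "(NINT y|N. msq (s, y)) <= 2 * (NINT y|N. zsq (s, y)) + ennreal KK * (ennreal (4 * exp ((2 * KK + 1) * T)) * (NINT a|S. zsq a))"
    using msq_slice_indicator[OF s] by (meson add_left_mono mult_left_mono order_trans zero_le)
  also have "ennreal KK * (ennreal (4 * exp ((2 * KK + 1) * T)) * (NINT a|S. zsq a)) = ennreal (KK * (4 * exp ((2 * KK + 1) * T))) * (NINT a|S. zsq a)"
    using KK by (simp only: ennreal_mult' mult.assoc)
  finally show ?slice by (simp add: msq_def zsq_def)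
qed

end
end

text \<open>The preimage of an interval under \<open>H\<close> is an interval of length between
  \<open>(b - a) / B\<close> and \<open>(b - a) / A\<close>. From above, the normal density is at
  most 1. From below, both end points of the preimage lie within \<open>(R + K) / A\<close> of the
  origin, where the density is at least its value at that distance.\<close>

lemma density_bilipschitz:
  fixes H :: "real => real"
  assumes A: "0 < A" and lo: "!!r r'. r' <= r ==> A * (r - r') <= H r - H r'" and hi: "!!r r'. r' <= r ==> H r - H r' <= B * (r - r')"
    and Hm[measurable]: "H \<in> bm borel" and ab: "a <= b"
  shows "emeasure std_normal_distribution {r. H r \<in> {a..b}} <= ennreal ((b - a) / A)"
    and "[|\<bar>H 0\<bar> <= K; \<bar>a\<bar> <= R; \<bar>b\<bar> <= R|] ==> ennreal (std_normal_density ((R + K) / A) * ((b - a) / B)) <= emeasure std_normal_distribution {r. H r \<in> {a..b}}"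
proof -
  have B: "A <= B" using lo[of 0 1] hi[of 0 1] by simp
  have lip: "\<bar>H r - H r'\<bar> <= B * \<bar>r - r'\<bar>" for r r'
  proof -
    have "\<bar>H r - H r'\<bar> <= B * \<bar>r - r'\<bar>" if "r' <= r" for r r'
    proof -
      have "0 <= A * (r - r')" using A that by simp
      then show ?thesis using hi[OF that] lo[OF that] that by (simp add: abs_of_nonneg)
    qed
    from this[of r' r] this[of r r'] show ?thesis by (cases "r' <= r") (auto simp: abs_minus_commute)
  qed
  have cont: "continuous_on UNIV H"
    by (rule lipschitz_on_continuous_on[where L=B]) (use lip A B in \<open>auto intro!: lipschitz_onI simp: dist_real_def\<close>)
  have inj: "r = r'" if "H r = H r'" for r r'
  proof -
    have "r = r'" if "H r = H r'" "r' <= r" for r r'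
      using lo[OF that(2)] that A by (auto simp: mult_le_0_iff)
    from this[of r r'] this[of r' r] that show ?thesis by (cases "r' <= r") auto
  qed
  have surj: "\<exists>r. H r = c \<and> \<bar>r\<bar> <= (\<bar>c\<bar> + \<bar>H 0\<bar>) / A" for c
  proof -
    define u where "u = (\<bar>c\<bar> + \<bar>H 0\<bar>) / A"
    have u: "0 <= u" "A * u = \<bar>c\<bar> + \<bar>H 0\<bar>" using A by (auto simp: u_def)
    have "c <= H u" "H (- u) <= c" using lo[of 0 u] lo[of "-u" 0] u by auto
    then obtain r where "- u <= r" "r <= u" "H r = c"
      using IVT'[of H "-u" c u] u cont continuous_on_subset by (metis (no_types) minus_le_iff neg_le_0_iff_le order_trans subset_UNIV)
    then show ?thesis unfolding u_def[symmetric] by (auto simp: abs_le_iff)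
  qed
  have mono: "H r' <= H r" if "r' <= r" for r r'
  proof -
    have "0 <= A * (r - r')" using A that by simp
    then show ?thesis using lo[OF that] by linarith
  qed
  obtain ra where ra: "H ra = a" "\<bar>ra\<bar> <= (\<bar>a\<bar> + \<bar>H 0\<bar>) / A" using surj by blast
  obtain rb where rb: "H rb = b" "\<bar>rb\<bar> <= (\<bar>b\<bar> + \<bar>H 0\<bar>) / A" using surj by blast
  have rab: "ra <= rb"
  proof (rule ccontr)
    assume "\<not> ra <= rb"
    then have "b <= a" using mono[of rb ra] ra rb by simp
    then show False using ab ra rb inj \<open>\<not> ra <= rb\<close> by auto
  qed
  have set: "{r. H r \<in> {a..b}} = {ra..rb}"
  proof (intro set_eqI iffI)
    fix r assume r: "r \<in> {r. H r \<in> {a..b}}"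
    have "ra <= r" proof (rule ccontr)
      assume "\<not> ra <= r" then have "H r <= a" using mono[of r ra] ra by simp
      then show False using r ra inj \<open>\<not> ra <= r\<close> by fastforce
    qed
    moreover have "r <= rb" proof (rule ccontr)
      assume "\<not> r <= rb" then have "b <= H r" using mono[of rb r] rb by simp
      then show False using r rb inj \<open>\<not> r <= rb\<close> by fastforce
    qed
    ultimately show "r \<in> {ra..rb}" by simp
  next
    fix r assume "r \<in> {ra..rb}" then show "r \<in> {r. H r \<in> {a..b}}" using mono[of ra r] mono[of r rb] ra rb by simp
  qed
  have em: "emeasure std_normal_distribution {r. H r \<in> {a..b}} = (NINT r|lborel. ennreal (std_normal_density r) * indicator {ra..rb} r)"
    unfolding set by (subst emeasure_density) auto
  have d1: "std_normal_density x <= 1" for x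
  proof -
    have "exp (- x\<^sup>2 / 2) <= 1" by simp
    moreover have "1 / sqrt (2 * pi) <= 1" using pi_ge_two by (simp add: real_le_rsqrt)
    ultimately have "1 / sqrt (2 * pi) * exp (- x\<^sup>2 / 2) <= 1 * 1" by (intro mult_mono) auto
    then show ?thesis by (simp add: std_normal_density_def)
  qed
  have "emeasure std_normal_distribution {r. H r \<in> {a..b}} <= (NINT r|lborel. 1 * indicator {ra..rb} r)"
    unfolding em using d1 by (intro nn_integral_mono mult_right_mono) (auto simp: ennreal_le_1)
  also have "... = ennreal (rb - ra)" using rab by simp
  also have "... <= ennreal ((b - a) / A)"
    using lo[OF rab] ra rb A by (intro ennreal_leI) (simp add: field_simps)
  finally show "emeasure std_normal_distribution {r. H r \<in> {a..b}} <= ennreal ((b - a) / A)" .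
  assume K: "\<bar>H 0\<bar> <= K" "\<bar>a\<bar> <= R" "\<bar>b\<bar> <= R"
  define m where "m = (R + K) / A"
  have ram: "\<bar>ra\<bar> <= m" "\<bar>rb\<bar> <= m"
  proof -
    have "(\<bar>a\<bar> + \<bar>H 0\<bar>) / A <= m" "(\<bar>b\<bar> + \<bar>H 0\<bar>) / A <= m"
      unfolding m_def using K A by (intro divide_right_mono; simp)+
    then show "\<bar>ra\<bar> <= m" "\<bar>rb\<bar> <= m" using ra(2) rb(2) by linarith+
  qed
  have dm: "std_normal_density m <= std_normal_density r" if "\<bar>r\<bar> <= m" for r
  proof -
    have "r\<^sup>2 <= m\<^sup>2" using that by (simp add: abs_le_square_iff[symmetric])
    then show ?thesis by (simp add: std_normal_density_def divide_right_mono)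
  qed
  have "(b - a) / B <= rb - ra" using hi[OF rab] ra rb A B by (simp add: field_simps)
  then have "ennreal (std_normal_density m * ((b - a) / B)) <= ennreal (std_normal_density m * (rb - ra))"
    by (intro ennreal_leI mult_left_mono) auto
  also have "... = (NINT r|lborel. ennreal (std_normal_density m) * indicator {ra..rb} r)"
    using rab by (simp add: nn_integral_cmult ennreal_mult)
  also have "... <= emeasure std_normal_distribution {r. H r \<in> {a..b}}"
    unfolding em using ram by (intro nn_integral_mono) (auto simp: indicator_def intro!: ennreal_leI dm)
  finally show "ennreal (std_normal_density ((R + K) / A) * ((b - a) / B)) <= emeasure std_normal_distribution {r. H r \<in> {a..b}}"
    unfolding m_def .
qed

section \<open>Isonormal processes\<close>

text \<open>The inner product of \<open>L2_time T\<close>. Functions that agree almost everywhere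
  are not identified, so it is only semi-definite.\<close>

definition ip :: "real => (real => 'h::{real_inner,banach,second_countable_topology}) => (real => 'h) => real" where
  "ip T h k = (LINT s|lebesgue_on {0..T}. h s \<bullet> k s)"

lemma L2_time_measurable: "h \<in> L2_time T ==> h \<in> bm (lebesgue_on {0..T})"
  by (simp add: L2_time_def)

lemma abs_inner_le: "\<bar>x \<bullet> y\<bar> <= (norm x)^2 + (norm y)^2" for x y :: "'h::real_inner"
proof -
  have "2 * (norm x * norm y) <= (norm x)^2 + (norm y)^2"
    using sum_squares_bound[of "norm x" "norm y"] by (simp add: mult.assoc)
  moreover have "0 <= norm x * norm y" by simp
  ultimately show ?thesis using Cauchy_Schwarz_ineq2[of x y] by linarith
qed

lemma L2_time_inner_integrable:
  assumes "h \<in> L2_time T" "k \<in> L2_time T"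
  shows "integrable (lebesgue_on {0..T}) (%s. h s \<bullet> k s)"
proof (rule Bochner_Integration.integrable_bound)
  show "integrable (lebesgue_on {0..T}) (%s. (norm (h s))^2 + (norm (k s))^2)"
    using assms by (simp add: L2_time_def)
  have [measurable]: "h \<in> bm (lebesgue_on {0..T})" "k \<in> bm (lebesgue_on {0..T})"
    using assms by (simp_all add: L2_time_def)
  show "(%s. h s \<bullet> k s) \<in> bm (lebesgue_on {0..T})" by measurable
  show "AE s in lebesgue_on {0..T}. norm (h s \<bullet> k s) <= norm ((norm (h s))^2 + (norm (k s))^2)"
    using abs_inner_le by auto
qed

lemma L2_time_lin:
  assumes h: "h \<in> L2_time T" and k: "k \<in> L2_time T"
  shows "(%s. h s + c *\<^sub>R k s) \<in> L2_time T"
proof -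
  have [measurable]: "h \<in> bm (lebesgue_on {0..T})" "k \<in> bm (lebesgue_on {0..T})"
    using assms by (simp_all add: L2_time_def)
  have "integrable (lebesgue_on {0..T}) (%s. h s \<bullet> h s + 2 * c * (h s \<bullet> k s) + c\<^sup>2 * (k s \<bullet> k s))"
    by (intro Bochner_Integration.integrable_add integrable_mult_right L2_time_inner_integrable h k)
  moreover have "(norm (h s + c *\<^sub>R k s))^2 = h s \<bullet> h s + 2 * c * (h s \<bullet> k s) + c\<^sup>2 * (k s \<bullet> k s)" for s
    unfolding power2_norm_eq_inner
    by (simp add: inner_add_left inner_add_right inner_commute[of "k s" "h s"] power2_eq_square algebra_simps)
  ultimately show ?thesis by (simp add: L2_time_def)
qed

lemma L2_time_zero: "(%s. 0) \<in> L2_time T" by (simp add: L2_time_def)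

lemma L2_time_scale: "k \<in> L2_time T ==> (%s. c *\<^sub>R k s) \<in> L2_time T"
  using L2_time_lin[OF L2_time_zero, of k T c] by simp

lemma L2_time_sum:
  assumes "finite I" "!!i. i \<in> I ==> e i \<in> L2_time T"
  shows "(%s. \<Sum>i\<in>I. c i *\<^sub>R e i s) \<in> L2_time T"
  using assms
proof (induction I rule: finite_induct)
  case (insert i I)
  have "(%s. (\<Sum>i\<in>I. c i *\<^sub>R e i s) + c i *\<^sub>R e i s) \<in> L2_time T"
    using insert by (intro L2_time_lin) auto
  then show ?case using insert by (simp add: add.commute)
qed (simp add: L2_time_zero)

lemma ip_commute: "ip T h k = ip T k h" by (simp add: ip_def inner_commute)

lemma ip_lin:
  assumes "h \<in> L2_time T" "k \<in> L2_time T" "l \<in> L2_time T"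
  shows "ip T (%s. h s + c *\<^sub>R k s) l = ip T h l + c * ip T k l"
  using L2_time_inner_integrable[OF assms(1,3)] L2_time_inner_integrable[OF assms(2,3)]
  by (simp add: ip_def inner_add_left)

lemma ip_scale:
  assumes "k \<in> L2_time T" "l \<in> L2_time T"
  shows "ip T (%s. c *\<^sub>R k s) l = c * ip T k l" "ip T l (%s. c *\<^sub>R k s) = c * ip T l k"
  using ip_lin[OF L2_time_zero assms, of c] ip_commute[of T l] by (simp_all add: ip_def)

lemma ip_sum:
  assumes "finite I" "!!i. i \<in> I ==> e i \<in> L2_time T" "l \<in> L2_time T"
  shows "ip T (%s. \<Sum>i\<in>I. c i *\<^sub>R e i s) l = (\<Sum>i\<in>I. c i * ip T (e i) l)"
    "ip T l (%s. \<Sum>i\<in>I. c i *\<^sub>R e i s) = (\<Sum>i\<in>I. c i * ip T l (e i))"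
proof -
  show 1: "ip T (%s. \<Sum>i\<in>I. c i *\<^sub>R e i s) l = (\<Sum>i\<in>I. c i * ip T (e i) l)"
    using assms
  proof (induction I rule: finite_induct)
    case (insert i I)
    have "ip T (%s. (\<Sum>i\<in>I. c i *\<^sub>R e i s) + c i *\<^sub>R e i s) l = (\<Sum>i\<in>I. c i * ip T (e i) l) + c i * ip T (e i) l"
      using insert by (subst ip_lin) (auto intro!: L2_time_sum)
    then show ?case using insert by (simp add: add.commute)
  qed (simp add: ip_def)
  then show "ip T l (%s. \<Sum>i\<in>I. c i *\<^sub>R e i s) = (\<Sum>i\<in>I. c i * ip T l (e i))"
    by (subst ip_commute) (simp add: ip_commute[of T l])
qed

lemma ip_nonneg: "0 <= ip T h h" by (simp add: ip_def)

lemma ip_expand: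
  assumes "h \<in> L2_time T" "k \<in> L2_time T"
  shows "ip T (%s. h s + c *\<^sub>R k s) (%s. h s + c *\<^sub>R k s) = ip T h h + 2 * c * ip T h k + c\<^sup>2 * ip T k k"
proof -
  note hk = L2_time_lin[OF assms, of c]
  have "ip T (%s. h s + c *\<^sub>R k s) (%s. h s + c *\<^sub>R k s) = ip T (%s. h s + c *\<^sub>R k s) h + c * ip T (%s. h s + c *\<^sub>R k s) k"
    by (subst ip_lin[OF assms hk]) (simp add: ip_commute)
  then show ?thesis using assms
    by (simp add: ip_lin ip_commute[of T k h] power2_eq_square algebra_simps)
qed

lemma ip_Cauchy_Schwarz:
  assumes "h \<in> L2_time T" "k \<in> L2_time T"
  shows "(ip T h k)^2 <= ip T h h * ip T k k"
proof (cases "ip T k k = 0")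
  case True
  have "0 <= ip T h h + 2 * c * ip T h k" for c
    using ip_nonneg[of T "%s. h s + c *\<^sub>R k s"] ip_expand[OF assms, of c] True by simp
  \<comment> \<open>If \<open>ip T h k\<close> were non-zero, this choice of \<open>c\<close> would
    give the non-negative expression the value -1.\<close>
  from this[of "- (ip T h h + 1) / (2 * ip T h k)"] have "ip T h k = 0"
    by (cases "ip T h k = 0") (auto simp: field_simps)
  then show ?thesis using True by simp
next
  case False
  then have p: "0 < ip T k k" using ip_nonneg[of T k] by simp
  define c where "c = - ip T h k / ip T k k"
  have "0 <= ip T h h + 2 * c * ip T h k + c\<^sup>2 * ip T k k"
    using ip_nonneg[of T "%s. h s + c *\<^sub>R k s"] ip_expand[OF assms, of c] by simp
  also have "... = ip T h h - (ip T h k)\<^sup>2 / ip T k k"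
    using p by (simp add: c_def power2_eq_square field_simps)
  finally show ?thesis using p by (simp add: field_simps)
qed

lemma centred_gaussian_moments:
  assumes P: "prob_space P" and Y: "centred_gaussian P Y v"
  shows "integrable P (%om. (Y om)^2)" "(LINT om|P. (Y om)^2) = v" "Y \<in> bm P" "0 <= v"
proof -
  show [measurable]: "Y \<in> bm P" and v: "0 <= v" using Y by (auto simp: centred_gaussian_def)
  have d: "distr P borel Y = (if v = 0 then return borel 0 else density lborel (normal_density 0 (sqrt v)))"
    using Y by (simp add: centred_gaussian_def)
  have "integrable (distr P borel Y) (%x. x\<^sup>2) \<and> (LINT x|distr P borel Y. x\<^sup>2) = v"
  proof (cases "v = 0")
    case True
    have "integrable (return borel 0) (%x::real. x\<^sup>2)"
      by (rule finite_measure.integrable_const_bound[where B=0])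
        (auto simp: AE_return intro!: prob_space.finite_measure prob_space_return)
    then show ?thesis unfolding d using True by (simp add: integral_return)
  next
    case False
    then have s: "0 < sqrt v" using v by simp
    have hb: "has_bochner_integral lborel (%x. normal_density 0 (sqrt v) x * (x - 0) ^ (2 * 1)) (fact (2 * 1) / ((2 / (sqrt v)\<^sup>2)^1 * fact 1))"
      using s by (rule normal_moment_even)
    then have "has_bochner_integral lborel (%x. normal_density 0 (sqrt v) x * x\<^sup>2) v"
      using v False by (simp add: fact_numeral power2_eq_square)
    then show ?thesis unfolding d using False s
      by (simp add: integrable_density integral_density has_bochner_integral_iff normal_density_nonneg)
  qed
  then show "integrable P (%om. (Y om)^2)" "(LINT om|P. (Y om)^2) = v"
    by (simp_all add: integrable_distr_eq integral_distr)
qed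

text \<open>Coordinates with coefficient zero are dropped, as their summands are degenerate and have
  no normal density. Independence of the others is read off from the product measure.\<close>

lemma std_normal_PiM_linear:
  fixes c :: "'i => real"
  assumes I: "finite I" and v: "(\<Sum>i\<in>I. (c i)^2) \<noteq> 0"
  shows "distr (Pi\<^sub>M I (%_. std_normal_distribution)) borel (%x. \<Sum>i\<in>I. c i * x i) =
    density lborel (normal_density 0 (sqrt (\<Sum>i\<in>I. (c i)^2)))"
proof -
  let ?M = "Pi\<^sub>M I (%_::'i. std_normal_distribution)"
  interpret product_prob_space "%_::'i. std_normal_distribution" by (rule product_prob_space_std_normal)
  have pM: "prob_space ?M" by (rule prob_space_PiM) (rule prob_space_std_normal)
  have sM: "sets ?M = sets (Pi\<^sub>M I (%_. borel))" by (rule sets_PiM_cong) auto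
  define J where "J = {i \<in> I. c i \<noteq> 0}"
  have J: "finite J" "J \<subseteq> I" using I by (auto simp: J_def)
  have Jne: "J \<noteq> {}"
  proof
    assume "J = {}"
    then have "(\<Sum>i\<in>I. (c i)^2) = 0" by (intro sum.neutral) (auto simp: J_def)
    then show False using v by simp
  qed
  have comp: "(%x. x i) \<in> bm ?M" if "i \<in> I" for i
  proof -
    have "(%x. x i) \<in> ?M \<rightarrow>\<^sub>M std_normal_distribution" using that by (rule measurable_component_singleton)
    then show ?thesis by simp
  qed
  have law: "distr ?M borel (%x. x i) = std_normal_distribution" if "i \<in> I" for i
  proof -
    have "distr ?M borel (%x. x i) = distr ?M std_normal_distribution (%x. x i)" by (rule distr_cong) auto
    then show ?thesis using PiM_component[OF that] by simp
  qed
  have "prob_space.indep_vars ?M (%_. borel) (%i x. x i) I"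
  proof (subst prob_space.indep_vars_iff_distr_eq_PiM'[OF pM])
    show "I \<noteq> {}" using Jne J by auto
    show "(%x. x i) \<in> bm ?M" if "i \<in> I" for i using comp[OF that] .
    have "distr ?M (Pi\<^sub>M I (%_. borel)) (%x. \<lambda>i\<in>I. x i) = distr ?M ?M (%x. x)"
      by (rule distr_cong) (auto simp: sM space_PiM PiE_def extensional_restrict)
    also have "... = ?M" by (rule distr_id)
    also have "... = Pi\<^sub>M I (%i. distr ?M borel (%x. x i))" using law by (intro PiM_cong) auto
    finally show "distr ?M (Pi\<^sub>M I (%_. borel)) (%x. \<lambda>i\<in>I. x i) = Pi\<^sub>M I (%i. distr ?M borel (%x. x i))" .
  qed
  then have "prob_space.indep_vars ?M (%_. borel) (%i x. x i) J" by (rule prob_space.indep_vars_subset[OF pM]) (rule J)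
  then have ind: "prob_space.indep_vars ?M (%_. borel) (%i x. c i * x i) J"
    by (rule prob_space.indep_vars_compose2[OF pM, where X="%i x. x i"]) simp
  have "distributed ?M lborel (%x. \<Sum>i\<in>J. c i * x i) (normal_density (\<Sum>i\<in>J. 0) (sqrt (\<Sum>i\<in>J. (\<bar>c i\<bar>)^2)))"
  proof (rule prob_space.sum_indep_normal[OF pM J(1) Jne ind])
    fix i assume i: "i \<in> J"
    then show "0 < \<bar>c i\<bar>" by (simp add: J_def)
    have "distributed ?M lborel (%x. x i) (normal_density 0 1)"
      using law[of i] i J comp[of i] by (auto simp: distributed_def cong: distr_cong)
    from prob_space.normal_density_affine[OF pM this, of "c i" 0] i
    show "distributed ?M lborel (%x. c i * x i) (normal_density 0 \<bar>c i\<bar>)" by (simp add: J_def)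
  qed
  moreover have "(\<Sum>i\<in>J. c i * x i) = (\<Sum>i\<in>I. c i * x i)" for x :: "'i => real"
    using I by (intro sum.mono_neutral_left) (auto simp: J_def)
  moreover have "(\<Sum>i\<in>J. (c i)^2) = (\<Sum>i\<in>I. (c i)^2)"
    using I by (intro sum.mono_neutral_left) (auto simp: J_def)
  ultimately have "distributed ?M lborel (%x. \<Sum>i\<in>I. c i * x i) (normal_density 0 (sqrt (\<Sum>i\<in>I. (c i)^2)))" by simp
  then show ?thesis by (auto simp: distributed_def cong: distr_cong)
qed

text \<open>\<open>H\<close> is the time horizon of the noise and \<open>'h\<close> the Hilbert
  space in which its integrands take values.\<close>

locale gaussian_family = prob_space P for P :: "'w measure" +
  fixes H :: real and W :: "(real => 'h::{real_inner,banach,second_countable_topology}) => 'w => real"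
  assumes iso: "isonormal P H W"
begin

abbreviation "DD \<equiv> L2_time H :: (real => 'h) set"

lemma gaussian_combination:
  "finite I ==> I \<subseteq> DD ==> \<exists>v. centred_gaussian P (%om. \<Sum>h\<in>I. c h * W h om) v"
  using conjunct1[OF iso[unfolded isonormal_def], THEN spec, THEN spec, THEN mp, of I c] by simp

lemma W_gauss:
  assumes h: "h \<in> DD"
  shows "\<exists>v. centred_gaussian P (W h) v"
proof -
  have "\<exists>v. centred_gaussian P (%om. \<Sum>k\<in>{h}. (%_. 1) k * W k om) v"
    using h by (intro gaussian_combination) auto
  then show ?thesis by simp
qed

lemma W_measurable[measurable (raw)]: "h \<in> DD ==> W h \<in> bm P"
  using W_gauss centred_gaussian_moments(3)[OF prob_space_axioms] by blast

lemma W_square_integrable: "h \<in> DD ==> integrable P (%om. (W h om)^2)"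
  using W_gauss centred_gaussian_moments(1)[OF prob_space_axioms] by blast

lemma square_integrable_mult:
  assumes [measurable]: "X \<in> bm P" "Y \<in> bm P"
    and "integrable P (%om. (X om)^2)" "integrable P (%om. (Y om)^2)"
  shows "integrable P (%om. X om * Y om :: real)"
proof (rule Bochner_Integration.integrable_bound)
  show "integrable P (%om. (X om)^2 + (Y om)^2)" using assms by simp
  show "AE om in P. norm (X om * Y om) <= norm ((X om)^2 + (Y om)^2)"
    using abs_inner_le[of "X _" "Y _"] by (auto simp: power2_eq_square)
qed simp

lemma W_integrable_mult: "h \<in> DD ==> k \<in> DD ==> integrable P (%om. W h om * W k om)"
  by (intro square_integrable_mult W_measurable W_square_integrable)

lemma W_cov: "h \<in> DD ==> k \<in> DD ==> (LINT om|P. W h om * W k om) = ip H h k"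
  using conjunct2[OF iso[unfolded isonormal_def], THEN bspec, THEN bspec, of h k] by (simp add: ip_def)

text \<open>Linearity of \<open>W\<close> is not part of \<open>isonormal\<close>. It holds almost
  surely, because the second moment of the defect, computed from covariances, is zero.\<close>

lemma W_scale:
  assumes h: "h \<in> DD"
  shows "AE om in P. W (%s. c *\<^sub>R h s) om = c * W h om"
proof -
  let ?k = "%s. c *\<^sub>R h s"
  have k: "?k \<in> DD" using h by (rule L2_time_scale)
  have e: "(W ?k om - c * W h om)^2 = W ?k om * W ?k om - 2 * c * (W ?k om * W h om) + c\<^sup>2 * (W h om * W h om)" for om
    by (simp add: power2_eq_square algebra_simps)
  note i = W_integrable_mult[OF k k] W_integrable_mult[OF k h] W_integrable_mult[OF h h]
  have int: "integrable P (%om. (W ?k om - c * W h om)^2)" unfolding e using i by auto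
  have "(LINT om|P. (W ?k om - c * W h om)^2) = ip H ?k ?k - 2 * c * ip H ?k h + c\<^sup>2 * ip H h h"
    unfolding e using i by (simp add: W_cov h k)
  also have "... = 0" using h k by (simp add: ip_scale power2_eq_square)
  finally have "AE om in P. (W ?k om - c * W h om)^2 = 0"
    using integral_nonneg_eq_0_iff_AE[OF int] by auto
  then show ?thesis by eventually_elim simp
qed

definition onb :: "nat set => (nat => real => 'h) => bool" where
  "onb I e \<longleftrightarrow> finite I \<and> (\<forall>i\<in>I. e i \<in> DD) \<and> (\<forall>i\<in>I. \<forall>j\<in>I. ip H (e i) (e j) = (if i = j then 1 else 0))"

lemma onb_subset: "onb I e ==> J \<subseteq> I ==> onb J e"
  unfolding onb_def by (meson finite_subset subset_iff)

lemma W_linear_law: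
  assumes e: "onb I e"
  shows "distr P borel (%om. \<Sum>i\<in>I. c i * W (e i) om) =
    distr (Pi\<^sub>M I (%_. std_normal_distribution)) borel (%x. \<Sum>i\<in>I. c i * x i)"
proof -
  have I: "finite I" and eD: "!!i. i \<in> I ==> e i \<in> DD" using e by (auto simp: onb_def)
  have ort: "!!i j. i \<in> I ==> j \<in> I ==> ip H (e i) (e j) = (if i = j then 1 else 0)" using e by (simp add: onb_def)
  \<comment> \<open>\<open>isonormal\<close> speaks of sums over finite sets of functions;
    orthonormality makes the indexing injective, so that sums over \<open>I\<close> are of this
    kind.\<close>
  have inj: "inj_on e I"
  proof (rule inj_onI)
    fix i j assume "i \<in> I" "j \<in> I" "e i = e j"
    then show "i = j" using ort[of i j] ort[of i i] by (auto split: if_splits)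
  qed
  define Y where "Y om = (\<Sum>i\<in>I. c i * W (e i) om)" for om
  define v where "v = (\<Sum>i\<in>I. (c i)^2)"
  have "\<exists>v. centred_gaussian P (%om. \<Sum>h\<in>e ` I. c (the_inv_into I e h) * W h om) v"
    using I eD by (intro gaussian_combination) auto
  moreover have "(\<Sum>h\<in>e ` I. c (the_inv_into I e h) * W h om) = Y om" for om
    unfolding Y_def by (subst sum.reindex[OF inj]) (auto intro!: sum.cong simp: the_inv_into_f_f[OF inj])
  ultimately obtain v' where g: "centred_gaussian P Y v'" by auto
  note mom = centred_gaussian_moments[OF prob_space_axioms g]
  have "v' = (LINT om|P. (Y om)^2)" using mom by simp
  also have "... = (LINT om|P. (\<Sum>i\<in>I. \<Sum>j\<in>I. c i * c j * (W (e i) om * W (e j) om)))"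
    by (intro Bochner_Integration.integral_cong) (auto simp: Y_def power2_eq_square sum_product mult_ac)
  also have "... = (\<Sum>i\<in>I. \<Sum>j\<in>I. c i * c j * ip H (e i) (e j))"
  proof -
    have i: "integrable P (%om. c i * c j * (W (e i) om * W (e j) om))" if "i \<in> I" "j \<in> I" for i j
      using that by (intro integrable_mult_right W_integrable_mult eD)
    have "(LINT om|P. (\<Sum>i\<in>I. \<Sum>j\<in>I. c i * c j * (W (e i) om * W (e j) om))) =
        (\<Sum>i\<in>I. LINT om|P. (\<Sum>j\<in>I. c i * c j * (W (e i) om * W (e j) om)))"
      by (rule Bochner_Integration.integral_sum) (intro Bochner_Integration.integrable_sum i)
    also have "... = (\<Sum>i\<in>I. \<Sum>j\<in>I. LINT om|P. c i * c j * (W (e i) om * W (e j) om))"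
      by (intro sum.cong refl Bochner_Integration.integral_sum i)
    also have "... = (\<Sum>i\<in>I. \<Sum>j\<in>I. c i * c j * ip H (e i) (e j))"
      by (intro sum.cong refl) (simp add: W_cov eD)
    finally show ?thesis .
  qed
  also have "... = v"
    unfolding v_def using I by (intro sum.cong) (auto simp: ort power2_eq_square if_distrib[of "%z. _ * z"] cong: if_cong)
  finally have v': "v' = v" .
  have d: "distr P borel Y = (if v = 0 then return borel 0 else density lborel (normal_density 0 (sqrt v)))"
    using g v' by (simp add: centred_gaussian_def)
  interpret PM: prob_space "Pi\<^sub>M I (%_::nat. std_normal_distribution)" by (rule prob_space_PiM) (rule prob_space_std_normal)
  show ?thesis
  proof (cases "v = 0")
    case True
    then have "c i = 0" if "i \<in> I" for i using that I unfolding v_def by (subst (asm) sum_nonneg_eq_0_iff) auto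
    then have "(%x. \<Sum>i\<in>I. c i * x i) = (%x::nat => real. 0)" by (auto intro!: ext sum.neutral)
    then show ?thesis using d True by (simp add: Y_def[abs_def] PM.distr_const)
  next
    case False
    then show ?thesis using d std_normal_PiM_linear[OF I, of c] by (simp add: Y_def[abs_def] v_def)
  qed
qed

text \<open>Orthonormal directions give independent standard normals; by Cramer--Wold it is enough
  that all linear combinations have the right law. Both conditioning on one coordinate and Gaussian
  concentration start from here.\<close>

theorem W_joint_law:
  assumes e: "onb I e"
  shows "distr P (Pi\<^sub>M I (%_. borel)) (%om. \<lambda>i\<in>I. W (e i) om) = Pi\<^sub>M I (%_. std_normal_distribution)"
proof -
  let ?M = "Pi\<^sub>M I (%_::nat. std_normal_distribution)"
  have I: "finite I" and eD: "!!i. i \<in> I ==> e i \<in> DD" using e by (auto simp: onb_def)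
  have sM: "sets ?M = sets (Pi\<^sub>M I (%_. borel))" by (rule sets_PiM_cong) auto
  have comp: "(%x. x i) \<in> bm ?M" if "i \<in> I" for i
  proof -
    have "(%x. x i) \<in> ?M \<rightarrow>\<^sub>M std_normal_distribution" using that by (rule measurable_component_singleton)
    then show ?thesis by simp
  qed
  have "distr P (Pi\<^sub>M I (%_. borel)) (%om. \<lambda>i\<in>I. W (e i) om) = distr ?M (Pi\<^sub>M I (%_. borel)) (%x. \<lambda>i\<in>I. x i)"
    by (rule distr_PiM_eqI[OF prob_space_axioms _ I])
      (auto intro!: prob_space_PiM prob_space_std_normal W_measurable eD comp W_linear_law[OF e])
  also have "... = distr ?M ?M (%x. x)"
    by (rule distr_cong) (auto simp: sM space_PiM PiE_def extensional_restrict)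
  also have "... = ?M" by (rule distr_id)
  finally show ?thesis .
qed

end

section \<open>Weak convergence in L2 from a generating family of sets\<close>

lemma abs_mult_le_weighted:
  fixes x y d :: real
  assumes "0 < d"
  shows "\<bar>x * y\<bar> <= d * x\<^sup>2 + y\<^sup>2 / d"
proof -
  have "2 * \<bar>x * y\<bar> <= d * x\<^sup>2 + y\<^sup>2 / d"
    using sum_squares_bound[of "sqrt d * \<bar>x\<bar>" "\<bar>y\<bar> / sqrt d"] assms
    by (simp add: power_mult_distrib power_divide abs_mult)
  then show ?thesis using abs_ge_zero[of "x * y"] by linarith
qed

lemma integrable_mult_square:
  fixes f g :: "'a => real"
  assumes [measurable]: "f \<in> bm M" "g \<in> bm M"
    and "integrable M (%x. (f x)^2)" "integrable M (%x. (g x)^2)"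
  shows "integrable M (%x. f x * g x)"
proof (rule Bochner_Integration.integrable_bound)
  show "integrable M (%x. (f x)^2 + (g x)^2)" using assms by simp
  show "AE x in M. norm (f x * g x) <= norm ((f x)^2 + (g x)^2)"
    using abs_mult_le_weighted[of 1] by auto
qed simp

lemma integral_mult_le_weighted:
  fixes f g :: "'a => real"
  assumes "f \<in> bm M" "g \<in> bm M"
    and "integrable M (%x. (f x)^2)" "integrable M (%x. (g x)^2)" and d: "0 < d"
  shows "\<bar>LINT x|M. f x * g x\<bar> <= d * (LINT x|M. (f x)^2) + (LINT x|M. (g x)^2) / d"
proof -
  have i: "integrable M (%x. f x * g x)" using assms(1-4) by (rule integrable_mult_square)
  have "\<bar>LINT x|M. f x * g x\<bar> <= (LINT x|M. \<bar>f x * g x\<bar>)" by (rule integral_abs_bound)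
  also have "... <= (LINT x|M. d * (f x)^2 + (g x)\<^sup>2 / d)"
    using assms i by (intro integral_mono abs_mult_le_weighted) auto
  also have "... = d * (LINT x|M. (f x)^2) + (LINT x|M. (g x)^2) / d" using assms by simp
  finally show ?thesis .
qed

text \<open>For each \<open>d\<close> the upper limit is at most \<open>d * B\<close>, and
  \<open>d\<close> is arbitrary. Bounds of this shape are what Young's inequality with weight
  \<open>d\<close> provides.\<close>

lemma tendsto_zero_weighted:
  fixes a :: "nat => real"
  assumes B: "0 <= B" and "!!d. 0 < d ==> \<exists>b. b \<longlonglongrightarrow> 0 \<and> (\<forall>n. \<bar>a n\<bar> <= d * B + b n)"
  shows "a \<longlonglongrightarrow> 0"
proof (rule LIMSEQ_I)
  fix r :: real assume r: "0 < r"
  define d where "d = r / (2 * (B + 1))"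
  have d: "0 < d" "d * B <= r / 2" using r B by (auto simp: d_def field_simps)
  obtain b where b: "b \<longlonglongrightarrow> 0" "!!n. \<bar>a n\<bar> <= d * B + b n" using assms(2)[OF d(1)] by blast
  have "\<forall>\<^sub>F n in sequentially. b n < r / 2" using order_tendstoD(2)[OF b(1), of "r/2"] r by simp
  then obtain n0 where n0: "!!n. n \<ge> n0 ==> b n < r / 2" by (auto simp: eventually_sequentially)
  have "norm (a n - 0) < r" if "n \<ge> n0" for n using n0[OF that] b(2)[of n] d(2) by simp
  then show "\<exists>n0. \<forall>n\<ge>n0. norm (a n - 0) < r" by blast
qed

context
  fixes M :: "'c measure" and R :: "nat => 'c => real" and B :: real and \<G> :: "'c set set"
  assumes M: "finite_measure M"
    and gen: "sets M = sigma_sets (space M) \<G>" "Int_stable \<G>" "\<G> \<subseteq> Pow (space M)" "space M \<in> \<G>"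
    and R[measurable]: "!!n. R n \<in> bm M" and iR: "!!n. integrable M (%x. (R n x)^2)"
    and B: "!!n. (LINT x|M. (R n x)^2) <= B"
    and G: "!!A. A \<in> \<G> ==> (%n. LINT x|M. R n x * indicator A x) \<longlonglongrightarrow> 0"
begin

interpretation M: finite_measure M by (rule M)

lemma weak_B: "0 <= B" using B[of 0] by (rule order_trans[rotated]) simp

lemma weak_int: "A \<in> sets M ==> integrable M (%x. R n x * indicator A x)"
  by (rule integrable_mult_square) (auto intro!: iR M.integrable_const_bound[where B=1] simp: indicator_def)

text \<open>A Dynkin class argument from the intersection-stable generator. For a countable disjoint
  union the tail has small measure, and a sequence bounded in L2 keeps its integral over such a tail
  small, uniformly in \<open>n\<close>.\<close>

lemma weak_sets:
  assumes A: "A \<in> sets M"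
  shows "(%n. LINT x|M. R n x * indicator A x) \<longlonglongrightarrow> 0"
  using gen(2,3) A[unfolded gen(1)]
proof (induction rule: sigma_sets_induct_disjoint)
  case (basic A) then show ?case by (rule G)
next
  case empty then show ?case by simp
next
  case (compl A)
  then have A: "A \<in> sets M" by (simp add: gen(1))
  have "(LINT x|M. R n x * indicator (space M - A) x) = (LINT x|M. R n x * indicator (space M) x) - (LINT x|M. R n x * indicator A x)" for n
  proof -
    have "R n x * indicator (space M - A) x = R n x * indicator (space M) x - R n x * indicator A x" for x
      using sets.sets_into_space[OF A] by (auto simp: indicator_def)
    then show ?thesis using weak_int[OF A, of n] weak_int[OF sets.top, of n] by simp
  qed
  then show ?case using tendsto_diff[OF G[OF gen(4)] compl.IH] by simp
next
  case (union A)
  have As: "A i \<in> sets M" for i using union.hyps by (auto simp: gen(1))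
  show ?case
  proof (rule tendsto_zero_weighted[where B="B + 1"])
    show "0 <= B + 1" using weak_B by simp
    fix d' :: real assume d': "0 < d'"
    define tl where "tl m = (\<Union>i. A i) - (\<Union>i<m. A i)" for m
    have tls[measurable]: "tl m \<in> sets M" for m unfolding tl_def using As by auto
    have "(%m. measure M (tl m)) \<longlonglongrightarrow> measure M (\<Inter>m. tl m)"
    proof (rule M.finite_Lim_measure_decseq)
      show "range tl \<subseteq> sets M" using tls by auto
      show "decseq tl" by (auto simp: decseq_def tl_def)
    qed
    moreover have "(\<Inter>m. tl m) = {}" by (auto simp: tl_def)
    ultimately have "(%m. measure M (tl m)) \<longlonglongrightarrow> 0" by simp
    show "\<exists>b. b \<longlonglongrightarrow> 0 \<and> (\<forall>n. \<bar>LINT x|M. R n x * indicator (\<Union>i. A i) x\<bar> <= d' * (B + 1) + b n)"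
      proof -
        have "\<forall>\<^sub>F m in sequentially. measure M (tl m) < d' * d'"
          using order_tendstoD(2)[OF \<open>(%m. measure M (tl m)) \<longlonglongrightarrow> 0\<close>, of "d' * d'"] d' by simp
        \<comment> \<open>Young's inequality with weight \<open>d'\<close> bounds the tail term by
          \<open>d' * B\<close> plus \<open>measure M (tl m) / d'\<close>; below the threshold
          \<open>d' * d'\<close> the latter is at most \<open>d'\<close>.\<close>
        then obtain m where m: "measure M (tl m) < d' * d'" by (auto simp: eventually_sequentially)
        define b where "b n = (\<Sum>i<m. \<bar>LINT x|M. R n x * indicator (A i) x\<bar>)" for n
        have "b \<longlonglongrightarrow> (\<Sum>i<m. \<bar>0\<bar>)" unfolding b_def by (intro tendsto_sum tendsto_rabs union.IH)
        then have b0: "b \<longlonglongrightarrow> 0" by simp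
        have "\<bar>LINT x|M. R n x * indicator (\<Union>i. A i) x\<bar> <= d' * (B + 1) + b n" for n
        proof -
          have ind: "indicator (\<Union>i. A i) x = indicator (tl m) x + (\<Sum>i<m. indicator (A i) x :: real)" for x
          proof -
            have "disjoint_family_on A {..<m}" using union.hyps by (auto simp: disjoint_family_on_def)
            then have "(\<Sum>i<m. indicator (A i) x :: real) = indicator (\<Union>i<m. A i) x" by (simp add: indicator_UN_disjoint)
            then show ?thesis by (auto simp: tl_def indicator_def)
          qed
          have "(LINT x|M. R n x * indicator (\<Union>i. A i) x) = (LINT x|M. R n x * indicator (tl m) x + (\<Sum>i<m. R n x * indicator (A i) x))"
            by (simp add: ind distrib_left sum_distrib_left)
          also have "... = (LINT x|M. R n x * indicator (tl m) x) + (\<Sum>i<m. LINT x|M. R n x * indicator (A i) x)"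
          proof -
            have i: "integrable M (%x. \<Sum>i<m. R n x * indicator (A i) x)"
              by (intro Bochner_Integration.integrable_sum weak_int As)
            have "(LINT x|M. (\<Sum>i<m. R n x * indicator (A i) x)) = (\<Sum>i<m. LINT x|M. R n x * indicator (A i) x)"
              by (intro Bochner_Integration.integral_sum weak_int As)
            then show ?thesis using Bochner_Integration.integral_add[OF weak_int[OF tls] i] by simp
          qed
          also have "\<bar>...\<bar> <= \<bar>LINT x|M. R n x * indicator (tl m) x\<bar> + b n"
            unfolding b_def using sum_abs[of "%i. LINT x|M. R n x * indicator (A i) x" "{..<m}"] by linarith
          also have "\<bar>LINT x|M. R n x * indicator (tl m) x\<bar> <= d' * (LINT x|M. (R n x)^2) + (LINT x|M. (indicator (tl m) x)^2) / d'"
            by (rule integral_mult_le_weighted) (auto intro!: iR M.integrable_const_bound[where B=1] d' simp: indicator_def)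
          also have "(LINT x|M. (indicator (tl m) x)\<^sup>2 :: real) = measure M (tl m)"
          proof -
            have "(%x. (indicator (tl m) x)\<^sup>2 :: real) = indicator (tl m)" by (auto simp: indicator_def)
            then show ?thesis using tls sets.sets_into_space[OF tls] by (simp add: Int_absorb2)
          qed
          also have "d' * (LINT x|M. (R n x)^2) + measure M (tl m) / d' <= d' * B + d'"
            using m d' B[of n] by (intro add_mono mult_left_mono) (auto simp: field_simps)
          finally show ?thesis by (simp add: algebra_simps)
        qed
        then show ?thesis using b0 by blast
      qed
  qed
qed

lemma weak_square_integrable:
  assumes Y[measurable]: "Y \<in> bm M" and iY: "integrable M (%x. (Y x)^2)"
  shows "(%n. LINT x|M. R n x * Y x) \<longlonglongrightarrow> 0"
proof (rule tendsto_zero_weighted[where B="B + 1"])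
  show "0 <= B + 1" using weak_B by simp
  fix d :: real assume d: "0 < d"
  obtain U where "\<forall>i. simple_function M (U i)" "\<forall>x\<in>space M. (%i. U i x) \<longlonglongrightarrow> Y x"
      "\<forall>i. \<forall>x\<in>space M. dist (U i x) 0 <= 2 * dist (Y x) 0"
    using borel_measurable_implies_sequence_metric[OF Y, of 0] by blast
  then have U: "!!i. simple_function M (U i)" "!!x. x \<in> space M ==> (%i. U i x) \<longlonglongrightarrow> Y x"
      "!!i x. x \<in> space M ==> norm (U i x) <= 2 * norm (Y x)"
    by (auto simp: dist_norm)
  note [measurable] = borel_measurable_simple_function[OF U(1)]
  have iU: "integrable M (%x. (U i x)^2)" for i
  proof (rule Bochner_Integration.integrable_bound)
    show "integrable M (%x. 4 * (Y x)^2)" using iY by simp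
    show "AE x in M. norm ((U i x)^2) <= norm (4 * (Y x)^2)"
    proof (rule AE_I2)
      fix x assume "x \<in> space M"
      then have "(norm (U i x))^2 <= (2 * norm (Y x))^2" using U(3) by (intro power_mono) auto
      then show "norm ((U i x)^2) <= norm (4 * (Y x)^2)" by (simp add: power_mult_distrib)
    qed
  qed simp
  have pw: "norm ((Y x - U i x)^2) <= 9 * (Y x)^2" if "x \<in> space M" for x i
  proof -
    have "\<bar>Y x - U i x\<bar> <= 3 * \<bar>Y x\<bar>" using U(3)[OF that, of i] by simp
    then have "\<bar>Y x - U i x\<bar>\<^sup>2 <= (3 * \<bar>Y x\<bar>)^2" by (intro power_mono) auto
    then show ?thesis by (simp add: power_mult_distrib)
  qed
  have "(%i. LINT x|M. (Y x - U i x)^2) \<longlonglongrightarrow> (LINT x|M. 0)"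
  proof (rule integral_dominated_convergence)
    show "integrable M (%x. 9 * (Y x)^2)" using iY by simp
    show "AE x in M. norm ((Y x - U i x)^2) <= 9 * (Y x)^2" for i using pw by auto
    show "AE x in M. (%i. (Y x - U i x)^2) \<longlonglongrightarrow> 0"
    proof (rule AE_I2)
      fix x assume "x \<in> space M"
      then have "(%i. (Y x - U i x)^2) \<longlonglongrightarrow> (Y x - Y x)\<^sup>2" by (intro tendsto_intros U(2))
      then show "(%i. (Y x - U i x)^2) \<longlonglongrightarrow> 0" by simp
    qed
  qed auto
  then have "\<forall>\<^sub>F i in sequentially. (LINT x|M. (Y x - U i x)^2) < d * d"
    using order_tendstoD(2)[of _ 0 sequentially "d * d"] d by simp
  then obtain i where i: "(LINT x|M. (Y x - U i x)^2) < d * d" by (auto simp: eventually_sequentially)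
  have iD: "integrable M (%x. (Y x - U i x)^2)"
    by (rule Bochner_Integration.integrable_bound[where f="%x. 9 * (Y x)^2"]) (use iY pw in auto)
  define b where "b n = \<bar>LINT x|M. R n x * U i x\<bar>" for n
  have Ueq: "U i x = (\<Sum>v\<in>U i ` space M. v * indicator (U i -` {v} \<inter> space M) x)" if "x \<in> space M" for x
  proof -
    have "(\<Sum>v\<in>U i ` space M. v * indicator (U i -` {v} \<inter> space M) x) = (\<Sum>v\<in>U i ` space M. if v = U i x then v else 0)"
      using that by (intro sum.cong) (auto simp: indicator_def)
    also have "... = U i x" using that simple_functionD(1)[OF U(1)] by simp
    finally show ?thesis by simp
  qed
  have "(LINT x|M. R n x * U i x) = (\<Sum>v\<in>U i ` space M. v * (LINT x|M. R n x * indicator (U i -` {v} \<inter> space M) x))" for n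
  proof -
    have s: "U i -` {v} \<inter> space M \<in> sets M" for v using simple_functionD(2)[OF U(1)] by simp
    have "(LINT x|M. R n x * U i x) = (LINT x|M. (\<Sum>v\<in>U i ` space M. v * (R n x * indicator (U i -` {v} \<inter> space M) x)))"
      by (rule Bochner_Integration.integral_cong[OF refl]) (subst Ueq, auto simp: sum_distrib_left mult_ac)
    also have "... = (\<Sum>v\<in>U i ` space M. LINT x|M. v * (R n x * indicator (U i -` {v} \<inter> space M) x))"
      by (rule Bochner_Integration.integral_sum) (intro integrable_mult_right weak_int s)
    finally show ?thesis by simp
  qed
  moreover have "(%n. \<Sum>v\<in>U i ` space M. v * (LINT x|M. R n x * indicator (U i -` {v} \<inter> space M) x)) \<longlonglongrightarrow> (\<Sum>v\<in>U i ` space M. v * 0)"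
    using simple_functionD(2)[OF U(1)] by (intro tendsto_intros weak_sets) auto
  ultimately have "b \<longlonglongrightarrow> \<bar>0\<bar>" unfolding b_def by (intro tendsto_rabs) simp
  then have b0: "b \<longlonglongrightarrow> 0" by simp
  have "\<bar>LINT x|M. R n x * Y x\<bar> <= d * (B + 1) + b n" for n
  proof -
    have "(LINT x|M. R n x * Y x) = (LINT x|M. R n x * (Y x - U i x) + R n x * U i x)" by (simp add: algebra_simps)
    also have "... = (LINT x|M. R n x * (Y x - U i x)) + (LINT x|M. R n x * U i x)"
      by (rule Bochner_Integration.integral_add) (auto intro!: integrable_mult_square iR iD iU)
    also have "\<bar>...\<bar> <= \<bar>LINT x|M. R n x * (Y x - U i x)\<bar> + b n" unfolding b_def by linarith
    also have "\<bar>LINT x|M. R n x * (Y x - U i x)\<bar> <= d * (LINT x|M. (R n x)^2) + (LINT x|M. (Y x - U i x)^2) / d"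
      by (rule integral_mult_le_weighted) (auto intro!: iR iD d)
    also have "... <= d * B + d" using i d B[of n] by (intro add_mono mult_left_mono) (auto simp: field_simps)
    finally show ?thesis by (simp add: algebra_simps)
  qed
  then show "\<exists>b. b \<longlonglongrightarrow> 0 \<and> (\<forall>n. \<bar>LINT x|M. R n x * Y x\<bar> <= d * (B + 1) + b n)" using b0 by blast
qed

end

section \<open>Residuals of finite orthonormal families\<close>

context gaussian_family begin

definition res :: "(nat => real => 'h) => nat set => (real => 'h) => real => 'h" where
  "res e I h = (%s. h s + (-1) *\<^sub>R (\<Sum>i\<in>I. ip H h (e i) *\<^sub>R e i s))"

text \<open>Squared distance of \<open>h\<close> from the span of the family, that is, the part of
  the variance of \<open>W h\<close> which the chosen coordinates leave unexplained.\<close>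

definition rho :: "(nat => real => 'h) => nat set => (real => 'h) => real" where
  "rho e I h = ip H h h - (\<Sum>i\<in>I. (ip H h (e i))^2)"

definition extends :: "nat set => (nat => real => 'h) => nat set => (nat => real => 'h) => bool" where
  "extends I e J d \<longleftrightarrow> onb J d \<and> I \<subseteq> J \<and> (\<forall>i\<in>I. d i = e i)"

lemma extends_trans: "extends I e J d ==> extends J d K c ==> extends I e K c"
  unfolding extends_def by (metis subset_iff)

lemma extends_refl: "onb I e ==> extends I e I e" by (simp add: extends_def)

context
  fixes I e assumes e: "onb I e"
begin

lemma onbD: "finite I" "i \<in> I ==> e i \<in> DD" "i \<in> I ==> j \<in> I ==> ip H (e i) (e j) = (if i = j then 1 else 0)"
  using e by (auto simp: onb_def)

lemma sum_in: "(%s. \<Sum>i\<in>I. c i *\<^sub>R e i s) \<in> DD" by (intro L2_time_sum onbD)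

lemma res_in: "h \<in> DD ==> res e I h \<in> DD"
  unfolding res_def by (intro L2_time_lin sum_in)

lemma ip_res:
  assumes "h \<in> DD" "k \<in> DD"
  shows "ip H (res e I h) k = ip H h k - (\<Sum>i\<in>I. ip H h (e i) * ip H k (e i))"
  unfolding res_def using assms
  by (subst ip_lin[OF assms(1) sum_in assms(2)]) (simp add: ip_sum onbD ip_commute[of H k])

lemma ip_res_onb: "h \<in> DD ==> j \<in> I ==> ip H (res e I h) (e j) = 0"
  by (subst ip_res) (auto simp: onbD if_distrib[of "%z. _ * z"] cong: if_cong)

lemma ip_res_res:
  assumes "h \<in> DD" "k \<in> DD"
  shows "ip H (res e I h) (res e I k) = ip H (res e I h) k"
proof -
  have "ip H (res e I h) (res e I k) = ip H (res e I k) (res e I h)" by (rule ip_commute)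
  also have "... = ip H k (res e I h) - (\<Sum>i\<in>I. ip H k (e i) * ip H (res e I h) (e i))"
    using assms by (intro ip_res res_in)
  also have "... = ip H (res e I h) k" using assms by (simp add: ip_res_onb) (rule ip_commute)
  finally show ?thesis .
qed

lemma rho_res: "h \<in> DD ==> rho e I h = ip H (res e I h) (res e I h)"
  by (simp add: ip_res_res ip_res rho_def power2_eq_square)

lemma rho_nonneg: "h \<in> DD ==> 0 <= rho e I h" by (simp add: rho_res ip_nonneg)

lemma rho_le: "rho e I h <= ip H h h" by (simp add: rho_def sum_nonneg)

text \<open>One Gram--Schmidt step: the normalised residual of \<open>c\<close> joins the family
  under a fresh index. The exact decrease of \<open>rho\<close> at every \<open>h\<close> is
  recorded, because near-minimality of the total residual will be exploited through it.\<close>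

lemma extend_by_residual:
  assumes c: "c \<in> DD" and p: "0 < rho e I c"
  shows "\<exists>J d. extends I e J d \<and> rho d J c = 0 \<and> (\<forall>h\<in>DD. rho d J h = rho e I h - (ip H (res e I h) (res e I c))\<^sup>2 / rho e I c)"
proof -
  obtain m where m: "m \<notin> I" using onbD(1) ex_new_if_finite[OF infinite_UNIV_nat] by blast
  define r where "r = sqrt (rho e I c)"
  have r: "0 < r" "r * r = rho e I c" using p by (auto simp: r_def)
  define u where "u = (%s. (1 / r) *\<^sub>R res e I c s)"
  define d where "d = e(m := u)"
  have u: "u \<in> DD" unfolding u_def by (intro L2_time_scale res_in c)
  have iu: "ip H h u = ip H h (res e I c) / r" if "h \<in> DD" for h
    unfolding u_def using that by (subst ip_scale(2)) (auto intro: res_in c)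
  have uu: "ip H u u = 1" using r p
    by (simp add: iu u) (simp add: u_def ip_scale res_in c rho_res[symmetric] field_simps)
  have ue: "ip H (e i) u = 0" "ip H u (e i) = 0" if "i \<in> I" for i
    using ip_res_onb[OF c that] by (simp_all add: iu onbD that ip_commute[of H u] ip_commute[of H "e i" "res e I c"])
  have on: "onb (insert m I) d"
    unfolding onb_def using m onbD u uu ue by (auto simp: d_def)
  have ext: "extends I e (insert m I) d" using on m by (auto simp: extends_def d_def)
  have rr: "rho d (insert m I) h = rho e I h - (ip H (res e I h) (res e I c))\<^sup>2 / rho e I c" if h: "h \<in> DD" for h
  proof -
    have "rho d (insert m I) h = ip H h h - ((ip H h u)^2 + (\<Sum>i\<in>I. (ip H h (e i))^2))"
    proof -
      have "(\<Sum>i\<in>I. (ip H h (d i))^2) = (\<Sum>i\<in>I. (ip H h (e i))^2)" using m by (intro sum.cong) (auto simp: d_def)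
      then show ?thesis using m onbD(1) by (simp add: rho_def d_def)
    qed
    moreover have "ip H h (res e I c) = ip H (res e I h) (res e I c)"
      using ip_res_res[OF c h] by (simp add: ip_commute)
    ultimately show ?thesis using r h by (simp add: rho_def iu power_divide power2_eq_square[of r])
  qed
  have "rho d (insert m I) c = 0" using rr[OF c] p by (simp add: rho_res[OF c, symmetric] power2_eq_square)
  then show ?thesis using ext rr by blast
qed

end

lemma extends_rho_le:
  assumes "extends I e J d"
  shows "rho d J h <= rho e I h"
proof -
  have "(\<Sum>i\<in>I. (ip H h (e i))^2) = (\<Sum>i\<in>I. (ip H h (d i))^2)" using assms by (intro sum.cong) (auto simp: extends_def)
  also have "... <= (\<Sum>i\<in>J. (ip H h (d i))^2)" using assms by (intro sum_mono2) (auto simp: extends_def onb_def)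
  finally show ?thesis by (simp add: rho_def)
qed

lemma extend_to_contain:
  assumes e: "onb I e" and c: "c \<in> DD"
  shows "\<exists>J d. extends I e J d \<and> rho d J c = 0"
proof (cases "rho e I c = 0")
  case True then show ?thesis using extends_refl[OF e] by blast
next
  case False
  then have "0 < rho e I c" using rho_nonneg[OF e c] by simp
  from extend_by_residual[OF e c this] show ?thesis by blast
qed

lemma W_lin:
  assumes h: "h \<in> DD" and k: "k \<in> DD"
  shows "AE om in P. W (%s. h s + c *\<^sub>R k s) om = W h om + c * W k om"
proof -
  let ?l = "%s. h s + c *\<^sub>R k s"
  have l: "?l \<in> DD" using h k by (rule L2_time_lin)
  have e: "(W ?l om - W h om - c * W k om)^2 = W ?l om * W ?l om + W h om * W h om + c\<^sup>2 * (W k om * W k om)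
      - 2 * (W ?l om * W h om) - 2 * c * (W ?l om * W k om) + 2 * c * (W h om * W k om)" for om
    by (simp add: power2_eq_square algebra_simps)
  note i = W_integrable_mult[OF l l] W_integrable_mult[OF l h] W_integrable_mult[OF l k]
     W_integrable_mult[OF h h] W_integrable_mult[OF h k] W_integrable_mult[OF k k]
  have int: "integrable P (%om. (W ?l om - W h om - c * W k om)^2)" unfolding e using i by simp
  have "(LINT om|P. (W ?l om - W h om - c * W k om)^2) = ip H ?l ?l + ip H h h + c\<^sup>2 * ip H k k - 2 * ip H ?l h - 2 * c * ip H ?l k + 2 * c * ip H h k"
    unfolding e using i by (simp add: W_cov h k l)
  also have "... = 0" unfolding ip_expand[OF h k] using h k by (simp add: ip_lin ip_commute[of H k h] power2_eq_square algebra_simps)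
  finally have "AE om in P. (W ?l om - W h om - c * W k om)^2 = 0"
    using integral_nonneg_eq_0_iff_AE[OF int] by auto
  then show ?thesis by eventually_elim simp
qed

lemma W_zero: "AE om in P. W (%s. 0) om = 0"
proof -
  have "(LINT om|P. (W (%s. 0) om)^2) = 0" using W_cov[OF L2_time_zero L2_time_zero] by (simp add: ip_def power2_eq_square)
  then have "AE om in P. (W (%s. 0) om)^2 = 0"
    using integral_nonneg_eq_0_iff_AE[OF W_square_integrable[OF L2_time_zero]] by auto
  then show ?thesis by eventually_elim simp
qed

lemma W_sum:
  assumes "finite I" "!!i. i \<in> I ==> e i \<in> DD"
  shows "AE om in P. W (%s. \<Sum>i\<in>I. c i *\<^sub>R e i s) om = (\<Sum>i\<in>I. c i * W (e i) om)"
  using assms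
proof (induction I rule: finite_induct)
  case empty then show ?case using W_zero by simp
next
  case (insert i I)
  have "(%s. \<Sum>i\<in>I. c i *\<^sub>R e i s) \<in> DD" using insert by (intro L2_time_sum) auto
  from W_lin[OF this insert.prems[of i], of "c i"] insert.IH insert.prems
  have "AE om in P. W (%s. (\<Sum>i\<in>I. c i *\<^sub>R e i s) + c i *\<^sub>R e i s) om = (\<Sum>i\<in>I. c i * W (e i) om) + c i * W (e i) om"
    by auto
  then show ?case using insert.hyps by (simp add: add.commute)
qed

lemma W_res:
  assumes e: "onb I e" and h: "h \<in> DD"
  shows "AE om in P. W (res e I h) om = W h om - (\<Sum>i\<in>I. ip H h (e i) * W (e i) om)"
proof -
  have "AE om in P. W (%s. \<Sum>i\<in>I. ip H h (e i) *\<^sub>R e i s) om = (\<Sum>i\<in>I. ip H h (e i) * W (e i) om)"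
    by (rule W_sum) (use onbD[OF e] in auto)
  then show ?thesis
    using W_lin[OF h sum_in[OF e, where c="%i. ip H h (e i)"], of "-1"]
    unfolding res_def by eventually_elim simp
qed

end

section \<open>Finite-dimensional approximation of Gaussian fields\<close>

context gaussian_family begin

context
  fixes N' :: "'b measure" and g :: "'b => real => 'h" and Y :: "'w => 'b => real" and q :: real
  assumes N': "finite_measure N'"
    and g: "!!b. b \<in> space N' ==> g b \<in> DD" and q: "!!b. b \<in> space N' ==> ip H (g b) (g b) <= q" and q0: "0 <= q"
    and Ym: "(%(om, b). Y om b) \<in> bm (P \<Otimes>\<^sub>M N')"
    and YW: "!!b. b \<in> space N' ==> AE om in P. Y om b = W (g b) om"
begin

interpretation N': finite_measure N' by (rule N')
interpretation PN: pair_sigma_finite P N' ..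
interpretation NN: pair_sigma_finite N' N' ..
interpretation NNf: finite_measure "N' \<Otimes>\<^sub>M N'" by (rule finite_measure_pair_measure[OF N' N'])
interpretation PNN: pair_sigma_finite P "N' \<Otimes>\<^sub>M N'" ..
interpretation PNf: finite_measure "P \<Otimes>\<^sub>M N'" by (rule finite_measure_pair_measure[OF N']) unfold_locales

lemma Ym'[measurable (raw)]:
  assumes "u \<in> K \<rightarrow>\<^sub>M P" "v \<in> K \<rightarrow>\<^sub>M N'"
  shows "(%x. Y (u x) (v x)) \<in> bm K"
  using measurable_compose[OF measurable_Pair[OF assms] Ym] by simp

lemma Y_section[measurable (raw)]: "b \<in> space N' ==> (%om. Y om b) \<in> bm P"
  by measurable

text \<open>\<open>g\<close> comes without measurability in \<open>b\<close>. The inner product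
  equals the covariance of \<open>W h\<close> with the jointly measurable field \<open>Y\<close>,
  and that covariance is a measurable function of \<open>b\<close> as an integral over
  \<open>P\<close>.\<close>

lemma ip_measurable:
  assumes h: "h \<in> DD"
  shows "(%b. ip H (g b) h) \<in> bm N'"
proof -
  note [measurable] = W_measurable[OF h]
  have "(%b. LINT om|P. Y om b * W h om) \<in> bm N'"
    by (rule borel_measurable_lebesgue_integral) (simp add: case_prod_beta')
  moreover have "(LINT om|P. Y om b * W h om) = ip H (g b) h" if b: "b \<in> space N'" for b
  proof -
    note [measurable] = W_measurable[OF g[OF b]] Y_section[OF b]
    have "(LINT om|P. Y om b * W h om) = (LINT om|P. W (g b) om * W h om)"
      by (rule integral_cong_AE) (use YW[OF b] in auto)
    then show ?thesis using W_cov[OF g[OF b] h] by simp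
  qed
  ultimately show ?thesis by (simp cong: measurable_cong)
qed

lemma ip_self_measurable: "(%b. ip H (g b) (g b)) \<in> bm N'"
proof -
  have "(%b. LINT om|P. Y om b * Y om b) \<in> bm N'"
    by (rule borel_measurable_lebesgue_integral) (simp add: case_prod_beta')
  moreover have "(LINT om|P. Y om b * Y om b) = ip H (g b) (g b)" if b: "b \<in> space N'" for b
  proof -
    note [measurable] = W_measurable[OF g[OF b]] Y_section[OF b]
    have "(LINT om|P. Y om b * Y om b) = (LINT om|P. W (g b) om * W (g b) om)"
      by (rule integral_cong_AE) (use YW[OF b] in auto)
    then show ?thesis using W_cov[OF g[OF b] g[OF b]] by simp
  qed
  ultimately show ?thesis by (simp cong: measurable_cong)
qed

lemma rho_measurable: "onb I e ==> (%b. rho e I (g b)) \<in> bm N'"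
  unfolding rho_def by (intro borel_measurable_diff ip_self_measurable borel_measurable_sum borel_measurable_power ip_measurable) (rule onbD(2))

lemma rho_bounds: "onb I e ==> b \<in> space N' ==> 0 <= rho e I (g b) \<and> rho e I (g b) <= q"
  using rho_nonneg[of I e "g b"] rho_le[of I e "g b"] g q by force

lemma rho_integrable: "onb I e ==> integrable N' (%b. rho e I (g b))"
  by (rule N'.integrable_const_bound[where B=q]) (use rho_bounds rho_measurable in auto)

text \<open>Jointly measurable version of \<open>W (res e I (g b))\<close>: the part of the field
  that the coordinates in \<open>I\<close> leave unexplained.\<close>

definition remainder :: "(nat => real => 'h) => nat set => 'w => 'b => real" where
  "remainder e I om b = Y om b - (\<Sum>i\<in>I. ip H (g b) (e i) * W (e i) om)"

lemma remainder_measurable: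
  assumes e: "onb I e" "u \<in> K \<rightarrow>\<^sub>M P" "v \<in> K \<rightarrow>\<^sub>M N'"
  shows "(%x. remainder e I (u x) (v x)) \<in> bm K"
  unfolding remainder_def
  by (intro borel_measurable_diff Ym' assms borel_measurable_sum borel_measurable_times
      measurable_compose[OF assms(3) ip_measurable] measurable_compose[OF assms(2) W_measurable] onbD(2)[OF e(1)])

lemma remainder_W:
  assumes "onb I e" "b \<in> space N'"
  shows "AE om in P. remainder e I om b = W (res e I (g b)) om"
  using W_res[OF assms(1) g[OF assms(2)]] YW[OF assms(2)] by eventually_elim (simp add: remainder_def)

lemma remainder_cov:
  assumes e: "onb I e" and b: "b \<in> space N'" and c: "c \<in> space N'"
  shows "integrable P (%om. remainder e I om b * remainder e I om c)"
    "(LINT om|P. remainder e I om b * remainder e I om c) = ip H (res e I (g b)) (res e I (g c))"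
proof -
  note [measurable] = remainder_measurable[OF e measurable_ident_sets[OF refl] measurable_const[OF b]]
    remainder_measurable[OF e measurable_ident_sets[OF refl] measurable_const[OF c]]
    W_measurable[OF res_in[OF e g[OF b]]] W_measurable[OF res_in[OF e g[OF c]]]
  have ae: "AE om in P. remainder e I om b * remainder e I om c = W (res e I (g b)) om * W (res e I (g c)) om"
    using remainder_W[OF e b] remainder_W[OF e c] by eventually_elim simp
  show "integrable P (%om. remainder e I om b * remainder e I om c)"
    by (subst integrable_cong_AE[OF _ _ ae]) (auto intro!: W_integrable_mult res_in e g b c)
  show "(LINT om|P. remainder e I om b * remainder e I om c) = ip H (res e I (g b)) (res e I (g c))"
    by (subst integral_cong_AE[OF _ _ ae]) (auto intro!: W_cov res_in e g b c)
qed

lemma remainder_sq: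
  assumes e: "onb I e" and b: "b \<in> space N'"
  shows "(NINT om|P. ennreal ((remainder e I om b)^2)) = ennreal (rho e I (g b))"
  using remainder_cov[OF e b b] by (subst nn_integral_eq_integral) (auto simp: power2_eq_square rho_res[OF e g[OF b]])

lemma remainder_L2:
  assumes e: "onb I e"
  shows "integrable (P \<Otimes>\<^sub>M N') (%p. (remainder e I (fst p) (snd p))^2)"
    and "(LINT p|(P \<Otimes>\<^sub>M N'). (remainder e I (fst p) (snd p))^2) = (LINT b|N'. rho e I (g b))"
proof -
  note [measurable (raw)] = remainder_measurable[OF e]
  have nn: "(NINT p|(P \<Otimes>\<^sub>M N'). ennreal ((remainder e I (fst p) (snd p))^2)) = ennreal (LINT b|N'. rho e I (g b))"
  proof -
    have "(NINT p|(P \<Otimes>\<^sub>M N'). ennreal ((remainder e I (fst p) (snd p))^2)) = (NINT b|N'. NINT om|P. ennreal ((remainder e I om b)^2))"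
      by (subst PN.nn_integral_snd[symmetric]) auto
    also have "... = (NINT b|N'. ennreal (rho e I (g b)))" by (intro nn_integral_cong remainder_sq e)
    also have "... = ennreal (LINT b|N'. rho e I (g b))"
      using rho_bounds[OF e] by (intro nn_integral_eq_integral rho_integrable e) auto
    finally show ?thesis .
  qed
  show i: "integrable (P \<Otimes>\<^sub>M N') (%p. (remainder e I (fst p) (snd p))^2)"
    by (rule integrableI_bounded) (use nn in auto)
  have "0 <= (LINT b|N'. rho e I (g b))" using rho_bounds[OF e] by (intro integral_nonneg_AE) auto
  then show "(LINT p|(P \<Otimes>\<^sub>M N'). (remainder e I (fst p) (snd p))^2) = (LINT b|N'. rho e I (g b))"
    using nn by (subst (asm) nn_integral_eq_integral[OF i]) auto
qed

text \<open>The covariance kernel of the remainder.\<close>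

definition kern where "kern e I p = ip H (res e I (g (fst p))) (res e I (g (snd p)))"

lemma kern_measurable:
  assumes e: "onb I e"
  shows "kern e I \<in> bm (N' \<Otimes>\<^sub>M N')"
proof -
  note [measurable (raw)] = remainder_measurable[OF e]
  have "(%p. LINT om|P. remainder e I om (fst p) * remainder e I om (snd p)) \<in> bm (N' \<Otimes>\<^sub>M N')"
    by (rule borel_measurable_lebesgue_integral) (simp add: case_prod_beta')
  then show ?thesis
    by (rule measurable_cong[THEN iffD1, rotated]) (auto simp: kern_def space_pair_measure remainder_cov[OF e])
qed

lemma kern_bound:
  assumes e: "onb I e" and p: "p \<in> space (N' \<Otimes>\<^sub>M N')"
  shows "(kern e I p)^2 <= q * q"
proof -
  obtain b c where bc: "p = (b, c)" "b \<in> space N'" "c \<in> space N'" using p by (auto simp: space_pair_measure)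
  have "(kern e I p)^2 <= rho e I (g b) * rho e I (g c)"
    unfolding kern_def bc rho_res[OF e g[OF bc(2)]] rho_res[OF e g[OF bc(3)]] fst_conv snd_conv
    by (intro ip_Cauchy_Schwarz res_in e g bc)
  also have "... <= q * q" using rho_bounds[OF e] bc q0 by (intro mult_mono) auto
  finally show ?thesis .
qed

text \<open>The integral equals the expectation of \<open>indicator F om * U om\<close>, with
  \<open>U\<close> the integral of the remainder over \<open>C\<close>, and the second moment of
  \<open>U\<close> is the integral of \<open>kern\<close> over \<open>C \<times> C\<close>. Young's
  inequality is used with weight \<open>d * d\<close> for the kernel and with weight
  \<open>d\<close> for the expectation, which gives the third power of \<open>d\<close>.\<close>

lemma rectangle_bound:
  assumes e: "onb I e" and F: "F \<in> sets P" and C: "C \<in> sets N'" and d: "0 < d"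
  shows "\<bar>LINT p|(P \<Otimes>\<^sub>M N'). remainder e I (fst p) (snd p) * indicator (F \<times> C) p\<bar> <=
    d * (1 + (measure N' (space N'))^2) + (LINT p|(N' \<Otimes>\<^sub>M N'). (kern e I p)^2) / (d * d * d)"
proof -
  note [measurable (raw)] = remainder_measurable[OF e]
  note [measurable] = F C kern_measurable[OF e]
  let ?R = "remainder e I"
  define h where "h om p = (?R om (fst p) * indicator C (fst p)) * (?R om (snd p) * indicator C (snd p))" for om p
  define U where "U om = (LINT b|N'. ?R om b * indicator C b)" for om
  have [measurable]: "U \<in> bm P"
    unfolding U_def by (rule N'.borel_measurable_lebesgue_integral) (simp add: case_prod_beta')
  have hm[measurable]: "(%x. h (fst x) (snd x)) \<in> bm (P \<Otimes>\<^sub>M (N' \<Otimes>\<^sub>M N'))"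
    unfolding h_def by measurable
  have hi: "integrable (P \<Otimes>\<^sub>M (N' \<Otimes>\<^sub>M N')) (%x. h (fst x) (snd x))"
  proof (rule integrableI_bounded)
    have "(NINT x|(P \<Otimes>\<^sub>M (N' \<Otimes>\<^sub>M N')). ennreal (norm (h (fst x) (snd x)))) = (NINT p|(N' \<Otimes>\<^sub>M N'). NINT om|P. ennreal (norm (h om p)))"
      by (subst PNN.nn_integral_snd[symmetric]) auto
    also have "... <= (NINT p|(N' \<Otimes>\<^sub>M N'). ennreal (q + q))"
    proof (rule nn_integral_mono)
      fix p assume "p \<in> space (N' \<Otimes>\<^sub>M N')"
      then obtain b c where bc: "p = (b, c)" "b \<in> space N'" "c \<in> space N'" by (auto simp: space_pair_measure)
      note [measurable] = remainder_measurable[OF e measurable_ident_sets[OF refl] measurable_const[OF bc(2)]]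
        remainder_measurable[OF e measurable_ident_sets[OF refl] measurable_const[OF bc(3)]]
      have "(NINT om|P. ennreal (norm (h om p))) <= (NINT om|P. ennreal ((?R om b)^2) + ennreal ((?R om c)^2))"
      proof (rule nn_integral_mono)
        fix om
        have "norm (h om p) <= \<bar>?R om b * ?R om c\<bar>" by (simp add: h_def bc abs_mult indicator_def)
        also have "... <= (?R om b)^2 + (?R om c)^2" using abs_mult_le_weighted[of 1] by simp
        finally show "ennreal (norm (h om p)) <= ennreal ((?R om b)^2) + ennreal ((?R om c)^2)"
          by (simp add: ennreal_leI flip: ennreal_plus)
      qed
      also have "... = ennreal (rho e I (g b)) + ennreal (rho e I (g c))"
        by (simp add: nn_integral_add remainder_sq[OF e] bc)
      also have "... <= ennreal q + ennreal q" using rho_bounds[OF e] bc by (intro add_mono ennreal_leI) auto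
      finally show "(NINT om|P. ennreal (norm (h om p))) <= ennreal (q + q)" by (simp only: ennreal_plus[OF q0 q0])
    qed
    also have "... < \<infinity>" by (simp add: less_top[symmetric] ennreal_mult_eq_top_iff NNf.emeasure_finite)
    finally show "(NINT x|(P \<Otimes>\<^sub>M (N' \<Otimes>\<^sub>M N')). ennreal (norm (h (fst x) (snd x)))) < \<infinity>" .
  qed simp
  have hU: "AE om in P. (LINT p|(N' \<Otimes>\<^sub>M N'). h om p) = (U om)\<^sup>2 \<and> integrable (N' \<Otimes>\<^sub>M N') (h om)"
    using PNN.AE_integrable_fst'[OF hi]
  proof eventually_elim
    case (elim om)
    then have i: "integrable (N' \<Otimes>\<^sub>M N') (h om)" by simp
    have "(LINT p|(N' \<Otimes>\<^sub>M N'). h om p) = (LINT b|N'. LINT c|N'. h om (b, c))" by (rule NN.integral_fst'[OF i, symmetric])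
    also have "... = U om * U om" by (simp add: h_def U_def)
    finally show ?case using i by (simp add: power2_eq_square)
  qed
  have iU: "integrable P (%om. (U om)^2)" and EU: "(LINT om|P. (U om)^2) = (LINT p|(N' \<Otimes>\<^sub>M N'). LINT om|P. h om p)"
  proof -
    have i1: "integrable P (%om. LINT p|(N' \<Otimes>\<^sub>M N'). h om p)" using PNN.integrable_fst'[OF hi] by simp
    then show "integrable P (%om. (U om)^2)"
      by (rule integrable_cong_AE_imp) (use hU in auto)
    have "(LINT om|P. (U om)^2) = (LINT om|P. LINT p|(N' \<Otimes>\<^sub>M N'). h om p)"
      by (rule integral_cong_AE) (use hU i1 in auto)
    also have "... = (LINT p|(N' \<Otimes>\<^sub>M N'). LINT om|P. h om p)"
      using PNN.Fubini_integral[of h] hi by (simp add: case_prod_beta')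
    finally show "(LINT om|P. (U om)^2) = (LINT p|(N' \<Otimes>\<^sub>M N'). LINT om|P. h om p)" .
  qed
  have ik2: "integrable (N' \<Otimes>\<^sub>M N') (%p. (kern e I p)^2)"
    by (rule NNf.integrable_const_bound[where B="q * q"]) (use kern_bound[OF e] in auto)
  have "(LINT p|(N' \<Otimes>\<^sub>M N'). LINT om|P. h om p) <= (LINT p|(N' \<Otimes>\<^sub>M N'). d * d + (kern e I p)\<^sup>2 / (d * d))"
  proof (rule integral_mono_AE)
    show "integrable (N' \<Otimes>\<^sub>M N') (%p. LINT om|P. h om p)" using PNN.integrable_snd[of h] hi by (simp add: case_prod_beta')
    show "integrable (N' \<Otimes>\<^sub>M N') (%p. d * d + (kern e I p)\<^sup>2 / (d * d))" using ik2 by simp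
    show "AE p in N' \<Otimes>\<^sub>M N'. (LINT om|P. h om p) <= d * d + (kern e I p)\<^sup>2 / (d * d)"
    proof (rule AE_I2)
      fix p assume p: "p \<in> space (N' \<Otimes>\<^sub>M N')"
      then obtain b c where bc: "p = (b, c)" "b \<in> space N'" "c \<in> space N'" by (auto simp: space_pair_measure)
      have "(LINT om|P. h om p) = (indicator C b * indicator C c) * kern e I p"
        unfolding h_def kern_def bc using remainder_cov(2)[OF e bc(2,3)] by (simp add: mult_ac)
      also have "... <= \<bar>1 * kern e I p\<bar>" by (auto simp: indicator_def)
      also have "... <= (d * d) * 1\<^sup>2 + (kern e I p)\<^sup>2 / (d * d)" using d by (intro abs_mult_le_weighted) simp
      finally show "(LINT om|P. h om p) <= d * d + (kern e I p)\<^sup>2 / (d * d)" by simp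
    qed
  qed
  also have "... = d * d * (measure N' (space N'))^2 + (LINT p|(N' \<Otimes>\<^sub>M N'). (kern e I p)^2) / (d * d)"
  proof -
    have "measure (N' \<Otimes>\<^sub>M N') (space (N' \<Otimes>\<^sub>M N')) = measure N' (space N') * measure N' (space N')"
      by (simp add: measure_def space_pair_measure N'.emeasure_pair_measure_Times enn2real_mult)
    then show ?thesis using ik2 by (simp add: power2_eq_square)
  qed
  finally have EU2: "(LINT om|P. (U om)^2) <= d * d * (measure N' (space N'))^2 + (LINT p|(N' \<Otimes>\<^sub>M N'). (kern e I p)^2) / (d * d)"
    using EU by simp
  have iRA: "integrable (P \<Otimes>\<^sub>M N') (%p. ?R (fst p) (snd p) * indicator (F \<times> C) p)"
    by (rule integrable_mult_square) (auto intro!: remainder_L2 e PNf.integrable_const_bound[where B=1] simp: indicator_def)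
  have "(LINT p|(P \<Otimes>\<^sub>M N'). ?R (fst p) (snd p) * indicator (F \<times> C) p) = (LINT om|P. LINT b|N'. ?R om b * indicator (F \<times> C) (om, b))"
    using PN.integral_fst'[OF iRA] by simp
  also have "... = (LINT om|P. indicator F om * U om)"
    unfolding U_def by (simp add: indicator_times mult.left_commute flip: integral_mult_right_zero)
  finally have eq: "(LINT p|(P \<Otimes>\<^sub>M N'). ?R (fst p) (snd p) * indicator (F \<times> C) p) = (LINT om|P. indicator F om * U om)" .
  have "\<bar>LINT om|P. indicator F om * U om\<bar> <= d * (LINT om|P. (indicator F om)^2) + (LINT om|P. (U om)^2) / d"
    by (rule integral_mult_le_weighted) (auto intro!: iU d integrable_const_bound[where B=1] simp: indicator_def)
  also have "(LINT om|P. (indicator F om :: real)^2) <= 1"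
    by (rule integral_le_const) (auto intro!: integrable_const_bound[where B=1] simp: indicator_def)
  also have "(LINT om|P. (U om)^2) / d <= (d * d * (measure N' (space N'))^2 + (LINT p|(N' \<Otimes>\<^sub>M N'). (kern e I p)^2) / (d * d)) / d"
    using EU2 d by (intro divide_right_mono) auto
  also have "d * 1 + ... = d * (1 + (measure N' (space N'))^2) + (LINT p|(N' \<Otimes>\<^sub>M N'). (kern e I p)^2) / (d * d * d)"
    using d by (simp add: field_simps)
  finally show ?thesis unfolding eq using d by simp
qed

text \<open>Adding the residual of \<open>g c\<close> to the family lowers the total residual by the
  integral of \<open>kern\<close> squared over its first argument, divided by
  \<open>rho e I (g c)\<close>. The total cannot drop below \<open>s\<close>, so this gain is at
  most the current excess over \<open>s\<close>. Integration over \<open>c\<close> bounds the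
  Hilbert--Schmidt norm.\<close>

lemma kern_square_le:
  assumes e: "extends I0 e0 I e" and s0: "!!J d. extends I0 e0 J d ==> s <= (LINT b|N'. rho d J (g b))"
  shows "(LINT p|(N' \<Otimes>\<^sub>M N'). (kern e I p)^2) <= measure N' (space N') * (((LINT b|N'. rho e I (g b)) - s) * q)"
proof -
  have on: "onb I e" using e by (simp add: extends_def)
  note [measurable] = kern_measurable[OF on]
  define J where "J = (LINT b|N'. rho e I (g b))"
  have Js: "0 <= J - s" using s0[OF e] by (simp add: J_def)
  have ik2: "integrable (N' \<Otimes>\<^sub>M N') (%p. (kern e I p)^2)"
    by (rule NNf.integrable_const_bound[where B="q * q"]) (use kern_bound[OF on] in auto)
  have one: "(LINT b|N'. (kern e I (b, c))^2) <= (J - s) * q" if c: "c \<in> space N'" for c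
  proof (cases "rho e I (g c) = 0")
    case True
    have "(kern e I (b, c))^2 = 0" if b: "b \<in> space N'" for b
    proof -
      have "(kern e I (b, c))^2 <= rho e I (g b) * rho e I (g c)"
        unfolding kern_def rho_res[OF on g[OF b]] rho_res[OF on g[OF c]] fst_conv snd_conv
        by (intro ip_Cauchy_Schwarz res_in on g b c)
      then show ?thesis using True by simp
    qed
    then have "(LINT b|N'. (kern e I (b, c))^2) = (LINT b|N'. 0)" by (intro Bochner_Integration.integral_cong) auto
    then show ?thesis using Js q0 by simp
  next
    case False
    then have p: "0 < rho e I (g c)" using rho_bounds[OF on c] by simp
    obtain J' d where d: "extends I e J' d"
      "!!h. h \<in> DD ==> rho d J' h = rho e I h - (ip H (res e I h) (res e I (g c)))\<^sup>2 / rho e I (g c)"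
      using extend_by_residual[OF on g[OF c] p] by blast
    have [measurable]: "(%b. kern e I (b, c)) \<in> bm N'"
      using measurable_compose[OF measurable_Pair2'[OF c] kern_measurable[OF on]] by simp
    have ik: "integrable N' (%b. (kern e I (b, c))^2)"
      by (rule N'.integrable_const_bound[where B="q * q"]) (use kern_bound[OF on] c in \<open>auto simp: space_pair_measure\<close>)
    have "s <= (LINT b|N'. rho d J' (g b))" by (rule s0[OF extends_trans[OF e d(1)]])
    also have "... = (LINT b|N'. rho e I (g b) - (kern e I (b, c))\<^sup>2 / rho e I (g c))"
      by (intro Bochner_Integration.integral_cong refl) (simp add: d(2) g kern_def)
    also have "... = J - (LINT b|N'. (kern e I (b, c))^2) / rho e I (g c)"
      using ik rho_integrable[OF on] by (simp add: J_def)
    finally have "(LINT b|N'. (kern e I (b, c))^2) <= (J - s) * rho e I (g c)" using p by (simp add: field_simps)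
    also have "... <= (J - s) * q" using Js rho_bounds[OF on c] by (intro mult_left_mono) auto
    finally show ?thesis .
  qed
  have "(LINT p|(N' \<Otimes>\<^sub>M N'). (kern e I p)^2) = (LINT c|N'. LINT b|N'. (kern e I (b, c))^2)"
    using NN.integral_snd[of "%b c. (kern e I (b, c))^2"] ik2 by (simp add: case_prod_beta')
  also have "... <= (LINT c|N'. (J - s) * q)"
  proof (rule integral_mono)
    show "integrable N' (%c. LINT b|N'. (kern e I (b, c))^2)"
      using NN.integrable_snd[of "%b c. (kern e I (b, c))^2"] ik2 by (simp add: case_prod_beta')
  qed (use one in auto)
  also have "... = measure N' (space N') * ((J - s) * q)" by simp
  finally show ?thesis unfolding J_def .
qed

text \<open>An almost optimal family leaves a residual covariance that is small in Hilbert--Schmidt norm, so the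
  remainders converge weakly to zero in \<open>L\<^sup>2\<close>. Tested against the field itself, this gives the claim.\<close>

theorem finite_dimensional_approximation:
  assumes e0: "onb I0 e0" and eps: "0 < \<epsilon>"
  shows "\<exists>I e. extends I0 e0 I e \<and> (LINT b|N'. rho e I (g b)) < \<epsilon>"
proof -
  define V where "V = {LINT b|N'. rho d J (g b) |J d. extends I0 e0 J d}"
  define s where "s = Inf V"
  have pos: "0 <= (LINT b|N'. rho d J (g b))" if "extends I0 e0 J d" for J d
    using rho_bounds[of J d] that by (intro integral_nonneg_AE) (auto simp: extends_def)
  have bdd: "bdd_below V" using pos by (auto simp: V_def intro!: bdd_belowI[of _ 0])
  have ne: "V \<noteq> {}" using extends_refl[OF e0] by (auto simp: V_def)
  have s0: "s <= (LINT b|N'. rho d J (g b))" if "extends I0 e0 J d" for J d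
    unfolding s_def using bdd that by (intro cInf_lower) (auto simp: V_def)
  have "\<exists>Je. extends I0 e0 (fst Je) (snd Je) \<and> (LINT b|N'. rho (snd Je) (fst Je) (g b)) < s + 1 / real (Suc n)" for n
  proof -
    have "Inf V < s + 1 / real (Suc n)" by (simp add: s_def)
    from cInf_lessD[OF ne this] show ?thesis by (auto simp: V_def)
  qed
  then obtain Je where Je: "!!n. extends I0 e0 (fst (Je n)) (snd (Je n))"
      "!!n. (LINT b|N'. rho (snd (Je n)) (fst (Je n)) (g b)) < s + 1 / real (Suc n)" by metis
  define I where "I n = fst (Je n)" for n
  define e where "e n = snd (Je n)" for n
  define J where "J n = (LINT b|N'. rho (e n) (I n) (g b))" for n
  have ext: "extends I0 e0 (I n) (e n)" and Jn: "J n < s + 1 / real (Suc n)" for n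
    using Je by (simp_all add: I_def e_def J_def)
  have on: "onb (I n) (e n)" for n using ext by (simp add: extends_def)
  let ?M = "P \<Otimes>\<^sub>M N'"
  define R where "R n p = remainder (e n) (I n) (fst p) (snd p)" for n p
  define m where "m = measure N' (space N')"
  have m0: "0 <= m" by (simp add: m_def)
  have Rm[measurable]: "R n \<in> bm ?M" for n
    unfolding R_def[abs_def] by (intro remainder_measurable on) measurable
  have YL2: "integrable ?M (%p. (Y (fst p) (snd p))^2)"
  proof (rule integrableI_bounded)
    have "(NINT p|?M. ennreal (norm ((Y (fst p) (snd p))^2))) = (NINT b|N'. NINT om|P. ennreal ((Y om b)^2))"
      by (subst PN.nn_integral_snd[symmetric]) auto
    also have "... <= (NINT b|N'. ennreal q)"
    proof (rule nn_integral_mono)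
      fix b assume b: "b \<in> space N'"
      have "(NINT om|P. ennreal ((Y om b)^2)) = (NINT om|P. ennreal ((W (g b) om)^2))"
        by (rule nn_integral_cong_AE) (use YW[OF b] in auto)
      also have "... = ennreal (ip H (g b) (g b))"
        using W_square_integrable[OF g[OF b]] W_cov[OF g[OF b] g[OF b]]
        by (subst nn_integral_eq_integral) (auto simp: power2_eq_square)
      also have "... <= ennreal q" using q[OF b] by (rule ennreal_leI)
      finally show "(NINT om|P. ennreal ((Y om b)^2)) <= ennreal q" .
    qed
    also have "... < \<infinity>" by (simp add: less_top[symmetric] ennreal_mult_eq_top_iff N'.emeasure_finite)
    finally show "(NINT p|?M. ennreal (norm ((Y (fst p) (snd p))^2))) < \<infinity>" .
  qed simp
  have null: "(%n. LINT p|?M. R n p * Y (fst p) (snd p)) \<longlonglongrightarrow> 0"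
  proof (rule weak_square_integrable[where \<G>="{A \<times> B |A B. A \<in> sets P \<and> B \<in> sets N'}" and B="m * q"])
    show "finite_measure ?M" by unfold_locales
    show "sets ?M = sigma_sets (space ?M) {A \<times> B |A B. A \<in> sets P \<and> B \<in> sets N'}"
      by (simp add: sets_pair_measure space_pair_measure)
    show "Int_stable {A \<times> B |A B. A \<in> sets P \<and> B \<in> sets N'}" by (rule Int_stable_pair_measure_generator)
    show "{A \<times> B |A B. A \<in> sets P \<and> B \<in> sets N'} \<subseteq> Pow (space ?M)"
      using pair_measure_closed[of P N'] by (simp add: space_pair_measure)
    show "space ?M \<in> {A \<times> B |A B. A \<in> sets P \<and> B \<in> sets N'}" by (auto simp: space_pair_measure)
    show "integrable ?M (%p. (R n p)^2)" for n unfolding R_def by (rule remainder_L2(1)[OF on])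
    show "(LINT p|?M. (R n p)^2) <= m * q" for n
    proof -
      have "(LINT p|?M. (R n p)^2) = (LINT b|N'. rho (e n) (I n) (g b))" unfolding R_def by (rule remainder_L2(2)[OF on])
      also have "... <= (LINT b|N'. q)" using rho_bounds[OF on] by (intro integral_mono rho_integrable on) auto
      finally show ?thesis by (simp add: m_def)
    qed
    fix A assume "A \<in> {A \<times> B |A B. A \<in> sets P \<and> B \<in> sets N'}"
    then obtain F C where A: "A = F \<times> C" "F \<in> sets P" "C \<in> sets N'" by auto
    show "(%n. LINT p|?M. R n p * indicator A p) \<longlonglongrightarrow> 0"
    proof (rule tendsto_zero_weighted[where B="1 + m\<^sup>2"])
      fix d :: real assume d: "0 < d"
      define b where "b n = (m * q / (d * d * d)) * (1 / real (Suc n))" for n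
      have "b \<longlonglongrightarrow> (m * q / (d * d * d)) * 0"
        unfolding b_def by (intro tendsto_mult tendsto_const LIMSEQ_Suc[OF lim_1_over_n])
      moreover have "\<bar>LINT p|?M. R n p * indicator A p\<bar> <= d * (1 + m\<^sup>2) + b n" for n
      proof -
        have "(LINT p|(N' \<Otimes>\<^sub>M N'). (kern (e n) (I n) p)^2) <= m * ((J n - s) * q)"
          unfolding m_def J_def by (rule kern_square_le[OF ext s0])
        also have "... <= m * ((1 / real (Suc n)) * q)"
          using m0 q0 Jn[of n] by (intro mult_left_mono mult_right_mono) auto
        finally have "(LINT p|(N' \<Otimes>\<^sub>M N'). (kern (e n) (I n) p)^2) / (d * d * d) <= (m * ((1 / real (Suc n)) * q)) / (d * d * d)"
          using d by (intro divide_right_mono) auto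
        also have "... = b n" by (simp add: b_def)
        finally have "(LINT p|(N' \<Otimes>\<^sub>M N'). (kern (e n) (I n) p)^2) / (d * d * d) <= b n" .
        then show ?thesis
          using rectangle_bound[OF on A(2,3) d, of n] unfolding R_def A(1) m_def by linarith
      qed
      ultimately show "\<exists>b. b \<longlonglongrightarrow> 0 \<and> (\<forall>n. \<bar>LINT p|?M. R n p * indicator A p\<bar> <= d * (1 + m\<^sup>2) + b n)" by auto
    qed simp
  qed (use YL2 in measurable)
  \<comment> \<open>The remainder is orthogonal to what the family explains, so pairing it with the
    whole field returns the total residual \<open>J n\<close>. Weak convergence of the remainders
    therefore sends \<open>J n\<close> itself to zero, although it was chosen close to an infimum of
    unknown value.\<close>
  have RY: "(LINT p|?M. R n p * Y (fst p) (snd p)) = J n" for n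
  proof -
    have i: "integrable ?M (%p. R n p * Y (fst p) (snd p))"
      by (rule integrable_mult_square) (use YL2 remainder_L2(1)[OF on, of n] Rm[of n] in \<open>auto simp: R_def[abs_def]\<close>)
    have "(LINT p|?M. R n p * Y (fst p) (snd p)) = (LINT b|N'. LINT om|P. remainder (e n) (I n) om b * Y om b)"
      using PN.integral_snd[of "%om b. remainder (e n) (I n) om b * Y om b"] i by (simp add: R_def case_prod_beta')
    also have "... = J n"
      unfolding J_def
    proof (rule Bochner_Integration.integral_cong[OF refl])
      fix b assume b: "b \<in> space N'"
      note [measurable] = W_measurable[OF g[OF b]] Y_section[OF b] W_measurable[OF res_in[OF on g[OF b]]]
        remainder_measurable[OF on measurable_ident_sets[OF refl] measurable_const[OF b]]
      have "(LINT om|P. remainder (e n) (I n) om b * Y om b) = (LINT om|P. W (res (e n) (I n) (g b)) om * W (g b) om)"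
        by (rule integral_cong_AE) (use YW[OF b] remainder_W[OF on[of n] b] in auto)
      also have "... = rho (e n) (I n) (g b)"
        by (simp add: W_cov res_in[OF on] g b rho_res[OF on g[OF b]] ip_res_res[OF on])
      finally show "(LINT om|P. remainder (e n) (I n) om b * Y om b) = rho (e n) (I n) (g b)" .
    qed
    finally show ?thesis .
  qed
  have "\<forall>\<^sub>F n in sequentially. J n < \<epsilon>" using order_tendstoD(2)[OF null, of \<epsilon>] eps unfolding RY by simp
  then obtain n where "J n < \<epsilon>" by (auto simp: eventually_sequentially)
  then show ?thesis using ext unfolding J_def by blast
qed

end
end

section \<open>The semi-linear equation\<close>

text \<open>\<open>f\<close> grows at most linearly, so uniformly bounded second moments make the
  expected absolute kernel integral finite; hence it is finite almost surely.\<close>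

lemma (in volterra) integrable_kernel_process:
  assumes M: "prob_space M" and X: "(%(om, a). X om a) \<in> bm (M \<Otimes>\<^sub>M S)"
    and X2: "!!a. a \<in> space S ==> (NINT om|M. ennreal ((X om a)^2)) <= ennreal K"
    and a: "a \<in> space S"
  shows "AE om in M. integrable S (%b. \<kappa> a b * f (X om b))"
proof -
  interpret M: prob_space M by fact
  interpret MS: pair_sigma_finite M S ..
  have [measurable]: "(%p. X (fst p) (snd p)) \<in> bm (M \<Otimes>\<^sub>M S)" using X by (simp add: case_prod_beta')
  define c where "c = \<bar>f 0\<bar> + L"
  have c: "0 <= c" using L by (simp add: c_def)
  have fb: "\<bar>f x\<bar> <= c + c * x\<^sup>2" for x
  proof -
    have "\<bar>f x\<bar> <= \<bar>f 0\<bar> + L * \<bar>x\<bar>" using f_lip[of x 0] by simp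
    also have "L * \<bar>x\<bar> <= L * (1 + x\<^sup>2)"
      using abs_mult_le_weighted[of 1 x 1] L by (intro mult_left_mono) auto
    also have "\<bar>f 0\<bar> + L * (1 + x\<^sup>2) <= c + c * x\<^sup>2" by (simp add: c_def algebra_simps)
    finally show ?thesis by simp
  qed
  have "(NINT om|M. NINT b|S. ennreal (norm (\<kappa> a b * f (X om b)))) = (NINT b|S. NINT om|M. ennreal (norm (\<kappa> a b * f (X om b))))"
    using a by (intro MS.Fubini'[symmetric]) (simp add: case_prod_beta')
  also have "... <= (NINT b|S. ennreal (c + c * \<bar>K\<bar>) * ennreal (\<kappa> a b))"
  proof (rule nn_integral_mono)
    fix b assume b: "b \<in> space S"
    have [measurable]: "(%om. X om b) \<in> bm M" by (rule section_M[OF X b])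
    have "(NINT om|M. ennreal (norm (\<kappa> a b * f (X om b)))) <= (NINT om|M. ennreal (\<kappa> a b) * (ennreal c + ennreal c * ennreal ((X om b)^2)))"
    proof (rule nn_integral_mono)
      fix om
      have "norm (\<kappa> a b * f (X om b)) <= \<kappa> a b * (c + c * (X om b)^2)"
        using \<kappa>_nonneg fb by (simp add: abs_mult mult_left_mono)
      then have "ennreal (norm (\<kappa> a b * f (X om b))) <= ennreal (\<kappa> a b * (c + c * (X om b)^2))" by (rule ennreal_leI)
      also have "... = ennreal (\<kappa> a b) * (ennreal c + ennreal c * ennreal ((X om b)^2))"
        using \<kappa>_nonneg c by (simp add: ennreal_mult)
      finally show "ennreal (norm (\<kappa> a b * f (X om b))) <= ennreal (\<kappa> a b) * (ennreal c + ennreal c * ennreal ((X om b)^2))" .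
    qed
    also have "... = ennreal (\<kappa> a b) * (ennreal c + ennreal c * (NINT om|M. ennreal ((X om b)^2)))"
      by (simp add: nn_integral_cmult nn_integral_add M.emeasure_space_1)
    also have "... <= ennreal (\<kappa> a b) * (ennreal c + ennreal c * ennreal \<bar>K\<bar>)"
      by (intro mult_left_mono add_left_mono order_trans[OF X2[OF b]] ennreal_leI) auto
    also have "... = ennreal (c + c * \<bar>K\<bar>) * ennreal (\<kappa> a b)" using c by (simp add: ennreal_mult mult.commute)
    finally show "(NINT om|M. ennreal (norm (\<kappa> a b * f (X om b)))) <= ennreal (c + c * \<bar>K\<bar>) * ennreal (\<kappa> a b)" .
  qed
  also have "... = ennreal (c + c * \<bar>K\<bar>) * (NINT b|S. ennreal (\<kappa> a b))" using a by (intro nn_integral_cmult) measurable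
  also have "... <= ennreal (c + c * \<bar>K\<bar>) * ennreal (C0 * T)" by (intro mult_left_mono kernel_mass a) simp
  also have "... < \<infinity>" by (simp add: ennreal_mult_less_top)
  finally have "AE om in M. (NINT b|S. ennreal (norm (\<kappa> a b * f (X om b)))) \<noteq> \<infinity>"
    using a by (intro nn_integral_PInf_AE) (auto intro!: S.borel_measurable_nn_integral simp: case_prod_beta' less_top)
  then show ?thesis
    using AE_space
  proof eventually_elim
    case (elim om)
    have [measurable]: "X om \<in> bm S" by (rule section_S[OF X elim(2)])
    show ?case by (rule integrableI_bounded) (use elim a in \<open>auto simp: less_top\<close>)
  qed
qed

text \<open>\<open>x0\<close> is the deterministic contribution of the initial value, and
  \<open>g a\<close> is the integrand of the noise at \<open>a\<close> with the noise level
  included. The equation is imposed almost surely at each fixed \<open>a\<close>, as befits a random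
  field determined up to modification.\<close>

locale spde = volterra N T C0 L \<kappa> f S + gaussian_family P H W
  for N :: "'a measure" and T C0 L \<kappa> f S and P :: "'w measure" and H
    and W :: "(real => 'h::{real_inner,banach,second_countable_topology}) => 'w => real" +
  fixes g :: "real \<times> 'a => real => 'h" and x0 :: "real \<times> 'a => real" and X :: "'w => real \<times> 'a => real" and q b0 K :: real
  assumes g_in: "!!a. a \<in> space S ==> g a \<in> L2_time H" and g_q: "!!a. a \<in> space S ==> ip H (g a) (g a) <= q\<^sup>2" and q: "0 < q"
    and x0_measurable[measurable]: "x0 \<in> bm S" and x0_bound: "!!a. a \<in> space S ==> \<bar>x0 a\<bar> <= b0"
    and X_measurable: "(%(om, a). X om a) \<in> bm (P \<Otimes>\<^sub>M S)"
    and X_square: "!!a. a \<in> space S ==> (NINT om|P. ennreal ((X om a)^2)) <= ennreal K"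
    and b0: "0 <= b0" and K0: "0 <= K"
    and X_eq: "!!a. a \<in> space S ==> AE om in P. X om a = x0 a + V (%b. f (X om b)) a + W (g a) om"
begin

sublocale PS: pair_sigma_finite P S ..

lemma X_meas[measurable (raw)]: "u \<in> M \<rightarrow>\<^sub>M P ==> v \<in> M \<rightarrow>\<^sub>M S ==> (%x. X (u x) (v x)) \<in> bm M"
  using measurable_compose[OF measurable_Pair X_measurable, of u M v] by simp

lemma X_section: "a \<in> space S ==> (%om. X om a) \<in> bm P"
  by measurable

lemma X_integrable: "a \<in> space S ==> AE om in P. integrable S (%b. \<kappa> a b * f (X om b))"
  by (rule integrable_kernel_process[OF prob_space_axioms X_measurable X_square])

text \<open>The noise recovered from the equation. It is a version of \<open>W (g a)\<close> that is
  jointly measurable in \<open>om\<close> and \<open>a\<close>, which the family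
  \<open>W (g a)\<close> itself need not be.\<close>

definition Y :: "'w => real \<times> 'a => real" where
  "Y om a = X om a - x0 a - V (%b. f (X om b)) a"

lemma Y_measurable: "(%(om, a). Y om a) \<in> bm (P \<Otimes>\<^sub>M S)"
proof -
  have "(%(om, a). V (%b. f (X om b)) a) \<in> bm (P \<Otimes>\<^sub>M S)"
    by (rule V_measurable) (simp add: case_prod_beta')
  then have "(%p. X (fst p) (snd p) - x0 (snd p) - V (%b. f (X (fst p) b)) (snd p)) \<in> bm (P \<Otimes>\<^sub>M S)"
    by (simp add: case_prod_beta')
  then show ?thesis by (simp add: Y_def case_prod_beta')
qed

lemma Y_W:
  assumes a: "a \<in> space S"
  shows "AE om in P. Y om a = W (g a) om"
  using X_eq[OF a] by eventually_elim (simp add: Y_def)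

lemma finite_S: "finite_measure S" by unfold_locales

lemma q2: "0 <= q\<^sup>2" by simp

lemma ip_g_measurable: "h \<in> DD ==> (%a. ip H (g a) h) \<in> bm S"
  by (rule ip_measurable[OF finite_S g_in g_q q2 Y_measurable Y_W])

lemma rho_g_measurable: "onb I e ==> (%a. rho e I (g a)) \<in> bm S"
  by (rule rho_measurable[OF finite_S g_in g_q q2 Y_measurable Y_W])

lemma rho_g_bounds: "onb I e ==> a \<in> space S ==> 0 <= rho e I (g a) \<and> rho e I (g a) <= q\<^sup>2"
  by (rule rho_bounds[OF finite_S g_in g_q q2 Y_measurable Y_W])

lemma remainder_g_sq:
  "onb I e ==> a \<in> space S ==>
    (NINT om|P. ennreal ((Y om a - (\<Sum>i\<in>I. ip H (g a) (e i) * W (e i) om))^2)) = ennreal (rho e I (g a))"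
  using remainder_sq[OF finite_S g_in g_q q2 Y_measurable Y_W, of I e a]
  by (simp add: remainder_def[OF finite_S g_in g_q q2 Y_measurable Y_W])

lemma remainder_g_measurable:
  assumes e: "onb I e"
  shows "(%p. Y (fst p) (snd p) - (\<Sum>i\<in>I. ip H (g (snd p)) (e i) * W (e i) (fst p))) \<in> bm (P \<Otimes>\<^sub>M S)"
proof -
  have "(%p. Y (fst p) (snd p)) \<in> bm (P \<Otimes>\<^sub>M S)"
    using Y_measurable by (simp add: case_prod_beta')
  then show ?thesis
    by (intro borel_measurable_diff borel_measurable_sum borel_measurable_times
        measurable_compose[OF measurable_snd ip_g_measurable] measurable_compose[OF measurable_fst W_measurable] onbD(2)[OF e])
qed

text \<open>Input of the Volterra equation when the Gaussian coordinates take the values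
  \<open>x\<close>. Solving with this input makes the truncated field a deterministic function of
  the coordinate vector.\<close>

definition zx :: "(nat => real => 'h) => nat set => (nat => real) => real \<times> 'a => real" where
  "zx e I x a = x0 a + (\<Sum>i\<in>I. ip H (g a) (e i) * x i)"

definition Xn :: "(nat => real => 'h) => nat set => 'w => real \<times> 'a => real" where
  "Xn e I om = sol (zx e I (%i. W (e i) om))"

lemma zx_measurable:
  assumes e: "onb I e" and v: "!!i. i \<in> I ==> (%om. v om i) \<in> bm M"
  shows "(%(om, a). zx e I (v om) a) \<in> bm (M \<Otimes>\<^sub>M S)"
proof -
  have "(%p. x0 (snd p) + (\<Sum>i\<in>I. ip H (g (snd p)) (e i) * v (fst p) i)) \<in> bm (M \<Otimes>\<^sub>M S)"
    by (intro borel_measurable_add borel_measurable_sum borel_measurable_times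
        measurable_compose[OF measurable_snd ip_g_measurable] measurable_compose[OF measurable_fst v]
        measurable_compose[OF measurable_snd x0_measurable] onbD(2)[OF e]; assumption)
  then show ?thesis by (simp add: zx_def case_prod_beta')
qed

lemma zx_measurable1:
  assumes e: "onb I e"
  shows "zx e I x \<in> bm S"
  unfolding zx_def[abs_def]
  by (intro borel_measurable_add borel_measurable_sum borel_measurable_times x0_measurable
      borel_measurable_const ip_g_measurable onbD(2)[OF e])

lemma ip_g_e_bound:
  assumes e: "onb I e" and a: "a \<in> space S" and i: "i \<in> I"
  shows "\<bar>ip H (g a) (e i)\<bar> <= q"
proof -
  have "(ip H (g a) (e i))^2 <= ip H (g a) (g a) * ip H (e i) (e i)"
    by (intro ip_Cauchy_Schwarz g_in a onbD(2)[OF e i])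
  also have "... <= q\<^sup>2" using g_q[OF a] onbD(3)[OF e i i] by simp
  finally have "(ip H (g a) (e i))^2 <= q\<^sup>2" .
  then show ?thesis using q by (simp add: abs_le_square_iff[symmetric])
qed

lemma zx_bound:
  assumes e: "onb I e" and a: "a \<in> space S"
  shows "\<bar>zx e I x a\<bar> <= b0 + q * (\<Sum>i\<in>I. \<bar>x i\<bar>)"
proof -
  have "\<bar>\<Sum>i\<in>I. ip H (g a) (e i) * x i\<bar> <= (\<Sum>i\<in>I. \<bar>ip H (g a) (e i) * x i\<bar>)" by (rule sum_abs)
  also have "... <= (\<Sum>i\<in>I. q * \<bar>x i\<bar>)"
    unfolding abs_mult by (intro sum_mono mult_right_mono ip_g_e_bound[OF e a] abs_ge_zero)
  finally show ?thesis using x0_bound[OF a] by (simp add: zx_def sum_distrib_left)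
qed

lemma zx_bound0: "0 <= b0 + q * (\<Sum>i\<in>I. \<bar>x i\<bar>)"
  using b0 q by (intro add_nonneg_nonneg mult_nonneg_nonneg sum_nonneg) auto

lemma Xn_measurable:
  assumes e: "onb I e"
  shows "(%(om, a). Xn e I om a) \<in> bm (P \<Otimes>\<^sub>M S)"
  unfolding Xn_def by (rule sol_measurable[OF zx_measurable[OF e W_measurable[OF onbD(2)[OF e]]]])

text \<open>First moment bound for the truncated field. It involves neither the family nor the
  second moment bound \<open>K\<close>.\<close>

definition m1 :: real where "m1 = 2 * (b0 + q + \<bar>f 0\<bar> * (C0 * T)) * E T"

lemma m1: "0 <= m1" using b0 q C0 T by (auto simp: m1_def intro!: mult_nonneg_nonneg add_nonneg_nonneg)

lemma noise_second_moment:
  assumes e: "onb I e" and a: "a \<in> space S"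
  shows "integrable P (%om. (\<Sum>i\<in>I. ip H (g a) (e i) * W (e i) om)^2)"
    "(LINT om|P. (\<Sum>i\<in>I. ip H (g a) (e i) * W (e i) om)^2) <= q\<^sup>2"
proof -
  let ?h = "%s. \<Sum>i\<in>I. ip H (g a) (e i) *\<^sub>R e i s"
  have h: "?h \<in> DD" by (rule sum_in[OF e])
  note [measurable] = W_measurable[OF h] W_measurable[OF onbD(2)[OF e]]
  have ae: "AE om in P. W ?h om = (\<Sum>i\<in>I. ip H (g a) (e i) * W (e i) om)"
    by (rule W_sum) (use onbD[OF e] in auto)
  have ae2: "AE om in P. (\<Sum>i\<in>I. ip H (g a) (e i) * W (e i) om)^2 = (W ?h om)^2" using ae by eventually_elim simp
  have m: "(%om. (\<Sum>i\<in>I. ip H (g a) (e i) * W (e i) om)^2) \<in> bm P"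
    by (intro borel_measurable_power borel_measurable_sum borel_measurable_times borel_measurable_const W_measurable onbD(2)[OF e])
  show "integrable P (%om. (\<Sum>i\<in>I. ip H (g a) (e i) * W (e i) om)^2)"
    by (subst integrable_cong_AE[OF m _ ae2]) (auto intro: W_square_integrable h)
  have "(LINT om|P. (\<Sum>i\<in>I. ip H (g a) (e i) * W (e i) om)^2) = (LINT om|P. (W ?h om)^2)"
    by (rule integral_cong_AE[OF m _ ae2]) simp
  also have "... = ip H ?h ?h" using W_cov[OF h h] by (simp add: power2_eq_square)
  also have "... = (\<Sum>i\<in>I. ip H (g a) (e i) * ip H (e i) ?h)" by (rule ip_sum(1)[OF onbD(1)[OF e] onbD(2)[OF e] h])
  also have "... = (\<Sum>i\<in>I. (ip H (g a) (e i))^2)"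
  proof (rule sum.cong[OF refl])
    fix i assume i: "i \<in> I"
    have "ip H (e i) ?h = (\<Sum>j\<in>I. ip H (g a) (e j) * ip H (e i) (e j))"
      by (rule ip_sum(2)[OF onbD(1)[OF e] onbD(2)[OF e] onbD(2)[OF e i]])
    also have "... = ip H (g a) (e i)"
      using i onbD(1)[OF e] by (simp add: onbD(3)[OF e] if_distrib[of "%z. _ * z"] cong: if_cong)
    finally show "ip H (g a) (e i) * ip H (e i) ?h = (ip H (g a) (e i))^2" by (simp add: power2_eq_square)
  qed
  also have "... <= q\<^sup>2" using rho_g_bounds[OF e a] g_q[OF a] by (simp add: rho_def)
  finally show "(LINT om|P. (\<Sum>i\<in>I. ip H (g a) (e i) * W (e i) om)^2) <= q\<^sup>2" .
qed

lemma zx_expectation: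
  assumes e: "onb I e" and a: "a \<in> space S"
  shows "(NINT om|P. ennreal \<bar>zx e I (%i. W (e i) om) a\<bar>) <= ennreal (b0 + q)"
proof -
  note n2 = noise_second_moment[OF e a]
  have "(NINT om|P. ennreal \<bar>zx e I (%i. W (e i) om) a\<bar>) <= (NINT om|P. ennreal (b0 + (q + (\<Sum>i\<in>I. ip H (g a) (e i) * W (e i) om)\<^sup>2 / q) / 2))"
  proof (intro nn_integral_mono ennreal_leI)
    fix om
    define u where "u = (\<Sum>i\<in>I. ip H (g a) (e i) * W (e i) om)"
    have "2 * q * \<bar>u\<bar> <= q\<^sup>2 + u\<^sup>2" using sum_squares_bound[of q "\<bar>u\<bar>"] by simp
    then have "\<bar>u\<bar> <= (q + u\<^sup>2 / q) / 2" using q by (simp add: field_simps power2_eq_square)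
    then show "\<bar>zx e I (%i. W (e i) om) a\<bar> <= b0 + (q + (\<Sum>i\<in>I. ip H (g a) (e i) * W (e i) om)\<^sup>2 / q) / 2"
      using x0_bound[OF a] unfolding zx_def u_def[symmetric] by linarith
  qed
  also have "... = ennreal (LINT om|P. b0 + (q + (\<Sum>i\<in>I. ip H (g a) (e i) * W (e i) om)\<^sup>2 / q) / 2)"
    using n2(1) q b0 by (intro nn_integral_eq_integral) auto
  also have "(LINT om|P. b0 + (q + (\<Sum>i\<in>I. ip H (g a) (e i) * W (e i) om)\<^sup>2 / q) / 2) = b0 + (q + (LINT om|P. (\<Sum>i\<in>I. ip H (g a) (e i) * W (e i) om)^2) / q) / 2"
    using n2(1) by (simp add: prob_space)
  also have "ennreal ... <= ennreal (b0 + q)"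
    using n2(2) q by (intro ennreal_leI) (simp add: field_simps power2_eq_square)
  finally show ?thesis .
qed

lemma W_abs_sum_finite:
  assumes e: "onb I e"
  shows "(NINT om|P. ennreal (b0 + q * (\<Sum>i\<in>I. \<bar>W (e i) om\<bar>))) < \<infinity>"
    and "integrable P (%om. (b0 + q * (\<Sum>i\<in>I. \<bar>W (e i) om\<bar>) + c)^2)"
proof -
  note eD = onbD(2)[OF e]
  have fI: "finite I" by (rule onbD(1)[OF e])
  have [measurable]: "(%om. b0 + q * (\<Sum>i\<in>I. \<bar>W (e i) om\<bar>)) \<in> bm P"
    by (intro borel_measurable_add borel_measurable_times borel_measurable_const borel_measurable_sum borel_measurable_abs W_measurable eD)
  have i2: "integrable P (%om. (b0 + q * (\<Sum>i\<in>I. \<bar>W (e i) om\<bar>) + c)^2)" for c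
  proof (rule Bochner_Integration.integrable_bound)
    show "integrable P (%om. 2 * (b0 + c)^2 + 2 * q\<^sup>2 * (real (card I) * (\<Sum>i\<in>I. (W (e i) om)^2)))"
      by (intro Bochner_Integration.integrable_add integrable_const integrable_mult_right Bochner_Integration.integrable_sum W_square_integrable eD)
    show "AE om in P. norm ((b0 + q * (\<Sum>i\<in>I. \<bar>W (e i) om\<bar>) + c)^2) <= norm (2 * (b0 + c)^2 + 2 * q\<^sup>2 * (real (card I) * (\<Sum>i\<in>I. (W (e i) om)^2)))"
    proof (rule AE_I2)
      fix om
      define u where "u = (\<Sum>i\<in>I. \<bar>W (e i) om\<bar>)"
      have "u\<^sup>2 <= real (card I) * (\<Sum>i\<in>I. \<bar>W (e i) om\<bar>\<^sup>2)"
        unfolding u_def using sum_squared_le_sum_of_squares[of "%i. \<bar>W (e i) om\<bar>" I] by (simp add: mult.commute)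
      then have "q\<^sup>2 * u\<^sup>2 <= q\<^sup>2 * (real (card I) * (\<Sum>i\<in>I. (W (e i) om)^2))" by (intro mult_left_mono) auto
      moreover have "((b0 + c) + q * u)^2 <= 2 * (b0 + c)^2 + 2 * (q\<^sup>2 * u\<^sup>2)"
        using sum_squares_bound[of "b0 + c" "q * u"] by (simp add: power2_sum power_mult_distrib)
      ultimately have "((b0 + c) + q * u)^2 <= 2 * (b0 + c)^2 + 2 * q\<^sup>2 * (real (card I) * (\<Sum>i\<in>I. (W (e i) om)^2))" by simp
      moreover have eq: "b0 + q * u + c = (b0 + c) + q * u" by simp
      ultimately show "norm ((b0 + q * (\<Sum>i\<in>I. \<bar>W (e i) om\<bar>) + c)^2) <= norm (2 * (b0 + c)^2 + 2 * q\<^sup>2 * (real (card I) * (\<Sum>i\<in>I. (W (e i) om)^2)))"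
        unfolding u_def[symmetric] eq real_norm_def abs_power2 by linarith
    qed
  qed simp
  then show "integrable P (%om. (b0 + q * (\<Sum>i\<in>I. \<bar>W (e i) om\<bar>) + c)^2)" .
  have "integrable P (%om. (b0 + q * (\<Sum>i\<in>I. \<bar>W (e i) om\<bar>)) * 1)"
    by (rule integrable_mult_square) (use i2[of 0] in auto)
  then have i1: "integrable P (%om. b0 + q * (\<Sum>i\<in>I. \<bar>W (e i) om\<bar>))" by simp
  show "(NINT om|P. ennreal (b0 + q * (\<Sum>i\<in>I. \<bar>W (e i) om\<bar>))) < \<infinity>"
  proof (subst nn_integral_eq_integral[OF i1])
    show "AE om in P. 0 <= b0 + q * (\<Sum>i\<in>I. \<bar>W (e i) om\<bar>)"
      by (rule AE_I2) (rule zx_bound0)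
  qed simp
qed

lemma Xn_expectation:
  assumes e: "onb I e" and a: "a \<in> space S"
  shows "(NINT om|P. ennreal \<bar>Xn e I om a\<bar>) <= ennreal m1"
proof -
  note eD = onbD(2)[OF e]
  have "(NINT om|P. ennreal \<bar>Xn e I om a\<bar>) <= ennreal (2 * ((b0 + q) + \<bar>f 0\<bar> * (C0 * T)) * E (fst a))"
    unfolding Xn_def
  proof (rule sol_expectation[OF prob_space_axioms zx_measurable[OF e W_measurable[OF eD]], where \<beta>="%om. b0 + q * (\<Sum>i\<in>I. \<bar>W (e i) om\<bar>)"])
    show "(%om. b0 + q * (\<Sum>i\<in>I. \<bar>W (e i) om\<bar>)) \<in> bm P"
      by (intro borel_measurable_add borel_measurable_times borel_measurable_const borel_measurable_sum borel_measurable_abs W_measurable eD)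
  qed (use zx_bound[OF e] zx_bound0 W_abs_sum_finite(1)[OF e] zx_expectation[OF e] b0 q a in auto)
  also have "... <= ennreal m1"
    unfolding m1_def using b0 q C0 T a by (intro ennreal_leI mult_left_mono E_mono) (auto simp: space_S)
  finally show ?thesis .
qed

text \<open>This bound depends on the family; its finiteness is all that the stability estimate asks
  for.\<close>

lemma Xn_square_bounded:
  assumes e: "onb I e"
  shows "\<exists>B. \<forall>a\<in>space S. (NINT om|P. (ennreal \<bar>X om a - Xn e I om a\<bar>)^2) <= ennreal B"
proof -
  define c where "c = \<bar>f 0\<bar> * (C0 * T)"
  define b where "b om = (b0 + q * (\<Sum>i\<in>I. \<bar>W (e i) om\<bar>) + c)^2" for om
  have bi: "integrable P b" unfolding b_def[abs_def] by (rule W_abs_sum_finite(2)[OF e])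
  have b0': "0 <= b om" for om by (simp add: b_def)
  have [measurable]: "b \<in> bm P" using bi by simp
  have "(NINT om|P. (ennreal \<bar>X om a - Xn e I om a\<bar>)^2) <= ennreal (2 * K + 8 * (E T)^2 * (LINT om|P. b om))" if a: "a \<in> space S" for a
  proof -
    note [measurable] = X_section[OF a]
    have "(NINT om|P. (ennreal \<bar>X om a - Xn e I om a\<bar>)^2) <= (NINT om|P. 2 * ennreal ((X om a)^2) + ennreal (8 * (E T)^2 * b om))"
    proof (rule nn_integral_mono)
      fix om
      define u where "u = b0 + q * (\<Sum>i\<in>I. \<bar>W (e i) om\<bar>) + c"
      have "\<bar>Xn e I om a\<bar> <= 2 * u * E T"
        unfolding Xn_def c_def u_def by (rule sol_bound'[OF zx_measurable1[OF e] zx_bound[OF e] zx_bound0 a])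
      then have "\<bar>Xn e I om a\<bar>\<^sup>2 <= (2 * u * E T)^2" by (rule power_mono) simp
      then have "(Xn e I om a)^2 <= 4 * (E T)^2 * b om" by (simp add: power_mult_distrib b_def u_def[symmetric] mult.commute mult.left_commute)
      moreover have "(X om a - Xn e I om a)^2 <= 2 * (X om a)^2 + 2 * (Xn e I om a)^2"
        using sum_squares_bound[of "X om a" "- Xn e I om a"] by (simp add: power2_diff)
      ultimately have "(X om a - Xn e I om a)^2 <= 2 * (X om a)^2 + 8 * (E T)^2 * b om" by simp
      then have "ennreal ((X om a - Xn e I om a)^2) <= ennreal (2 * (X om a)^2 + 8 * (E T)^2 * b om)" by (rule ennreal_leI)
      also have "... = ennreal (2 * (X om a)^2) + ennreal (8 * (E T)^2 * b om)" using b0' by (intro ennreal_plus) auto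
      also have "ennreal (2 * (X om a)^2) = 2 * ennreal ((X om a)^2)" by (simp add: ennreal_mult')
      finally show "(ennreal \<bar>X om a - Xn e I om a\<bar>)^2 <= 2 * ennreal ((X om a)^2) + ennreal (8 * (E T)^2 * b om)"
        by (simp add: ennreal_power)
    qed
    also have "... = 2 * (NINT om|P. ennreal ((X om a)^2)) + (NINT om|P. ennreal (8 * (E T)^2 * b om))"
      by (simp add: nn_integral_add nn_integral_cmult)
    also have "(NINT om|P. ennreal (8 * (E T)^2 * b om)) = ennreal (8 * (E T)^2 * (LINT om|P. b om))"
      using bi b0' by (subst nn_integral_eq_integral) auto
    also have "2 * (NINT om|P. ennreal ((X om a)^2)) + ... <= 2 * ennreal K + ennreal (8 * (E T)^2 * (LINT om|P. b om))"
      by (intro add_right_mono mult_left_mono X_square a) simp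
    also have "... = ennreal (2 * K + 8 * (E T)^2 * (LINT om|P. b om))"
      using K0 b0' by (simp add: ennreal_plus ennreal_mult')
    finally show ?thesis .
  qed
  then show ?thesis by blast
qed

text \<open>The field and its truncation solve the same Volterra equation with inputs that differ by
  the unexplained part of the noise.\<close>

lemma difference_le:
  assumes e: "onb I e" and a: "a \<in> space S"
  shows "AE om in P. ennreal \<bar>X om a - Xn e I om a\<bar> <= ennreal \<bar>Y om a - (\<Sum>i\<in>I. ip H (g a) (e i) * W (e i) om)\<bar> +
    (NINT b|S. ennreal (\<kappa> a b) * (ennreal L * ennreal \<bar>X om b - Xn e I om b\<bar>))"
  using X_integrable[OF a]
proof eventually_elim
  case (elim om)
  define r where "r = Y om a - (\<Sum>i\<in>I. ip H (g a) (e i) * W (e i) om)"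
  note zs = zx_measurable1[OF e] zx_bound[OF e] zx_bound0
  have "Xn e I om a = zx e I (%i. W (e i) om) a + V (%b. f (Xn e I om b)) a"
    unfolding Xn_def by (rule sol_eq[OF zs a])
  then have "X om a - Xn e I om a = r + (V (%b. f (X om b)) a - V (%b. f (Xn e I om b)) a)"
    by (simp add: r_def Y_def zx_def)
  then have "\<bar>X om a - Xn e I om a\<bar> <= \<bar>r\<bar> + \<bar>V (%b. f (X om b)) a - V (%b. f (Xn e I om b)) a\<bar>" by linarith
  then have "ennreal \<bar>X om a - Xn e I om a\<bar> <= ennreal \<bar>r\<bar> + ennreal \<bar>V (%b. f (X om b)) a - V (%b. f (Xn e I om b)) a\<bar>"
    by (simp add: ennreal_leI flip: ennreal_plus)
  also have "... <= ennreal \<bar>r\<bar> + (NINT b|S. ennreal (\<kappa> a b) * (ennreal L * ennreal \<bar>X om b - Xn e I om b\<bar>))"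
    by (intro add_left_mono V_diff elim) (simp add: Xn_def integrable_sol[OF zs a])
  finally show ?case unfolding r_def .
qed

text \<open>The constant of the total bound in \<open>L2_stability\<close>.\<close>

definition gap :: real where "gap = 4 * exp ((2 * KK + 1) * T)"

lemma approximation_error:
  assumes e: "onb I e"
  shows "(NINT a|S. NINT om|P. (ennreal \<bar>X om a - Xn e I om a\<bar>)^2) <= ennreal gap * (NINT a|S. ennreal (rho e I (g a)))"
    and "s \<in> {0..T} ==> (NINT y|N. NINT om|P. (ennreal \<bar>X om (s, y) - Xn e I om (s, y)\<bar>)^2) <=
      2 * (NINT y|N. ennreal (rho e I (g (s, y)))) + ennreal (KK * gap) * (NINT a|S. ennreal (rho e I (g a)))"
proof -
  obtain B where B: "!!a. a \<in> space S ==> (NINT om|P. (ennreal \<bar>X om a - Xn e I om a\<bar>)^2) <= ennreal B"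
    using Xn_square_bounded[OF e] by blast
  let ?R = "%om a. Y om a - (\<Sum>i\<in>I. ip H (g a) (e i) * W (e i) om)"
  have m1: "(%(om, a). ennreal \<bar>X om a - Xn e I om a\<bar>) \<in> bm (P \<Otimes>\<^sub>M S)"
    using X_measurable Xn_measurable[OF e] by (simp add: case_prod_beta')
  have m2: "(%(om, a). ennreal \<bar>?R om a\<bar>) \<in> bm (P \<Otimes>\<^sub>M S)"
    using remainder_g_measurable[OF e] by (simp add: case_prod_beta')
  have sq: "(NINT om|P. (ennreal \<bar>?R om a\<bar>)^2) = ennreal (rho e I (g a))" if "a \<in> space S" for a
    using remainder_g_sq[OF e that] by (simp add: ennreal_power)
  have sf: "sigma_finite_measure P" by unfold_locales
  note L2 = L2_stability[OF sf m1 m2 difference_le[OF e] B]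
  have t: "(NINT a|S. NINT om|P. (ennreal \<bar>?R om a\<bar>)^2) = (NINT a|S. ennreal (rho e I (g a)))"
    by (intro nn_integral_cong sq)
  show "(NINT a|S. NINT om|P. (ennreal \<bar>X om a - Xn e I om a\<bar>)^2) <= ennreal gap * (NINT a|S. ennreal (rho e I (g a)))"
    using L2(1) unfolding t gap_def by simp
  assume s: "s \<in> {0..T}"
  have "(NINT y|N. NINT om|P. (ennreal \<bar>?R om (s, y)\<bar>)^2) = (NINT y|N. ennreal (rho e I (g (s, y))))"
    using s by (intro nn_integral_cong sq) (simp add: space_S)
  then show "(NINT y|N. NINT om|P. (ennreal \<bar>X om (s, y) - Xn e I om (s, y)\<bar>)^2) <=
      2 * (NINT y|N. ennreal (rho e I (g (s, y)))) + ennreal (KK * gap) * (NINT a|S. ennreal (rho e I (g a)))"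
    using L2(2)[of s] s unfolding t gap_def by simp
qed

end

section \<open>Bounds on the law of the field\<close>

lemma le_from_linear_slack:
  fixes p u v t0 :: real
  assumes "0 < t0" "0 < v" "!!t. 0 < t ==> t < t0 ==> p <= u + v * t"
  shows "p <= u"
proof (rule field_le_epsilon)
  fix e :: real assume e: "0 < e"
  define t where "t = min (t0 / 2) (e / v)"
  have t: "0 < t" "t < t0" "v * t <= e"
    using assms(1,2) e by (auto simp: t_def min_def field_simps)
  then show "p <= u + e" using assms(3)[OF t(1,2)] by linarith
qed

section \<open>Approximation of the solution at a single point\<close>

context spde
begin

lemma law_transfer:
  assumes e: "onb I e" and h: "h \<in> bm (Pi\<^sub>M I (%_. borel))"
  shows "(NINT om|P. h (\<lambda>i\<in>I. W (e i) om)) = (NINT x|(Pi\<^sub>M I (%_. std_normal_distribution)). h x)"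
proof -
  have m: "(%om. \<lambda>i\<in>I. W (e i) om) \<in> P \<rightarrow>\<^sub>M Pi\<^sub>M I (%_. borel)"
    by (intro measurable_restrict W_measurable onbD(2)[OF e])
  show ?thesis unfolding W_joint_law[OF e, symmetric] by (rule nn_integral_distr[OF m, symmetric]) (simp add: h)
qed

lemma zx_restrict: "zx e I (\<lambda>i\<in>I. x i) = zx e I x"
  by (auto simp: zx_def fun_eq_iff intro!: sum.cong)

lemma sol_zx_measurable:
  assumes e: "onb I e" and a: "a \<in> space S"
  shows "(%x. sol (zx e I x) a) \<in> bm (Pi\<^sub>M I (%_. borel))"
  by (rule section_M[OF sol_measurable[OF zx_measurable[OF e]] a]) (rule measurable_component_singleton)

lemma zx_upd:
  assumes e: "onb I e" and 0: "0 \<in> I"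
  shows "zx e I (x(0 := r)) b = zx e (I - {0}) x b + ip H (g b) (e 0) * r"
proof -
  have "(\<Sum>i\<in>I. ip H (g b) (e i) * (x(0 := r)) i) = ip H (g b) (e 0) * r + (\<Sum>i\<in>I - {0}. ip H (g b) (e i) * (x(0 := r)) i)"
    using 0 by (subst sum.remove[OF onbD(1)[OF e]]) auto
  also have "(\<Sum>i\<in>I - {0}. ip H (g b) (e i) * (x(0 := r)) i) = (\<Sum>i\<in>I - {0}. ip H (g b) (e i) * x i)"
    by (intro sum.cong) auto
  finally show ?thesis by (simp add: zx_def)
qed

lemma X_abs: "a \<in> space S ==> (NINT om|P. ennreal \<bar>X om a\<bar>) <= ennreal (1 + K)"
proof -
  assume a: "a \<in> space S"
  note [measurable] = X_section[OF a]
  have "(NINT om|P. ennreal \<bar>X om a\<bar>) <= (NINT om|P. 1 + ennreal ((X om a)^2))"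
  proof (rule nn_integral_mono)
    fix om
    have "\<bar>X om a\<bar> <= 1 + (X om a)^2" using abs_mult_le_weighted[of 1 "X om a" 1] by simp
    then have "ennreal \<bar>X om a\<bar> <= ennreal (1 + (X om a)^2)" by (rule ennreal_leI)
    then show "ennreal \<bar>X om a\<bar> <= 1 + ennreal ((X om a)^2)" by (simp add: ennreal_plus)
  qed
  also have "... = 1 + (NINT om|P. ennreal ((X om a)^2))" by (simp add: nn_integral_add emeasure_space_1)
  also have "... <= 1 + ennreal K" by (intro add_left_mono X_square a)
  finally show ?thesis using K0 by (simp add: ennreal_plus)
qed

text \<open>Contains \<open>K\<close> and so need not be uniform in the diffusivity; it serves the
  limit at a single point, where a finite value is enough.\<close>

definition m2 :: real where "m2 = 1 + K + m1"

lemma m2: "0 <= m2" using K0 m1 by (simp add: m2_def)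

lemma difference_abs:
  assumes e: "onb I e" and b: "b \<in> space S"
  shows "(NINT om|P. ennreal \<bar>X om b - Xn e I om b\<bar>) <= ennreal m2"
proof -
  note [measurable] = X_section[OF b] section_M[OF Xn_measurable[OF e] b]
  have "(NINT om|P. ennreal \<bar>X om b - Xn e I om b\<bar>) <= (NINT om|P. ennreal \<bar>X om b\<bar> + ennreal \<bar>Xn e I om b\<bar>)"
    by (intro nn_integral_mono) (simp add: ennreal_leI flip: ennreal_plus)
  also have "... = (NINT om|P. ennreal \<bar>X om b\<bar>) + (NINT om|P. ennreal \<bar>Xn e I om b\<bar>)"
    by (rule nn_integral_add) auto
  also have "... <= ennreal (1 + K) + ennreal m1" by (intro add_mono X_abs Xn_expectation e b)
  finally show ?thesis using K0 m1 by (simp add: m2_def ennreal_plus)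
qed

lemma rho_nn_integral:
  assumes e: "onb I e"
  shows "(NINT a|S. ennreal (rho e I (g a))) = ennreal (LINT a|S. rho e I (g a))"
proof (rule nn_integral_eq_integral)
  show "integrable S (%a. rho e I (g a))"
    by (rule S.integrable_const_bound[where B="q\<^sup>2"]) (use rho_g_bounds[OF e] rho_g_measurable[OF e] in auto)
qed (use rho_g_bounds[OF e] in auto)

lemma difference_total_le:
  assumes e: "onb I e" and d: "0 < d"
  shows "(NINT b|S. NINT om|P. ennreal \<bar>X om b - Xn e I om b\<bar>) <= ennreal (d * measure S (space S) + gap * (LINT a|S. rho e I (g a)) / d)"
proof -
  have "(NINT b|S. NINT om|P. ennreal \<bar>X om b - Xn e I om b\<bar>) <= (NINT b|S. ennreal d + ennreal (1 / d) * (NINT om|P. (ennreal \<bar>X om b - Xn e I om b\<bar>)^2))"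
  proof (rule nn_integral_mono)
    fix b assume b: "b \<in> space S"
    note [measurable] = X_section[OF b] section_M[OF Xn_measurable[OF e] b]
    have "(NINT om|P. ennreal \<bar>X om b - Xn e I om b\<bar>) <= (NINT om|P. ennreal d + ennreal (1 / d) * (ennreal \<bar>X om b - Xn e I om b\<bar>)^2)"
    proof (rule nn_integral_mono)
      fix om
      have "\<bar>X om b - Xn e I om b\<bar> <= d + (1 / d) * \<bar>X om b - Xn e I om b\<bar>\<^sup>2"
        using abs_mult_le_weighted[OF d, of 1 "X om b - Xn e I om b"] by simp
      then have "ennreal \<bar>X om b - Xn e I om b\<bar> <= ennreal (d + (1 / d) * \<bar>X om b - Xn e I om b\<bar>\<^sup>2)" by (rule ennreal_leI)
      also have "... = ennreal d + ennreal (1 / d) * ennreal (\<bar>X om b - Xn e I om b\<bar>\<^sup>2)"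
        using d by (subst ennreal_plus) (auto simp: ennreal_mult'[symmetric])
      finally show "ennreal \<bar>X om b - Xn e I om b\<bar> <= ennreal d + ennreal (1 / d) * (ennreal \<bar>X om b - Xn e I om b\<bar>)^2"
        by (simp add: ennreal_power)
    qed
    also have "... = ennreal d + ennreal (1 / d) * (NINT om|P. (ennreal \<bar>X om b - Xn e I om b\<bar>)^2)"
      by (simp add: nn_integral_add nn_integral_cmult emeasure_space_1)
    finally show "(NINT om|P. ennreal \<bar>X om b - Xn e I om b\<bar>) <= ennreal d + ennreal (1 / d) * (NINT om|P. (ennreal \<bar>X om b - Xn e I om b\<bar>)^2)" .
  qed
  also have "... = ennreal d * emeasure S (space S) + ennreal (1 / d) * (NINT b|S. NINT om|P. (ennreal \<bar>X om b - Xn e I om b\<bar>)^2)"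
  proof -
    have "(%p. (ennreal \<bar>X (snd p) (fst p) - Xn e I (snd p) (fst p)\<bar>)^2) \<in> bm (S \<Otimes>\<^sub>M P)"
      using measurable_compose[OF measurable_pair_swap' Xn_measurable[OF e]] measurable_compose[OF measurable_pair_swap' X_measurable] by (simp add: case_prod_beta')
    then have "(%b. NINT om|P. (ennreal \<bar>X om b - Xn e I om b\<bar>)^2) \<in> bm S"
      by (intro borel_measurable_nn_integral) (simp add: case_prod_beta')
    then show ?thesis by (simp add: nn_integral_add nn_integral_cmult)
  qed
  also have "... <= ennreal d * emeasure S (space S) + ennreal (1 / d) * (ennreal gap * ennreal (LINT a|S. rho e I (g a)))"
    using approximation_error(1)[OF e] unfolding rho_nn_integral[OF e] by (intro add_left_mono mult_left_mono) auto
  also have "... = ennreal (d * measure S (space S) + gap * (LINT a|S. rho e I (g a)) / d)"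
  proof -
    have g: "0 <= gap" by (simp add: gap_def)
    have "0 <= (LINT a|S. rho e I (g a))" using rho_g_bounds[OF e] by (intro integral_nonneg_AE) auto
    then show ?thesis using d g
      by (simp add: S.emeasure_eq_measure ennreal_plus ennreal_mult'[symmetric] mult_ac del: ennreal_plus flip: ennreal_plus)
  qed
  finally show ?thesis .
qed

lemma kernel_tail:
  assumes a: "a \<in> space S" and eps: "0 < \<epsilon>"
  shows "\<exists>k::nat. (NINT b|S. ennreal (\<kappa> a b - real k)) < ennreal \<epsilon>"
proof -
  have "(%k. NINT b|S. ennreal (\<kappa> a b - real k)) \<longlonglongrightarrow> (NINT b|S. 0)"
  proof (rule nn_integral_dominated_convergence[where w="%b. ennreal (\<kappa> a b)"])
    show "(NINT b|S. ennreal (\<kappa> a b)) < \<infinity>" using kernel_mass[OF a] by (simp add: le_less_trans)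
    show "AE b in S. (%k. ennreal (\<kappa> a b - real k)) \<longlonglongrightarrow> 0"
    proof (rule AE_I2)
      fix b
      obtain k0 :: nat where "\<kappa> a b <= real k0" using real_arch_simple by blast
      then have "\<forall>\<^sub>F k in sequentially. ennreal (\<kappa> a b - real k) = 0"
        by (auto simp: eventually_sequentially ennreal_eq_0_iff intro!: exI[of _ k0])
      then show "(%k. ennreal (\<kappa> a b - real k)) \<longlonglongrightarrow> 0" by (rule tendsto_eventually)
    qed
  qed (use a in \<open>auto intro!: ennreal_leI\<close>)
  then have "\<forall>\<^sub>F k in sequentially. (NINT b|S. ennreal (\<kappa> a b - real k)) < ennreal \<epsilon>"
    by (rule order_tendstoD(2)) (simp add: eps)
  then show ?thesis by (auto simp: eventually_sequentially)
qed

text \<open>At a point the kernel is only integrable, while the approximation is controlled in mean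
  over space and time. The kernel is cut at height \<open>k\<close>: the excess has small mass and
  is paired with the first moment bound \<open>m2\<close>, the rest is bounded and is paired with
  the error over space and time. The remainder at \<open>a\<close> itself vanishes because
  \<open>rho e I (g a) = 0\<close>.\<close>

lemma difference_at_le:
  assumes e: "onb I e" and a: "a \<in> space S" and r: "rho e I (g a) = 0" and k: "0 <= k"
  shows "(NINT om|P. ennreal \<bar>X om a - Xn e I om a\<bar>) <=
    ennreal (L * m2) * (NINT b|S. ennreal (\<kappa> a b - k)) + ennreal (L * k) * (NINT b|S. NINT om|P. ennreal \<bar>X om b - Xn e I om b\<bar>)"
proof -
  note dm = X_measurable Xn_measurable[OF e]
  define D where "D b = (NINT om|P. ennreal \<bar>X om b - Xn e I om b\<bar>)" for b
  have dd[measurable]: "(%p. ennreal \<bar>X (fst p) (snd p) - Xn e I (fst p) (snd p)\<bar>) \<in> bm (P \<Otimes>\<^sub>M S)"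
    using dm by (simp add: case_prod_beta')
  have dd': "(%p. ennreal \<bar>X (snd p) (fst p) - Xn e I (snd p) (fst p)\<bar>) \<in> bm (S \<Otimes>\<^sub>M P)"
    using measurable_compose[OF measurable_pair_swap' dd] by (simp add: case_prod_beta')
  have Dm[measurable]: "D \<in> bm S"
    unfolding D_def[abs_def] by (rule borel_measurable_nn_integral) (use dd' in \<open>simp add: case_prod_beta'\<close>)
  let ?R = "%om. Y om a - (\<Sum>i\<in>I. ip H (g a) (e i) * W (e i) om)"
  have Rm[measurable]: "?R \<in> bm P"
    using measurable_compose[OF measurable_Pair2'[OF a] remainder_g_measurable[OF e]] by simp
  have "(NINT om|P. ennreal ((?R om)^2)) = 0" using remainder_g_sq[OF e a] r by simp
  then have R0: "AE om in P. ?R om = 0" by (subst (asm) nn_integral_0_iff_AE) (auto simp: ennreal_eq_0_iff)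
  have "(NINT om|P. ennreal \<bar>X om a - Xn e I om a\<bar>) <= (NINT om|P. NINT b|S. ennreal (\<kappa> a b) * (ennreal L * ennreal \<bar>X om b - Xn e I om b\<bar>))"
    by (rule nn_integral_mono_AE) (use difference_le[OF e a] R0 in \<open>eventually_elim, simp\<close>)
  also have "... = (NINT b|S. NINT om|P. ennreal (\<kappa> a b) * (ennreal L * ennreal \<bar>X om b - Xn e I om b\<bar>))"
    using a by (intro PS.Fubini'[symmetric]) (simp add: case_prod_beta')
  also have "... = (NINT b|S. ennreal (\<kappa> a b) * (ennreal L * D b))"
  proof (rule nn_integral_cong)
    fix b assume b: "b \<in> space S"
    note [measurable] = X_section[OF b] section_M[OF Xn_measurable[OF e] b]
    show "(NINT om|P. ennreal (\<kappa> a b) * (ennreal L * ennreal \<bar>X om b - Xn e I om b\<bar>)) = ennreal (\<kappa> a b) * (ennreal L * D b)"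
      by (simp add: nn_integral_cmult D_def)
  qed
  also have "... <= (NINT b|S. ennreal (L * m2) * ennreal (\<kappa> a b - k) + ennreal (L * k) * D b)"
  proof (rule nn_integral_mono)
    fix b assume b: "b \<in> space S"
    have "ennreal (\<kappa> a b) <= ennreal (\<kappa> a b - k) + ennreal k"
    proof (cases "k <= \<kappa> a b")
      case True then show ?thesis using k by (simp flip: ennreal_plus)
    next
      case False then show ?thesis using k by (simp add: ennreal_neg ennreal_leI)
    qed
    then have "ennreal (\<kappa> a b) * (ennreal L * D b) <= (ennreal (\<kappa> a b - k) + ennreal k) * (ennreal L * D b)"
      by (rule mult_right_mono) simp
    also have "... = ennreal (\<kappa> a b - k) * (ennreal L * D b) + ennreal (L * k) * D b"
      using L by (simp add: distrib_left distrib_right ennreal_mult' mult_ac)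
    also have "... <= ennreal (\<kappa> a b - k) * (ennreal L * ennreal m2) + ennreal (L * k) * D b"
      unfolding D_def by (intro add_right_mono mult_left_mono difference_abs e b) auto
    finally show "ennreal (\<kappa> a b) * (ennreal L * D b) <= ennreal (L * m2) * ennreal (\<kappa> a b - k) + ennreal (L * k) * D b"
      using L by (simp add: ennreal_mult' mult.commute)
  qed
  also have "... = ennreal (L * m2) * (NINT b|S. ennreal (\<kappa> a b - k)) + ennreal (L * k) * (NINT b|S. D b)"
    using a by (subst nn_integral_add) (auto simp: nn_integral_cmult)
  finally show ?thesis unfolding D_def .
qed

text \<open>Enlarging a family never increases a residual. A family with small total residual can
  thus be enlarged until it explains \<open>g a\<close> completely, without losing the first
  property.\<close>

lemma pointwise_approximation:
  assumes e0: "onb I0 e0" and a: "a \<in> space S" and eta: "0 < \<eta>"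
  shows "\<exists>I e. extends I0 e0 I e \<and> (NINT om|P. ennreal \<bar>X om a - Xn e I om a\<bar>) <= ennreal \<eta>"
proof -
  \<comment> \<open>Budget: half of \<open>\<eta>\<close> for the excess of the kernel and a quarter
    for each of the two terms of the error over space and time. The summands 1 in \<open>c\<close>,
    \<open>c'\<close> and \<open>mS\<close> make these divisors positive.\<close>
  define c where "c = L * m2 + 1"
  have c: "0 < c" "L * m2 <= c" using L m2 by (auto simp: c_def add_nonneg_pos)
  obtain k :: nat where k: "(NINT b|S. ennreal (\<kappa> a b - real k)) < ennreal (\<eta> / (2 * c))"
    using kernel_tail[OF a, of "\<eta> / (2 * c)"] eta c by auto
  define c' where "c' = L * real k + 1"
  have c': "0 < c'" "L * real k <= c'" using L by (auto simp: c'_def add_nonneg_pos)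
  define mS where "mS = measure S (space S) + 1"
  have mS: "0 < mS" "measure S (space S) <= mS" by (auto simp: mS_def add_nonneg_pos)
  define d where "d = \<eta> / (4 * c' * mS)"
  have d: "0 < d" "d * mS * c' = \<eta> / 4" using eta c' mS by (auto simp: d_def)
  have g: "0 < gap" by (simp add: gap_def)
  define \<epsilon> where "\<epsilon> = \<eta> * d / (4 * c' * gap)"
  have eps: "0 < \<epsilon>" "gap * \<epsilon> / d * c' = \<eta> / 4" using eta d c' g by (auto simp: \<epsilon>_def)
  obtain I1 e1 where 1: "extends I0 e0 I1 e1" "(LINT b|S. rho e1 I1 (g b)) < \<epsilon>"
    using finite_dimensional_approximation[OF finite_S g_in g_q q2 Y_measurable Y_W e0 eps(1)] by blast
  have o1: "onb I1 e1" using 1 by (simp add: extends_def)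
  obtain I e where 2: "extends I1 e1 I e" "rho e I (g a) = 0" using extend_to_contain[OF o1 g_in[OF a]] by blast
  have o: "onb I e" using 2 by (simp add: extends_def)
  have ir: "integrable S (%a. rho e I (g a))" if "onb I e" for I e
    by (rule S.integrable_const_bound[where B="q\<^sup>2"]) (use rho_g_bounds[OF that] rho_g_measurable[OF that] in auto)
  have "(LINT b|S. rho e I (g b)) <= (LINT b|S. rho e1 I1 (g b))"
    by (intro integral_mono ir o o1 extends_rho_le[OF 2(1)])
  then have le: "(LINT b|S. rho e I (g b)) <= \<epsilon>" using 1 by simp
  have nn: "0 <= (LINT b|S. rho e I (g b))" using rho_g_bounds[OF o] by (intro integral_nonneg_AE) auto
  have "(NINT om|P. ennreal \<bar>X om a - Xn e I om a\<bar>) <=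
    ennreal (L * m2) * (NINT b|S. ennreal (\<kappa> a b - real k)) + ennreal (L * real k) * (NINT b|S. NINT om|P. ennreal \<bar>X om b - Xn e I om b\<bar>)"
    by (rule difference_at_le[OF o a 2(2)]) simp
  also have "... <= ennreal c * ennreal (\<eta> / (2 * c)) + ennreal c' * ennreal (d * mS + gap * \<epsilon> / d)"
  proof (intro add_mono mult_mono)
    have "gap * (LINT a|S. rho e I (g a)) / d <= gap * \<epsilon> / d"
      using le g d by (intro divide_right_mono mult_left_mono) auto
    moreover have "d * measure S (space S) <= d * mS" using d mS by (intro mult_left_mono) auto
    ultimately have "d * measure S (space S) + gap * (LINT a|S. rho e I (g a)) / d <= d * mS + gap * \<epsilon> / d" by linarith
    then show "(NINT b|S. NINT om|P. ennreal \<bar>X om b - Xn e I om b\<bar>) <= ennreal (d * mS + gap * \<epsilon> / d)"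
      by (rule order_trans[OF difference_total_le[OF o d(1)] ennreal_leI])
  qed (use c c' k in \<open>auto intro: ennreal_leI\<close>)
  also have "... = ennreal (c * (\<eta> / (2 * c)) + c' * (d * mS + gap * \<epsilon> / d))"
  proof -
    have 1: "ennreal c * ennreal (\<eta> / (2 * c)) = ennreal (c * (\<eta> / (2 * c)))"
      using c by (simp only: ennreal_mult'[of c] less_imp_le)
    have 2: "ennreal c' * ennreal (d * mS + gap * \<epsilon> / d) = ennreal (c' * (d * mS + gap * \<epsilon> / d))"
      using c' by (simp only: ennreal_mult'[of c'] less_imp_le)
    have "0 <= c * (\<eta> / (2 * c))" "0 <= c' * (d * mS + gap * \<epsilon> / d)" using c c' eta d mS eps g by auto
    then show ?thesis unfolding 1 2 by (rule ennreal_plus[symmetric])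
  qed
  also have "c * (\<eta> / (2 * c)) + c' * (d * mS + gap * \<epsilon> / d) = \<eta>"
  proof -
    have "c * (\<eta> / (2 * c)) = \<eta> / 2" using c by simp
    moreover have "c' * (d * mS + gap * \<epsilon> / d) = d * mS * c' + gap * \<epsilon> / d * c'" by (simp add: algebra_simps)
    ultimately show ?thesis unfolding d(2) eps(2) by linarith
  qed
  finally show ?thesis using extends_trans[OF 1(1) 2(1)] by blast
qed

section \<open>Conditioning on one Gaussian direction\<close>

context
  fixes t :: real and y :: 'a and u :: "real => 'h" and \<delta> A0 q1 :: real
  assumes a: "(t, y) \<in> space S" and u: "u \<in> L2_time H" "ip H u u = 1"
    and A0: "0 < A0" and \<delta>: "0 <= \<delta>"
    and lower: "2 * A0 <= ip H (g (t, y)) u"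
    and upper: "!!b. b \<in> space S ==> fst b <= t ==> \<bar>ip H (g b) u\<bar> <= q1"
    and early: "!!b. b \<in> space S ==> fst b <= t - \<delta> ==> ip H (g b) u = 0"
    and small: "C0 * (L * (2 * q1 * E T)) * \<delta> <= A0"
begin

lemma q1: "0 <= q1" "2 * A0 <= q1"
  using upper[OF a] lower A0 by auto

text \<open>Moving the coordinate of \<open>u\<close> by \<open>w\<close> moves the input at
  \<open>(t, y)\<close> by at least \<open>2 * A0 * w\<close>. As \<open>u\<close> is invisible up
  to time \<open>t - \<delta>\<close>, the two solutions agree until then, and the drift can respond
  only during a window of length \<open>\<delta>\<close>; by \<open>small\<close> the response is at
  most \<open>A0 * w\<close>.\<close>

lemma bilipschitz_direction:
  assumes e: "onb I e" and 0: "0 \<in> I" "e 0 = u" and rr: "r' <= r"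
  shows "A0 * (r - r') <= sol (zx e I (x(0 := r))) (t, y) - sol (zx e I (x(0 := r'))) (t, y)"
    "sol (zx e I (x(0 := r))) (t, y) - sol (zx e I (x(0 := r'))) (t, y) <= (q1 + A0) * (r - r')"
proof -
  define w where "w = r - r'"
  have w: "0 <= w" using rr by (simp add: w_def)
  define s1 where "s1 = sol (zx e I (x(0 := r)))"
  define s2 where "s2 = sol (zx e I (x(0 := r')))"
  note z1 = zx_measurable1[OF e, of "x(0 := r)"] zx_bound[OF e, of _ "x(0 := r)"] zx_bound0[of "x(0 := r)"]
  note z2 = zx_measurable1[OF e, of "x(0 := r')"] zx_bound[OF e, of _ "x(0 := r')"] zx_bound0[of "x(0 := r')"]
  have [measurable]: "s1 \<in> bm S" "s2 \<in> bm S"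
    unfolding s1_def s2_def by (intro sol_measurable1 zx_measurable1 e)+
  have diff: "s1 b - s2 b = ip H (g b) u * w + (V (%b. f (s1 b)) b - V (%b. f (s2 b)) b)" if b: "b \<in> space S" for b
  proof -
    have "s1 b = zx e I (x(0 := r)) b + V (%b. f (s1 b)) b" unfolding s1_def by (rule sol_eq[OF z1 b])
    moreover have "s2 b = zx e I (x(0 := r')) b + V (%b. f (s2 b)) b" unfolding s2_def by (rule sol_eq[OF z2 b])
    ultimately show ?thesis by (simp add: zx_upd[OF e 0(1)] 0(2) w_def algebra_simps)
  qed
  have Vd: "ennreal \<bar>V (%b. f (s1 b)) b - V (%b. f (s2 b)) b\<bar> <= (NINT c|S. ennreal (\<kappa> b c) * (ennreal L * ennreal \<bar>s1 c - s2 c\<bar>))"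
    if b: "b \<in> space S" for b
    by (rule V_diff) (auto simp: s1_def s2_def intro: integrable_sol[OF z1 b] integrable_sol[OF z2 b])
  obtain B where B: "!!b. b \<in> space S ==> \<bar>s1 b - s2 b\<bar> <= B"
  proof -
    have "\<bar>s1 b - s2 b\<bar> <= 2 * (b0 + q * (\<Sum>i\<in>I. \<bar>(x(0 := r)) i\<bar>) + \<bar>f 0\<bar> * (C0 * T)) * E T + 2 * (b0 + q * (\<Sum>i\<in>I. \<bar>(x(0 := r')) i\<bar>) + \<bar>f 0\<bar> * (C0 * T)) * E T"
      if b: "b \<in> space S" for b
      using sol_bound'[OF z1 b] sol_bound'[OF z2 b] unfolding s1_def s2_def by linarith
    then show ?thesis using that by blast
  qed
  have step: "ennreal \<bar>s1 b - s2 b\<bar> <= ennreal (c * w) + (NINT c|S. ennreal (\<kappa> b c) * (ennreal L * ennreal \<bar>s1 c - s2 c\<bar>))"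
    if b: "b \<in> space S" and c: "\<bar>ip H (g b) u\<bar> <= c" for b c
  proof -
    have "\<bar>s1 b - s2 b\<bar> <= \<bar>ip H (g b) u\<bar> * w + \<bar>V (%b. f (s1 b)) b - V (%b. f (s2 b)) b\<bar>"
      using diff[OF b] w abs_triangle_ineq[of "ip H (g b) u * w"] by (simp add: abs_mult)
    also have "\<bar>ip H (g b) u\<bar> * w <= c * w" using c w by (rule mult_right_mono)
    finally have "ennreal \<bar>s1 b - s2 b\<bar> <= ennreal (c * w + \<bar>V (%b. f (s1 b)) b - V (%b. f (s2 b)) b\<bar>)"
      by (simp add: ennreal_leI)
    also have "... = ennreal (c * w) + ennreal \<bar>V (%b. f (s1 b)) b - V (%b. f (s2 b)) b\<bar>"
    proof (rule ennreal_plus)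
      show "0 <= c * w" using c w abs_ge_zero[of "ip H (g b) u"] by (intro mult_nonneg_nonneg) linarith+
    qed simp
    also have "... <= ennreal (c * w) + (NINT c|S. ennreal (\<kappa> b c) * (ennreal L * ennreal \<bar>s1 c - s2 c\<bar>))"
      by (intro add_left_mono Vd b)
    finally show ?thesis .
  qed
  \<comment> \<open>Gronwall with \<open>A = 0\<close> and horizon \<open>t - \<delta>\<close>:
    without forcing the difference vanishes.\<close>
  have zero: "s1 b = s2 b" if b: "b \<in> space S" "fst b <= t - \<delta>" for b
  proof -
    have "ennreal \<bar>s1 b - s2 b\<bar> <= ennreal (2 * 0 * E (fst b))"
    proof (rule gronwall_kernel[where \<tau>="t - \<delta>" and B=B])
      fix b assume "b \<in> space S" "fst b <= t - \<delta>"
      then show "ennreal \<bar>s1 b - s2 b\<bar> <= ennreal 0 + (NINT c|S. ennreal (\<kappa> b c) * (ennreal L * ennreal \<bar>s1 c - s2 c\<bar>))"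
        using step[of b 0] early[of b] by simp
    qed (use b B in \<open>auto intro: ennreal_leI\<close>)
    then show ?thesis by (simp add: ennreal_eq_0_iff)
  qed
  have bound: "\<bar>s1 b - s2 b\<bar> <= 2 * (q1 * w) * E T" if b: "b \<in> space S" "fst b <= t" for b
  proof -
    have "ennreal \<bar>s1 b - s2 b\<bar> <= ennreal (2 * (q1 * w) * E (fst b))"
    proof (rule gronwall_kernel[where \<tau>=t and B=B])
      fix b assume "b \<in> space S" "fst b <= t"
      then show "ennreal \<bar>s1 b - s2 b\<bar> <= ennreal (q1 * w) + (NINT c|S. ennreal (\<kappa> b c) * (ennreal L * ennreal \<bar>s1 c - s2 c\<bar>))"
        by (intro step upper)
    qed (use b B q1 w in \<open>auto intro: ennreal_leI\<close>)
    then have "\<bar>s1 b - s2 b\<bar> <= 2 * (q1 * w) * E (fst b)" using q1 w by (subst (asm) ennreal_le_iff) auto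
    also have "... <= 2 * (q1 * w) * E T" using b q1 w by (intro mult_left_mono E_mono) (auto simp: space_S)
    finally show ?thesis .
  qed
  have t: "0 <= t" "t <= T" using a by (auto simp: space_S)
  have "ennreal \<bar>V (%b. f (s1 b)) (t, y) - V (%b. f (s2 b)) (t, y)\<bar> <= (NINT c|S. ennreal (\<kappa> (t, y) c) * (ennreal L * ennreal \<bar>s1 c - s2 c\<bar>))"
    by (rule Vd[OF a])
  also have "... <= (NINT c|S. ennreal (\<kappa> (t, y) c) * (ennreal (L * (2 * (q1 * w) * E T)) * indicator {t - \<delta>..t} (fst c)))"
  proof (rule nn_integral_mono)
    fix c assume c: "c \<in> space S"
    show "ennreal (\<kappa> (t, y) c) * (ennreal L * ennreal \<bar>s1 c - s2 c\<bar>) <= ennreal (\<kappa> (t, y) c) * (ennreal (L * (2 * (q1 * w) * E T)) * indicator {t - \<delta>..t} (fst c))"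
    proof (cases "t <= fst c")
      case True then show ?thesis by (simp add: \<kappa>_causal)
    next
      case False
      show ?thesis
      proof (cases "fst c <= t - \<delta>")
        case True then show ?thesis using zero[OF c] by simp
      next
        case f2: False
        have "ennreal L * ennreal \<bar>s1 c - s2 c\<bar> <= ennreal L * ennreal (2 * (q1 * w) * E T)"
          using False by (intro mult_left_mono ennreal_leI bound c) auto
        then show ?thesis using False f2 L by (intro mult_left_mono) (auto simp: ennreal_mult')
      qed
    qed
  qed
  also have "... <= ennreal C0 * (NINT r|lborel. (ennreal (L * (2 * (q1 * w) * E T)) * indicator {t - \<delta>..t} r) * indicator {0..fst (t, y)} r)"
    by (rule kernel_time[OF _ a]) measurable
  also have "(NINT r|lborel. (ennreal (L * (2 * (q1 * w) * E T)) * indicator {t - \<delta>..t} r) * indicator {0..fst (t, y)} r) <= (NINT r|lborel. ennreal (L * (2 * (q1 * w) * E T)) * indicator {t - \<delta>..t} r)"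
    by (intro nn_integral_mono) (auto simp: indicator_def)
  also have "... = ennreal (L * (2 * (q1 * w) * E T)) * ennreal \<delta>" using \<delta> by (subst nn_integral_cmult_indicator) auto
  finally have "ennreal \<bar>V (%b. f (s1 b)) (t, y) - V (%b. f (s2 b)) (t, y)\<bar> <= ennreal C0 * (ennreal (L * (2 * (q1 * w) * E T)) * ennreal \<delta>)"
    by (simp add: mult_left_mono)
  also have "... = ennreal (C0 * (L * (2 * (q1 * w) * E T)) * \<delta>)"
  proof -
    have nn: "0 <= C0" "0 <= L * (2 * (q1 * w) * E T)" using C0 L q1 w by auto
    have "ennreal (C0 * M * \<delta>) = ennreal C0 * (ennreal M * ennreal \<delta>)" if "0 <= M" for M
      by (simp only: mult.assoc ennreal_mult'[OF nn(1)] ennreal_mult'[OF that])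
    from this[OF nn(2)] show ?thesis by simp
  qed
  also have "C0 * (L * (2 * (q1 * w) * E T)) * \<delta> = (C0 * (L * (2 * q1 * E T)) * \<delta>) * w" by (simp add: mult_ac)
  also have "ennreal ... <= ennreal (A0 * w)" using small w by (intro ennreal_leI mult_right_mono)
  finally have "\<bar>V (%b. f (s1 b)) (t, y) - V (%b. f (s2 b)) (t, y)\<bar> <= A0 * w"
    using A0 w by (subst (asm) ennreal_le_iff) auto
  moreover have "2 * A0 * w <= ip H (g (t, y)) u * w" using lower w by (rule mult_right_mono)
  moreover have "ip H (g (t, y)) u * w <= q1 * w" using upper[OF a] w by (intro mult_right_mono) auto
  ultimately have "A0 * w <= s1 (t, y) - s2 (t, y)" "s1 (t, y) - s2 (t, y) <= (q1 + A0) * w"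
    using diff[OF a] by (auto simp: algebra_simps)
  then show "A0 * (r - r') <= sol (zx e I (x(0 := r))) (t, y) - sol (zx e I (x(0 := r'))) (t, y)"
    "sol (zx e I (x(0 := r))) (t, y) - sol (zx e I (x(0 := r'))) (t, y) <= (q1 + A0) * (r - r')"
    by (simp_all add: s1_def s2_def w_def)
qed

text \<open>Lower bound for the density on \<open>{-R..R}\<close>. With probability at least 1/2 the
  field with \<open>u\<close> switched off is at most \<open>2 * m1 + 1\<close> in absolute value,
  by Markov's inequality; this explains the shift and the last factor.\<close>

definition dens :: "real => real" where
  "dens R = std_normal_density ((R + (2 * m1 + 1)) / A0) / (q1 + A0) / 2"

text \<open>Given the other coordinates, the truncated field at \<open>(t, y)\<close> is a
  bi-Lipschitz function of one standard normal with constants that do not depend on them, so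
  \<open>density_bilipschitz\<close> applies inside the integral over the other coordinates.\<close>

lemma Xn_law_bounds:
  assumes e: "onb I e" and 0: "0 \<in> I" "e 0 = u" and ab: "\<alpha> <= \<beta>"
  shows "emeasure P {om \<in> space P. Xn e I om (t, y) \<in> {\<alpha>..\<beta>}} <= ennreal ((\<beta> - \<alpha>) / A0)"
    and "\<bar>\<alpha>\<bar> <= R ==> \<bar>\<beta>\<bar> <= R ==> ennreal (dens R * (\<beta> - \<alpha>)) <= emeasure P {om \<in> space P. Xn e I om (t, y) \<in> {\<alpha>..\<beta>}}"
proof -
  let ?\<gamma> = "std_normal_distribution"
  let ?J = "I - {0}"
  interpret PP: product_prob_space "%_::nat. ?\<gamma>" by (rule product_prob_space_std_normal)
  interpret PJ: prob_space "Pi\<^sub>M ?J (%_::nat. ?\<gamma>)" by (rule prob_space_PiM) (rule prob_space_std_normal)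
  have I: "insert 0 ?J = I" "finite ?J" "0 \<notin> ?J" using 0 onbD(1)[OF e] by auto
  have eJ: "onb ?J e" by (rule onb_subset[OF e]) auto
  have sc: "sets (Pi\<^sub>M K (%_::nat. ?\<gamma>)) = sets (Pi\<^sub>M K (%_. borel))" for K by (rule sets_PiM_cong) auto
  have mc: "bm (Pi\<^sub>M K (%_::nat. ?\<gamma>)) = bm (Pi\<^sub>M K (%_. borel))" for K
    by (rule measurable_cong_sets[OF sc refl])
  have cont: "(%r. sol (zx e I (x(0 := r))) (t, y)) \<in> bm borel" for x
  proof (rule borel_measurable_mono, rule monoI)
    fix r' r :: real assume "r' <= r"
    moreover from this have "0 <= A0 * (r - r')" using A0 by simp
    ultimately show "sol (zx e I (x(0 := r'))) (t, y) <= sol (zx e I (x(0 := r))) (t, y)"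
      using bilipschitz_direction(1)[OF e 0, of r' r x] by linarith
  qed
  define h where "h x = (indicator {\<alpha>..\<beta>} (sol (zx e I x) (t, y)) :: ennreal)" for x :: "nat => real"
  note [measurable] = sol_zx_measurable[OF e a]
  have hm': "h \<in> bm (Pi\<^sub>M I (%_. borel))" unfolding h_def[abs_def] by measurable
  note Xm[measurable] = section_M[OF Xn_measurable[OF e] a]
  have "emeasure P {om \<in> space P. Xn e I om (t, y) \<in> {\<alpha>..\<beta>}} = (NINT om|P. indicator {om \<in> space P. Xn e I om (t, y) \<in> {\<alpha>..\<beta>}} om)" by simp
  also have "... = (NINT om|P. h (\<lambda>i\<in>I. W (e i) om))"
    by (intro nn_integral_cong) (simp add: h_def zx_restrict Xn_def indicator_def)
  also have "... = (NINT x|(Pi\<^sub>M I (%_. ?\<gamma>)). h x)" by (rule law_transfer[OF e hm'])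
  also have "... = (NINT x|(Pi\<^sub>M ?J (%_. ?\<gamma>)). NINT r|?\<gamma>. h (x(0 := r)))"
    using PP.product_nn_integral_insert[OF I(2,3), of h] hm' unfolding I(1) mc by simp
  also have "... = (NINT x|(Pi\<^sub>M ?J (%_. ?\<gamma>)). emeasure ?\<gamma> {r. sol (zx e I (x(0 := r))) (t, y) \<in> {\<alpha>..\<beta>}})"
  proof (rule nn_integral_cong)
    fix x assume "x \<in> space (Pi\<^sub>M ?J (%_::nat. ?\<gamma>))"
    note [measurable] = cont[of x]
    have "{r. sol (zx e I (x(0 := r))) (t, y) \<in> {\<alpha>..\<beta>}} \<in> sets ?\<gamma>" by simp
    then have "emeasure ?\<gamma> {r. sol (zx e I (x(0 := r))) (t, y) \<in> {\<alpha>..\<beta>}} = (NINT r|?\<gamma>. indicator {r. sol (zx e I (x(0 := r))) (t, y) \<in> {\<alpha>..\<beta>}} r)" by simp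
    then show "(NINT r|?\<gamma>. h (x(0 := r))) = emeasure ?\<gamma> {r. sol (zx e I (x(0 := r))) (t, y) \<in> {\<alpha>..\<beta>}}"
      by (simp add: h_def[abs_def] indicator_def)
  qed
  finally have eq: "emeasure P {om \<in> space P. Xn e I om (t, y) \<in> {\<alpha>..\<beta>}} = (NINT x|(Pi\<^sub>M ?J (%_. ?\<gamma>)). emeasure ?\<gamma> {r. sol (zx e I (x(0 := r))) (t, y) \<in> {\<alpha>..\<beta>}})" .
  note db = density_bilipschitz[OF A0 bilipschitz_direction(1)[OF e 0] bilipschitz_direction(2)[OF e 0] cont ab]
  have "(NINT x|(Pi\<^sub>M ?J (%_. ?\<gamma>)). emeasure ?\<gamma> {r. sol (zx e I (x(0 := r))) (t, y) \<in> {\<alpha>..\<beta>}}) <= (NINT x|(Pi\<^sub>M ?J (%_::nat. ?\<gamma>)). ennreal ((\<beta> - \<alpha>) / A0))"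
    by (intro nn_integral_mono db(1))
  then show "emeasure P {om \<in> space P. Xn e I om (t, y) \<in> {\<alpha>..\<beta>}} <= ennreal ((\<beta> - \<alpha>) / A0)"
    unfolding eq by (simp add: PJ.emeasure_space_1)
  assume R: "\<bar>\<alpha>\<bar> <= R" "\<bar>\<beta>\<bar> <= R"
  define K0 where "K0 = 2 * m1 + 1"
  have K0: "0 < K0" using m1 by (simp add: K0_def)
  define c where "c = std_normal_density ((R + K0) / A0) * ((\<beta> - \<alpha>) / (q1 + A0))"
  have c: "0 <= c" unfolding c_def using ab q1 A0 by (intro mult_nonneg_nonneg divide_nonneg_nonneg) auto
  define Z where "Z x = sol (zx e ?J x) (t, y)" for x
  have Zm[measurable]: "Z \<in> bm (Pi\<^sub>M ?J (%_. borel))" unfolding Z_def[abs_def] by (rule sol_zx_measurable[OF eJ a])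
  \<comment> \<open>At \<open>r = 0\<close> the direction \<open>u\<close> is switched off, so the
    value there is the truncated field for the family without index 0, and \<open>m1\<close> bounds
    its first moment.\<close>
  have H0: "sol (zx e I (x(0 := 0))) (t, y) = Z x" for x
  proof -
    have "zx e I (x(0 := 0)) = zx e ?J x" by (rule ext) (simp add: zx_upd[OF e 0(1)])
    then show ?thesis by (simp add: Z_def)
  qed
  have half: "ennreal (1/2) <= (NINT x|(Pi\<^sub>M ?J (%_. ?\<gamma>)). indicator {x. \<bar>Z x\<bar> <= K0} x)"
  proof -
    note [measurable] = section_M[OF Xn_measurable[OF eJ] a]
    have "(NINT x|(Pi\<^sub>M ?J (%_. ?\<gamma>)). indicator {x. \<bar>Z x\<bar> <= K0} x) = (NINT om|P. indicator {x. \<bar>Z x\<bar> <= K0} (\<lambda>i\<in>?J. W (e i) om))"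
      by (rule law_transfer[OF eJ, symmetric]) (simp add: indicator_def)
    also have "... = (NINT om|P. indicator {om \<in> space P. \<bar>Xn e ?J om (t, y)\<bar> <= K0} om)"
      by (intro nn_integral_cong) (simp add: indicator_def Z_def zx_restrict Xn_def)
    also have "... = emeasure P {om \<in> space P. \<bar>Xn e ?J om (t, y)\<bar> <= K0}" by simp
    finally have eq2: "(NINT x|(Pi\<^sub>M ?J (%_. ?\<gamma>)). indicator {x. \<bar>Z x\<bar> <= K0} x) = ennreal (prob {om \<in> space P. \<bar>Xn e ?J om (t, y)\<bar> <= K0})"
      by (simp add: emeasure_eq_measure)
    have i: "integrable P (%om. \<bar>Xn e ?J om (t, y)\<bar>)"
      by (rule integrableI_bounded) (use Xn_expectation[OF eJ a] in \<open>auto simp: le_less_trans\<close>)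
    have "ennreal (LINT om|P. \<bar>Xn e ?J om (t, y)\<bar>) <= ennreal m1"
      using Xn_expectation[OF eJ a] by (subst nn_integral_eq_integral[OF i, symmetric]) auto
    then have "(LINT om|P. \<bar>Xn e ?J om (t, y)\<bar>) <= m1" using m1 by (subst (asm) ennreal_le_iff) auto
    moreover have "prob {om \<in> space P. K0 <= \<bar>Xn e ?J om (t, y)\<bar>} <= (LINT om|P. \<bar>Xn e ?J om (t, y)\<bar>) / K0"
      by (rule integral_Markov_inequality_measure[OF i, where A="space P", simplified]) (use K0 in auto)
    moreover have "m1 / K0 <= 1 / 2" using K0 by (simp add: K0_def field_simps)
    ultimately have m: "prob {om \<in> space P. K0 <= \<bar>Xn e ?J om (t, y)\<bar>} <= 1 / 2"
      using K0 by (smt (verit, best) divide_right_mono)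
    have "1 - prob {om \<in> space P. \<bar>Xn e ?J om (t, y)\<bar> <= K0} = prob (space P - {om \<in> space P. \<bar>Xn e ?J om (t, y)\<bar> <= K0})"
      by (rule prob_compl[symmetric]) measurable
    also have "... <= prob {om \<in> space P. K0 <= \<bar>Xn e ?J om (t, y)\<bar>}" by (intro finite_measure_mono) auto
    finally have "1 / 2 <= prob {om \<in> space P. \<bar>Xn e ?J om (t, y)\<bar> <= K0}" using m by linarith
    then show ?thesis unfolding eq2 by (rule ennreal_leI)
  qed
  have "ennreal (dens R * (\<beta> - \<alpha>)) = ennreal c * ennreal (1/2)"
  proof -
    have "dens R * (\<beta> - \<alpha>) = c * (1/2)" by (simp add: dens_def c_def K0_def)
    then show ?thesis using c by (simp only: ennreal_mult')
  qed
  also have "... <= ennreal c * (NINT x|(Pi\<^sub>M ?J (%_. ?\<gamma>)). indicator {x. \<bar>Z x\<bar> <= K0} x)"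
    by (intro mult_left_mono half) simp
  also have "... = (NINT x|(Pi\<^sub>M ?J (%_. ?\<gamma>)). ennreal c * indicator {x. \<bar>Z x\<bar> <= K0} x)"
    by (rule nn_integral_cmult[symmetric]) (unfold mc, simp add: indicator_def)
  also have "... <= (NINT x|(Pi\<^sub>M ?J (%_. ?\<gamma>)). emeasure ?\<gamma> {r. sol (zx e I (x(0 := r))) (t, y) \<in> {\<alpha>..\<beta>}})"
  proof (rule nn_integral_mono)
    fix x
    show "ennreal c * indicator {x. \<bar>Z x\<bar> <= K0} x <= emeasure ?\<gamma> {r. sol (zx e I (x(0 := r))) (t, y) \<in> {\<alpha>..\<beta>}}"
      using db(2)[of x K0 R] H0[of x] R by (auto simp: indicator_def c_def)
  qed
  finally show "ennreal (dens R * (\<beta> - \<alpha>)) <= emeasure P {om \<in> space P. Xn e I om (t, y) \<in> {\<alpha>..\<beta>}}"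
    unfolding eq .
qed

end
end

section \<open>The law at a point and Lipschitz dependence on the noise\<close>

context spde
begin

text \<open>The truncated fields converge in probability at \<open>(t, y)\<close>. Comparison with
  intervals enlarged or shrunk by \<open>\<theta>\<close> costs an error linear in
  \<open>\<theta>\<close>, and \<open>\<theta>\<close> is sent to zero. The family starts from
  \<open>u\<close> as index 0, so that every enlargement retains the chosen direction.\<close>

theorem law_bounds:
  assumes a: "(t, y) \<in> space S" and u: "u \<in> L2_time H" "ip H u u = 1"
    and A0: "0 < A0" and \<delta>: "0 <= \<delta>"
    and lower: "2 * A0 <= ip H (g (t, y)) u"
    and upper: "!!b. b \<in> space S ==> fst b <= t ==> \<bar>ip H (g b) u\<bar> <= q1"
    and early: "!!b. b \<in> space S ==> fst b <= t - \<delta> ==> ip H (g b) u = 0"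
    and small: "C0 * (L * (2 * q1 * E T)) * \<delta> <= A0"
    and ab: "\<alpha> < \<beta>"
  shows "prob {om \<in> space P. X om (t, y) \<in> {\<alpha>..\<beta>}} <= (\<beta> - \<alpha>) / A0"
    and "\<bar>\<alpha>\<bar> <= R ==> \<bar>\<beta>\<bar> <= R ==>
      std_normal_density ((R + (2 * m1 + 1)) / A0) / (q1 + A0) / 2 * (\<beta> - \<alpha>) <= prob {om \<in> space P. X om (t, y) \<in> {\<alpha>..\<beta>}}"
proof -
  note hyp = a u A0 \<delta> lower upper early small
  have on: "onb {0} (%_. u)" using u by (simp add: onb_def)
  note [measurable] = X_section[OF a]
  have ex: "\<exists>I e. onb I e \<and> 0 \<in> I \<and> e 0 = u \<and> prob {om \<in> space P. \<theta> <= \<bar>X om (t, y) - Xn e I om (t, y)\<bar>} <= \<theta>"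
    if th: "0 < \<theta>" for \<theta>
  proof -
    \<comment> \<open>A mean error of \<open>\<theta> * \<theta>\<close>, so that Markov's
      inequality gives an error of size \<open>\<theta>\<close> probability at most
      \<open>\<theta>\<close>.\<close>
    obtain I e where e: "extends {0} (%_. u) I e" "(NINT om|P. ennreal \<bar>X om (t, y) - Xn e I om (t, y)\<bar>) <= ennreal (\<theta> * \<theta>)"
      using pointwise_approximation[OF on a, of "\<theta> * \<theta>"] th by auto
    have o: "onb I e" "0 \<in> I" "e 0 = u" using e(1) by (auto simp: extends_def)
    note [measurable] = section_M[OF Xn_measurable[OF o(1)] a]
    have i: "integrable P (%om. \<bar>X om (t, y) - Xn e I om (t, y)\<bar>)"
      by (rule integrableI_bounded) (use e(2) in \<open>auto simp: le_less_trans\<close>)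
    have "ennreal (LINT om|P. \<bar>X om (t, y) - Xn e I om (t, y)\<bar>) <= ennreal (\<theta> * \<theta>)"
      using e(2) by (subst nn_integral_eq_integral[OF i, symmetric]) auto
    then have le: "(LINT om|P. \<bar>X om (t, y) - Xn e I om (t, y)\<bar>) <= \<theta> * \<theta>" using th by (subst (asm) ennreal_le_iff) auto
    have "prob {om \<in> space P. \<theta> <= \<bar>X om (t, y) - Xn e I om (t, y)\<bar>} <= (LINT om|P. \<bar>X om (t, y) - Xn e I om (t, y)\<bar>) / \<theta>"
      by (rule integral_Markov_inequality_measure[OF i, where A="space P", simplified]) (use th in auto)
    also have "... <= (\<theta> * \<theta>) / \<theta>" using le th by (intro divide_right_mono) auto
    finally show ?thesis using o th by auto
  qed
  show "prob {om \<in> space P. X om (t, y) \<in> {\<alpha>..\<beta>}} <= (\<beta> - \<alpha>) / A0"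
  proof (rule le_from_linear_slack[of 1 "2 / A0 + 1"])
    show "0 < 2 / A0 + 1" using A0 by (simp add: add_pos_pos)
    fix \<theta> :: real assume th: "0 < \<theta>"
    obtain I e where o: "onb I e" "0 \<in> I" "e 0 = u" and p: "prob {om \<in> space P. \<theta> <= \<bar>X om (t, y) - Xn e I om (t, y)\<bar>} <= \<theta>"
      using ex[OF th] by blast
    note [measurable] = section_M[OF Xn_measurable[OF o(1)] a]
    have "ennreal (prob {om \<in> space P. Xn e I om (t, y) \<in> {\<alpha> - \<theta>..\<beta> + \<theta>}}) <= ennreal ((\<beta> + \<theta> - (\<alpha> - \<theta>)) / A0)"
      using Xn_law_bounds(1)[OF hyp o, of "\<alpha> - \<theta>" "\<beta> + \<theta>"] ab th by (simp add: emeasure_eq_measure)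
    then have 1: "prob {om \<in> space P. Xn e I om (t, y) \<in> {\<alpha> - \<theta>..\<beta> + \<theta>}} <= (\<beta> + \<theta> - (\<alpha> - \<theta>)) / A0"
      using ab th A0 by (subst (asm) ennreal_le_iff) auto
    have "prob {om \<in> space P. X om (t, y) \<in> {\<alpha>..\<beta>}} <= prob ({om \<in> space P. Xn e I om (t, y) \<in> {\<alpha> - \<theta>..\<beta> + \<theta>}} \<union> {om \<in> space P. \<theta> <= \<bar>X om (t, y) - Xn e I om (t, y)\<bar>})"
      by (intro finite_measure_mono) auto
    also have "... <= prob {om \<in> space P. Xn e I om (t, y) \<in> {\<alpha> - \<theta>..\<beta> + \<theta>}} + prob {om \<in> space P. \<theta> <= \<bar>X om (t, y) - Xn e I om (t, y)\<bar>}"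
      by (rule measure_Un_le) measurable
    also have "... <= (\<beta> + \<theta> - (\<alpha> - \<theta>)) / A0 + \<theta>" using 1 p by (rule add_mono)
    also have "... = (\<beta> - \<alpha>) / A0 + (2 / A0 + 1) * \<theta>" using A0 by (simp add: field_simps)
    finally show "prob {om \<in> space P. X om (t, y) \<in> {\<alpha>..\<beta>}} <= (\<beta> - \<alpha>) / A0 + (2 / A0 + 1) * \<theta>" .
  qed simp
  assume R: "\<bar>\<alpha>\<bar> <= R" "\<bar>\<beta>\<bar> <= R"
  define c where "c = std_normal_density ((R + (2 * m1 + 1)) / A0) / (q1 + A0) / 2"
  have q1: "0 <= q1" using q1[OF hyp] by simp
  have c: "0 <= c" unfolding c_def using q1 A0 by (intro divide_nonneg_nonneg) auto
  show "std_normal_density ((R + (2 * m1 + 1)) / A0) / (q1 + A0) / 2 * (\<beta> - \<alpha>) <= prob {om \<in> space P. X om (t, y) \<in> {\<alpha>..\<beta>}}"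
    unfolding c_def[symmetric]
  proof (rule le_from_linear_slack[of "(\<beta> - \<alpha>) / 2" "2 * c + 1"])
    show "0 < 2 * c + 1" using c by simp
    show "0 < (\<beta> - \<alpha>) / 2" using ab by simp
    fix \<theta> :: real assume th: "0 < \<theta>" "\<theta> < (\<beta> - \<alpha>) / 2"
    obtain I e where o: "onb I e" "0 \<in> I" "e 0 = u" and p: "prob {om \<in> space P. \<theta> <= \<bar>X om (t, y) - Xn e I om (t, y)\<bar>} <= \<theta>"
      using ex[OF th(1)] by blast
    note [measurable] = section_M[OF Xn_measurable[OF o(1)] a]
    have "ennreal (c * (\<beta> - \<theta> - (\<alpha> + \<theta>))) <= ennreal (prob {om \<in> space P. Xn e I om (t, y) \<in> {\<alpha> + \<theta>..\<beta> - \<theta>}})"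
      using Xn_law_bounds(2)[OF hyp o, of "\<alpha> + \<theta>" "\<beta> - \<theta>" R] th R by (simp add: emeasure_eq_measure dens_def[OF hyp] c_def)
    then have 1: "c * (\<beta> - \<theta> - (\<alpha> + \<theta>)) <= prob {om \<in> space P. Xn e I om (t, y) \<in> {\<alpha> + \<theta>..\<beta> - \<theta>}}"
      by (subst (asm) ennreal_le_iff) auto
    have "prob {om \<in> space P. Xn e I om (t, y) \<in> {\<alpha> + \<theta>..\<beta> - \<theta>}} <= prob ({om \<in> space P. X om (t, y) \<in> {\<alpha>..\<beta>}} \<union> {om \<in> space P. \<theta> <= \<bar>X om (t, y) - Xn e I om (t, y)\<bar>})"
      by (intro finite_measure_mono) auto
    also have "... <= prob {om \<in> space P. X om (t, y) \<in> {\<alpha>..\<beta>}} + prob {om \<in> space P. \<theta> <= \<bar>X om (t, y) - Xn e I om (t, y)\<bar>}"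
      by (rule measure_Un_le) measurable
    finally have "c * (\<beta> - \<theta> - (\<alpha> + \<theta>)) <= prob {om \<in> space P. X om (t, y) \<in> {\<alpha>..\<beta>}} + \<theta>" using 1 p by linarith
    then show "c * (\<beta> - \<alpha>) <= prob {om \<in> space P. X om (t, y) \<in> {\<alpha>..\<beta>}} + (2 * c + 1) * \<theta>"
      by (simp add: algebra_simps)
  qed
qed

text \<open>\<open>op\<close> bounds by \<open>l\<close> the norm of the noise as an operator into
  L2 over space. Two solutions differ in their input by \<open>ip H (g b) h\<close>, where
  \<open>h\<close> combines the increments of the coordinates; mean square stability then gives a
  Lipschitz constant proportional to \<open>l\<close> in which the number of coordinates does not
  occur.\<close>

lemma field_lipschitz:
  assumes e: "onb I e" and l: "0 < l" and s: "s \<in> {0..T}"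
    and op: "!!h s. h \<in> DD ==> s \<in> {0..T} ==> (NINT y|N. ennreal ((ip H (g (s, y)) h)^2)) <= ennreal (l\<^sup>2 * ip H h h)"
  shows "(NINT y|N. ennreal ((sol (zx e I v) (s, y) - sol (zx e I w) (s, y))^2)) <=
    ennreal ((2 + KK * gap * T) * (l\<^sup>2 * (\<Sum>i\<in>I. (v i - w i)^2)))"
proof -
  \<comment> \<open>A one-point probability space makes the stability estimate available for two
    deterministic inputs.\<close>
  define M where "M = return (count_space (UNIV :: unit set)) ()"
  interpret M: prob_space M unfolding M_def by (rule prob_space_return) simp
  have sfM: "sigma_finite_measure M" by unfold_locales
  have iM: "(NINT om|M. k) = k" for k :: ennreal by (simp add: M.emeasure_space_1)
  define s1 where "s1 = sol (zx e I v)"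
  define s2 where "s2 = sol (zx e I w)"
  note z1 = zx_measurable1[OF e, of v] zx_bound[OF e, of _ v] zx_bound0[of v I]
  note z2 = zx_measurable1[OF e, of w] zx_bound[OF e, of _ w] zx_bound0[of w I]
  have [measurable]: "s1 \<in> bm S" "s2 \<in> bm S"
    unfolding s1_def s2_def by (intro sol_measurable1 zx_measurable1 e)+
  define h where "h = (%s. \<Sum>i\<in>I. (v i - w i) *\<^sub>R e i s)"
  have h: "h \<in> DD" unfolding h_def by (rule sum_in[OF e])
  have hh: "ip H h h = (\<Sum>i\<in>I. (v i - w i)^2)"
  proof -
    have "ip H h h = (\<Sum>i\<in>I. (v i - w i) * ip H (e i) h)"
      using ip_sum(1)[OF onbD(1)[OF e] onbD(2)[OF e] h, where c="%i. v i - w i"] unfolding h_def by simp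
    also have "... = (\<Sum>i\<in>I. (v i - w i)^2)"
    proof (rule sum.cong[OF refl])
      fix i assume i: "i \<in> I"
      have "ip H (e i) h = (\<Sum>j\<in>I. (v j - w j) * ip H (e i) (e j))"
        unfolding h_def by (rule ip_sum(2)[OF onbD(1)[OF e] onbD(2)[OF e] onbD(2)[OF e i]])
      also have "... = v i - w i"
        using i onbD(1)[OF e] by (simp add: onbD(3)[OF e] if_distrib[of "%z. _ * z"] cong: if_cong)
      finally show "(v i - w i) * ip H (e i) h = (v i - w i)^2" by (simp add: power2_eq_square)
    qed
    finally show ?thesis .
  qed
  have zd: "zx e I v b - zx e I w b = ip H (g b) h" if b: "b \<in> space S" for b
    unfolding h_def zx_def using ip_sum(2)[OF onbD(1)[OF e] onbD(2)[OF e] g_in[OF b], where c="%i. v i - w i"]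
    by (simp add: sum_subtractf algebra_simps)
  have le: "ennreal \<bar>s1 b - s2 b\<bar> <= ennreal \<bar>ip H (g b) h\<bar> + (NINT c|S. ennreal (\<kappa> b c) * (ennreal L * ennreal \<bar>s1 c - s2 c\<bar>))"
    if b: "b \<in> space S" for b
  proof -
    have "s1 b = zx e I v b + V (%b. f (s1 b)) b" unfolding s1_def by (rule sol_eq[OF z1 b])
    moreover have "s2 b = zx e I w b + V (%b. f (s2 b)) b" unfolding s2_def by (rule sol_eq[OF z2 b])
    ultimately have "\<bar>s1 b - s2 b\<bar> <= \<bar>ip H (g b) h\<bar> + \<bar>V (%b. f (s1 b)) b - V (%b. f (s2 b)) b\<bar>"
      using zd[OF b] by linarith
    then have "ennreal \<bar>s1 b - s2 b\<bar> <= ennreal \<bar>ip H (g b) h\<bar> + ennreal \<bar>V (%b. f (s1 b)) b - V (%b. f (s2 b)) b\<bar>"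
      by (simp add: ennreal_leI flip: ennreal_plus)
    also have "... <= ennreal \<bar>ip H (g b) h\<bar> + (NINT c|S. ennreal (\<kappa> b c) * (ennreal L * ennreal \<bar>s1 c - s2 c\<bar>))"
      by (intro add_left_mono V_diff) (auto simp: s1_def s2_def intro: integrable_sol[OF z1 b] integrable_sol[OF z2 b])
    finally show ?thesis .
  qed
  obtain B where B: "!!b. b \<in> space S ==> \<bar>s1 b - s2 b\<bar> <= B"
  proof -
    have "\<bar>s1 b - s2 b\<bar> <= 2 * (b0 + q * (\<Sum>i\<in>I. \<bar>v i\<bar>) + \<bar>f 0\<bar> * (C0 * T)) * E T + 2 * (b0 + q * (\<Sum>i\<in>I. \<bar>w i\<bar>) + \<bar>f 0\<bar> * (C0 * T)) * E T"
      if b: "b \<in> space S" for b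
      using sol_bound'[OF z1 b] sol_bound'[OF z2 b] unfolding s1_def s2_def by linarith
    then show ?thesis using that by blast
  qed
  note [measurable] = ip_g_measurable[OF h]
  have "(NINT y|N. NINT om|M. (ennreal \<bar>s1 (s, y) - s2 (s, y)\<bar>)^2) <=
      2 * (NINT y|N. NINT om|M. (ennreal \<bar>ip H (g (s, y)) h\<bar>)^2) +
      ennreal (KK * (4 * exp ((2 * KK + 1) * T))) * (NINT a|S. NINT om|M. (ennreal \<bar>ip H (g a) h\<bar>)^2)"
  proof (rule L2_stability(2)[OF sfM, where B="B\<^sup>2"])
    show "(%(om, a). ennreal \<bar>s1 a - s2 a\<bar>) \<in> bm (M \<Otimes>\<^sub>M S)"
      "(%(om, a). ennreal \<bar>ip H (g a) h\<bar>) \<in> bm (M \<Otimes>\<^sub>M S)"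
      by (simp_all add: case_prod_beta')
    show "AE om in M. ennreal \<bar>s1 a - s2 a\<bar> <= ennreal \<bar>ip H (g a) h\<bar> + (NINT b|S. ennreal (\<kappa> a b) * (ennreal L * ennreal \<bar>s1 b - s2 b\<bar>))"
      if "a \<in> space S" for a using le[OF that] by simp
    show "(NINT om|M. (ennreal \<bar>s1 a - s2 a\<bar>)^2) <= ennreal (B\<^sup>2)" if "a \<in> space S" for a
    proof -
      have "\<bar>s1 a - s2 a\<bar>\<^sup>2 <= B\<^sup>2" using B[OF that] by (intro power_mono) auto
      then show ?thesis unfolding iM by (simp add: ennreal_power ennreal_leI)
    qed
  qed (rule s)
  then have "(NINT y|N. (ennreal \<bar>s1 (s, y) - s2 (s, y)\<bar>)^2) <=
      2 * (NINT y|N. (ennreal \<bar>ip H (g (s, y)) h\<bar>)^2) + ennreal (KK * gap) * (NINT a|S. (ennreal \<bar>ip H (g a) h\<bar>)^2)"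
    unfolding iM gap_def .
  also have "... <= 2 * ennreal (l\<^sup>2 * ip H h h) + ennreal (KK * gap) * ennreal (T * (l\<^sup>2 * ip H h h))"
  proof (intro add_mono mult_left_mono)
    show "(NINT y|N. (ennreal \<bar>ip H (g (s, y)) h\<bar>)^2) <= ennreal (l\<^sup>2 * ip H h h)"
      using op[OF h s] by (simp add: ennreal_power)
    have "(NINT a|S. (ennreal \<bar>ip H (g a) h\<bar>)^2) = (NINT r|lborel. (NINT y|N. (ennreal \<bar>ip H (g (r, y)) h\<bar>)^2) * indicator {0..T} r)"
      by (rule nn_integral_S) measurable
    also have "... <= (NINT r|lborel. ennreal (l\<^sup>2 * ip H h h) * indicator {0..T} r)"
      using op[OF h] by (intro nn_integral_mono) (auto simp: ennreal_power indicator_def)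
    also have "... = ennreal (l\<^sup>2 * ip H h h) * ennreal T" using T by (subst nn_integral_cmult_indicator) auto
    finally show "(NINT a|S. (ennreal \<bar>ip H (g a) h\<bar>)^2) <= ennreal (T * (l\<^sup>2 * ip H h h))"
      using T by (simp add: ennreal_mult' mult.commute)
  qed auto
  also have "... = ennreal ((2 + KK * gap * T) * (l\<^sup>2 * ip H h h))"
  proof -
    define w where "w = l\<^sup>2 * ip H h h"
    have w: "0 <= w" using ip_nonneg[of H h] by (simp add: w_def)
    have kg: "0 <= KK * gap" using KK by (simp add: gap_def)
    have "2 * ennreal w = ennreal (2 * w)" using w by (simp add: ennreal_mult')
    moreover have "ennreal (KK * gap) * ennreal (T * w) = ennreal (KK * gap * (T * w))" using kg by (rule ennreal_mult'[symmetric])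
    moreover have "ennreal (2 * w) + ennreal (KK * gap * (T * w)) = ennreal (2 * w + KK * gap * (T * w))"
      using w kg T by (intro ennreal_plus[symmetric]) auto
    moreover have "2 * w + KK * gap * (T * w) = (2 + KK * gap * T) * w" by (simp add: algebra_simps)
    ultimately show ?thesis unfolding w_def[symmetric] by simp
  qed
  finally show ?thesis unfolding hh by (simp add: s1_def s2_def ennreal_power)
qed

end

section \<open>Deviation of occupation functionals\<close>

context spde begin

text \<open>The error on a slice involves the total residual and the residual on the slice. The
  approximation theorem is applied to both in turn, and the second enlargement keeps the first
  residual small.\<close>

lemma slice_approximation:
  assumes s: "s \<in> {0..T}" and \<eta>: "0 < \<eta>"
  shows "\<exists>I e. onb I e \<and> (NINT y|N. NINT om|P. (ennreal \<bar>X om (s, y) - Xn e I om (s, y)\<bar>)^2) <= ennreal \<eta>"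
proof -
  interpret N: finite_measure N by (rule finite_N)
  have sy: "(s, y) \<in> space S" if "y \<in> space N" for y using that s by (simp add: space_S)
  define c where "c = 2 + KK * gap"
  have kg: "0 <= KK * gap" using KK by (simp add: gap_def)
  define \<epsilon> where "\<epsilon> = \<eta> / c"
  have eps: "0 < \<epsilon>" "\<epsilon> * c = \<eta>" using \<eta> kg by (auto simp: \<epsilon>_def c_def)
  have e0: "onb {} (%_ _. 0)" by (simp add: onb_def)
  obtain I1 e1 where 1: "extends {} (%_ _. 0) I1 e1" "(LINT b|S. rho e1 I1 (g b)) < \<epsilon>"
    using finite_dimensional_approximation[OF finite_S g_in g_q q2 Y_measurable Y_W e0 eps(1)] by blast
  have o1: "onb I1 e1" using 1 by (simp add: extends_def)
  have pm: "(%y. (s, y)) \<in> N \<rightarrow>\<^sub>M S"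
    unfolding S_eq using s by (intro measurable_Pair measurable_const) (auto simp: space_restrict_space)
  have Ys: "(%(om, y). Y om (s, y)) \<in> bm (P \<Otimes>\<^sub>M N)"
  proof -
    have "(%p. (fst p, (s, snd p))) \<in> P \<Otimes>\<^sub>M N \<rightarrow>\<^sub>M P \<Otimes>\<^sub>M S"
      using measurable_compose[OF measurable_snd pm] by (intro measurable_Pair) auto
    from measurable_compose[OF this Y_measurable] show ?thesis by (simp add: case_prod_beta')
  qed
  obtain I e where 2: "extends I1 e1 I e" "(LINT y|N. rho e I (g (s, y))) < \<epsilon>"
    using finite_dimensional_approximation[OF finite_N g_in[OF sy] g_q[OF sy] q2 Ys Y_W[OF sy] o1 eps(1)] by blast
  have o: "onb I e" using 2 by (simp add: extends_def)
  have ir: "integrable S (%a. rho e I (g a))" if "onb I e" for I e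
    by (rule S.integrable_const_bound[where B="q\<^sup>2"]) (use rho_g_bounds[OF that] rho_g_measurable[OF that] in auto)
  have "(LINT b|S. rho e I (g b)) <= (LINT b|S. rho e1 I1 (g b))"
    by (intro integral_mono ir o o1 extends_rho_le[OF 2(1)])
  then have "(LINT b|S. rho e I (g b)) <= \<epsilon>" using 1 by simp
  moreover have "(NINT a|S. ennreal (rho e I (g a))) = ennreal (LINT b|S. rho e I (g b))"
    by (rule nn_integral_eq_integral[OF ir[OF o]]) (use rho_g_bounds[OF o] in auto)
  ultimately have r1: "(NINT a|S. ennreal (rho e I (g a))) <= ennreal \<epsilon>" by (simp add: ennreal_leI)
  have irN: "integrable N (%y. rho e I (g (s, y)))"
    by (rule N.integrable_const_bound[where B="q\<^sup>2"])
      (use rho_g_bounds[OF o sy] measurable_compose[OF pm rho_g_measurable[OF o]] in auto)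
  have "(NINT y|N. ennreal (rho e I (g (s, y)))) = ennreal (LINT y|N. rho e I (g (s, y)))"
    by (rule nn_integral_eq_integral[OF irN]) (use rho_g_bounds[OF o sy] in auto)
  then have r2: "(NINT y|N. ennreal (rho e I (g (s, y)))) <= ennreal \<epsilon>" using 2 by (simp add: ennreal_leI)
  have "(NINT y|N. NINT om|P. (ennreal \<bar>X om (s, y) - Xn e I om (s, y)\<bar>)^2) <=
      2 * (NINT y|N. ennreal (rho e I (g (s, y)))) + ennreal (KK * gap) * (NINT a|S. ennreal (rho e I (g a)))"
    by (rule approximation_error(2)[OF o s])
  also have "... <= 2 * ennreal \<epsilon> + ennreal (KK * gap) * ennreal \<epsilon>"
    by (intro add_mono mult_left_mono r1 r2) auto
  also have "... = ennreal (2 * \<epsilon>) + ennreal (KK * gap * \<epsilon>)" using kg eps by (simp add: ennreal_mult')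
  also have "... = ennreal \<eta>"
    using kg eps by (subst ennreal_plus[symmetric]) (auto simp: c_def algebra_simps)
  finally show ?thesis using o by blast
qed

text \<open>For a finite family the functional is a Lipschitz function of independent standard
  normals, by Cauchy--Schwarz over space and \<open>field_lipschitz\<close>. The resulting deviation
  bound is the same for all families and therefore survives the limit.\<close>

theorem occupation_functional_deviation:
  assumes l: "0 < l" and s: "s \<in> {0..T}"
    and op: "!!h s. h \<in> DD ==> s \<in> {0..T} ==> (NINT y|N. ennreal ((ip H (g (s, y)) h)^2)) <= ennreal (l\<^sup>2 * ip H h h)"
    and \<Gamma>[measurable]: "\<Gamma> \<in> sets N" and \<phi>[measurable]: "\<phi> \<in> bm borel"
    and \<phi>1: "!!x. \<bar>\<phi> x\<bar> <= 1" and Lp: "0 < Lp" and \<phi>L: "!!x y. \<bar>\<phi> x - \<phi> y\<bar> <= Lp * \<bar>x - y\<bar>"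
  defines "M \<equiv> %om. LINT y|N. indicator \<Gamma> y * \<phi> (X om (s, y))"
  shows "M \<in> bm P" "!!om. \<bar>M om\<bar> <= measure N (space N)"
    "(LINT om|P. \<bar>M om - (LINT om|P. M om)\<bar>) <= 3 * (Lp * l * sqrt ((measure N (space N) + 1) * (2 + KK * gap * T)))"
proof -
  interpret N: finite_measure N by (rule finite_N)
  interpret PN: pair_sigma_finite P N ..
  define mN where "mN = measure N (space N)"
  have mN: "0 <= mN" by (simp add: mN_def)
  have kg: "0 <= KK * gap * T" using KK T by (simp add: gap_def)
  have sy: "(s, y) \<in> space S" if "y \<in> space N" for y using that s by (simp add: space_S)
  have pm[measurable]: "(%y. (s, y)) \<in> N \<rightarrow>\<^sub>M S"
    unfolding S_eq using s by (intro measurable_Pair measurable_const) (auto simp: space_restrict_space)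
  have lift: "(%(om, y). Z om (s, y)) \<in> bm (M' \<Otimes>\<^sub>M N)"
    if "(%(om, a). Z om a) \<in> bm (M' \<Otimes>\<^sub>M S)" for M' :: "'c measure" and Z
  proof -
    have "(%p. (fst p, (s, snd p))) \<in> M' \<Otimes>\<^sub>M N \<rightarrow>\<^sub>M M' \<Otimes>\<^sub>M S"
      using measurable_compose[OF measurable_snd pm] by (intro measurable_Pair) auto
    from measurable_compose[OF this that] show ?thesis by (simp add: case_prod_beta')
  qed
  define A where "A u = (LINT y|N. indicator \<Gamma> y * \<phi> (u y))" for u
  have iA: "integrable N (%y. indicator \<Gamma> y * \<phi> (u y))" if [measurable]: "u \<in> bm N" for u
    by (rule N.integrable_const_bound[where B=1]) (use \<phi>1 in \<open>auto simp: indicator_def\<close>)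
  have A_bd: "\<bar>A u\<bar> <= mN" for u
  proof (cases "integrable N (%y. indicator \<Gamma> y * \<phi> (u y))")
    case True
    have "\<bar>A u\<bar> <= (LINT y|N. \<bar>indicator \<Gamma> y * \<phi> (u y)\<bar>)" unfolding A_def by (rule integral_abs_bound)
    also have "... <= (LINT y|N. 1)" using True \<phi>1 by (intro integral_mono) (auto simp: indicator_def)
    finally show ?thesis by (simp add: mN_def)
  next
    case False then show ?thesis using mN by (simp add: A_def not_integrable_integral_eq)
  qed
  have A_meas: "(%om. A (%y. Z om (s, y))) \<in> bm M'"
    if Z: "(%(om, a). Z om a) \<in> bm (M' \<Otimes>\<^sub>M S)" for M' :: "'c measure" and Z
  proof -
    have [measurable]: "(%p. Z (fst p) (s, snd p)) \<in> bm (M' \<Otimes>\<^sub>M N)" using lift[OF Z] by (simp add: case_prod_beta')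
    show ?thesis unfolding A_def by (rule N.borel_measurable_lebesgue_integral) (simp add: case_prod_beta')
  qed
  have A_diff: "ennreal \<bar>A u - A v\<bar> <= ennreal Lp * (NINT y|N. ennreal \<bar>u y - v y\<bar>)"
    if [measurable]: "u \<in> bm N" "v \<in> bm N" for u v
  proof -
    have "A u - A v = (LINT y|N. indicator \<Gamma> y * \<phi> (u y) - indicator \<Gamma> y * \<phi> (v y))"
      unfolding A_def by (rule Bochner_Integration.integral_diff[OF iA iA, symmetric]) measurable
    then have "ennreal \<bar>A u - A v\<bar> = ennreal (norm (LINT y|N. indicator \<Gamma> y * \<phi> (u y) - indicator \<Gamma> y * \<phi> (v y)))" by simp
    also have "... <= (NINT y|N. ennreal (norm (indicator \<Gamma> y * \<phi> (u y) - indicator \<Gamma> y * \<phi> (v y))))"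
      by (intro integral_norm_bound_ennreal Bochner_Integration.integrable_diff iA) measurable
    also have "... <= (NINT y|N. ennreal Lp * ennreal \<bar>u y - v y\<bar>)"
      using \<phi>L Lp by (intro nn_integral_mono) (auto simp: indicator_def ennreal_mult'[symmetric] intro!: ennreal_leI)
    also have "... = ennreal Lp * (NINT y|N. ennreal \<bar>u y - v y\<bar>)" by (rule nn_integral_cmult) measurable
    finally show ?thesis .
  qed
  have M_A: "M = (%om. A (%y. X om (s, y)))" by (simp add: M_def A_def)
  show Mm[measurable]: "M \<in> bm P" unfolding M_A by (rule A_meas[OF X_measurable])
  show Mb: "\<bar>M om\<bar> <= measure N (space N)" for om using A_bd by (simp add: M_A mN_def)
  have iM: "integrable P M" by (rule integrable_const_bound[where B=mN]) (use Mb in \<open>auto simp: mN_def\<close>)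
  \<comment> \<open>\<open>mN + 1\<close> in place of \<open>mN\<close> makes \<open>c\<close>
    positive, as the concentration bound requires.\<close>
  define c where "c = Lp * l * sqrt ((mN + 1) * (2 + KK * gap * T))"
  have c: "0 < c" using Lp l mN kg by (simp add: c_def add_nonneg_pos add_pos_nonneg)
  have c2: "c\<^sup>2 = Lp\<^sup>2 * (mN + 1) * ((2 + KK * gap * T) * l\<^sup>2)"
    using mN kg by (simp add: c_def power_mult_distrib mult_ac)
  show "(LINT om|P. \<bar>M om - (LINT om|P. M om)\<bar>) <= 3 * (Lp * l * sqrt ((measure N (space N) + 1) * (2 + KK * gap * T)))"
    unfolding mN_def[symmetric] c_def[symmetric]
  proof (rule le_from_linear_slack[of 1 "2 * (Lp * (mN + 1))"])
    show "0 < 2 * (Lp * (mN + 1))" using Lp mN by simp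
    fix d :: real assume d: "0 < d"
    obtain I e where o: "onb I e" and ap: "(NINT y|N. NINT om|P. (ennreal \<bar>X om (s, y) - Xn e I om (s, y)\<bar>)^2) <= ennreal (d * d)"
      using slice_approximation[OF s, of "d * d"] d by auto
    define F where "F x = A (%y. sol (zx e I x) (s, y))" for x
    have Fm: "F \<in> bm (Pi\<^sub>M I (%_. borel))"
      unfolding F_def[abs_def] by (rule A_meas[OF sol_measurable[OF zx_measurable[OF o]]]) (rule measurable_component_singleton)
    have Flip: "(F v - F w)^2 <= c\<^sup>2 * (\<Sum>i\<in>I. (v i - w i)^2)" for v w
    proof -
      have [measurable]: "(%y. sol (zx e I x) (s, y)) \<in> bm N" for x
        by (rule measurable_compose[OF pm sol_measurable1[OF zx_measurable1[OF o]]])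
      define D where "D y = \<bar>sol (zx e I v) (s, y) - sol (zx e I w) (s, y)\<bar>" for y
      have [measurable]: "D \<in> bm N" unfolding D_def[abs_def] by measurable
      define ss where "ss = (\<Sum>i\<in>I. (v i - w i)^2)"
      have ss: "0 <= ss" by (simp add: ss_def sum_nonneg)
      have "ennreal ((F v - F w)^2) = (ennreal \<bar>F v - F w\<bar>)^2" by (simp add: ennreal_power)
      also have "... <= (ennreal Lp * (NINT y|N. ennreal (D y)))^2"
        unfolding F_def D_def by (intro power_mono A_diff) auto
      also have "... = (ennreal Lp)^2 * (NINT y|N. ennreal (D y) * 1)^2" by (simp add: power_mult_distrib)
      also have "... <= (ennreal Lp)^2 * ((NINT y|N. (ennreal (D y))^2) * (NINT y|N. 1\<^sup>2))"
        by (intro mult_left_mono Cauchy_Schwarz_nn_integral) auto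
      also have "... <= (ennreal Lp)^2 * (ennreal ((2 + KK * gap * T) * (l\<^sup>2 * ss)) * ennreal (mN + 1))"
      proof (intro mult_left_mono mult_mono)
        show "(NINT y|N. (ennreal (D y))^2) <= ennreal ((2 + KK * gap * T) * (l\<^sup>2 * ss))"
          using field_lipschitz[OF o l s op, of v w] by (simp add: D_def ss_def ennreal_power)
        show "(NINT y|N. 1\<^sup>2) <= ennreal (mN + 1)"
          using mN by (simp add: mN_def N.emeasure_eq_measure ennreal_leI del: ennreal_plus)
      qed auto
      also have "... = ennreal (c\<^sup>2 * ss)"
        using Lp mN kg ss by (simp add: c2 ennreal_power ennreal_mult'[symmetric] mult_ac del: ennreal_plus)
      finally have "ennreal ((F v - F w)^2) <= ennreal (c\<^sup>2 * ss)" .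
      then show ?thesis using ss unfolding ss_def[symmetric] by (subst (asm) ennreal_le_iff) auto
    qed
    define Mn where "Mn om = A (%y. Xn e I om (s, y))" for om
    have Mn: "Mn om = F (\<lambda>i\<in>I. W (e i) om)" for om by (simp add: Mn_def F_def zx_restrict Xn_def)
    have [measurable]: "Mn \<in> bm P" unfolding Mn_def[abs_def] by (rule A_meas[OF Xn_measurable[OF o]])
    have iMn: "integrable P Mn" by (rule integrable_const_bound[where B=mN]) (use A_bd in \<open>auto simp: Mn_def\<close>)
    have wm: "(%om. \<lambda>i\<in>I. W (e i) om) \<in> P \<rightarrow>\<^sub>M Pi\<^sub>M I (%_. borel)"
      by (intro measurable_restrict W_measurable onbD(2)[OF o])
    have tr: "(LINT om|P. k (\<lambda>i\<in>I. W (e i) om)) = (LINT x|Pi\<^sub>M I (%_. std_normal_distribution). k x)"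
      if "k \<in> bm (Pi\<^sub>M I (%_. borel))" for k :: "(nat => real) => real"
      unfolding W_joint_law[OF o, symmetric] by (rule integral_distr[OF wm that, symmetric])
    have dev: "(LINT om|P. \<bar>Mn om - (LINT om|P. Mn om)\<bar>) <= 3 * c"
    proof -
      have "(LINT om|P. Mn om) = (LINT x|Pi\<^sub>M I (%_. std_normal_distribution). F x)" unfolding Mn by (rule tr[OF Fm])
      moreover have "(LINT om|P. \<bar>Mn om - m\<bar>) = (LINT x|Pi\<^sub>M I (%_. std_normal_distribution). \<bar>F x - m\<bar>)" for m
        unfolding Mn by (intro tr borel_measurable_abs borel_measurable_diff borel_measurable_const Fm)
      ultimately show ?thesis
        using std_normal_PiM_lipschitz_deviation[OF onbD(1)[OF o] Fm _ c Flip, of mN] A_bd by (simp add: F_def)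
    qed
    have xm[measurable]: "(%p. X (fst p) (s, snd p)) \<in> bm (P \<Otimes>\<^sub>M N)" "(%p. Xn e I (fst p) (s, snd p)) \<in> bm (P \<Otimes>\<^sub>M N)"
      using lift[OF X_measurable] lift[OF Xn_measurable[OF o]] by (simp_all add: case_prod_beta')
    have xm': "(%y. X om (s, y)) \<in> bm N" "(%y. Xn e I om (s, y)) \<in> bm N" if "om \<in> space P" for om
      using measurable_compose[OF measurable_Pair1'[OF that] xm(1)] measurable_compose[OF measurable_Pair1'[OF that] xm(2)] by simp_all
    have near: "(LINT om|P. \<bar>M om - Mn om\<bar>) <= Lp * (mN + 1) * d"
    proof -
      have "ennreal (LINT om|P. \<bar>M om - Mn om\<bar>) = (NINT om|P. ennreal \<bar>M om - Mn om\<bar>)"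
        using iM iMn by (intro nn_integral_eq_integral[symmetric]) auto
      also have "... <= (NINT om|P. ennreal Lp * (NINT y|N. ennreal \<bar>X om (s, y) - Xn e I om (s, y)\<bar>))"
        unfolding M_A Mn_def by (intro nn_integral_mono A_diff xm')
      also have "... = ennreal Lp * (NINT om|P. NINT y|N. ennreal \<bar>X om (s, y) - Xn e I om (s, y)\<bar>)"
        by (rule nn_integral_cmult) (rule N.borel_measurable_nn_integral, simp add: case_prod_beta')
      also have "(NINT om|P. NINT y|N. ennreal \<bar>X om (s, y) - Xn e I om (s, y)\<bar>) = (NINT y|N. NINT om|P. ennreal \<bar>X om (s, y) - Xn e I om (s, y)\<bar>)"
        by (rule PN.Fubini'[symmetric]) (simp add: case_prod_beta')
      also have "... <= (NINT y|N. ennreal d + ennreal (1 / d) * (NINT om|P. (ennreal \<bar>X om (s, y) - Xn e I om (s, y)\<bar>)^2))"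
      proof (rule nn_integral_mono)
        fix y assume y: "y \<in> space N"
        note [measurable] = X_section[OF sy[OF y]] section_M[OF Xn_measurable[OF o] sy[OF y]]
        have "(NINT om|P. ennreal \<bar>X om (s, y) - Xn e I om (s, y)\<bar>) <= (NINT om|P. ennreal d + ennreal (1 / d) * (ennreal \<bar>X om (s, y) - Xn e I om (s, y)\<bar>)^2)"
        proof (rule nn_integral_mono)
          fix om
          have "\<bar>X om (s, y) - Xn e I om (s, y)\<bar> <= d + (1 / d) * \<bar>X om (s, y) - Xn e I om (s, y)\<bar>\<^sup>2"
            using abs_mult_le_weighted[OF d, of 1 "X om (s, y) - Xn e I om (s, y)"] by simp
          then have "ennreal \<bar>X om (s, y) - Xn e I om (s, y)\<bar> <= ennreal (d + (1 / d) * \<bar>X om (s, y) - Xn e I om (s, y)\<bar>\<^sup>2)" by (rule ennreal_leI)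
          also have "... = ennreal d + ennreal (1 / d) * (ennreal \<bar>X om (s, y) - Xn e I om (s, y)\<bar>)^2"
            using d by (subst ennreal_plus) (auto simp: ennreal_mult'[symmetric] ennreal_power)
          finally show "ennreal \<bar>X om (s, y) - Xn e I om (s, y)\<bar> <= ennreal d + ennreal (1 / d) * (ennreal \<bar>X om (s, y) - Xn e I om (s, y)\<bar>)^2" .
        qed
        also have "... = ennreal d + ennreal (1 / d) * (NINT om|P. (ennreal \<bar>X om (s, y) - Xn e I om (s, y)\<bar>)^2)"
          by (subst nn_integral_add) (auto simp: nn_integral_cmult emeasure_space_1)
        finally show "(NINT om|P. ennreal \<bar>X om (s, y) - Xn e I om (s, y)\<bar>) <= ennreal d + ennreal (1 / d) * (NINT om|P. (ennreal \<bar>X om (s, y) - Xn e I om (s, y)\<bar>)^2)" .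
      qed
      also have "... = ennreal d * emeasure N (space N) + ennreal (1 / d) * (NINT y|N. NINT om|P. (ennreal \<bar>X om (s, y) - Xn e I om (s, y)\<bar>)^2)"
      proof -
        have "(%p. (ennreal \<bar>X (snd p) (s, fst p) - Xn e I (snd p) (s, fst p)\<bar>)^2) \<in> bm (N \<Otimes>\<^sub>M P)"
          using measurable_compose[OF measurable_pair_swap' xm(1)] measurable_compose[OF measurable_pair_swap' xm(2)]
          by (simp add: case_prod_beta')
        then have [measurable]: "(%y. NINT om|P. (ennreal \<bar>X om (s, y) - Xn e I om (s, y)\<bar>)^2) \<in> bm N"
          by (intro borel_measurable_nn_integral) (simp add: case_prod_beta')
        show ?thesis by (subst nn_integral_add) (auto simp: nn_integral_cmult)
      qed
      also have "... <= ennreal d * ennreal mN + ennreal (1 / d) * ennreal (d * d)"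
        by (intro add_mono mult_left_mono ap) (auto simp: mN_def N.emeasure_eq_measure)
      also have "... = ennreal ((mN + 1) * d)"
        using d mN by (simp add: ennreal_mult'[symmetric] ennreal_plus[symmetric] algebra_simps del: ennreal_plus)
      finally have "ennreal (LINT om|P. \<bar>M om - Mn om\<bar>) <= ennreal (Lp * (mN + 1) * d)"
        using Lp by (simp add: mult_left_mono ennreal_mult' mult.assoc)
      then show ?thesis using Lp d mN by (subst (asm) ennreal_le_iff) auto
    qed
    define m where "m = (LINT om|P. M om)"
    define mn where "mn = (LINT om|P. Mn om)"
    have "\<bar>m - mn\<bar> = \<bar>LINT om|P. M om - Mn om\<bar>" unfolding m_def mn_def using iM iMn by simp
    also have "... <= (LINT om|P. \<bar>M om - Mn om\<bar>)" by (rule integral_abs_bound)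
    finally have mm: "\<bar>m - mn\<bar> <= Lp * (mN + 1) * d" using near by simp
    have "(LINT om|P. \<bar>M om - m\<bar>) <= (LINT om|P. (\<bar>Mn om - mn\<bar> + \<bar>M om - Mn om\<bar>) + \<bar>m - mn\<bar>)"
      using iM iMn by (intro integral_mono Bochner_Integration.integrable_add integrable_abs Bochner_Integration.integrable_diff) auto
    also have "... = (LINT om|P. \<bar>Mn om - mn\<bar>) + (LINT om|P. \<bar>M om - Mn om\<bar>) + \<bar>m - mn\<bar>"
      using iM iMn by (simp add: prob_space)
    finally show "(LINT om|P. \<bar>M om - (LINT om|P. M om)\<bar>) <= 3 * c + 2 * (Lp * (mN + 1)) * d"
      using dev near mm by (simp add: m_def[symmetric] mn_def[symmetric])
  qed simp
qed

end

section \<open>Measurability and approximation in Hilbert spaces\<close>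

text \<open>The equation is posed with Lebesgue measurable functions, whereas the product measures
  of the proof are formed from Borel ones. For Borel integrands the two integrals agree.\<close>

lemma lebesgue_on_borel:
  fixes h :: "'a::euclidean_space => 'b::{banach, second_countable_topology}"
  assumes S: "S \<in> sets borel" and h: "h \<in> bm (restrict_space lborel S)"
  shows "integrable (lebesgue_on S) h \<longleftrightarrow> integrable (restrict_space lborel S) h"
    and "(LINT x|lebesgue_on S. h x) = (LINT x|restrict_space lborel S. h x)"
proof -
  have m: "(%x. indicator S x *\<^sub>R h x) \<in> bm lborel"
    using h S by (subst (asm) borel_measurable_restrict_space_iff) auto
  show "integrable (lebesgue_on S) h \<longleftrightarrow> integrable (restrict_space lborel S) h"
    using S m by (simp add: integrable_restrict_space integrable_completion)
  show "(LINT x|lebesgue_on S. h x) = (LINT x|restrict_space lborel S. h x)"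
    using S m by (simp add: integral_restrict_space integral_completion)
qed

lemma nn_integral_lebesgue_on_borel:
  assumes S: "S \<in> sets borel"
  shows "(NINT x|(lebesgue_on S). h x) = (NINT x|(restrict_space lborel S). h x)"
  using S by (simp add: nn_integral_restrict_space nn_integral_completion)

lemma lebesgue_on_borel_version:
  fixes w :: "'a::euclidean_space => real"
  assumes S: "S \<in> sets borel" and w: "w \<in> bm (lebesgue_on S)"
  obtains v where "v \<in> bm borel" "AE x in lebesgue_on S. w x = v x"
proof -
  have "(%x. indicator S x *\<^sub>R w x) \<in> bm lebesgue"
    using w S by (subst (asm) borel_measurable_restrict_space_iff) auto
  then obtain v where v: "v \<in> bm lborel" "AE x in lborel. indicator S x *\<^sub>R w x = v x"
    using completion_ex_borel_measurable_real by blast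
  have "AE x in lebesgue. indicator S x *\<^sub>R w x = v x" using v(2) by (rule AE_completion)
  then have "AE x in lebesgue_on S. w x = v x"
    using S by (subst AE_restrict_space_iff) (auto elim: eventually_mono simp: indicator_def)
  then show ?thesis using v(1) that by simp
qed

text \<open>Pettis' theorem. Pairings with a dense set give all pairings by limits; a countable
  dense set then gives the distances \<open>norm (h r - z)\<close>, and every open set is a
  countable union of balls.\<close>

lemma weakly_measurable_imp_measurable:
  fixes h :: "'s => 'h::{real_inner, second_countable_topology}"
  assumes w: "!!z. z \<in> Z ==> (%r. h r \<bullet> z) \<in> bm M" and Z: "closure Z = UNIV"
  shows "h \<in> bm M"
proof -
  have w'[measurable]: "(%r. h r \<bullet> z) \<in> bm M" for z
  proof -
    obtain u where u: "!!n. u n \<in> Z" "u \<longlonglongrightarrow> z" using Z closure_sequential[of z Z] by auto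
    show ?thesis
      by (rule borel_measurable_LIMSEQ_real[where u="%n r. h r \<bullet> u n"])
        (use u w in \<open>auto intro: tendsto_intros\<close>)
  qed
  obtain D :: "'h set" where D: "countable D" "!!X. open X ==> X \<noteq> {} ==> \<exists>d\<in>D. d \<in> X"
    by (rule countable_dense_setE) blast
  have n[measurable]: "(%r. norm (h r - z)) \<in> bm M" for z
  proof (rule borel_measurable_iff_greater[THEN iffD2], intro allI)
    fix c :: real
    \<comment> \<open>The norm is a supremum of normalised pairings, and an element of
      \<open>D\<close> close to \<open>x\<close> nearly attains it. The countable form is what makes
      the level sets measurable.\<close>
    have eq: "(c < norm x) \<longleftrightarrow> c < 0 \<or> (\<exists>d\<in>D. c * norm d < x \<bullet> d)" for x :: 'h
    proof (intro iffI)
      assume c: "c < norm x"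
      show "c < 0 \<or> (\<exists>d\<in>D. c * norm d < x \<bullet> d)"
      proof (cases "c < 0")
        case False
        have "open {d. c * norm d < x \<bullet> d}" by (intro open_Collect_less continuous_intros)
        moreover have "x \<in> {d. c * norm d < x \<bullet> d}"
          using c False by (auto simp: power2_norm_eq_inner[symmetric] power2_eq_square intro!: mult_strict_right_mono)
        ultimately show ?thesis using D(2)[of "{d. c * norm d < x \<bullet> d}"] by auto
      qed simp
    next
      assume "c < 0 \<or> (\<exists>d\<in>D. c * norm d < x \<bullet> d)"
      then show "c < norm x"
      proof
        assume "c < 0" then show ?thesis using norm_ge_zero[of x] by linarith
      next
        assume "\<exists>d\<in>D. c * norm d < x \<bullet> d"
        then obtain d where "c * norm d < x \<bullet> d" by blast
        then have "c * norm d < norm x * norm d" using norm_cauchy_schwarz[of x d] by linarith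
        then show ?thesis by (rule mult_right_less_imp_less) simp
      qed
    qed
    have "{r \<in> space M. c < norm (h r - z)} = {r \<in> space M. c < 0 \<or> (\<exists>d\<in>D. c * norm d < h r \<bullet> d - z \<bullet> d)}"
      unfolding eq by (simp add: inner_diff_left)
    also have "... = (if c < 0 then space M else (\<Union>d\<in>D. {r \<in> space M. c * norm d < h r \<bullet> d - z \<bullet> d}))" by auto
    also have "... \<in> sets M" using D(1) by (auto intro!: sets.countable_UN'')
    finally show "{r \<in> space M. c < norm (h r - z)} \<in> sets M" .
  qed
  show ?thesis
  proof (rule borel_measurableI)
    fix O' :: "'h set" assume O: "open O'"
    define I where "I = {p \<in> D \<times> \<rat>. ball (fst p) (snd p) \<subseteq> O'}"
    have I: "countable I" unfolding I_def using D(1) countable_rat by (intro countable_Collect countable_SIGMA) auto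
    have "x \<in> (\<Union>p\<in>I. ball (fst p) (snd p))" if x: "x \<in> O'" for x
    proof -
      obtain e where e: "0 < e" "ball x e \<subseteq> O'" using O x openE by blast
      obtain k where k: "k \<in> \<rat>" "0 < k" "k < e / 2" using Rats_dense_in_real[of 0 "e / 2"] e by auto
      obtain d where d: "d \<in> D" "d \<in> ball x k" using D(2)[of "ball x k"] k by auto
      have "ball d k \<subseteq> ball x e"
      proof
        fix z assume "z \<in> ball d k"
        then show "z \<in> ball x e" using d k dist_triangle[of x z d] by (simp add: dist_commute)
      qed
      then have "(d, k) \<in> I" using d k e by (auto simp: I_def)
      then show ?thesis using d by (force simp: dist_commute)
    qed
    then have "O' = (\<Union>p\<in>I. ball (fst p) (snd p))" by (auto simp: I_def)
    then have "h -` O' \<inter> space M = (\<Union>p\<in>I. {r \<in> space M. h r \<in> ball (fst p) (snd p)})" by blast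
    also have "... = (\<Union>p\<in>I. {r \<in> space M. norm (h r - fst p) < snd p})"
      by (simp add: dist_norm norm_minus_commute)
    also have "... \<in> sets M" using I by (intro sets.countable_UN'') auto
    finally show "h -` O' \<inter> space M \<in> sets M" .
  qed
qed

text \<open>The values are chosen in \<open>D\<close> itself and not merely in its image: for
  elements of L2 the operator \<open>Q\<close> and hence the pairing with the noise are
  explicit.\<close>

lemma simple_approximation_in_dense_image:
  fixes h :: "'s => 'h::{real_normed_vector, second_countable_topology}"
  assumes h: "h \<in> bm M" and D: "closure (\<iota> ` D) = UNIV"
  obtains U where "!!i. simple_function M (U i)" "!!i x. U i x \<in> D"
    "!!x. x \<in> space M ==> (%i. \<iota> (U i x)) \<longlonglongrightarrow> h x"
    "!!i x. x \<in> space M ==> norm (\<iota> (U i x)) <= 2 * norm (h x) + 1"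
proof -
  obtain F where F: "!!i. simple_function M (F i)" "!!x. x \<in> space M ==> (%i. F i x) \<longlonglongrightarrow> h x"
    "!!i x. x \<in> space M ==> dist (F i x) 0 <= 2 * dist (h x) 0"
    using borel_measurable_implies_sequence_metric[OF h, of 0] by blast
  have "\<exists>u\<in>D. dist (\<iota> u) z < 1 / real (Suc i)" for z and i :: nat
  proof -
    have "z \<in> closure (\<iota> ` D)" using D by simp
    then show ?thesis unfolding closure_approachable by (auto dest: spec[of _ "1 / real (Suc i)"])
  qed
  then have "\<exists>c. \<forall>i z. c i z \<in> D \<and> dist (\<iota> (c i z)) z < 1 / real (Suc i)"
    by (intro choice allI) blast
  then obtain c where c: "!!i z. c i z \<in> D" "!!i z. dist (\<iota> (c i z)) z < 1 / real (Suc i)" by blast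
  show ?thesis
  proof (rule that[of "%i x. c i (F i x)"])
    show "simple_function M (%x. c i (F i x))" for i
      using simple_function_compose[OF F(1)[of i], of "c i"] by (simp add: comp_def)
    show "c i (F i x) \<in> D" for i x by (rule c(1))
    fix x assume x: "x \<in> space M"
    have "(%i. dist (\<iota> (c i (F i x))) (F i x)) \<longlonglongrightarrow> 0"
      by (rule tendsto_sandwich[OF _ _ tendsto_const LIMSEQ_inverse_real_of_nat])
        (use c(2) less_imp_le in \<open>auto simp: inverse_eq_divide intro!: always_eventually\<close>)
    then have "(%i. (\<iota> (c i (F i x)) - F i x) + F i x) \<longlonglongrightarrow> 0 + h x"
      by (intro tendsto_add F(2) x) (simp add: dist_norm tendsto_norm_zero_iff)
    then show "(%i. \<iota> (c i (F i x))) \<longlonglongrightarrow> h x" by simp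
    fix i
    have "1 / real (Suc i) <= 1" by simp
    then have "dist (\<iota> (c i (F i x))) (F i x) <= 1" using c(2)[of i "F i x"] by linarith
    then show "norm (\<iota> (c i (F i x))) <= 2 * norm (h x) + 1"
      using F(3)[OF x, of i] dist_triangle[of "\<iota> (c i (F i x))" 0 "F i x"] by simp
  qed
qed

lemma nn_integral_lebesgue_on_shift:
  fixes F :: "real => ennreal"
  assumes F: "F \<in> bm (lebesgue_on {r..r + t})"
  shows "(NINT s|(lebesgue_on {0..t}). F (r + s)) = (NINT s|(lebesgue_on {r..r + t}). F s)"
proof -
  have m: "(%s. F s * indicator {r..r + t} s) \<in> bm lebesgue"
    using F by (subst (asm) borel_measurable_restrict_space_iff_ennreal) auto
  have "(NINT s|(lebesgue_on {r..r + t}). F s) = (NINT s|lebesgue. F s * indicator {r..r + t} s)"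
    by (simp add: nn_integral_restrict_space)
  also have "... = (NINT s|lebesgue. F (r + s) * indicator {r..r + t} (r + s))"
    using nn_integral_real_affine_lebesgue[OF m, of 1 r] by simp
  also have "... = (NINT s|lebesgue. F (r + s) * indicator {0..t} s)"
    by (intro nn_integral_cong) (auto simp: indicator_def)
  finally show ?thesis by (simp add: nn_integral_restrict_space)
qed

section \<open>The diffusion model\<close>

text \<open>One fixed diffusivity. The constants \<open>C0\<close>, \<open>L\<close>,
  \<open>Kb\<close>, \<open>Cl\<close>, \<open>Cu\<close>, \<open>\<alpha>\<close> and
  \<open>bX\<close> are parameters and not obtained inside, so whatever is built from them alone is
  the same for all diffusivities. \<open>Q_bound\<close> reflects that \<open>Q u\<close> is
  \<open>B\<close> applied to the adjoint image of \<open>u\<close>, whose norm is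
  \<open>norm (\<iota> u)\<close>.\<close>

locale diffusion_model =
  fixes \<Lambda> \<Gamma> :: "'a::euclidean_space set" and T :: real and Q :: "('a => real) => 'a => real"
    and \<iota> :: "('a => real) => 'h::{real_inner,banach,second_countable_topology}"
    and P :: "'w measure" and W :: "(real => 'h) => 'w => real" and G :: "'a green" and f :: "real => real"
    and X0 :: "'a => real" and \<nu> \<sigma> :: real and X :: "real => 'a => 'w => real" and C0 L Kb Cl Cu \<alpha> bX :: real
  assumes T: "0 < T" and open_\<Lambda>: "open \<Lambda>" and bounded_\<Lambda>: "bounded \<Lambda>" and \<Gamma>_subset: "\<Gamma> \<subseteq> \<Lambda>" and \<Gamma>_lebesgue: "\<Gamma> \<in> sets lebesgue"
    and completion: "is_completion \<Lambda> Q \<iota>" and Q_L2: "!!u. u \<in> L2 \<Lambda> ==> Q u \<in> L2 \<Lambda>" and Kb: "0 < Kb"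
    and Q_bound: "!!u. u \<in> L2 \<Lambda> ==> (LINT x|lebesgue_on \<Lambda>. (Q u x)^2) <= Kb\<^sup>2 * (norm (\<iota> u))^2"
    and P: "prob_space P" and iso: "isonormal P T W"
    and X0_cont: "continuous_on \<Lambda> X0" and X0_bound: "!!y. y \<in> \<Lambda> ==> \<bar>X0 y\<bar> <= bX" and bX: "0 <= bX"
    and \<sigma>: "0 < \<sigma>" and L: "0 <= L" and f_lip: "!!x y. \<bar>f x - f y\<bar> <= L * \<bar>x - y\<bar>" and C0: "0 < C0"
    and G_measurable: "(%(t, s, y, \<eta>). G \<nu> t s y \<eta>) \<in> bm (restrict_space borel
           {(t, s, y, \<eta>). 0 <= s \<and> s < t \<and> t <= T \<and> y \<in> \<Lambda> \<and> \<eta> \<in> \<Lambda>})"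
    and G_nonneg: "!!s t y \<eta>. 0 <= s ==> s < t ==> t <= T ==> y \<in> \<Lambda> ==> \<eta> \<in> \<Lambda> ==> 0 <= G \<nu> t s y \<eta>"
    and evolution_bound: "!!s t u. 0 <= s ==> s < t ==> t <= T ==> u \<in> L2 \<Lambda> ==>
           (AE y in lebesgue_on \<Lambda>. integrable (lebesgue_on \<Lambda>) (%\<eta>. G \<nu> t s y \<eta> * u \<eta>)) \<and>
           evolution \<Lambda> G \<nu> t s u \<in> L2 \<Lambda> \<and>
           L2_norm \<Lambda> (evolution \<Lambda> G \<nu> t s u) <= C0 * L2_norm \<Lambda> u"
    and G_L1: "!!s t y. 0 <= s ==> s < t ==> t <= T ==> y \<in> \<Lambda> ==>
           integrable (lebesgue_on \<Lambda>) (G \<nu> t s y) \<and> (LINT \<eta>|lebesgue_on \<Lambda>. \<bar>G \<nu> t s y \<eta>\<bar>) <= C0"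
    and G_represented: "!!t y. t \<in> {0..T} ==> y \<in> \<Lambda> ==> AE s in lebesgue_on {0..t}. \<exists>h. represents \<Lambda> Q \<iota> (G \<nu> t s y) h"
    and Cl: "0 < Cl" "Cl <= Cu" and \<alpha>: "0 < \<alpha>"
    and noise_upper: "!!r t y. r \<in> {0..<T} ==> t \<in> {0..T - r} ==> y \<in> \<Lambda> ==> ennreal (\<sigma>\<^sup>2) *
           (NINT s|(lebesgue_on {0..t}). ennreal ((norm (to_H \<Lambda> Q \<iota> (G \<nu> (r + t) (r + s) y)))^2)) <= ennreal (Cu * t powr \<alpha>)"
    and noise_lower: "!!r t y. r \<in> {0..<T} ==> t \<in> {0..T - r} ==> y \<in> \<Gamma> ==> ennreal (Cl * t powr \<alpha>) <= ennreal (\<sigma>\<^sup>2) *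
           (NINT s|(lebesgue_on {0..t}). ennreal ((norm (to_H \<Lambda> Q \<iota> (G \<nu> (r + t) (r + s) y)))^2))"
    and solution: "random_field_solution P \<Lambda> T Q \<iota> W G f X0 \<nu> \<sigma> X"
begin

definition N where "N = restrict_space lborel \<Lambda>"

definition S where "S = restrict_space lborel {0..T} \<Otimes>\<^sub>M N"

text \<open>The Green function extended by zero, which makes it total, causal and jointly
  Borel.\<close>

definition \<kappa> :: "real \<times> 'a => real \<times> 'a => real" where
  "\<kappa> a b = (if 0 <= fst b \<and> fst b < fst a \<and> fst a <= T \<and> snd a \<in> \<Lambda> \<and> snd b \<in> \<Lambda>
    then G \<nu> (fst a) (fst b) (snd a) (snd b) else 0)"

lemma \<Lambda>_borel[measurable]: "\<Lambda> \<in> sets borel" using open_\<Lambda> by simp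

lemma space_N: "space N = \<Lambda>" by (simp add: N_def space_restrict_space)

lemma space_S: "space S = {0..T} \<times> \<Lambda>" by (simp add: S_def space_pair_measure space_restrict_space space_N)

lemma finite_N: "finite_measure N"
proof (rule finite_measureI)
  have "emeasure N (space N) = emeasure lborel \<Lambda>"
    unfolding space_N unfolding N_def by (rule emeasure_restrict_space) auto
  then show "emeasure N (space N) \<noteq> \<infinity>" using emeasure_bounded_finite[OF bounded_\<Lambda>] by simp
qed

lemma borel_N: "(%x. x) \<in> N \<rightarrow>\<^sub>M borel" by (simp add: N_def measurable_restrict_space1)

lemma borel_S:
  "fst \<in> S \<rightarrow>\<^sub>M borel" "snd \<in> S \<rightarrow>\<^sub>M borel" "snd \<in> S \<rightarrow>\<^sub>M N"
proof -
  have "(%x. x) \<in> restrict_space lborel {0..T} \<rightarrow>\<^sub>M (borel :: real measure)" by (simp add: measurable_restrict_space1)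
  from measurable_compose[OF measurable_fst this] show "fst \<in> S \<rightarrow>\<^sub>M borel" by (simp add: S_def)
  show "snd \<in> S \<rightarrow>\<^sub>M N" by (simp add: S_def)
  from measurable_compose[OF this borel_N] show "snd \<in> S \<rightarrow>\<^sub>M borel" by simp
qed

lemma borel_to_lebesgue:
  assumes "h \<in> N \<rightarrow>\<^sub>M K" shows "h \<in> lebesgue_on \<Lambda> \<rightarrow>\<^sub>M K"
proof -
  have "(%x. x) \<in> lebesgue \<rightarrow>\<^sub>M (lborel :: 'a measure)" by (rule measurable_completion) simp
  then have "(%x. x) \<in> lebesgue_on \<Lambda> \<rightarrow>\<^sub>M N"
    unfolding N_def by (intro measurable_restrict_space2 measurable_restrict_space1) (auto simp: space_restrict_space)
  from measurable_compose[OF this assms] show ?thesis .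
qed

lemma \<kappa>_compose[measurable (raw)]:
  assumes [measurable]: "\<tau> \<in> bm M" "\<rho> \<in> bm M" "u \<in> bm M" "v \<in> bm M"
  shows "(%x. \<kappa> (\<tau> x, u x) (\<rho> x, v x)) \<in> bm M"
proof -
  define D :: "(real \<times> real \<times> 'a \<times> 'a) set" where "D = {(t, s, y, \<eta>). 0 <= s \<and> s < t \<and> t <= T \<and> y \<in> \<Lambda> \<and> \<eta> \<in> \<Lambda>}"
  have "D = {p. 0 <= fst (snd p)} \<inter> {p. fst (snd p) < fst p} \<inter> {p. fst p <= T} \<inter> (%p. fst (snd (snd p))) -` \<Lambda> \<inter> (%p. snd (snd (snd p))) -` \<Lambda>"
    by (auto simp: D_def)
  also have "... \<in> sets borel"
    by (intro sets.Int borel_closed[OF closed_Collect_le] borel_open[OF open_Collect_less] borel_open[OF open_vimage[OF open_\<Lambda>]] continuous_intros)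
  finally have D: "D \<in> sets borel" .
  have Gm: "(%p. indicator D p *\<^sub>R (case p of (t, s, y, \<eta>) => G \<nu> t s y \<eta>)) \<in> bm borel"
    by (rule borel_measurable_restrict_space_iff[THEN iffD1]) (use G_measurable D in \<open>simp_all add: D_def\<close>)
  have "(%x. (\<tau> x, \<rho> x, u x, v x)) \<in> M \<rightarrow>\<^sub>M borel" by measurable
  from measurable_compose[OF this Gm]
  have "(%x. indicator D (\<tau> x, \<rho> x, u x, v x) *\<^sub>R G \<nu> (\<tau> x) (\<rho> x) (u x) (v x)) \<in> bm M"
    by (simp only: prod.case)
  moreover have "indicator D (\<tau> x, \<rho> x, u x, v x) *\<^sub>R G \<nu> (\<tau> x) (\<rho> x) (u x) (v x) = \<kappa> (\<tau> x, u x) (\<rho> x, v x)" for x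
    by (simp add: \<kappa>_def D_def indicator_def)
  ultimately show ?thesis by simp
qed

lemma \<kappa>_eq: "0 <= r ==> r < s ==> s <= T ==> y \<in> \<Lambda> ==> \<eta> \<in> \<Lambda> ==> \<kappa> (s, y) (r, \<eta>) = G \<nu> s r y \<eta>"
  by (simp add: \<kappa>_def)

lemma \<kappa>_zero: "s <= r ==> \<kappa> (s, y) (r, \<eta>) = 0" by (simp add: \<kappa>_def)

lemma \<kappa>_nonneg': "0 <= \<kappa> a b" using G_nonneg by (simp add: \<kappa>_def)

lemma \<kappa>_mass:
  assumes s: "s \<in> {0..T}" and r: "r \<in> {0..T}" and y: "y \<in> \<Lambda>"
  shows "(NINT \<eta>|N. ennreal (\<kappa> (s, y) (r, \<eta>))) <= ennreal C0"
proof (cases "r < s")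
  case True
  have c: "0 <= r" "r < s" "s <= T" using True s r by auto
  have "(NINT \<eta>|N. ennreal (\<kappa> (s, y) (r, \<eta>))) = (NINT \<eta>|(lebesgue_on \<Lambda>). ennreal (\<kappa> (s, y) (r, \<eta>)))"
    unfolding N_def by (rule nn_integral_lebesgue_on_borel[symmetric]) simp
  also have "... = (NINT \<eta>|(lebesgue_on \<Lambda>). ennreal \<bar>G \<nu> s r y \<eta>\<bar>)"
    using c y G_nonneg by (intro nn_integral_cong) (simp add: \<kappa>_eq space_restrict_space)
  also have "... = ennreal (LINT \<eta>|lebesgue_on \<Lambda>. \<bar>G \<nu> s r y \<eta>\<bar>)"
    using G_L1[OF c y] by (intro nn_integral_eq_integral) auto
  finally show ?thesis using G_L1[OF c y] by (simp add: ennreal_leI)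
qed (simp add: \<kappa>_zero)

text \<open>An extended-valued \<open>u\<close> with finite square integral is almost everywhere a
  real function, to which the operator norm of the evolution applies. If the integral is infinite,
  so is the right side, since \<open>C0\<close> is positive.\<close>

lemma \<kappa>_L2_bound:
  assumes s: "s \<in> {0..T}" and r: "r \<in> {0..T}" and u[measurable]: "u \<in> bm N"
  shows "(NINT y|N. (NINT \<eta>|N. ennreal (\<kappa> (s, y) (r, \<eta>)) * u \<eta>)^2) <= ennreal (C0\<^sup>2) * (NINT y|N. (u y)^2)"
proof (cases "r < s \<and> (NINT y|N. (u y)^2) < \<infinity>")
  case False
  then consider "s <= r" | "(NINT y|N. (u y)^2) = \<infinity>" by (auto simp: less_top[symmetric])
  then show ?thesis
  proof cases
    case 2 then show ?thesis using C0 by (simp add: ennreal_mult_top)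
  qed (simp add: \<kappa>_zero)
next
  case True
  then have c: "0 <= r" "r < s" "s <= T" and fin: "(NINT y|N. (u y)^2) < \<infinity>" using s r by auto
  define v where "v x = enn2real (u x)" for x
  have [measurable]: "v \<in> bm N" unfolding v_def[abs_def] by measurable
  have v0: "0 <= v x" for x by (simp add: v_def)
  have "AE x in N. (u x)\<^sup>2 \<noteq> \<infinity>" by (rule nn_integral_PInf_AE) (use fin in auto)
  then have uv: "AE x in N. u x = ennreal (v x)"
    by eventually_elim (auto simp: v_def ennreal_enn2real_if)
  have u2: "(NINT x|N. (u x)^2) = (NINT x|N. ennreal ((v x)^2))"
    by (rule nn_integral_cong_AE) (use uv in eventually_elim, simp add: ennreal_power v0)
  have v2: "integrable N (%x. (v x)^2)"
    by (rule integrableI_bounded) (use fin u2 in auto)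
  have v2l: "integrable (lebesgue_on \<Lambda>) (%x. (v x)^2)" "(LINT x|lebesgue_on \<Lambda>. (v x)^2) = (LINT x|N. (v x)^2)"
    using v2 by (simp_all add: N_def lebesgue_on_borel)
  have vL2: "v \<in> L2 \<Lambda>" using v2l(1) by (simp add: L2_def borel_to_lebesgue)
  note ev = evolution_bound[OF c vL2]
  have eq: "AE y in lebesgue_on \<Lambda>. (NINT \<eta>|N. ennreal (\<kappa> (s, y) (r, \<eta>)) * u \<eta>)^2 = ennreal ((evolution \<Lambda> G \<nu> s r v y)^2)"
    using ev[THEN conjunct1] AE_space
  proof eventually_elim
    case (elim y)
    then have y: "y \<in> \<Lambda>" by (simp add: space_restrict_space)
    have "(NINT \<eta>|N. ennreal (\<kappa> (s, y) (r, \<eta>)) * u \<eta>) = (NINT \<eta>|N. ennreal (\<kappa> (s, y) (r, \<eta>)) * ennreal (v \<eta>))"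
      by (rule nn_integral_cong_AE) (use uv in eventually_elim, simp)
    also have "... = (NINT \<eta>|(lebesgue_on \<Lambda>). ennreal (\<kappa> (s, y) (r, \<eta>)) * ennreal (v \<eta>))"
      unfolding N_def by (rule nn_integral_lebesgue_on_borel[symmetric]) simp
    also have "... = (NINT \<eta>|(lebesgue_on \<Lambda>). ennreal (G \<nu> s r y \<eta> * v \<eta>))"
      using c y G_nonneg by (intro nn_integral_cong) (simp add: \<kappa>_eq space_restrict_space ennreal_mult')
    also have "... = ennreal (evolution \<Lambda> G \<nu> s r v y)"
      unfolding evolution_def using c y G_nonneg elim
      by (intro nn_integral_eq_integral AE_I2) (auto simp: space_restrict_space v_def)
    finally have "(NINT \<eta>|N. ennreal (\<kappa> (s, y) (r, \<eta>)) * u \<eta>) = ennreal (evolution \<Lambda> G \<nu> s r v y)" .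
    moreover have "0 <= evolution \<Lambda> G \<nu> s r v y"
      unfolding evolution_def using c y G_nonneg by (intro integral_nonneg_AE AE_I2) (auto simp: space_restrict_space v_def)
    ultimately show ?case by (simp add: ennreal_power)
  qed
  have "(NINT y|N. (NINT \<eta>|N. ennreal (\<kappa> (s, y) (r, \<eta>)) * u \<eta>)^2) = (NINT y|(lebesgue_on \<Lambda>). (NINT \<eta>|N. ennreal (\<kappa> (s, y) (r, \<eta>)) * u \<eta>)^2)"
    unfolding N_def by (rule nn_integral_lebesgue_on_borel[symmetric]) simp
  also have "... = (NINT y|(lebesgue_on \<Lambda>). ennreal ((evolution \<Lambda> G \<nu> s r v y)^2))" by (rule nn_integral_cong_AE[OF eq])
  also have "... = ennreal (L2_inner \<Lambda> (evolution \<Lambda> G \<nu> s r v) (evolution \<Lambda> G \<nu> s r v))"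
    unfolding L2_inner_def power2_eq_square[symmetric]
    using ev by (intro nn_integral_eq_integral) (auto simp: L2_def)
  also have "... <= ennreal (C0\<^sup>2 * L2_inner \<Lambda> v v)"
  proof (rule ennreal_leI)
    have nn: "0 <= L2_inner \<Lambda> w w" for w by (simp add: L2_inner_def)
    have "(L2_norm \<Lambda> (evolution \<Lambda> G \<nu> s r v))^2 <= (C0 * L2_norm \<Lambda> v)^2"
      using ev nn by (intro power_mono) (auto simp: L2_norm_def)
    then show "L2_inner \<Lambda> (evolution \<Lambda> G \<nu> s r v) (evolution \<Lambda> G \<nu> s r v) <= C0\<^sup>2 * L2_inner \<Lambda> v v"
      using nn by (simp add: L2_norm_def power_mult_distrib)
  qed
  also have "... = ennreal (C0\<^sup>2) * ennreal (LINT x|N. (v x)^2)"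
    using v2l(2) by (simp add: L2_inner_def power2_eq_square[symmetric] ennreal_mult')
  also have "ennreal (LINT x|N. (v x)^2) = (NINT y|N. (u y)^2)"
    unfolding u2 by (rule nn_integral_eq_integral[symmetric]) (use v2 in auto)
  finally show ?thesis .
qed

sublocale volterra N T C0 L \<kappa> f S
proof (rule volterra.intro)
  have m: "fst \<in> S \<Otimes>\<^sub>M S \<rightarrow>\<^sub>M S" "snd \<in> S \<Otimes>\<^sub>M S \<rightarrow>\<^sub>M S" by simp_all
  have "(%p. \<kappa> (fst (fst p), snd (fst p)) (fst (snd p), snd (snd p))) \<in> bm (S \<Otimes>\<^sub>M S)"
    by (intro \<kappa>_compose measurable_compose[OF m(1)] measurable_compose[OF m(2)] borel_S)
  then show "(%(a, b). \<kappa> a b) \<in> bm (S \<Otimes>\<^sub>M S)" by (simp add: case_prod_beta')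
  show "fst a <= fst b ==> \<kappa> a b = 0" for a b by (simp add: \<kappa>_def)
  show "(NINT \<eta>|N. ennreal (\<kappa> (s, y) (r, \<eta>))) <= ennreal C0" if "s \<in> {0..T}" "r \<in> {0..T}" "y \<in> space N" for s r y
    using that by (intro \<kappa>_mass) (simp_all add: space_N)
qed (fact finite_N T C0 L S_def \<kappa>_nonneg' \<kappa>_L2_bound f_lip)+

text \<open>Integrand of the stochastic integral, without the noise level.\<close>

definition g0 :: "real => 'a => real => 'h" where
  "g0 s y r = (if 0 <= r \<and> r < s then to_H \<Lambda> Q \<iota> (G \<nu> s r y) else 0)"

text \<open>At almost every time the Green function is represented in the completion, which
  identifies \<open>g0 s y r\<close> through its pairings. The exceptional set of times serves all
  \<open>u\<close> at once.\<close>

lemma g0_inner: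
  assumes s: "s \<in> {0..T}" and y: "y \<in> \<Lambda>"
  shows "AE r in lebesgue_on {0..T}. \<forall>u\<in>L2 \<Lambda>. g0 s y r \<bullet> \<iota> u = (LINT \<eta>|lebesgue_on \<Lambda>. \<kappa> (s, y) (r, \<eta>) * Q u \<eta>)"
proof -
  have "AE r in lebesgue. r \<in> {0..s} \<longrightarrow> (\<exists>h. represents \<Lambda> Q \<iota> (G \<nu> s r y) h)"
    using G_represented[OF s y] by (subst (asm) AE_restrict_space_iff) auto
  then have "AE r in lebesgue_on {0..T}. r \<in> {0..s} \<longrightarrow> (\<exists>h. represents \<Lambda> Q \<iota> (G \<nu> s r y) h)"
    by (subst AE_restrict_space_iff) (auto elim: eventually_mono)
  then show ?thesis using AE_space
  proof eventually_elim
    case (elim r)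
    then have r: "r \<in> {0..T}" by (simp add: space_restrict_space)
    show ?case
    proof (cases "r < s")
      case True
      then obtain h where h: "represents \<Lambda> Q \<iota> (G \<nu> s r y) h" using elim r by auto
      then have "to_H \<Lambda> Q \<iota> (G \<nu> s r y) = h"
        unfolding to_H_def using represents_unique[OF completion] by blast
      moreover have "(LINT \<eta>|lebesgue_on \<Lambda>. \<kappa> (s, y) (r, \<eta>) * Q u \<eta>) = (LINT \<eta>|lebesgue_on \<Lambda>. G \<nu> s r y \<eta> * Q u \<eta>)" for u
        using True r s y by (intro Bochner_Integration.integral_cong) (auto simp: space_restrict_space \<kappa>_eq)
      ultimately show ?thesis using h True r by (simp add: g0_def represents_def)
    qed (simp add: g0_def \<kappa>_zero)
  qed
qed

lemma integral_version:
  assumes w: "AE x in lebesgue_on \<Lambda>. w x = v x" and v: "v \<in> bm borel" and wm: "w \<in> bm (lebesgue_on \<Lambda>)" and y: "y \<in> \<Lambda>"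
  shows "(LINT \<eta>|lebesgue_on \<Lambda>. \<kappa> (s, y) (r, \<eta>) * w \<eta>) = (LINT \<eta>|N. \<kappa> (s, y) (r, \<eta>) * v \<eta>)"
proof -
  have km: "(%\<eta>. \<kappa> (s, y) (r, \<eta>)) \<in> bm N" by (intro \<kappa>_compose borel_N) auto
  have vm: "v \<in> bm N" using measurable_compose[OF borel_N v] by simp
  have "(LINT \<eta>|lebesgue_on \<Lambda>. \<kappa> (s, y) (r, \<eta>) * w \<eta>) = (LINT \<eta>|lebesgue_on \<Lambda>. \<kappa> (s, y) (r, \<eta>) * v \<eta>)"
    by (intro wm integral_cong_AE borel_measurable_times borel_to_lebesgue[OF km] borel_to_lebesgue[OF vm]) (use w in eventually_elim, simp)
  also have "... = (LINT \<eta>|N. \<kappa> (s, y) (r, \<eta>) * v \<eta>)"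
    unfolding N_def by (rule lebesgue_on_borel(2)) (use km vm in \<open>auto simp: N_def\<close>)
  finally show ?thesis .
qed

lemma time_lebesgue: "k \<in> bm borel ==> k \<in> bm (lebesgue_on {0..T})"
  for k :: "real => 'b::topological_space"
  by (intro measurable_restrict_space1 measurable_completion) simp

text \<open>\<open>to_H\<close> is a description at each time separately and says nothing about
  measurability in time. Pettis' theorem reduces the claim to scalar pairings, which almost
  everywhere are integrals of a jointly Borel function.\<close>

lemma g0_measurable:
  assumes s: "s \<in> {0..T}" and y: "y \<in> \<Lambda>"
  shows "g0 s y \<in> bm (lebesgue_on {0..T})"
proof (rule weakly_measurable_imp_measurable[where Z="\<iota> ` L2 \<Lambda>"])
  interpret N: finite_measure N by (rule finite_N)
  show "closure (\<iota> ` L2 \<Lambda>) = UNIV" using completion by (simp add: is_completion_def)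
  fix z assume "z \<in> \<iota> ` L2 \<Lambda>"
  then obtain u where u: "u \<in> L2 \<Lambda>" "z = \<iota> u" by blast
  have Qm: "Q u \<in> bm (lebesgue_on \<Lambda>)" using Q_L2[OF u(1)] by (simp add: L2_def)
  obtain v where v: "v \<in> bm borel" "AE x in lebesgue_on \<Lambda>. Q u x = v x"
    by (rule lebesgue_on_borel_version[OF \<Lambda>_borel Qm])
  have "(%p. \<kappa> (s, y) (fst p, snd p) * v (snd p)) \<in> bm (borel \<Otimes>\<^sub>M N)"
    by (intro borel_measurable_times \<kappa>_compose measurable_compose[OF measurable_snd borel_N] measurable_compose[OF measurable_snd measurable_compose[OF borel_N v(1)]]) auto
  then have m: "(%r. LINT \<eta>|N. \<kappa> (s, y) (r, \<eta>) * v \<eta>) \<in> bm borel"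
    by (intro N.borel_measurable_lebesgue_integral) (simp add: case_prod_beta')
  have ae: "AE r in lebesgue_on {0..T}. (LINT \<eta>|N. \<kappa> (s, y) (r, \<eta>) * v \<eta>) = g0 s y r \<bullet> z"
    using g0_inner[OF s y] by eventually_elim (use u integral_version[OF v(2,1) Qm y, of s] in simp)
  have "(%r. indicator {0..T} r *\<^sub>R (LINT \<eta>|N. \<kappa> (s, y) (r, \<eta>) * v \<eta>)) \<in> bm lebesgue"
    by (intro borel_measurable_scaleR measurable_completion) (use m in auto)
  moreover have "AE r in lebesgue. indicator {0..T} r *\<^sub>R (LINT \<eta>|N. \<kappa> (s, y) (r, \<eta>) * v \<eta>) = indicator {0..T} r *\<^sub>R (g0 s y r \<bullet> z)"
    using ae by (subst (asm) AE_restrict_space_iff) (auto elim!: eventually_mono simp: indicator_def)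
  ultimately have "(%r. indicator {0..T} r *\<^sub>R (g0 s y r \<bullet> z)) \<in> bm lebesgue"
    by (rule borel_measurable_AE)
  then show "(%r. g0 s y r \<bullet> z) \<in> bm (lebesgue_on {0..T})"
    by (subst borel_measurable_restrict_space_iff) auto
qed

end

section \<open>Energy of the noise kernel and the abstract equation\<close>

context diffusion_model begin

text \<open>The noise scaling is assumed for every starting time. After a time shift its integral
  with start \<open>r\<close> and length \<open>s - r\<close> is the energy of the kernel on
  \<open>{r..<s}\<close>, so both bounds hold for every terminal piece of the kernel.\<close>

lemma noise_tail:
  assumes r: "0 <= r" "r <= s" "s <= T" and y: "y \<in> \<Lambda>"
  defines "k \<equiv> (NINT x|(lebesgue_on {0..T}). ennreal ((norm (\<sigma> *\<^sub>R g0 s y x))^2) * indicator {r..<s} x)"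
  shows "k <= ennreal (Cu * (s - r) powr \<alpha>)" "y \<in> \<Gamma> ==> ennreal (Cl * (s - r) powr \<alpha>) <= k"
proof -
  have sT: "s \<in> {0..T}" using r by auto
  have "k = ennreal (\<sigma>\<^sup>2) * (NINT x|(lebesgue_on {0..s - r}). ennreal ((norm (to_H \<Lambda> Q \<iota> (G \<nu> s (r + x) y)))^2))" if "r < s"
  proof -
    have m0: "(%x. indicator {0..T} x *\<^sub>R g0 s y x) \<in> bm lebesgue"
      using g0_measurable[OF sT y] by (subst (asm) borel_measurable_restrict_space_iff) auto
    have mm: "(%x. ennreal ((norm (indicator {0..T} x *\<^sub>R g0 s y x))^2)) \<in> bm lebesgue"
      using m0 by measurable
    then have m: "(%x. ennreal ((norm (indicator {0..T} x *\<^sub>R g0 s y x))^2)) \<in> bm (lebesgue_on {r..r + (s - r)})"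
      by (rule measurable_restrict_space1)
    have ae: "AE x in lebesgue. x \<noteq> s" "AE x in lebesgue. x \<noteq> s - r"
      by (intro AE_completion AE_lborel_singleton)+
    have "k = (NINT x|lebesgue. ennreal (\<sigma>\<^sup>2) * (ennreal ((norm (indicator {0..T} x *\<^sub>R g0 s y x))^2) * indicator {r..r + (s - r)} x))"
      unfolding k_def by (subst nn_integral_restrict_space, simp, intro nn_integral_cong_AE)
        (use ae(1) in eventually_elim, use r in \<open>auto simp: indicator_def power_mult_distrib ennreal_mult'\<close>)
    also have "... = ennreal (\<sigma>\<^sup>2) * (NINT x|lebesgue. ennreal ((norm (indicator {0..T} x *\<^sub>R g0 s y x))^2) * indicator {r..r + (s - r)} x)"
      by (intro nn_integral_cmult borel_measurable_times_ennreal mm borel_measurable_indicator) simp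
    also have "(NINT x|lebesgue. ennreal ((norm (indicator {0..T} x *\<^sub>R g0 s y x))^2) * indicator {r..r + (s - r)} x) =
        (NINT x|(lebesgue_on {r..r + (s - r)}). ennreal ((norm (indicator {0..T} x *\<^sub>R g0 s y x))^2))"
      by (simp add: nn_integral_restrict_space)
    also have "... = (NINT x|(lebesgue_on {0..s - r}). ennreal ((norm (indicator {0..T} (r + x) *\<^sub>R g0 s y (r + x)))^2))"
      by (rule nn_integral_lebesgue_on_shift[OF m, symmetric])
    also have "... = (NINT x|(lebesgue_on {0..s - r}). ennreal ((norm (to_H \<Lambda> Q \<iota> (G \<nu> s (r + x) y)))^2))"
      by (simp add: nn_integral_restrict_space, intro nn_integral_cong_AE)
        (use ae(2) in eventually_elim, use r in \<open>auto simp: indicator_def g0_def\<close>)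
    finally show ?thesis .
  qed
  then have "k <= ennreal (Cu * (s - r) powr \<alpha>) \<and> (y \<in> \<Gamma> \<longrightarrow> ennreal (Cl * (s - r) powr \<alpha>) <= k)"
  proof (cases "r < s")
    case True
    then show ?thesis
      using \<open>r < s ==> k = _\<close> noise_upper[of r "s - r" y] noise_lower[of r "s - r" y] r y by auto
  next
    case False
    then have "r = s" using r by simp
    then show ?thesis by (simp add: k_def)
  qed
  then show "k <= ennreal (Cu * (s - r) powr \<alpha>)" "y \<in> \<Gamma> ==> ennreal (Cl * (s - r) powr \<alpha>) <= k" by auto
qed

definition g :: "real \<times> 'a => real => 'h" where "g a r = \<sigma> *\<^sub>R g0 (fst a) (snd a) r"

text \<open>The part of \<open>g a\<close> from time \<open>r\<close> on. It needs no cut at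
  \<open>fst a\<close>, where \<open>g a\<close> itself becomes zero.\<close>

definition gtail :: "real => real \<times> 'a => real => 'h" where
  "gtail r a x = (if r <= x then g a x else 0)"

lemma g_measurable: "a \<in> space S ==> g a \<in> bm (lebesgue_on {0..T})"
  unfolding g_def[abs_def] using g0_measurable by (intro borel_measurable_scaleR) (auto simp: space_S)

lemma gtail_L2:
  assumes r: "0 <= r" "r <= fst a" and a: "a \<in> space S"
  shows "gtail r a \<in> L2_time T" "ip T (gtail r a) (gtail r a) <= Cu * (fst a - r) powr \<alpha>"
    "snd a \<in> \<Gamma> ==> Cl * (fst a - r) powr \<alpha> <= ip T (gtail r a) (gtail r a)"
proof -
  have sT: "fst a <= T" "snd a \<in> \<Lambda>" using a by (auto simp: space_S)
  have ind: "(%x. indicator {r..} x) \<in> bm (lebesgue_on {0..T})" by (rule time_lebesgue) simp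
  have "(%x. indicator {r..} x *\<^sub>R g a x) \<in> bm (lebesgue_on {0..T})"
    by (intro borel_measurable_scaleR ind g_measurable a)
  moreover have "(%x. indicator {r..} x *\<^sub>R g a x) = gtail r a" by (auto simp: gtail_def indicator_def fun_eq_iff)
  ultimately have m[measurable]: "gtail r a \<in> bm (lebesgue_on {0..T})" by simp
  have eq: "(NINT x|(lebesgue_on {0..T}). ennreal ((norm (gtail r a x))^2)) =
     (NINT x|(lebesgue_on {0..T}). ennreal ((norm (\<sigma> *\<^sub>R g0 (fst a) (snd a) x))^2) * indicator {r..<fst a} x)"
    using r by (intro nn_integral_cong) (auto simp: gtail_def g_def g0_def indicator_def)
  note tail = noise_tail[OF r sT, folded eq]
  have i: "integrable (lebesgue_on {0..T}) (%x. (norm (gtail r a x))^2)"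
    by (rule integrableI_bounded) (use tail(1) in \<open>auto simp: le_less_trans\<close>)
  show "gtail r a \<in> L2_time T" using m i by (simp add: L2_time_def)
  have "ennreal (ip T (gtail r a) (gtail r a)) = (NINT x|(lebesgue_on {0..T}). ennreal ((norm (gtail r a x))^2))"
    unfolding ip_def power2_norm_eq_inner[symmetric] using i by (intro nn_integral_eq_integral[symmetric]) auto
  note tail' = tail[folded this]
  show "ip T (gtail r a) (gtail r a) <= Cu * (fst a - r) powr \<alpha>"
    using tail'(1) Cl by (subst (asm) ennreal_le_iff) auto
  show "Cl * (fst a - r) powr \<alpha> <= ip T (gtail r a) (gtail r a)" if "snd a \<in> \<Gamma>"
    using tail'(2)[OF that] by (subst (asm) ennreal_le_iff) (auto simp: ip_nonneg)
qed

lemma g_gtail: "gtail 0 a = g a" by (auto simp: gtail_def g_def g0_def fun_eq_iff)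

lemma g_L2: "a \<in> space S ==> g a \<in> L2_time T"
  using gtail_L2(1)[of 0 a] by (simp add: g_gtail space_S mem_Times_iff)

text \<open>Bounds the standard deviation of the noise at all times, by the noise scaling over the
  full length \<open>T\<close>.\<close>

definition q :: real where "q = sqrt (Cu * T powr \<alpha>)"

lemma q: "0 < q" "q\<^sup>2 = Cu * T powr \<alpha>"
proof -
  have "0 < Cu * T powr \<alpha>" using Cl T by simp
  then show "0 < q" "q\<^sup>2 = Cu * T powr \<alpha>" by (simp_all add: q_def)
qed

lemma g_norm: "a \<in> space S ==> ip T (g a) (g a) <= q\<^sup>2"
proof -
  assume a: "a \<in> space S"
  then have "ip T (g a) (g a) <= Cu * fst a powr \<alpha>" using gtail_L2(2)[of 0 a] by (auto simp: g_gtail space_S)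
  also have "... <= Cu * T powr \<alpha>" using a Cl \<alpha> by (intro mult_left_mono powr_mono2) (auto simp: space_S)
  finally show ?thesis by (simp add: q)
qed

text \<open>The Green function is given for positive elapsed time only; at time 0 the initial value
  takes its place.\<close>

definition x0 :: "real \<times> 'a => real" where
  "x0 a = (if fst a = 0 then X0 (snd a) else LINT \<eta>|N. \<kappa> a (0, \<eta>) * X0 \<eta>)"

lemma X0_measurable: "X0 \<in> bm N"
proof -
  have "sets N = sets (restrict_space borel \<Lambda>)" by (simp add: N_def sets_restrict_space)
  then show ?thesis
    using borel_measurable_continuous_on_restrict[OF X0_cont] measurable_cong_sets[of N "restrict_space borel \<Lambda>" borel borel] by simp
qed

lemma x0_measurable: "x0 \<in> bm S"
proof -
  have "(%p. \<kappa> (fst (fst p), snd (fst p)) (0, snd p) * X0 (snd p)) \<in> bm (S \<Otimes>\<^sub>M N)"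
    by (intro borel_measurable_times \<kappa>_compose measurable_compose[OF measurable_fst borel_S(1)] measurable_compose[OF measurable_fst borel_S(2)]
        measurable_compose[OF measurable_snd borel_N] measurable_compose[OF measurable_snd X0_measurable]) auto
  then have [measurable]: "(%a. LINT \<eta>|N. \<kappa> a (0, \<eta>) * X0 \<eta>) \<in> bm S"
    by (intro N.borel_measurable_lebesgue_integral) (simp add: case_prod_beta')
  have [measurable]: "(%a. X0 (snd a)) \<in> bm S" "fst \<in> bm S"
    by (rule measurable_compose[OF borel_S(3) X0_measurable], rule borel_S)
  show ?thesis unfolding x0_def[abs_def] by measurable
qed

lemma x0_bound: "a \<in> space S ==> \<bar>x0 a\<bar> <= max 1 C0 * bX"
proof -
  assume a: "a \<in> space S"
  show ?thesis
  proof (cases "fst a = 0")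
    case True
    have "\<bar>X0 (snd a)\<bar> <= 1 * bX" using a X0_bound by (auto simp: space_S)
    also have "... <= max 1 C0 * bX" using bX by (intro mult_right_mono) auto
    finally show ?thesis using True by (simp add: x0_def)
  next
    case False
    have "ennreal \<bar>LINT \<eta>|N. \<kappa> a (0, \<eta>) * X0 \<eta>\<bar> <= (NINT \<eta>|N. ennreal bX * ennreal (\<kappa> a (0, \<eta>)))"
    proof (cases "integrable N (%\<eta>. \<kappa> a (0, \<eta>) * X0 \<eta>)")
      case True
      have "ennreal (norm (LINT \<eta>|N. \<kappa> a (0, \<eta>) * X0 \<eta>)) <= (NINT \<eta>|N. ennreal (norm (\<kappa> a (0, \<eta>) * X0 \<eta>)))"
        by (rule integral_norm_bound_ennreal[OF True])
      also have "... <= (NINT \<eta>|N. ennreal bX * ennreal (\<kappa> a (0, \<eta>)))"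
      proof (rule nn_integral_mono)
        fix \<eta> assume "\<eta> \<in> space N"
        then have "\<bar>X0 \<eta>\<bar> <= bX" using X0_bound by (simp add: space_N)
        then have "norm (\<kappa> a (0, \<eta>) * X0 \<eta>) <= bX * \<kappa> a (0, \<eta>)"
          using \<kappa>_nonneg'[of a "(0, \<eta>)"] by (simp add: abs_mult mult.commute mult_right_mono)
        then show "ennreal (norm (\<kappa> a (0, \<eta>) * X0 \<eta>)) <= ennreal bX * ennreal (\<kappa> a (0, \<eta>))"
          using bX by (simp add: ennreal_mult'[symmetric] ennreal_leI)
      qed
      finally show ?thesis by simp
    qed (simp add: not_integrable_integral_eq)
    also have "... = ennreal bX * (NINT \<eta>|N. ennreal (\<kappa> (fst a, snd a) (0, \<eta>)))"
    proof -
      have "(%\<eta>. \<kappa> (fst a, snd a) (0, \<eta>)) \<in> bm N" by (intro \<kappa>_compose borel_N) auto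
      then show ?thesis by (simp add: nn_integral_cmult)
    qed
    also have "... <= ennreal bX * ennreal C0"
      using a T by (intro mult_left_mono \<kappa>_mass) (auto simp: space_S)
    finally have "\<bar>LINT \<eta>|N. \<kappa> a (0, \<eta>) * X0 \<eta>\<bar> <= bX * C0"
      using bX C0 by (simp add: ennreal_mult'[symmetric])
    also have "... <= max 1 C0 * bX" using bX by (subst mult.commute) (intro mult_right_mono, auto)
    finally show ?thesis using False by (simp add: x0_def)
  qed
qed

definition XS :: "'w => real \<times> 'a => real" where "XS om a = X (fst a) (snd a) om"

lemma XS_measurable: "(%(om, a). XS om a) \<in> bm (P \<Otimes>\<^sub>M S)"
proof -
  have X: "(%(om, t, y). X t y om) \<in> bm (P \<Otimes>\<^sub>M restrict_space borel ({0..T} \<times> \<Lambda>))"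
    using solution by (simp add: random_field_solution_def)
  have "(%a. (fst a, snd a)) \<in> S \<rightarrow>\<^sub>M borel"
    unfolding borel_prod[symmetric] by (intro measurable_Pair borel_S)
  then have "(%a. a) \<in> S \<rightarrow>\<^sub>M restrict_space borel ({0..T} \<times> \<Lambda>)"
    by (intro measurable_restrict_space2) (auto simp: space_S)
  then have "(%p. (fst p, snd p)) \<in> P \<Otimes>\<^sub>M S \<rightarrow>\<^sub>M P \<Otimes>\<^sub>M restrict_space borel ({0..T} \<times> \<Lambda>)"
    by (intro measurable_Pair measurable_fst measurable_compose[OF measurable_snd])
  from measurable_compose[OF this X] show ?thesis by (simp add: XS_def case_prod_beta')
qed

lemma XS_square: "\<exists>K\<ge>0. \<forall>a\<in>space S. (NINT om|P. ennreal ((XS om a)^2)) <= ennreal K"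
proof -
  obtain K where K: "!!t y. t \<in> {0..T} ==> y \<in> \<Lambda> ==> integrable P (%om. (X t y om)^2) \<and> (LINT om|P. (X t y om)^2) <= K"
    using solution unfolding random_field_solution_def by blast
  have "(NINT om|P. ennreal ((XS om a)^2)) <= ennreal (max K 0)" if "a \<in> space S" for a
  proof -
    have a: "fst a \<in> {0..T}" "snd a \<in> \<Lambda>" using that by (auto simp: space_S)
    have "(NINT om|P. ennreal ((XS om a)^2)) = ennreal (LINT om|P. (X (fst a) (snd a) om)^2)"
      unfolding XS_def using K[OF a] by (intro nn_integral_eq_integral) auto
    then show ?thesis using K[OF a] by (auto intro!: ennreal_leI)
  qed
  then show ?thesis by (intro exI[of _ "max K 0"]) auto
qed

definition K where "K = (SOME K. 0 <= K \<and> (\<forall>a\<in>space S. (NINT om|P. ennreal ((XS om a)^2)) <= ennreal K))"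

lemma K: "0 <= K" "a \<in> space S ==> (NINT om|P. ennreal ((XS om a)^2)) <= ennreal K"
  using someI_ex[OF XS_square[unfolded Bex_def]] unfolding K_def by blast+

sublocale gaussian_family P T W
  using P iso by (simp add: gaussian_family_def gaussian_family_axioms_def)

text \<open>Passes from the iterated Lebesgue integral in the notion of solution to an integral over
  \<open>S\<close>. Fubini is available because the kernel integral converges absolutely for this
  \<open>om\<close>.\<close>

lemma drift_eq:
  assumes a: "(t, y) \<in> space S" and om: "om \<in> space P" and i: "integrable S (%b. \<kappa> (t, y) b * f (XS om b))"
  shows "(LINT s|lebesgue_on {0..t}. LINT \<eta>|lebesgue_on \<Lambda>. G \<nu> t s y \<eta> * f (X s \<eta> om)) = V (%b. f (XS om b)) (t, y)"
proof -
  have ty: "t \<in> {0..T}" "y \<in> \<Lambda>" using a by (auto simp: space_S)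
  define I where "I s = (LINT \<eta>|N. \<kappa> (t, y) (s, \<eta>) * f (X s \<eta> om))" for s
  have i': "integrable (restrict_space lborel {0..T} \<Otimes>\<^sub>M N) (%(s, \<eta>). \<kappa> (t, y) (s, \<eta>) * f (X s \<eta> om))"
    using i by (simp add: S_def XS_def case_prod_beta')
  have XSm: "XS om \<in> bm S" by (rule section_S[OF XS_measurable om])
  have inner: "(LINT \<eta>|lebesgue_on \<Lambda>. G \<nu> t s y \<eta> * f (X s \<eta> om)) = I s" if s: "0 <= s" "s < t" for s
  proof -
    have "(%\<eta>. (s, \<eta>)) \<in> N \<rightarrow>\<^sub>M S"
      unfolding S_def using s ty by (intro measurable_Pair measurable_const) (auto simp: space_restrict_space)
    from measurable_compose[OF this XSm] have [measurable]: "(%\<eta>. X s \<eta> om) \<in> bm N" by (simp add: XS_def)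
    have [measurable]: "(%\<eta>. \<kappa> (t, y) (s, \<eta>)) \<in> bm N" by (intro \<kappa>_compose borel_N) auto
    have "(LINT \<eta>|lebesgue_on \<Lambda>. G \<nu> t s y \<eta> * f (X s \<eta> om)) = (LINT \<eta>|lebesgue_on \<Lambda>. \<kappa> (t, y) (s, \<eta>) * f (X s \<eta> om))"
      using s ty by (intro Bochner_Integration.integral_cong) (auto simp: \<kappa>_eq space_restrict_space)
    also have "... = I s"
      unfolding I_def N_def by (rule lebesgue_on_borel(2)[OF \<Lambda>_borel], fold N_def) measurable
    finally show ?thesis .
  qed
  have Im: "I \<in> bm (restrict_space lborel {0..T})"
    unfolding I_def[abs_def] using borel_measurable_integrable[OF i'] by (intro N.borel_measurable_lebesgue_integral) auto
  have "(LINT s|lebesgue_on {0..t}. LINT \<eta>|lebesgue_on \<Lambda>. G \<nu> t s y \<eta> * f (X s \<eta> om)) =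
      (LINT s|lebesgue. indicator {0..t} s *\<^sub>R (LINT \<eta>|lebesgue_on \<Lambda>. G \<nu> t s y \<eta> * f (X s \<eta> om)))"
    by (rule integral_restrict_space) simp
  also have "... = (LINT s|lebesgue. indicator {0..T} s *\<^sub>R I s)"
  proof (rule integral_discrete_difference[where X="{t}"])
    fix s :: real assume "s \<notin> {t}"
    then show "indicator {0..t} s *\<^sub>R (LINT \<eta>|lebesgue_on \<Lambda>. G \<nu> t s y \<eta> * f (X s \<eta> om)) = indicator {0..T} s *\<^sub>R I s"
      using ty inner[of s] by (auto simp: indicator_def I_def \<kappa>_zero)
  qed auto
  also have "... = (LINT s|lebesgue_on {0..T}. I s)" by (rule integral_restrict_space[symmetric]) simp
  also have "... = (LINT s|restrict_space lborel {0..T}. I s)" by (rule lebesgue_on_borel(2)[OF _ Im]) simp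
  also have "... = (LINT b|S. \<kappa> (t, y) b * f (XS om b))"
    unfolding I_def S_def using TN.integral_fst'[OF i'] by (simp add: XS_def case_prod_beta')
  finally show ?thesis by (simp add: V_def)
qed

text \<open>At time 0 the drift and the integrand of the noise vanish. At positive times the noise
  level moves inside \<open>W\<close>, which \<open>W_scale\<close> permits almost surely.\<close>

lemma XS_eq:
  assumes a: "a \<in> space S"
  shows "AE om in P. XS om a = x0 a + V (%b. f (XS om b)) a + W (g a) om"
proof -
  obtain t y where ty: "a = (t, y)" "t \<in> {0..T}" "y \<in> \<Lambda>" using a by (auto simp: space_S)
  show ?thesis
  proof (cases "t = 0")
    case True
    have Vz: "V h a = 0" for h
    proof -
      have "\<kappa> a b = 0" for b using True ty by (simp add: \<kappa>_def)
      then show ?thesis by (simp add: V_def)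
    qed
    have "g a = (%s. 0 *\<^sub>R (0::'h))" using True ty by (auto simp: g_def g0_def fun_eq_iff)
    then have "AE om in P. W (g a) om = 0" using W_scale[OF L2_time_zero, of 0] by simp
    moreover have "AE om in P. X 0 y om = X0 y" using solution ty by (simp add: random_field_solution_def)
    ultimately show ?thesis by eventually_elim (use Vz in \<open>simp add: XS_def x0_def True ty\<close>)
  next
    case False
    then have t: "t \<in> {0<..T}" using ty by auto
    have x0e: "(LINT \<eta>|lebesgue_on \<Lambda>. G \<nu> t 0 y \<eta> * X0 \<eta>) = x0 a"
    proof -
      have [measurable]: "(%\<eta>. \<kappa> (t, y) (0, \<eta>)) \<in> bm N" by (intro \<kappa>_compose borel_N) auto
      note [measurable] = X0_measurable
      have "(LINT \<eta>|lebesgue_on \<Lambda>. G \<nu> t 0 y \<eta> * X0 \<eta>) = (LINT \<eta>|lebesgue_on \<Lambda>. \<kappa> (t, y) (0, \<eta>) * X0 \<eta>)"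
        using t ty by (intro Bochner_Integration.integral_cong) (auto simp: \<kappa>_eq space_restrict_space)
      also have "... = (LINT \<eta>|N. \<kappa> (t, y) (0, \<eta>) * X0 \<eta>)"
        unfolding N_def by (rule lebesgue_on_borel(2)[OF \<Lambda>_borel], fold N_def) measurable
      finally show ?thesis using False ty by (simp add: x0_def)
    qed
    let ?k = "%s. if 0 <= s \<and> s < t then to_H \<Lambda> Q \<iota> (G \<nu> t s y) else 0"
    have k: "?k = g0 t y" by (auto simp: g0_def fun_eq_iff)
    have "(%s. (1 / \<sigma>) *\<^sub>R g a s) \<in> L2_time T" by (rule L2_time_scale[OF g_L2[OF a]])
    then have "g0 t y \<in> L2_time T" using \<sigma> by (simp add: g_def ty)
    from W_scale[OF this, of \<sigma>] have "AE om in P. W (g a) om = \<sigma> * W (g0 t y) om" by (simp add: g_def[abs_def] ty)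
    moreover have "AE om in P. X t y om = (LINT \<eta>|lebesgue_on \<Lambda>. G \<nu> t 0 y \<eta> * X0 \<eta>) +
          (LINT s|lebesgue_on {0..t}. LINT \<eta>|lebesgue_on \<Lambda>. G \<nu> t s y \<eta> * f (X s \<eta> om)) + \<sigma> * W (g0 t y) om"
      unfolding k[symmetric] using solution t ty(3) unfolding random_field_solution_def by blast
    moreover have "AE om in P. integrable S (%b. \<kappa> a b * f (XS om b))"
      by (rule integrable_kernel_process[OF P XS_measurable K(2) a])
    ultimately show ?thesis using AE_space
      by eventually_elim (use a ty drift_eq[of t y] x0e in \<open>simp add: XS_def\<close>)
  qed
qed

sublocale spde N T C0 L \<kappa> f S P T W g x0 XS q "max 1 C0 * bX" K
  by (rule spde.intro[OF volterra_axioms gaussian_family_axioms], rule spde_axioms.intro)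
    (use g_L2 g_norm q(1) x0_measurable x0_bound XS_measurable K bX XS_eq in \<open>auto intro: mult_nonneg_nonneg\<close>)

end

section \<open>Operator norm of the noise and the law of the field\<close>

context diffusion_model begin

text \<open>As measurability rules these unify with any real-valued process and hide the intended rules.\<close>

declare Ym'[measurable del] Y_section[measurable del]

text \<open>The noise acts into L2 over space with norm at most \<open>\<sigma> * lc\<close>:
  \<open>sqrt T\<close> comes from Cauchy--Schwarz in time, \<open>C0\<close> from the evolution and
  \<open>Kb\<close> from \<open>Q\<close>.\<close>

definition lc :: real where "lc = sqrt T * C0 * Kb"

lemma lc: "0 < lc" using T C0 Kb by (simp add: lc_def)

abbreviation "TL \<equiv> lebesgue_on {0..T}"

lemma TL_mass: "emeasure TL (space TL) = ennreal T"
proof -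
  have "emeasure TL {0..T} = emeasure lebesgue {0..T}" by (rule emeasure_restrict_space) auto
  then show ?thesis using T by (simp add: space_restrict_space)
qed

sublocale TL: finite_measure TL
proof (rule finite_measureI)
  show "emeasure TL (space TL) \<noteq> \<infinity>" unfolding TL_mass by simp
qed

sublocale TLN: pair_sigma_finite TL N ..

lemma time_id: "(%x. x) \<in> bm TL" by (rule time_lebesgue) simp

text \<open>For integrands with values in L2 the pairing in the completion is an ordinary integral
  of the Green function against \<open>Q (U r)\<close>. As \<open>U\<close> takes finitely many
  values, Borel versions of \<open>Q (U r)\<close> can be chosen jointly measurable in time and
  space.\<close>

lemma noise_operator_simple:
  assumes s: "s \<in> {0..T}" and U: "simple_function TL U" and UL: "!!r. U r \<in> L2 \<Lambda>" and h: "(%r. \<iota> (U r)) \<in> L2_time T"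
  shows "(NINT y|N. ennreal ((ip T (g (s, y)) (%r. \<iota> (U r)))^2)) <= ennreal ((\<sigma> * lc)^2 * ip T (%r. \<iota> (U r)) (%r. \<iota> (U r)))"
proof -
  have Qm: "Q u \<in> bm (lebesgue_on \<Lambda>)" if "u \<in> L2 \<Lambda>" for u using Q_L2[OF that] by (simp add: L2_def)
  have "\<exists>v. v \<in> bm borel \<and> (AE x in lebesgue_on \<Lambda>. Q u x = v x)" if u: "u \<in> L2 \<Lambda>" for u
    by (rule lebesgue_on_borel_version[OF \<Lambda>_borel Qm[OF u]]) blast
  then obtain ver where ver: "!!u. u \<in> L2 \<Lambda> ==> ver u \<in> bm borel" "!!u. u \<in> L2 \<Lambda> ==> AE x in lebesgue_on \<Lambda>. Q u x = ver u x"
    by metis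
  define v where "v r = ver (U r)" for r
  have vm: "v r \<in> bm N" for r
    using measurable_compose[OF borel_N ver(1)[OF UL]] by (simp add: v_def)
  have v_meas: "(%p. v (fst p) (snd p)) \<in> bm (TL \<Otimes>\<^sub>M N)"
  proof -
    have fin: "finite (U ` space TL)" using U by (simp add: simple_function_def)
    have "(%p. \<Sum>u\<in>U ` space TL. indicator (U -` {u} \<inter> space TL) (fst p) * ver u (snd p)) \<in> bm (TL \<Otimes>\<^sub>M N)"
    proof (intro borel_measurable_sum borel_measurable_times)
      fix u assume u: "u \<in> U ` space TL"
      then have uL: "u \<in> L2 \<Lambda>" using UL by auto
      show "(%p. ver u (snd p)) \<in> bm (TL \<Otimes>\<^sub>M N)"
        by (rule measurable_compose[OF measurable_snd measurable_compose[OF borel_N ver(1)[OF uL]]])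
      have us: "U -` {u} \<inter> space TL \<in> sets TL" using U u unfolding simple_function_def by blast
      show "(%p. indicator (U -` {u} \<inter> space TL) (fst p) :: real) \<in> bm (TL \<Otimes>\<^sub>M N)"
        by (rule measurable_compose[OF measurable_fst borel_measurable_indicator[OF us]])
    qed
    moreover have "(\<Sum>u\<in>U ` space TL. indicator (U -` {u} \<inter> space TL) (fst p) * ver u (snd p)) = v (fst p) (snd p)"
      if "p \<in> space (TL \<Otimes>\<^sub>M N)" for p
    proof -
      have p: "fst p \<in> space TL" using that by (auto simp: space_pair_measure)
      have "(\<Sum>u\<in>U ` space TL. indicator (U -` {u} \<inter> space TL) (fst p) * ver u (snd p)) = (\<Sum>u\<in>U ` space TL. if u = U (fst p) then ver u (snd p) else 0)"
        using p by (intro sum.cong) (auto simp: indicator_def)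
      also have "... = v (fst p) (snd p)" using p fin by (simp add: v_def)
      finally show ?thesis .
    qed
    ultimately show ?thesis by (subst measurable_cong[symmetric]) auto
  qed
  define w where "w y r = (NINT \<eta>|N. ennreal (\<kappa> (s, y) (r, \<eta>)) * ennreal \<bar>v r \<eta>\<bar>)" for y r
  have w_meas: "(%p. w (snd p) (fst p)) \<in> bm (TL \<Otimes>\<^sub>M N)"
  proof -
    have "(%p. ennreal (\<kappa> (s, snd (fst p)) (fst (fst p), snd p)) * ennreal \<bar>v (fst (fst p)) (snd p)\<bar>) \<in> bm ((TL \<Otimes>\<^sub>M N) \<Otimes>\<^sub>M N)"
    proof (intro borel_measurable_times_ennreal measurable_compose[OF _ measurable_ennreal] \<kappa>_compose borel_measurable_abs)
      show "(%p. snd (fst p)) \<in> bm ((TL \<Otimes>\<^sub>M N) \<Otimes>\<^sub>M N)"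
        by (rule measurable_compose[OF measurable_fst measurable_compose[OF measurable_snd borel_N]])
      show "(%p. fst (fst p)) \<in> bm ((TL \<Otimes>\<^sub>M N) \<Otimes>\<^sub>M N)"
        by (rule measurable_compose[OF measurable_fst measurable_compose[OF measurable_fst time_id]])
      show "snd \<in> bm ((TL \<Otimes>\<^sub>M N) \<Otimes>\<^sub>M N)"
        by (rule measurable_compose[OF measurable_snd borel_N])
      have "(%p. (fst (fst p), snd p)) \<in> (TL \<Otimes>\<^sub>M N) \<Otimes>\<^sub>M N \<rightarrow>\<^sub>M TL \<Otimes>\<^sub>M N"
        by (intro measurable_Pair measurable_compose[OF measurable_fst measurable_fst] measurable_snd)
      from measurable_compose[OF this v_meas]
      show "(%p. v (fst (fst p)) (snd p)) \<in> bm ((TL \<Otimes>\<^sub>M N) \<Otimes>\<^sub>M N)" by simp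
    qed simp
    then show ?thesis unfolding w_def by (intro N.borel_measurable_nn_integral) (simp add: case_prod_beta')
  qed
  have w_meas1: "(%r. w y r) \<in> bm TL" if "y \<in> \<Lambda>" for y
    using measurable_compose[OF measurable_Pair2'[of y N TL] w_meas] that by (simp add: space_N)
  define hU where "hU r = \<iota> (U r)" for r
  have hU: "hU \<in> L2_time T" using h by (simp add: hU_def[abs_def])
  have pt: "ennreal ((ip T (g (s, y)) hU)^2) <= ennreal (\<sigma>\<^sup>2 * T) * (NINT r|TL. (w y r)^2)" if y: "y \<in> \<Lambda>" for y
  proof -
    have a: "(s, y) \<in> space S" using s y by (simp add: space_S)
    have i: "integrable TL (%r. g (s, y) r \<bullet> hU r)" by (rule L2_time_inner_integrable[OF g_L2[OF a] hU])
    have ae: "AE r in TL. ennreal \<bar>g (s, y) r \<bullet> hU r\<bar> <= ennreal \<sigma> * w y r"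
      using g0_inner[OF s y]
    proof eventually_elim
      case (elim r)
      have "g0 s y r \<bullet> hU r = (LINT \<eta>|N. \<kappa> (s, y) (r, \<eta>) * v r \<eta>)"
        using elim UL[of r] integral_version[OF ver(2)[OF UL] ver(1)[OF UL] Qm[OF UL] y, where s=s and r=r, of r] by (simp add: hU_def v_def)
      moreover have "ennreal \<bar>LINT \<eta>|N. \<kappa> (s, y) (r, \<eta>) * v r \<eta>\<bar> <= w y r"
      proof (cases "integrable N (%\<eta>. \<kappa> (s, y) (r, \<eta>) * v r \<eta>)")
        case True
        from integral_norm_bound_ennreal[OF True] show ?thesis
          by (simp add: w_def abs_mult ennreal_mult' \<kappa>_nonneg')
      qed (simp add: not_integrable_integral_eq)
      ultimately show ?case using \<sigma> by (simp add: g_def abs_mult ennreal_mult' mult_left_mono)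
    qed
    have "ennreal \<bar>ip T (g (s, y)) hU\<bar> <= (NINT r|TL. ennreal \<bar>g (s, y) r \<bullet> hU r\<bar>)"
      using integral_norm_bound_ennreal[OF i] by (simp add: ip_def)
    also have "... <= (NINT r|TL. (ennreal \<sigma> * w y r) * 1)" using ae by (intro nn_integral_mono_AE) simp
    finally have "(ennreal \<bar>ip T (g (s, y)) hU\<bar>)^2 <= (NINT r|TL. (ennreal \<sigma> * w y r) * 1)^2" by (rule power_mono) simp
    also have "... <= (NINT r|TL. (ennreal \<sigma> * w y r)^2) * (NINT r|TL. 1\<^sup>2)"
      by (intro Cauchy_Schwarz_nn_integral borel_measurable_times_ennreal w_meas1 y) auto
    also have "(NINT r|TL. (ennreal \<sigma> * w y r)^2) = ennreal (\<sigma>\<^sup>2) * (NINT r|TL. (w y r)^2)"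
      using w_meas1[OF y] \<sigma> by (simp add: power_mult_distrib nn_integral_cmult ennreal_power)
    also have "(NINT r|TL. 1\<^sup>2) = ennreal T" using TL_mass by simp
    also have "ennreal (\<sigma>\<^sup>2) * (NINT r|TL. (w y r)^2) * ennreal T = ennreal (\<sigma>\<^sup>2 * T) * (NINT r|TL. (w y r)^2)"
    proof -
      have e: "ennreal (\<sigma>\<^sup>2 * T) = ennreal (\<sigma>\<^sup>2) * ennreal T" by (rule ennreal_mult) (use T in auto)
      show ?thesis unfolding e by (simp only: mult.assoc mult.commute mult.left_commute)
    qed
    finally show ?thesis by (simp add: ennreal_power)
  qed
  have "(NINT y|N. ennreal ((ip T (g (s, y)) hU)^2)) <= (NINT y|N. ennreal (\<sigma>\<^sup>2 * T) * (NINT r|TL. (w y r)^2))"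
    by (intro nn_integral_mono pt) (simp add: space_N)
  also have "... = ennreal (\<sigma>\<^sup>2 * T) * (NINT y|N. NINT r|TL. (w y r)^2)"
  proof (rule nn_integral_cmult)
    have "(%p. (w (fst p) (snd p))^2) \<in> bm (N \<Otimes>\<^sub>M TL)"
      using measurable_compose[OF measurable_pair_swap' w_meas] by (simp add: case_prod_beta')
    then show "(%y. NINT r|TL. (w y r)^2) \<in> bm N"
      by (intro TL.borel_measurable_nn_integral) (simp add: case_prod_beta')
  qed
  also have "(NINT y|N. NINT r|TL. (w y r)^2) = (NINT r|TL. NINT y|N. (w y r)^2)"
    by (rule TLN.Fubini') (use w_meas in \<open>simp add: case_prod_beta'\<close>)
  also have "... <= (NINT r|TL. ennreal (C0\<^sup>2 * Kb\<^sup>2) * ennreal ((norm (hU r))^2))"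
  proof (rule nn_integral_mono)
    fix r assume "r \<in> space TL"
    then have r: "r \<in> {0..T}" by (simp add: space_restrict_space)
    have "(NINT y|N. (w y r)^2) <= ennreal (C0\<^sup>2) * (NINT y|N. (ennreal \<bar>v r y\<bar>)^2)"
      unfolding w_def using vm[of r] by (intro \<kappa>_L2_bound s r) measurable
    also have "(NINT y|N. (ennreal \<bar>v r y\<bar>)^2) = (NINT y|(lebesgue_on \<Lambda>). ennreal ((v r y)^2))"
      unfolding N_def nn_integral_lebesgue_on_borel[OF \<Lambda>_borel, symmetric] by (simp add: ennreal_power)
    also have "... = (NINT y|(lebesgue_on \<Lambda>). ennreal ((Q (U r) y)^2))"
      by (rule nn_integral_cong_AE) (use ver(2)[OF UL[of r]] in eventually_elim, simp add: v_def)
    also have "... = ennreal (LINT y|lebesgue_on \<Lambda>. (Q (U r) y)^2)"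
      using Q_L2[OF UL[of r]] by (intro nn_integral_eq_integral) (auto simp: L2_def)
    also have "... <= ennreal (Kb\<^sup>2 * (norm (hU r))^2)"
      unfolding hU_def by (intro ennreal_leI Q_bound UL)
    finally show "(NINT y|N. (w y r)^2) <= ennreal (C0\<^sup>2 * Kb\<^sup>2) * ennreal ((norm (hU r))^2)"
      by (simp add: ennreal_mult'[symmetric] mult_left_mono mult.assoc)
  qed
  also have "... = ennreal (C0\<^sup>2 * Kb\<^sup>2) * ennreal (ip T hU hU)"
  proof -
    have i: "integrable TL (%r. (norm (hU r))^2)" using hU by (simp add: L2_time_def)
    have "(NINT r|TL. ennreal ((norm (hU r))^2)) = ennreal (ip T hU hU)"
      unfolding ip_def power2_norm_eq_inner[symmetric] using i by (intro nn_integral_eq_integral) auto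
    then show ?thesis using borel_measurable_integrable[OF i] by (subst nn_integral_cmult) auto
  qed
  finally have "(NINT y|N. ennreal ((ip T (g (s, y)) hU)^2)) <= ennreal (\<sigma>\<^sup>2 * T) * (ennreal (C0\<^sup>2 * Kb\<^sup>2) * ennreal (ip T hU hU))"
    by (simp add: mult_left_mono)
  also have "... = ennreal ((\<sigma> * lc)^2 * ip T hU hU)"
  proof -
    define x where "x = ip T hU hU"
    have x: "0 <= x" by (simp add: x_def ip_nonneg)
    have "ennreal (C0\<^sup>2 * Kb\<^sup>2) * ennreal x = ennreal (C0\<^sup>2 * Kb\<^sup>2 * x)" by (rule ennreal_mult'[symmetric]) simp
    moreover have "ennreal (\<sigma>\<^sup>2 * T) * ennreal (C0\<^sup>2 * Kb\<^sup>2 * x) = ennreal (\<sigma>\<^sup>2 * T * (C0\<^sup>2 * Kb\<^sup>2 * x))"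
      by (rule ennreal_mult'[symmetric]) (use T in simp)
    moreover have "\<sigma>\<^sup>2 * T * (C0\<^sup>2 * Kb\<^sup>2 * x) = (\<sigma> * lc)^2 * x"
      using T by (simp add: lc_def power_mult_distrib)
    ultimately show ?thesis unfolding x_def by simp
  qed
  finally show ?thesis unfolding hU_def .
qed

text \<open>A general integrand is a limit of those with simple L2 values, and Fatou's lemma carries
  the bound over.\<close>

lemma noise_operator:
  assumes h: "h \<in> L2_time T" and s: "s \<in> {0..T}"
  shows "(NINT y|N. ennreal ((ip T (g (s, y)) h)^2)) <= ennreal ((\<sigma> * lc)^2 * ip T h h)"
proof -
  have hm: "h \<in> bm TL" using h by (rule L2_time_measurable)
  have i2: "integrable TL (%x. (norm (h x))^2)" using h by (simp add: L2_time_def)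
  have cl: "closure (\<iota> ` L2 \<Lambda>) = UNIV" using completion by (simp add: is_completion_def)
  obtain U where U: "!!i. simple_function TL (U i)" "!!i x. U i x \<in> L2 \<Lambda>"
    "!!x. x \<in> space TL ==> (%i. \<iota> (U i x)) \<longlonglongrightarrow> h x"
    "!!i x. x \<in> space TL ==> norm (\<iota> (U i x)) <= 2 * norm (h x) + 1"
    by (rule simple_approximation_in_dense_image[OF hm cl]) blast
  define k where "k i x = \<iota> (U i x)" for i x
  have km: "k i \<in> bm TL" for i
    using borel_measurable_simple_function[OF simple_function_compose[OF U(1)[of i], of \<iota>]] by (simp add: k_def[abs_def] comp_def)
  have sq: "(norm (k i x))^2 <= 8 * (norm (h x))^2 + 2" if "x \<in> space TL" for i x
  proof -
    have "(norm (k i x))^2 <= (2 * norm (h x) + 1)^2" unfolding k_def by (intro power_mono U(4) that) simp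
    also have "... <= 8 * (norm (h x))^2 + 2"
      using zero_le_power2[of "2 * norm (h x) - 1"] by (simp add: power2_eq_square algebra_simps)
    finally show ?thesis .
  qed
  have dom: "integrable TL (%x. 8 * (norm (h x))^2 + 2)" using i2 by simp
  have kL: "k i \<in> L2_time T" for i
  proof -
    have "integrable TL (%x. (norm (k i x))^2)"
      by (rule Bochner_Integration.integrable_bound[OF dom]) (use km sq in \<open>auto intro!: AE_I2\<close>)
    then show ?thesis using km by (simp add: L2_time_def)
  qed
  have lim1: "(%i. ip T (g (s, y)) (k i)) \<longlonglongrightarrow> ip T (g (s, y)) h" if y: "y \<in> \<Lambda>" for y
    unfolding ip_def
  proof (rule integral_dominated_convergence[where w="%x. (norm (g (s, y) x))^2 + (8 * (norm (h x))^2 + 2)"])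
    have a: "(s, y) \<in> space S" using s y by (simp add: space_S)
    have gm: "g (s, y) \<in> bm TL" by (rule g_measurable[OF a])
    show "(%x. g (s, y) x \<bullet> h x) \<in> bm TL" "(%x. g (s, y) x \<bullet> k i x) \<in> bm TL" for i
      by (intro borel_measurable_inner gm hm km)+
    show "integrable TL (%x. (norm (g (s, y) x))^2 + (8 * (norm (h x))^2 + 2))"
      by (rule Bochner_Integration.integrable_add[OF _ dom]) (use g_L2[OF a] in \<open>simp add: L2_time_def\<close>)
    show "AE x in TL. (%i. g (s, y) x \<bullet> k i x) \<longlonglongrightarrow> g (s, y) x \<bullet> h x"
      using U(3) by (intro AE_I2 tendsto_inner tendsto_const) (simp add: k_def)
    show "AE x in TL. norm (g (s, y) x \<bullet> k i x) <= (norm (g (s, y) x))^2 + (8 * (norm (h x))^2 + 2)" for i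
    proof (rule AE_I2)
      fix x assume "x \<in> space TL"
      from sq[OF this, of i] abs_inner_le[of "g (s, y) x" "k i x"]
      show "norm (g (s, y) x \<bullet> k i x) <= (norm (g (s, y) x))^2 + (8 * (norm (h x))^2 + 2)" by simp
    qed
  qed
  have lim2: "(%i. ip T (k i) (k i)) \<longlonglongrightarrow> ip T h h"
    unfolding ip_def
  proof (rule integral_dominated_convergence[where w="%x. 8 * (norm (h x))^2 + 2"])
    show "(%x. h x \<bullet> h x) \<in> bm TL" "(%x. k i x \<bullet> k i x) \<in> bm TL" for i
      by (intro borel_measurable_inner hm km)+
    show "AE x in TL. (%i. k i x \<bullet> k i x) \<longlonglongrightarrow> h x \<bullet> h x"
      using U(3) by (intro AE_I2 tendsto_inner) (simp_all add: k_def)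
    show "AE x in TL. norm (k i x \<bullet> k i x) <= 8 * (norm (h x))^2 + 2" for i
      using sq by (intro AE_I2) (simp add: power2_norm_eq_inner[symmetric])
  qed (rule dom)
  have pm: "(%y. (s, y)) \<in> N \<rightarrow>\<^sub>M S"
    unfolding S_def using s by (intro measurable_Pair measurable_const) (auto simp: space_restrict_space)
  have ipm: "(%y. ip T (g (s, y)) (k i)) \<in> bm N" for i
    by (rule measurable_compose[OF pm ip_g_measurable[OF kL]])
  have "(NINT y|N. ennreal ((ip T (g (s, y)) h)^2)) = (NINT y|N. liminf (%i. ennreal ((ip T (g (s, y)) (k i))^2)))"
  proof (rule nn_integral_cong)
    fix y assume "y \<in> space N"
    then have "(%i. ennreal ((ip T (g (s, y)) (k i))^2)) \<longlonglongrightarrow> ennreal ((ip T (g (s, y)) h)^2)"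
      by (intro tendsto_ennrealI tendsto_power lim1) (simp add: space_N)
    then show "ennreal ((ip T (g (s, y)) h)^2) = liminf (%i. ennreal ((ip T (g (s, y)) (k i))^2))"
      by (intro lim_imp_Liminf[symmetric]) auto
  qed
  also have "... <= liminf (%i. NINT y|N. ennreal ((ip T (g (s, y)) (k i))^2))"
    by (intro nn_integral_liminf measurable_compose[OF borel_measurable_power[OF ipm] measurable_ennreal])
  also have "... <= liminf (%i. ennreal ((\<sigma> * lc)^2 * ip T (k i) (k i)))"
    unfolding k_def[abs_def]
    by (intro Liminf_mono always_eventually allI noise_operator_simple s U kL[unfolded k_def[abs_def]])
  also have "... = ennreal ((\<sigma> * lc)^2 * ip T h h)"
    by (intro lim_imp_Liminf tendsto_ennrealI tendsto_mult tendsto_const lim2) auto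
  finally show ?thesis .
qed

text \<open>The pairing of the kernel at \<open>(t, y)\<close> with the normalised tail is the norm
  \<open>n\<close> of that tail, bounded below by noise scaling on the window. Any other kernel up
  to time \<open>t\<close> meets the direction only through its own tail on the window, which noise
  scaling bounds above; Cauchy--Schwarz then gives \<open>q1\<close>.\<close>

theorem field_law_bounds:
  assumes t: "0 < t" "t <= T" and y: "y \<in> \<Gamma>" and \<delta>: "0 < \<delta>" "\<delta> <= t"
    and small: "C0 * (L * (2 * sqrt (Cu * \<delta> powr \<alpha>) * E T)) * \<delta> <= sqrt (Cl * \<delta> powr \<alpha>) / 2"
    and ab: "a < b"
  shows "measure P {om \<in> space P. X t y om \<in> {a..b}} <= (b - a) / (sqrt (Cl * \<delta> powr \<alpha>) / 2)"
    and "\<bar>a\<bar> <= R ==> \<bar>b\<bar> <= R ==>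
      std_normal_density ((R + (2 * m1 + 1)) / (sqrt (Cl * \<delta> powr \<alpha>) / 2)) / (sqrt (Cu * \<delta> powr \<alpha>) + sqrt (Cl * \<delta> powr \<alpha>) / 2) / 2 * (b - a)
        <= measure P {om \<in> space P. X t y om \<in> {a..b}}"
proof -
  define A0 where "A0 = sqrt (Cl * \<delta> powr \<alpha>) / 2"
  define q1 where "q1 = sqrt (Cu * \<delta> powr \<alpha>)"
  have ty: "(t, y) \<in> space S" using t y \<Gamma>_subset by (auto simp: space_S)
  have A0: "0 < A0" using Cl \<delta> by (simp add: A0_def)
  define r where "r = t - \<delta>"
  have r: "0 <= r" "r <= t" using \<delta> by (simp_all add: r_def)
  define w where "w = gtail r (t, y)"
  define n where "n = sqrt (ip T w w)"
  have w: "w \<in> L2_time T" "ip T w w <= Cu * \<delta> powr \<alpha>" "Cl * \<delta> powr \<alpha> <= ip T w w"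
    using gtail_L2[of r "(t, y)"] r ty y by (simp_all add: w_def r_def)
  have pos: "0 < Cl * \<delta> powr \<alpha>" using Cl \<delta> by simp
  then have n: "0 < n" "n\<^sup>2 = ip T w w" "2 * A0 <= n" using w by (simp_all add: n_def A0_def)
  have CuP: "0 <= Cu * \<delta> powr \<alpha>" using Cl by (intro mult_nonneg_nonneg) auto
  define u where "u x = (1 / n) *\<^sub>R w x" for x
  have u: "u \<in> L2_time T" "ip T u u = 1"
  proof -
    show uL: "u \<in> L2_time T" unfolding u_def[abs_def] by (rule L2_time_scale[OF w(1)])
    have "ip T u u = (1 / n) * ((1 / n) * ip T w w)"
      unfolding u_def[abs_def] using ip_scale[OF w(1) L2_time_scale[OF w(1)]] ip_scale[OF w(1) w(1)] by simp
    then show "ip T u u = 1" unfolding n(2)[symmetric] using n(1) by (simp add: power2_eq_square)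
  qed
  have ipu: "ip T (g b) u = (1 / n) * ip T (gtail r b) w" if b: "b \<in> space S" for b
  proof -
    have "ip T (g b) u = (1 / n) * ip T (g b) w"
      unfolding u_def[abs_def] by (rule ip_scale(2)[OF w(1) g_L2[OF b]])
    moreover have "g b x \<bullet> w x = gtail r b x \<bullet> w x" for x by (simp add: w_def gtail_def)
    ultimately show ?thesis by (simp add: ip_def)
  qed
  have lower: "2 * A0 <= ip T (g (t, y)) u"
  proof -
    have "ip T (g (t, y)) u = n" unfolding ipu[OF ty] w_def[symmetric] n(2)[symmetric] using n(1) by (simp add: power2_eq_square)
    then show ?thesis using n by simp
  qed
  have early: "ip T (g b) u = 0" if b: "b \<in> space S" "fst b <= t - \<delta>" for b
  proof -
    have "gtail r b = (%_. 0)" using b by (auto simp: gtail_def g_def g0_def r_def fun_eq_iff)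
    then show ?thesis using ipu[OF b(1)] by (simp add: ip_def)
  qed
  have upper: "\<bar>ip T (g b) u\<bar> <= q1" if b: "b \<in> space S" "fst b <= t" for b
  proof (cases "r <= fst b")
    case False
    then show ?thesis using early[OF b(1)] CuP by (simp add: r_def q1_def)
  next
    case True
    note gt = gtail_L2[OF r(1) True b(1)]
    have "(ip T (gtail r b) w)^2 <= ip T (gtail r b) (gtail r b) * ip T w w" by (rule ip_Cauchy_Schwarz[OF gt(1) w(1)])
    also have "... <= (Cu * \<delta> powr \<alpha>) * n\<^sup>2"
    proof -
      have "Cu * (fst b - r) powr \<alpha> <= Cu * \<delta> powr \<alpha>"
        using b True Cl \<alpha> by (intro mult_left_mono powr_mono2) (auto simp: r_def)
      then show ?thesis unfolding n(2) using gt(2) by (intro mult_right_mono ip_nonneg) linarith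
    qed
    finally have "(ip T (g b) u)^2 <= Cu * \<delta> powr \<alpha>"
      unfolding ipu[OF b(1)] using n(1) by (simp add: power_mult_distrib power_divide field_simps)
    also have "... = q1\<^sup>2" using CuP by (simp add: q1_def)
    finally have "\<bar>ip T (g b) u\<bar>\<^sup>2 <= q1\<^sup>2" by simp
    moreover have "0 <= q1" using CuP by (simp add: q1_def)
    ultimately show ?thesis by (rule power2_le_imp_le)
  qed
  have sm: "C0 * (L * (2 * q1 * E T)) * \<delta> <= A0" using small unfolding q1_def A0_def .
  note lb = law_bounds[OF ty u A0 less_imp_le[OF \<delta>(1)] lower upper early sm ab]
  show "measure P {om \<in> space P. X t y om \<in> {a..b}} <= (b - a) / (sqrt (Cl * \<delta> powr \<alpha>) / 2)"
    using lb(1) unfolding A0_def XS_def by (simp only: fst_conv snd_conv)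
  show "\<bar>a\<bar> <= R ==> \<bar>b\<bar> <= R ==>
      std_normal_density ((R + (2 * m1 + 1)) / (sqrt (Cl * \<delta> powr \<alpha>) / 2)) / (sqrt (Cu * \<delta> powr \<alpha>) + sqrt (Cl * \<delta> powr \<alpha>) / 2) / 2 * (b - a)
        <= measure P {om \<in> space P. X t y om \<in> {a..b}}"
    using lb(2)[of R] unfolding A0_def q1_def XS_def by (simp only: fst_conv snd_conv)
qed

end

section \<open>Occupation measures\<close>

context diffusion_model begin

lemma \<Gamma>_borel_part:
  "\<exists>A. A \<in> sets borel \<and> A \<subseteq> \<Gamma> \<and> (AE x in lebesgue. x \<in> \<Gamma> \<longleftrightarrow> x \<in> A)"
proof -
  from \<Gamma>_lebesgue obtain S N1 N' where A: "\<Gamma> = S \<union> N1" "N1 \<subseteq> N'" "N' \<in> null_sets lborel" "S \<in> sets lborel"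
    by (rule sets_completionE)
  have "AE x in lebesgue. x \<notin> N'" by (rule AE_completion[OF AE_not_in[OF A(3)]])
  then have "AE x in lebesgue. x \<in> \<Gamma> \<longleftrightarrow> x \<in> S" by eventually_elim (use A in auto)
  then show ?thesis using A by auto
qed

text \<open>A Borel subset that differs from \<open>\<Gamma>\<close> by a null set, since
  \<open>N\<close> has Borel sets only.\<close>

definition \<Gamma>0 where "\<Gamma>0 = (SOME A. A \<in> sets borel \<and> A \<subseteq> \<Gamma> \<and> (AE x in lebesgue. x \<in> \<Gamma> \<longleftrightarrow> x \<in> A))"

lemma \<Gamma>0: "\<Gamma>0 \<in> sets borel" "\<Gamma>0 \<subseteq> \<Gamma>" "AE x in lebesgue. x \<in> \<Gamma> \<longleftrightarrow> x \<in> \<Gamma>0"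
  using someI_ex[OF \<Gamma>_borel_part] unfolding \<Gamma>0_def by blast+

lemma \<Gamma>0_N: "\<Gamma>0 \<in> sets N"
proof -
  have "\<Gamma>0 = \<Gamma>0 \<inter> \<Lambda>" using \<Gamma>0 \<Gamma>_subset by blast
  then show ?thesis using \<Gamma>0(1) unfolding N_def by (auto simp: sets_restrict_space)
qed

lemma integral_\<Gamma>:
  fixes h :: "'a => real"
  assumes h: "h \<in> bm N"
  shows "(LINT y|lebesgue_on \<Gamma>. h y) = (LINT y|N. indicator \<Gamma>0 y * h y)"
proof -
  have hl: "(%y. indicator \<Lambda> y *\<^sub>R h y) \<in> bm lebesgue"
    by (rule borel_measurable_restrict_space_iff[THEN iffD1, OF _ borel_to_lebesgue[OF h]]) simp
  have m: "(%y. indicator A y *\<^sub>R (indicator \<Lambda> y *\<^sub>R h y)) \<in> bm lebesgue" if "A \<in> sets lebesgue" for A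
    by (intro borel_measurable_scaleR borel_measurable_indicator that hl)
  have "(LINT y|lebesgue_on \<Gamma>. h y) = (LINT y|lebesgue. indicator \<Gamma> y *\<^sub>R h y)"
    using \<Gamma>_lebesgue by (intro integral_restrict_space) simp
  also have "... = (LINT y|lebesgue. indicator \<Gamma> y *\<^sub>R (indicator \<Lambda> y *\<^sub>R h y))"
    using \<Gamma>_subset by (intro Bochner_Integration.integral_cong) (auto simp: indicator_def)
  also have "... = (LINT y|lebesgue. indicator \<Gamma>0 y *\<^sub>R (indicator \<Lambda> y *\<^sub>R h y))"
  proof (rule integral_cong_AE[OF m m])
    show "AE y in lebesgue. indicator \<Gamma> y *\<^sub>R (indicator \<Lambda> y *\<^sub>R h y) = indicator \<Gamma>0 y *\<^sub>R (indicator \<Lambda> y *\<^sub>R h y)"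
      using \<Gamma>0(3) by eventually_elim (auto simp: indicator_def)
  qed (use \<Gamma>_lebesgue \<Gamma>0(1) in auto)
  also have "... = (LINT y|lebesgue. indicator \<Lambda> y *\<^sub>R (indicator \<Gamma>0 y * h y))"
    by (simp add: mult_ac)
  also have "... = (LINT y|lebesgue_on \<Lambda>. indicator \<Gamma>0 y * h y)"
    by (rule integral_restrict_space[symmetric]) simp
  also have "... = (LINT y|N. indicator \<Gamma>0 y * h y)"
    unfolding N_def by (rule lebesgue_on_borel(2)[OF \<Lambda>_borel], fold N_def) (intro borel_measurable_times borel_measurable_indicator \<Gamma>0_N h)
  finally show ?thesis .
qed

lemma measure_\<Gamma>0: "measure N \<Gamma>0 = measure lebesgue \<Gamma>"
proof -
  have "(LINT y|lebesgue_on \<Gamma>. 1) = measure lebesgue \<Gamma>"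
    using \<Gamma>_lebesgue by (simp add: measure_restrict_space space_restrict_space)
  moreover have "(LINT y|N. indicator \<Gamma>0 y * 1) = measure N \<Gamma>0" using \<Gamma>0_N by simp
  ultimately show ?thesis using integral_\<Gamma>[of "%_. 1"] by simp
qed

context
  fixes t :: real assumes t: "t \<in> {0..T}"
begin

interpretation PN: pair_sigma_finite P N ..

lemma PNf: "finite_measure (P \<Otimes>\<^sub>M N)" by (rule finite_measure_pair_measure[OF finite_N]) unfold_locales

lemma integrable_\<Gamma>0: "integrable N (%y. indicator \<Gamma>0 y * c :: real)"
proof (rule N.integrable_const_bound[where B="\<bar>c\<bar>"])
  show "(%y. indicator \<Gamma>0 y * c) \<in> bm N"
    by (intro borel_measurable_times borel_measurable_indicator \<Gamma>0_N borel_measurable_const)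
qed (auto simp: indicator_def)

lemma slice_measurable: "(%p. X t (snd p) (fst p)) \<in> bm (P \<Otimes>\<^sub>M N)"
proof -
  have pm: "(%y. (t, y)) \<in> N \<rightarrow>\<^sub>M S"
    unfolding S_def using t by (intro measurable_Pair measurable_const) (auto simp: space_restrict_space)
  have "(%p. (fst p, (t, snd p))) \<in> P \<Otimes>\<^sub>M N \<rightarrow>\<^sub>M P \<Otimes>\<^sub>M S"
    using measurable_compose[OF measurable_snd pm] by (intro measurable_Pair) auto
  from measurable_compose[OF this XS_measurable] show ?thesis by (simp add: XS_def case_prod_beta')
qed

lemma slice1: "om \<in> space P ==> (%y. X t y om) \<in> bm N"
  using measurable_compose[OF measurable_Pair1' slice_measurable] by simp

lemma slice2: "y \<in> \<Lambda> ==> (%om. X t y om) \<in> bm P"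
  using measurable_compose[OF measurable_Pair2'[of y N P] slice_measurable] by (simp add: space_N)

text \<open>Occupation functional with a general weight \<open>\<psi>\<close>. The indicator of an
  interval gives the occupation time, a Lipschitz weight gives a functional to which concentration
  applies.\<close>

definition occ :: "(real => real) => 'w => real" where
  "occ \<psi> om = (LINT y|N. indicator \<Gamma>0 y * \<psi> (X t y om))"

lemma occ_integrable_product:
  fixes \<psi> :: "real => real"
  assumes \<psi>: "\<psi> \<in> bm borel" "!!x. \<bar>\<psi> x\<bar> <= 1"
  shows "integrable (P \<Otimes>\<^sub>M N) (%(om, y). indicator \<Gamma>0 y * \<psi> (X t y om))"
proof (rule Bochner_Integration.integrable_bound)
  show "integrable (P \<Otimes>\<^sub>M N) (%_. 1 :: real)" by (rule finite_measure.integrable_const[OF PNf])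
  have "(%p. indicator \<Gamma>0 (snd p) * \<psi> (X t (snd p) (fst p))) \<in> bm (P \<Otimes>\<^sub>M N)"
    by (intro borel_measurable_times measurable_compose[OF measurable_snd borel_measurable_indicator[OF \<Gamma>0_N]]
        measurable_compose[OF slice_measurable \<psi>(1)])
  then show "(%(om, y). indicator \<Gamma>0 y * \<psi> (X t y om)) \<in> bm (P \<Otimes>\<^sub>M N)" by (simp add: case_prod_beta')
  show "AE p in P \<Otimes>\<^sub>M N. norm (case p of (om, y) => indicator \<Gamma>0 y * \<psi> (X t y om)) <= norm (1 :: real)"
    using \<psi>(2) by (auto simp: indicator_def)
qed

lemma occ_integrable:
  assumes \<psi>: "\<psi> \<in> bm borel" "!!x. \<bar>\<psi> x\<bar> <= 1"
  shows "integrable P (occ \<psi>)" "(LINT om|P. occ \<psi> om) = (LINT y|N. indicator \<Gamma>0 y * (LINT om|P. \<psi> (X t y om)))"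
    "integrable N (%y. indicator \<Gamma>0 y * (LINT om|P. \<psi> (X t y om)))"
proof -
  note i = occ_integrable_product[OF \<psi>]
  show "integrable P (occ \<psi>)" unfolding occ_def[abs_def] using PN.integrable_fst'[OF i] by simp
  have "(LINT om|P. occ \<psi> om) = (LINT y|N. LINT om|P. indicator \<Gamma>0 y * \<psi> (X t y om))"
    unfolding occ_def using PN.Fubini_integral[OF i] by simp
  then show "(LINT om|P. occ \<psi> om) = (LINT y|N. indicator \<Gamma>0 y * (LINT om|P. \<psi> (X t y om)))" by simp
  show "integrable N (%y. indicator \<Gamma>0 y * (LINT om|P. \<psi> (X t y om)))"
    using PN.integrable_snd[OF i] by simp
qed

lemma expectation_occ_le:
  assumes \<psi>: "\<psi> \<in> bm borel" "!!x. \<bar>\<psi> x\<bar> <= 1" and c: "!!y. y \<in> \<Gamma> ==> (LINT om|P. \<psi> (X t y om)) <= c"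
  shows "(LINT om|P. occ \<psi> om) <= measure lebesgue \<Gamma> * c"
proof -
  have "(LINT om|P. occ \<psi> om) <= (LINT y|N. indicator \<Gamma>0 y * c)"
    unfolding occ_integrable(2)[OF \<psi>] using c \<Gamma>0(2)
    by (intro integral_mono occ_integrable(3)[OF \<psi>] integrable_\<Gamma>0) (auto simp: indicator_def)
  then show ?thesis using \<Gamma>0_N by (simp add: measure_\<Gamma>0)
qed

lemma expectation_occ_ge:
  assumes \<psi>: "\<psi> \<in> bm borel" "!!x. \<bar>\<psi> x\<bar> <= 1" and c: "!!y. y \<in> \<Gamma> ==> c <= (LINT om|P. \<psi> (X t y om))"
  shows "measure lebesgue \<Gamma> * c <= (LINT om|P. occ \<psi> om)"
proof -
  have "(LINT y|N. indicator \<Gamma>0 y * c) <= (LINT om|P. occ \<psi> om)"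
    unfolding occ_integrable(2)[OF \<psi>] using c \<Gamma>0(2)
    by (intro integral_mono occ_integrable(3)[OF \<psi>] integrable_\<Gamma>0) (auto simp: indicator_def)
  then show ?thesis using \<Gamma>0_N by (simp add: measure_\<Gamma>0)
qed

lemma occupation_time_occ:
  assumes J: "J \<in> sets borel" and om: "om \<in> space P"
  shows "occupation_time \<Gamma> (X t) J om = occ (indicator J) om"
  unfolding occupation_time_def occ_def
  by (rule integral_\<Gamma>) (rule measurable_compose[OF slice1[OF om] borel_measurable_indicator[OF J]])

lemma occupation_measure_occ:
  "J \<in> sets borel ==> occupation_measure P \<Gamma> (X t) J = (LINT om|P. occ (indicator J) om)"
  unfolding occupation_measure_def by (intro Bochner_Integration.integral_cong occupation_time_occ) auto

lemma prob_indicator: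
  assumes J: "J \<in> sets borel" and y: "y \<in> \<Lambda>"
  shows "(LINT om|P. indicator J (X t y om)) = measure P {om \<in> space P. X t y om \<in> J}"
proof -
  have "{om \<in> space P. X t y om \<in> J} \<in> sets P" using slice2[OF y] J by measurable
  moreover have "(LINT om|P. indicator J (X t y om)) = (LINT om|P. indicator {om \<in> space P. X t y om \<in> J} om :: real)"
    by (intro Bochner_Integration.integral_cong) (auto simp: indicator_def)
  ultimately show ?thesis by simp
qed

lemma occupation_measure_eq:
  assumes J: "J \<in> sets borel"
  shows "occupation_measure P \<Gamma> (X t) J = (LINT y|lebesgue_on \<Gamma>. measure P {om \<in> space P. X t y om \<in> J})"
proof -
  have b: "(indicator J :: real => real) \<in> bm borel" "!!x. \<bar>indicator J x :: real\<bar> <= 1"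
    using J by (auto simp: indicator_def)
  have m: "(%y. LINT om|P. indicator J (X t y om) :: real) \<in> bm N"
  proof (rule borel_measurable_lebesgue_integral)
    have "(%p. X t (fst p) (snd p)) \<in> bm (N \<Otimes>\<^sub>M P)"
      using measurable_compose[OF measurable_pair_swap' slice_measurable] by (simp add: case_prod_beta')
    from measurable_compose[OF this b(1)]
    show "(%(y, om). indicator J (X t y om) :: real) \<in> bm (N \<Otimes>\<^sub>M P)" by (simp add: case_prod_beta')
  qed
  have "occupation_measure P \<Gamma> (X t) J = (LINT y|lebesgue_on \<Gamma>. LINT om|P. indicator J (X t y om))"
    unfolding occupation_measure_occ[OF J] occ_integrable(2)[OF b] integral_\<Gamma>[OF m] ..
  also have "... = (LINT y|lebesgue_on \<Gamma>. measure P {om \<in> space P. X t y om \<in> J})"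
    using \<Gamma>_subset by (intro Bochner_Integration.integral_cong prob_indicator J) (auto simp: space_restrict_space)
  finally show ?thesis .
qed

text \<open>\<open>\<phi>\<close> is a Lipschitz substitute for \<open>\<psi>\<close> and
  \<open>\<xi>\<close> dominates the error. The substitution is paid for twice, once in the
  functional and once in its expectation.\<close>

lemma occ_deviation:
  assumes \<psi>: "\<psi> \<in> bm borel" "!!x. \<bar>\<psi> x\<bar> <= 1" and \<phi>: "\<phi> \<in> bm borel" "!!x. \<bar>\<phi> x\<bar> <= 1"
    and Lp: "0 < Lp" "!!x y. \<bar>\<phi> x - \<phi> y\<bar> <= Lp * \<bar>x - y\<bar>"
    and \<xi>: "\<xi> \<in> bm borel" "!!x. \<bar>\<xi> x\<bar> <= 1" and near: "!!x. \<bar>\<psi> x - \<phi> x\<bar> <= \<xi> x"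
    and c: "!!y. y \<in> \<Gamma> ==> (LINT om|P. \<xi> (X t y om)) <= c"
  shows "(LINT om|P. \<bar>occ \<psi> om - (LINT om|P. occ \<psi> om)\<bar>) <=
    3 * (Lp * (\<sigma> * lc) * sqrt ((measure N (space N) + 1) * (2 + KK * gap * T))) + 2 * (measure lebesgue \<Gamma> * c)"
proof -
  note i\<psi> = occ_integrable(1)[OF \<psi>] and i\<phi> = occ_integrable(1)[OF \<phi>] and i\<xi> = occ_integrable(1)[OF \<xi>]
  have dev: "(LINT om|P. \<bar>occ \<phi> om - (LINT om|P. occ \<phi> om)\<bar>) <= 3 * (Lp * (\<sigma> * lc) * sqrt ((measure N (space N) + 1) * (2 + KK * gap * T)))"
    using occupation_functional_deviation(3)[OF mult_pos_pos[OF \<sigma> lc] t noise_operator \<Gamma>0_N \<phi> Lp] by (simp add: occ_def XS_def)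
  have pt: "\<bar>occ \<psi> om - occ \<phi> om\<bar> <= occ \<xi> om" if om: "om \<in> space P" for om
  proof -
    have ii: "integrable N (%y. indicator \<Gamma>0 y * \<theta> (X t y om))" if "\<theta> \<in> bm borel" "!!x. \<bar>\<theta> x\<bar> <= 1" for \<theta> :: "real => real"
    proof (rule N.integrable_const_bound[where B=1])
      show "(%y. indicator \<Gamma>0 y * \<theta> (X t y om)) \<in> bm N"
        by (intro borel_measurable_times borel_measurable_indicator \<Gamma>0_N measurable_compose[OF slice1[OF om] that(1)])
    qed (use that(2) in \<open>auto simp: indicator_def\<close>)
    have "occ \<psi> om - occ \<phi> om = (LINT y|N. indicator \<Gamma>0 y * \<psi> (X t y om) - indicator \<Gamma>0 y * \<phi> (X t y om))"
      unfolding occ_def by (rule Bochner_Integration.integral_diff[OF ii[OF \<psi>] ii[OF \<phi>], symmetric])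
    then have "\<bar>occ \<psi> om - occ \<phi> om\<bar> <= (LINT y|N. \<bar>indicator \<Gamma>0 y * \<psi> (X t y om) - indicator \<Gamma>0 y * \<phi> (X t y om)\<bar>)" by simp
    also have "... <= occ \<xi> om"
      unfolding occ_def
      by (intro integral_mono integrable_abs Bochner_Integration.integrable_diff ii \<psi> \<phi> \<xi>) (use near in \<open>auto simp: indicator_def\<close>)
    finally show ?thesis .
  qed
  have "(LINT om|P. \<bar>occ \<psi> om - occ \<phi> om\<bar>) <= (LINT om|P. occ \<xi> om)"
    using i\<psi> i\<phi> i\<xi> pt by (intro integral_mono) auto
  also have "... <= measure lebesgue \<Gamma> * c" by (rule expectation_occ_le[OF \<xi> c])
  finally have near': "(LINT om|P. \<bar>occ \<psi> om - occ \<phi> om\<bar>) <= measure lebesgue \<Gamma> * c" .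
  define m where "m = (LINT om|P. occ \<psi> om)"
  define n where "n = (LINT om|P. occ \<phi> om)"
  have "\<bar>n - m\<bar> = \<bar>LINT om|P. occ \<phi> om - occ \<psi> om\<bar>" unfolding m_def n_def using i\<psi> i\<phi> by simp
  also have "... <= (LINT om|P. \<bar>occ \<phi> om - occ \<psi> om\<bar>)" by (rule integral_abs_bound)
  finally have mn: "\<bar>n - m\<bar> <= measure lebesgue \<Gamma> * c" using near' by (simp add: abs_minus_commute)
  have "(LINT om|P. \<bar>occ \<psi> om - m\<bar>) <= (LINT om|P. (\<bar>occ \<phi> om - n\<bar> + \<bar>occ \<psi> om - occ \<phi> om\<bar>) + \<bar>n - m\<bar>)"
    using i\<psi> i\<phi> by (intro integral_mono Bochner_Integration.integrable_add integrable_abs Bochner_Integration.integrable_diff) auto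
  also have "... = (LINT om|P. \<bar>occ \<phi> om - n\<bar>) + (LINT om|P. \<bar>occ \<psi> om - occ \<phi> om\<bar>) + \<bar>n - m\<bar>"
    using i\<psi> i\<phi> by (simp add: prob_space)
  finally show ?thesis using dev near' mn by (simp add: m_def[symmetric] n_def[symmetric])
qed

end

end

lemma nondegenerate_interval_bounds:
  assumes "nondegenerate_interval J"
  obtains a b where "a < b" "{a<..<b} \<subseteq> J" "J \<subseteq> {a..b}" "J \<in> sets borel" "measure lborel J = b - a"
proof -
  have i: "is_interval J" and bd: "bounded J" and "interior J \<noteq> {}"
    using assms by (auto simp: nondegenerate_interval_def)
  then obtain x e where e: "0 < e" "ball x e \<subseteq> J" by (meson all_not_in_conv mem_interior)
  have ne: "J \<noteq> {}" using e by auto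
  define a where "a = Inf J"
  define b where "b = Sup J"
  have ba: "bdd_above J" "bdd_below J" using bd by (auto simp: bounded_imp_bdd_above bounded_imp_bdd_below)
  have sub: "J \<subseteq> {a..b}" using ba by (auto simp: a_def b_def cInf_lower cSup_upper)
  have "x - e / 2 \<in> J" "x + e / 2 \<in> J" using e by (auto simp: subset_iff dist_real_def)
  then have "a <= x - e / 2" "x + e / 2 <= b" using sub by auto
  then have ab: "a < b" using e(1) by linarith
  have inner: "{a<..<b} \<subseteq> J"
  proof
    fix z assume z: "z \<in> {a<..<b}"
    obtain u where u: "u \<in> J" "u < z" using z ne ba by (auto simp: a_def cInf_less_iff)
    obtain v where v: "v \<in> J" "z < v" using z ne ba by (auto simp: b_def less_cSup_iff)
    show "z \<in> J" using mem_is_interval_1_I[OF i u(1) v(1)] u v by simp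
  qed
  have J: "J = {a<..<b} \<union> (J \<inter> {a, b})" using sub inner by force
  have fin: "finite (J \<inter> {a, b})" by simp
  have "J \<in> sets borel" by (subst J) (intro sets.Un borel_open borel_closed finite_imp_closed fin open_greaterThanLessThan)
  moreover have "measure lborel J = b - a"
  proof (rule antisym)
    have f: "{a..b} \<in> fmeasurable lborel" by (rule fmeasurableI) (use ab in auto)
    show "measure lborel J <= b - a"
      using measure_mono_fmeasurable[OF sub _ f] calculation ab by simp
    have "J \<in> fmeasurable lborel" using fmeasurableI2[OF f sub] calculation by simp
    from measure_mono_fmeasurable[OF inner _ this] show "b - a <= measure lborel J" using ab by simp
  qed
  ultimately show ?thesis using that[OF ab inner sub] by blast
qed

section \<open>Occupation of an interval for one diffusivity\<close>

context diffusion_model begin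

context
  fixes t \<delta> :: real
  assumes t: "0 < t" "t <= T" and \<delta>: "0 < \<delta>" "\<delta> <= t"
    and small: "C0 * (L * (2 * sqrt (Cu * \<delta> powr \<alpha>) * E T)) * \<delta> <= sqrt (Cl * \<delta> powr \<alpha>) / 2"
begin

lemma interval_probability_le:
  assumes y: "y \<in> \<Gamma>" and J: "a < b" "J \<subseteq> {a..b}"
  shows "measure P {om \<in> space P. X t y om \<in> J} <= (b - a) / (sqrt (Cl * \<delta> powr \<alpha>) / 2)"
proof -
  have tT: "t \<in> {0..T}" using t by simp
  have [measurable]: "(%om. X t y om) \<in> bm P" using slice2[OF tT] y \<Gamma>_subset by auto
  have "measure P {om \<in> space P. X t y om \<in> J} <= measure P {om \<in> space P. X t y om \<in> {a..b}}"
    using J by (intro finite_measure_mono) auto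
  also have "... <= (b - a) / (sqrt (Cl * \<delta> powr \<alpha>) / 2)" by (rule field_law_bounds(1)[OF t y \<delta> small J(1)])
  finally show ?thesis .
qed

text \<open>The law bound is for closed intervals, while an interval \<open>J\<close> is only known
  to contain \<open>{a<..<b}\<close>; hence the slack \<open>\<theta>\<close>.\<close>

lemma interval_probability_ge:
  assumes y: "y \<in> \<Gamma>" and J: "a < b" "{a<..<b} \<subseteq> J" "J \<in> sets borel" and R: "\<bar>a\<bar> <= R" "\<bar>b\<bar> <= R"
  shows "std_normal_density ((R + (2 * m1 + 1)) / (sqrt (Cl * \<delta> powr \<alpha>) / 2)) / (sqrt (Cu * \<delta> powr \<alpha>) + sqrt (Cl * \<delta> powr \<alpha>) / 2) / 2 * (b - a)
    <= measure P {om \<in> space P. X t y om \<in> J}" (is "?c * _ <= _")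
proof (rule le_from_linear_slack[of "(b - a) / 2" "2 * ?c + 1"])
  have tT: "t \<in> {0..T}" using t by simp
  have [measurable]: "(%om. X t y om) \<in> bm P" using slice2[OF tT] y \<Gamma>_subset by auto
  note [measurable] = J(3)
  have c: "0 <= ?c" using Cl by (intro divide_nonneg_nonneg add_nonneg_nonneg real_sqrt_ge_zero mult_nonneg_nonneg) auto
  then show "0 < 2 * ?c + 1" by (simp add: add_nonneg_pos)
  show "0 < (b - a) / 2" using J by simp
  fix \<theta> assume \<theta>: "0 < \<theta>" "\<theta> < (b - a) / 2"
  have "?c * ((b - \<theta>) - (a + \<theta>)) <= measure P {om \<in> space P. X t y om \<in> {a + \<theta>..b - \<theta>}}"
    using \<theta> R by (intro field_law_bounds(2)[OF t y \<delta> small]) auto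
  also have "... <= measure P {om \<in> space P. X t y om \<in> J}"
    using J \<theta> by (intro finite_measure_mono) (auto simp: subset_iff)
  finally have "?c * ((b - \<theta>) - (a + \<theta>)) <= measure P {om \<in> space P. X t y om \<in> J}" .
  moreover have "?c * ((b - \<theta>) - (a + \<theta>)) = ?c * (b - a) - 2 * ?c * \<theta>" by (simp only: algebra_simps mult_2)
  ultimately show "?c * (b - a) <= measure P {om \<in> space P. X t y om \<in> J} + (2 * ?c + 1) * \<theta>"
    using \<theta>(1) by (simp only: distrib_right)
qed

lemma occupation_measure_bounds:
  assumes J: "a < b" "{a<..<b} \<subseteq> J" "J \<subseteq> {a..b}" "J \<in> sets borel"
  shows "occupation_measure P \<Gamma> (X t) J <= measure lebesgue \<Gamma> * ((b - a) / (sqrt (Cl * \<delta> powr \<alpha>) / 2))"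
    and "\<bar>a\<bar> <= R ==> \<bar>b\<bar> <= R ==>
      measure lebesgue \<Gamma> * (std_normal_density ((R + (2 * m1 + 1)) / (sqrt (Cl * \<delta> powr \<alpha>) / 2)) / (sqrt (Cu * \<delta> powr \<alpha>) + sqrt (Cl * \<delta> powr \<alpha>) / 2) / 2 * (b - a))
        <= occupation_measure P \<Gamma> (X t) J"
proof -
  have tT: "t \<in> {0..T}" using t by simp
  have b: "(indicator J :: real => real) \<in> bm borel" "!!x. \<bar>indicator J x :: real\<bar> <= 1"
    using J by (auto simp: indicator_def)
  show "occupation_measure P \<Gamma> (X t) J <= measure lebesgue \<Gamma> * ((b - a) / (sqrt (Cl * \<delta> powr \<alpha>) / 2))"
    unfolding occupation_measure_occ[OF tT J(4)] using interval_probability_le[OF _ J(1,3)] \<Gamma>_subset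
    by (intro expectation_occ_le[OF tT b]) (simp add: prob_indicator[OF tT J(4)] subset_iff)
  assume R: "\<bar>a\<bar> <= R" "\<bar>b\<bar> <= R"
  show "measure lebesgue \<Gamma> * (std_normal_density ((R + (2 * m1 + 1)) / (sqrt (Cl * \<delta> powr \<alpha>) / 2)) / (sqrt (Cu * \<delta> powr \<alpha>) + sqrt (Cl * \<delta> powr \<alpha>) / 2) / 2 * (b - a))
        <= occupation_measure P \<Gamma> (X t) J"
    unfolding occupation_measure_occ[OF tT J(4)]
  proof (rule expectation_occ_ge[OF tT b])
    fix y assume y: "y \<in> \<Gamma>"
    then have "y \<in> \<Lambda>" using \<Gamma>_subset by auto
    from interval_probability_ge[OF y J(1,2,4) R]
    show "std_normal_density ((R + (2 * m1 + 1)) / (sqrt (Cl * \<delta> powr \<alpha>) / 2)) / (sqrt (Cu * \<delta> powr \<alpha>) + sqrt (Cl * \<delta> powr \<alpha>) / 2) / 2 * (b - a)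
        <= (LINT om|P. indicator J (X t y om))"
      unfolding prob_indicator[OF tT J(4) \<open>y \<in> \<Lambda>\<close>] .
  qed
qed

text \<open>Markov's inequality for the mean deviation. The first summand is small with the noise
  level once \<open>\<eta>\<close> is fixed, the second is small with \<open>\<eta>\<close>, so
  \<open>\<eta>\<close> has to be chosen before the diffusivity.\<close>

lemma occupation_deviation:
  assumes J: "a < b" "{a<..<b} \<subseteq> J" "J \<subseteq> {a..b}" "J \<in> sets borel" and \<eta>: "0 < \<eta>"
    and \<epsilon>: "0 < \<epsilon>" and \<mu>: "0 < occupation_measure P \<Gamma> (X t) J"
  shows "measure P {om \<in> space P. \<epsilon> < \<bar>occupation_time \<Gamma> (X t) J om / occupation_measure P \<Gamma> (X t) J - 1\<bar>} <=
    (3 * (1 / \<eta> * (\<sigma> * lc) * sqrt ((measure N (space N) + 1) * (2 + KK * gap * T))) +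
     2 * (measure lebesgue \<Gamma> * (2 * (\<eta> / (sqrt (Cl * \<delta> powr \<alpha>) / 2))))) / (\<epsilon> * occupation_measure P \<Gamma> (X t) J)"
proof -
  have tT: "t \<in> {0..T}" using t by simp
  define \<mu> where "\<mu> = occupation_measure P \<Gamma> (X t) J"
  have \<mu>0: "0 < \<mu>" using \<mu> by (simp add: \<mu>_def)
  have b: "(indicator J :: real => real) \<in> bm borel" "!!x. \<bar>indicator J x :: real\<bar> <= 1"
    using J by (auto simp: indicator_def)
  \<comment> \<open>\<open>d x\<close> is the distance from \<open>x\<close> to
    \<open>{a..b}\<close>. The weight \<open>\<phi>\<close> is 1 on this interval and falls off with
    slope \<open>1 / \<eta>\<close>, so it can differ from the indicator of \<open>J\<close> only in
    two closed layers of width \<open>\<eta>\<close>, which \<open>\<xi>\<close> covers together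
    with the end points of \<open>J\<close>.\<close>
  define d where "d x = max 0 (max (a - x) (x - b))" for x
  define \<phi> where "\<phi> x = max 0 (1 - d x / \<eta>)" for x
  define \<xi> :: "real => real" where "\<xi> x = indicator {a - \<eta>..a} x + indicator {b..b + \<eta>} x" for x
  have d0: "0 <= d x" for x by (simp add: d_def)
  have dL: "\<bar>d x - d y\<bar> <= \<bar>x - y\<bar>" for x y by (auto simp: d_def max_def abs_if)
  have \<phi>01: "0 <= \<phi> x" "\<phi> x <= 1" for x using d0[of x] \<eta> by (auto simp: \<phi>_def)
  have \<phi>L: "\<bar>\<phi> x - \<phi> y\<bar> <= 1 / \<eta> * \<bar>x - y\<bar>" for x y
  proof -
    have "\<bar>\<phi> x - \<phi> y\<bar> <= \<bar>d x / \<eta> - d y / \<eta>\<bar>" by (auto simp: \<phi>_def max_def abs_if)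
    also have "... = \<bar>d x - d y\<bar> / \<eta>" using \<eta> by (simp add: diff_divide_distrib[symmetric])
    also have "... <= \<bar>x - y\<bar> / \<eta>" using dL \<eta> by (intro divide_right_mono) auto
    finally show ?thesis by simp
  qed
  have \<phi>m: "\<phi> \<in> bm borel" unfolding \<phi>_def[abs_def] d_def[abs_def] by (intro borel_measurable_continuous_onI continuous_intros) (use \<eta> in auto)
  have \<xi>m: "\<xi> \<in> bm borel" unfolding \<xi>_def[abs_def] by simp
  have \<xi>1: "\<bar>\<xi> x\<bar> <= 1" for x using J(1) by (auto simp: \<xi>_def indicator_def)
  have near: "\<bar>indicator J x - \<phi> x\<bar> <= \<xi> x" for x
  proof -
    consider "x < a - \<eta>" | "a - \<eta> <= x" "x <= a" | "a < x" "x < b" | "b <= x" "x <= b + \<eta>" | "b + \<eta> < x" by linarith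
    then show ?thesis
    proof cases
      case 1
      then have "x \<notin> J" "\<phi> x = 0" using J(1,3) \<eta> by (auto simp: \<phi>_def d_def max_def field_simps subset_iff)
      then show ?thesis by (simp add: \<xi>_def)
    next
      case 3
      then have "x \<in> J" "\<phi> x = 1" using J(2) by (auto simp: \<phi>_def d_def)
      then show ?thesis by (simp add: \<xi>_def)
    next
      case 5
      then have "x \<notin> J" "\<phi> x = 0" using J(1,3) \<eta> by (auto simp: \<phi>_def d_def max_def field_simps subset_iff)
      then show ?thesis by (simp add: \<xi>_def)
    qed (use \<phi>01[of x] in \<open>auto simp: \<xi>_def indicator_def\<close>)
  qed
  have E\<xi>: "(LINT om|P. \<xi> (X t y om)) <= 2 * (\<eta> / (sqrt (Cl * \<delta> powr \<alpha>) / 2))" if y: "y \<in> \<Gamma>" for y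
  proof -
    have yL: "y \<in> \<Lambda>" using y \<Gamma>_subset by auto
    have ii: "integrable P (%om. indicator {u..v} (X t y om) :: real)" for u v
      by (rule integrable_const_bound[where B=1]) (auto intro!: measurable_compose[OF slice2[OF tT yL]])
    have "(LINT om|P. \<xi> (X t y om)) = (LINT om|P. indicator {a - \<eta>..a} (X t y om)) + (LINT om|P. indicator {b..b + \<eta>} (X t y om))"
      unfolding \<xi>_def by (rule Bochner_Integration.integral_add[OF ii ii])
    also have "... <= (a - (a - \<eta>)) / (sqrt (Cl * \<delta> powr \<alpha>) / 2) + (b + \<eta> - b) / (sqrt (Cl * \<delta> powr \<alpha>) / 2)"
      using \<eta> by (subst (1 2) prob_indicator[OF tT _ yL]; (intro add_mono interval_probability_le[OF y])?; simp)
    finally show ?thesis by simp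
  qed
  define M where "M = occupation_time \<Gamma> (X t) J"
  have M: "M om = occ t (indicator J) om" if "om \<in> space P" for om
    unfolding M_def by (rule occupation_time_occ[OF tT J(4) that])
  have iM: "integrable P M"
    using occ_integrable(1)[OF tT b] Bochner_Integration.integrable_cong[OF refl M, of P] by simp
  have \<mu>M: "\<mu> = (LINT om|P. occ t (indicator J) om)" unfolding \<mu>_def by (rule occupation_measure_occ[OF tT J(4)])
  have "(LINT om|P. \<bar>M om - \<mu>\<bar>) = (LINT om|P. \<bar>occ t (indicator J) om - (LINT om|P. occ t (indicator J) om)\<bar>)"
    unfolding \<mu>M by (intro Bochner_Integration.integral_cong) (simp_all add: M)
  also have "... <= 3 * (1 / \<eta> * (\<sigma> * lc) * sqrt ((measure N (space N) + 1) * (2 + KK * gap * T))) +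
     2 * (measure lebesgue \<Gamma> * (2 * (\<eta> / (sqrt (Cl * \<delta> powr \<alpha>) / 2))))" (is "_ <= ?D")
    by (rule occ_deviation[OF tT b \<phi>m _ _ \<phi>L \<xi>m \<xi>1 near E\<xi>]) (use \<phi>01 \<eta> in auto)
  finally have D: "(LINT om|P. \<bar>M om - \<mu>\<bar>) <= ?D" .
  have iA: "integrable P (%om. \<bar>M om - \<mu>\<bar>)" using iM by auto
  have [measurable]: "M \<in> bm P" using iM by auto
  have "measure P {om \<in> space P. \<epsilon> < \<bar>M om / \<mu> - 1\<bar>} <= measure P {om \<in> space P. \<epsilon> * \<mu> <= \<bar>M om - \<mu>\<bar>}"
  proof (rule finite_measure_mono)
    have "\<epsilon> * \<mu> <= \<bar>M om - \<mu>\<bar>" if "\<epsilon> < \<bar>M om / \<mu> - 1\<bar>" for om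
    proof -
      have "M om / \<mu> - 1 = (M om - \<mu>) / \<mu>" using \<mu>0 by (simp add: field_simps)
      then show ?thesis using that \<mu>0 by (simp add: field_simps)
    qed
    then show "{om \<in> space P. \<epsilon> < \<bar>M om / \<mu> - 1\<bar>} \<subseteq> {om \<in> space P. \<epsilon> * \<mu> <= \<bar>M om - \<mu>\<bar>}" by blast
  qed measurable
  also have "... <= (LINT om|P. \<bar>M om - \<mu>\<bar>) / (\<epsilon> * \<mu>)"
    by (rule integral_Markov_inequality_measure[OF iA, where A="space P", simplified]) (use \<epsilon> \<mu>0 in auto)
  also have "... <= ?D / (\<epsilon> * \<mu>)" using D \<epsilon> \<mu>0 by (intro divide_right_mono) auto
  finally show ?thesis by (simp only: M_def \<mu>_def)
qed

end
end

text \<open>\<open>Q u\<close> equals \<open>B w\<close> almost everywhere, with \<open>w\<close>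
  the image of \<open>u\<close> under the adjoint of \<open>B\<close>. The norm of
  \<open>\<iota> u\<close> in the completion is the L2 norm of \<open>w\<close>, so boundedness of
  \<open>B\<close> bounds \<open>Q\<close> by the completion norm. Taking \<open>max K 1\<close>
  makes the constant positive.\<close>

lemma BB_adjoint_bound:
  fixes \<iota> :: "('a::euclidean_space => real) => 'h::{real_inner,banach,second_countable_topology}"
  assumes B: "bounded_operator \<Lambda> B" and Q: "is_BB_adjoint \<Lambda> B Q" and \<iota>: "is_completion \<Lambda> Q \<iota>"
  obtains Kb where "0 < Kb" "!!u. u \<in> L2 \<Lambda> ==> Q u \<in> L2 \<Lambda>"
    "!!u. u \<in> L2 \<Lambda> ==> (LINT x|lebesgue_on \<Lambda>. (Q u x)^2) <= Kb\<^sup>2 * (norm (\<iota> u))^2"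
proof -
  have lin: "linear_operator \<Lambda> (L2 \<Lambda>) B" and "\<exists>K. \<forall>u\<in>L2 \<Lambda>. L2_norm \<Lambda> (B u) <= K * L2_norm \<Lambda> u"
    using B by (simp_all add: bounded_operator_def)
  then obtain K where K: "!!u. u \<in> L2 \<Lambda> ==> L2_norm \<Lambda> (B u) <= K * L2_norm \<Lambda> u" by blast
  have BL: "!!u. u \<in> L2 \<Lambda> ==> B u \<in> L2 \<Lambda>" using lin by (simp add: linear_operator_def)
  define Kb where "Kb = max K 1"
  have nn: "0 <= L2_inner \<Lambda> w w" for w by (simp add: L2_inner_def)
  have n2: "(L2_norm \<Lambda> w)^2 = L2_inner \<Lambda> w w" for w using nn by (simp add: L2_norm_def)
  show ?thesis
  proof (rule that[of Kb])
    show "0 < Kb" by (simp add: Kb_def)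
    show QL: "Q u \<in> L2 \<Lambda>" if "u \<in> L2 \<Lambda>" for u using Q that unfolding is_BB_adjoint_def by blast
    fix u assume u: "u \<in> L2 \<Lambda>"
    obtain w where w: "adjoint_graph \<Lambda> (L2 \<Lambda>) B u w" "L2_eq \<Lambda> (Q u) (B w)"
      using Q u unfolding is_BB_adjoint_def by blast
    have wL: "w \<in> L2 \<Lambda>" using w(1) by (simp add: adjoint_graph_def)
    have m: "Q u \<in> bm (lebesgue_on \<Lambda>)" "B w \<in> bm (lebesgue_on \<Lambda>)" "u \<in> bm (lebesgue_on \<Lambda>)"
      using QL[OF u] BL[OF wL] u by (simp_all add: L2_def)
    have ae: "AE x in lebesgue_on \<Lambda>. Q u x = B w x" using w(2) by (simp add: L2_eq_def)
    have "(norm (\<iota> u))^2 = L2_inner \<Lambda> (Q u) u"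
      using \<iota> u unfolding is_completion_def power2_norm_eq_inner by blast
    also have "... = L2_inner \<Lambda> (B w) u"
      unfolding L2_inner_def by (intro integral_cong_AE borel_measurable_times m) (use ae in eventually_elim, simp)
    also have "... = L2_inner \<Lambda> w w" using w(1) wL unfolding adjoint_graph_def by blast
    finally have nw: "(norm (\<iota> u))^2 = (L2_norm \<Lambda> w)^2" by (simp add: n2)
    have "(LINT x|lebesgue_on \<Lambda>. (Q u x)^2) = (LINT x|lebesgue_on \<Lambda>. (B w x)^2)"
      by (intro integral_cong_AE borel_measurable_power m) (use ae in eventually_elim, simp)
    also have "... = (L2_norm \<Lambda> (B w))^2" by (simp add: n2) (simp add: L2_inner_def power2_eq_square)
    also have "... <= (Kb * L2_norm \<Lambda> w)^2"
    proof (rule power_mono)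
      have "K * L2_norm \<Lambda> w <= Kb * L2_norm \<Lambda> w" using nn by (intro mult_right_mono) (auto simp: Kb_def L2_norm_def)
      then show "L2_norm \<Lambda> (B w) <= Kb * L2_norm \<Lambda> w" using K[OF wL] by linarith
      show "0 <= L2_norm \<Lambda> (B w)" using nn by (simp add: L2_norm_def)
    qed
    finally show "(LINT x|lebesgue_on \<Lambda>. (Q u x)^2) <= Kb\<^sup>2 * (norm (\<iota> u))^2" by (simp add: nw power_mult_distrib)
  qed
qed

text \<open>Makes the sign of \<open>E T\<close> available outside the locale, where constants are
  fixed before the diffusivity varies.\<close>

lemma (in diffusion_model) growth_nonneg: "0 <= E T" by simp

text \<open>Comparability with Lebesgue measure is stated for intervals in a fixed bounded range,
  because the lower bound on the density decays at infinity. Both constants are chosen before the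
  interval and the diffusivity.\<close>

theorem lemma4p12:
  fixes \<Lambda> \<Gamma> :: "'a::euclidean_space set"
    and T \<nu>max t :: real
    and B Q :: "('a \<Rightarrow> real) \<Rightarrow> 'a \<Rightarrow> real"
    and \<iota> :: "('a \<Rightarrow> real) \<Rightarrow> 'h::{real_inner,banach,second_countable_topology}"
    and P :: "'w measure"
    and W :: "(real \<Rightarrow> 'h) \<Rightarrow> 'w \<Rightarrow> real"
    and D :: "real \<Rightarrow> ('a \<Rightarrow> real) set"
    and A :: "real \<Rightarrow> ('a \<Rightarrow> real) \<Rightarrow> 'a \<Rightarrow> real"
    and G :: "'a green"
    and f \<sigma> :: "real \<Rightarrow> real"
    and X0 :: "'a \<Rightarrow> real"
    and X :: "real \<Rightarrow> real \<Rightarrow> 'a \<Rightarrow> 'w \<Rightarrow> real"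
  assumes "0 < T" and "0 < \<nu>max"
    and "open \<Lambda>" and "bounded \<Lambda>" and "lipschitz_boundary \<Lambda>"
    and "\<Gamma> \<subseteq> \<Lambda>" and "connected \<Gamma>" and "\<Gamma> \<in> sets lebesgue" and "0 < measure lebesgue \<Gamma>"
    and "bounded_operator \<Lambda> B" and "is_BB_adjoint \<Lambda> B Q" and "is_completion \<Lambda> Q \<iota>"
    and "prob_space P" and "isonormal P T W"
    and "continuous_on \<Lambda> X0" and "bounded (X0 ` \<Lambda>)"
    and "\<And>\<nu>. \<nu> \<in> {0<..\<nu>max} \<Longrightarrow> 0 < \<sigma> \<nu>"
    and "well_posed \<Lambda> T \<nu>max Q \<iota> D A G f"
    and "noise_scaling \<Lambda> \<Gamma> T \<nu>max Q \<iota> G \<sigma>"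
    and "\<And>\<nu>. \<nu> \<in> {0<..\<nu>max} \<Longrightarrow> random_field_solution P \<Lambda> T Q \<iota> W G f X0 \<nu> (\<sigma> \<nu>) (X \<nu>)"
    and "0 < t" and "t \<le> T"
  shows "(\<forall>\<nu>\<in>{0<..\<nu>max}. \<forall>J. nondegenerate_interval J \<longrightarrow>
            occupation_measure P \<Gamma> (X \<nu> t) J =
              (LINT y|lebesgue_on \<Gamma>. measure P {\<omega> \<in> space P. X \<nu> t y \<omega> \<in> J})) \<and>
         (\<forall>R. \<exists>c>0. \<exists>C>0. \<forall>J. nondegenerate_interval J \<and> J \<subseteq> {-R..R} \<longrightarrow>
            (\<forall>\<nu>\<in>{0<..\<nu>max}.
               c * measure lborel J \<le> occupation_measure P \<Gamma> (X \<nu> t) J \<and>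
               occupation_measure P \<Gamma> (X \<nu> t) J \<le> C * measure lborel J)) \<and>
         (\<forall>J. nondegenerate_interval J \<longrightarrow>
            (\<forall>\<epsilon>>0. ((\<lambda>\<nu>. measure P {\<omega> \<in> space P.
                 \<epsilon> < \<bar>occupation_time \<Gamma> (X \<nu> t) J \<omega> / occupation_measure P \<Gamma> (X \<nu> t) J - 1\<bar>})
               \<longlongrightarrow> 0) (at_right 0)))"
proof -
  note well_posed = \<open>well_posed \<Lambda> T \<nu>max Q \<iota> D A G f\<close>[unfolded well_posed_def]
  obtain Kb where Kb: "0 < Kb" "!!u. u \<in> L2 \<Lambda> ==> Q u \<in> L2 \<Lambda>"
    "!!u. u \<in> L2 \<Lambda> ==> (LINT x|lebesgue_on \<Lambda>. (Q u x)^2) <= Kb\<^sup>2 * (norm (\<iota> u))^2"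
    by (rule BB_adjoint_bound[OF \<open>bounded_operator \<Lambda> B\<close> \<open>is_BB_adjoint \<Lambda> B Q\<close> \<open>is_completion \<Lambda> Q \<iota>\<close>]) blast
  note wp = well_posed[THEN conjunct2, THEN conjunct2, THEN conjunct2]
  obtain L where "L-lipschitz_on UNIV f" using well_posed[THEN conjunct1] by (rule exE)
  then have L: "0 <= L" "!!x y. \<bar>f x - f y\<bar> <= L * \<bar>x - y\<bar>"
    by (auto simp: lipschitz_on_def dist_real_def)
  obtain b0 where b0: "!!x. x \<in> X0 ` \<Lambda> ==> norm x <= b0" using \<open>bounded (X0 ` \<Lambda>)\<close> unfolding bounded_iff by blast
  define bX where "bX = max b0 0"
  have bX: "0 <= bX" "!!y. y \<in> \<Lambda> ==> \<bar>X0 y\<bar> <= bX" using b0 by (force simp: bX_def)+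
  have C0_ex: "\<exists>C0>0. \<forall>\<nu>\<in>{0<..\<nu>max}. \<forall>s t. 0 <= s \<and> s < t \<and> t <= T \<longrightarrow>
        (\<forall>u\<in>L2 \<Lambda>.
           (AE y in lebesgue_on \<Lambda>. integrable (lebesgue_on \<Lambda>) (%\<eta>. G \<nu> t s y \<eta> * u \<eta>)) \<and>
           evolution \<Lambda> G \<nu> t s u \<in> L2 \<Lambda> \<and>
           L2_norm \<Lambda> (evolution \<Lambda> G \<nu> t s u) <= C0 * L2_norm \<Lambda> u) \<and>
        (\<forall>y\<in>\<Lambda>. integrable (lebesgue_on \<Lambda>) (G \<nu> t s y) \<and>
           (LINT \<eta>|lebesgue_on \<Lambda>. \<bar>G \<nu> t s y \<eta>\<bar>) <= C0)"
    by (rule wp[THEN conjunct2, THEN conjunct2, THEN conjunct2, THEN conjunct1])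
  obtain C0 where C0: "0 < C0"
    "!!\<nu> s t u. \<nu> \<in> {0<..\<nu>max} ==> 0 <= s ==> s < t ==> t <= T ==> u \<in> L2 \<Lambda> ==>
           (AE y in lebesgue_on \<Lambda>. integrable (lebesgue_on \<Lambda>) (%\<eta>. G \<nu> t s y \<eta> * u \<eta>)) \<and>
           evolution \<Lambda> G \<nu> t s u \<in> L2 \<Lambda> \<and>
           L2_norm \<Lambda> (evolution \<Lambda> G \<nu> t s u) <= C0 * L2_norm \<Lambda> u"
    "!!\<nu> s t y. \<nu> \<in> {0<..\<nu>max} ==> 0 <= s ==> s < t ==> t <= T ==> y \<in> \<Lambda> ==>
        integrable (lebesgue_on \<Lambda>) (G \<nu> t s y) \<and> (LINT \<eta>|lebesgue_on \<Lambda>. \<bar>G \<nu> t s y \<eta>\<bar>) <= C0"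
    using C0_ex by blast
  have \<sigma>0: "(\<sigma> \<longlongrightarrow> 0) (at_right 0)"
    using \<open>noise_scaling \<Lambda> \<Gamma> T \<nu>max Q \<iota> G \<sigma>\<close> by (simp add: noise_scaling_def)
  obtain Cl Cu \<alpha> where C: "0 < Cl" "Cl <= Cu" "0 < \<alpha>"
    and noise: "!!r t \<nu> y. r \<in> {0..<T} ==> t \<in> {0..T - r} ==> \<nu> \<in> {0<..\<nu>max} ==> y \<in> \<Lambda> ==> ennreal ((\<sigma> \<nu>)^2) *
           (NINT s|(lebesgue_on {0..t}). ennreal ((norm (to_H \<Lambda> Q \<iota> (G \<nu> (r + t) (r + s) y)))^2)) <= ennreal (Cu * t powr \<alpha>)"
      "!!r t \<nu> y. r \<in> {0..<T} ==> t \<in> {0..T - r} ==> \<nu> \<in> {0<..\<nu>max} ==> y \<in> \<Gamma> ==> ennreal (Cl * t powr \<alpha>) <= ennreal ((\<sigma> \<nu>)^2) *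
           (NINT s|(lebesgue_on {0..t}). ennreal ((norm (to_H \<Lambda> Q \<iota> (G \<nu> (r + t) (r + s) y)))^2))"
    using \<open>noise_scaling \<Lambda> \<Gamma> T \<nu>max Q \<iota> G \<sigma>\<close> unfolding noise_scaling_def Let_def by blast
  have G: "\<forall>\<nu>\<in>{0<..\<nu>max}.
        (%(t, s, y, \<eta>). G \<nu> t s y \<eta>) \<in> bm (restrict_space borel
           {(t, s, y, \<eta>). 0 <= s \<and> s < t \<and> t <= T \<and> y \<in> \<Lambda> \<and> \<eta> \<in> \<Lambda>})"
    "\<forall>\<nu>\<in>{0<..\<nu>max}. \<forall>s t. 0 <= s \<and> s < t \<and> t <= T \<longrightarrow> (\<forall>y\<in>\<Lambda>. \<forall>\<eta>\<in>\<Lambda>. 0 <= G \<nu> t s y \<eta>)"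
    "\<forall>\<nu>\<in>{0<..\<nu>max}. \<forall>t\<in>{0..T}. \<forall>y\<in>\<Lambda>. AE s in lebesgue_on {0..t}. \<exists>h. represents \<Lambda> Q \<iota> (G \<nu> t s y) h"
    by (rule wp[THEN conjunct1], rule wp[THEN conjunct2, THEN conjunct1])
      (use wp[THEN conjunct2, THEN conjunct2, THEN conjunct2, THEN conjunct2, THEN conjunct2] in blast)
  have model: "diffusion_model \<Lambda> \<Gamma> T Q \<iota> P W G f X0 \<nu> (\<sigma> \<nu>) (X \<nu>) C0 L Kb Cl Cu \<alpha> bX" if \<nu>: "\<nu> \<in> {0<..\<nu>max}" for \<nu>
  proof (rule diffusion_model.intro)
    show "0 < \<sigma> \<nu>" "random_field_solution P \<Lambda> T Q \<iota> W G f X0 \<nu> (\<sigma> \<nu>) (X \<nu>)" using assms \<nu> by blast+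
    show "(%(t, s, y, \<eta>). G \<nu> t s y \<eta>) \<in> bm (restrict_space borel
           {(t, s, y, \<eta>). 0 <= s \<and> s < t \<and> t <= T \<and> y \<in> \<Lambda> \<and> \<eta> \<in> \<Lambda>})" using G(1) \<nu> by blast
    show "0 <= G \<nu> t s y \<eta>" if "0 <= s" "s < t" "t <= T" "y \<in> \<Lambda>" "\<eta> \<in> \<Lambda>" for s t y \<eta> using G(2) \<nu> that by blast
    show "AE s in lebesgue_on {0..t}. \<exists>h. represents \<Lambda> Q \<iota> (G \<nu> t s y) h" if "t \<in> {0..T}" "y \<in> \<Lambda>" for t y
      using G(3) \<nu> that by blast
  qed (fact assms Kb L bX C0(1) C0(2)[OF \<nu>] C0(3)[OF \<nu>] C noise(1)[OF _ _ \<nu>] noise(2)[OF _ _ \<nu>])+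
  \<comment> \<open>\<open>E\<close>, \<open>d\<close> and \<open>\<delta>\<close> are built from
    shared constants. In the smallness condition both sides contain the factor
    \<open>sqrt (\<delta> powr \<alpha>)\<close>, so it reduces to the linear condition
    \<open>d * \<delta> <= sqrt Cl / 2\<close>.\<close>
  define E where "E = volterra.E C0 L T"
  define d where "d = C0 * (L * (2 * sqrt Cu * E))"
  define \<delta> where "\<delta> = min t (sqrt Cl / 2 / (d + 1))"
  have E: "0 <= E"
    unfolding E_def using \<open>0 < \<nu>max\<close> by (intro diffusion_model.growth_nonneg[OF model]) auto
  have d: "0 <= d" unfolding d_def using C0 L C E by (intro mult_nonneg_nonneg) auto
  have "0 < sqrt Cl / 2 / (d + 1)" using d C by (intro divide_pos_pos) auto
  then have \<delta>: "0 < \<delta>" "\<delta> <= t" using \<open>0 < t\<close> by (auto simp: \<delta>_def)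
  have small: "C0 * (L * (2 * sqrt (Cu * \<delta> powr \<alpha>) * volterra.E C0 L T)) * \<delta> <= sqrt (Cl * \<delta> powr \<alpha>) / 2"
  proof -
    have "d * \<delta> <= (d + 1) * \<delta>" using \<delta> by (intro mult_right_mono) auto
    also have "... <= (d + 1) * (sqrt Cl / 2 / (d + 1))"
      using d by (intro mult_left_mono) (auto simp: \<delta>_def)
    also have "... = sqrt Cl / 2"
      by (subst times_divide_eq_right, rule nonzero_mult_div_cancel_left) (use d in linarith)
    finally have "d * \<delta> <= sqrt Cl / 2" .
    then have "d * \<delta> * sqrt (\<delta> powr \<alpha>) <= sqrt Cl / 2 * sqrt (\<delta> powr \<alpha>)"
      by (rule mult_right_mono) simp
    moreover have "C0 * (L * (2 * sqrt (Cu * \<delta> powr \<alpha>) * volterra.E C0 L T)) * \<delta> = d * \<delta> * sqrt (\<delta> powr \<alpha>)"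
      unfolding d_def real_sqrt_mult E_def by (simp only: mult_ac)
    ultimately show ?thesis unfolding real_sqrt_mult by (simp only: times_divide_eq_left)
  qed
  note t = \<open>0 < t\<close> \<open>t <= T\<close>
  define m\<Gamma> where "m\<Gamma> = measure lebesgue \<Gamma>"
  have m\<Gamma>: "0 < m\<Gamma>" using assms by (simp add: m\<Gamma>_def)
  define A0 where "A0 = sqrt (Cl * \<delta> powr \<alpha>) / 2"
  have A0: "0 < A0" using C \<delta> by (simp add: A0_def)
  \<comment> \<open>Written with the explicit parameters of the locale constants, which show that no
    diffusivity enters the bounds below.\<close>
  define M where "M = 2 * spde.m1 T C0 L f (diffusion_model.q T Cu \<alpha>) (max 1 C0 * bX) + 1"
  define q1 where "q1 = sqrt (Cu * \<delta> powr \<alpha>)"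
  have q1: "0 <= q1" using C by (simp add: q1_def)
  define c where "c R = m\<Gamma> * (std_normal_density ((R + M) / A0) / (q1 + A0) / 2)" for R
  have c: "0 < c R" for R
    unfolding c_def using m\<Gamma> A0 q1 by (intro mult_pos_pos divide_pos_pos normal_density_pos) auto
  have upper: "occupation_measure P \<Gamma> (X \<nu> t) J <= m\<Gamma> / A0 * (b - a)"
    if "\<nu> \<in> {0<..\<nu>max}" "a < b" "{a<..<b} \<subseteq> J" "J \<subseteq> {a..b}" "J \<in> sets borel" for \<nu> a b J
  proof -
    have "occupation_measure P \<Gamma> (X \<nu> t) J <= m\<Gamma> * ((b - a) / A0)"
      unfolding m\<Gamma>_def A0_def by (rule diffusion_model.occupation_measure_bounds(1)[OF model[OF that(1)] t \<delta> small that(2-5)])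
    then show ?thesis by simp
  qed
  have lower: "c R * (b - a) <= occupation_measure P \<Gamma> (X \<nu> t) J"
    if "\<nu> \<in> {0<..\<nu>max}" "a < b" "{a<..<b} \<subseteq> J" "J \<subseteq> {a..b}" "J \<in> sets borel" "\<bar>a\<bar> <= R" "\<bar>b\<bar> <= R" for \<nu> a b J R
    using diffusion_model.occupation_measure_bounds(2)[OF model[OF that(1)] t \<delta> small that(2-7)]
    unfolding c_def M_def A0_def q1_def m\<Gamma>_def by (simp only: mult.assoc)
  show ?thesis
  proof (intro conjI ballI allI impI)
    fix \<nu> J assume \<nu>: "\<nu> \<in> {0<..\<nu>max}" and J: "nondegenerate_interval J"
    obtain a b where "a < b" "{a<..<b} \<subseteq> J" "J \<subseteq> {a..b}" "J \<in> sets borel" "measure lborel J = b - a"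
      by (rule nondegenerate_interval_bounds[OF J])
    then show "occupation_measure P \<Gamma> (X \<nu> t) J = (LINT y|lebesgue_on \<Gamma>. measure P {om \<in> space P. X \<nu> t y om \<in> J})"
      using t by (intro diffusion_model.occupation_measure_eq[OF model[OF \<nu>]]) auto
  next
    fix R
    show "\<exists>c>0. \<exists>C>0. \<forall>J. nondegenerate_interval J \<and> J \<subseteq> {-R..R} \<longrightarrow>
            (\<forall>\<nu>\<in>{0<..\<nu>max}.
               c * measure lborel J <= occupation_measure P \<Gamma> (X \<nu> t) J \<and>
               occupation_measure P \<Gamma> (X \<nu> t) J <= C * measure lborel J)"
    proof (rule exI[of _ "c R"], rule conjI[OF c], rule exI[of _ "m\<Gamma> / A0"], intro conjI allI impI ballI)
      show "0 < m\<Gamma> / A0" using m\<Gamma> A0 by simp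
      fix J \<nu> assume J: "nondegenerate_interval J \<and> J \<subseteq> {-R..R}" and \<nu>: "\<nu> \<in> {0<..\<nu>max}"
      obtain a b where ab: "a < b" "{a<..<b} \<subseteq> J" "J \<subseteq> {a..b}" "J \<in> sets borel" "measure lborel J = b - a"
        by (rule nondegenerate_interval_bounds[OF J[THEN conjunct1]])
      have "{a<..<b} \<subseteq> {-R..R}" using J ab by blast
      then have R: "\<bar>a\<bar> <= R" "\<bar>b\<bar> <= R" using ab(1) by (auto simp: greaterThanLessThan_subseteq_atLeastAtMost_iff)
      show "c R * measure lborel J <= occupation_measure P \<Gamma> (X \<nu> t) J" using lower[OF \<nu> ab(1-4) R] ab(5) by simp
      show "occupation_measure P \<Gamma> (X \<nu> t) J <= m\<Gamma> / A0 * measure lborel J" using upper[OF \<nu> ab(1-4)] ab(5) by simp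
    qed
  next
    fix J and \<epsilon> :: real assume J: "nondegenerate_interval J" and \<epsilon>: "0 < \<epsilon>"
    obtain a b where ab: "a < b" "{a<..<b} \<subseteq> J" "J \<subseteq> {a..b}" "J \<in> sets borel" "measure lborel J = b - a"
      by (rule nondegenerate_interval_bounds[OF J])
    define R where "R = max \<bar>a\<bar> \<bar>b\<bar>"
    define c0 where "c0 = c R * (b - a)"
    have c0: "0 < c0" unfolding c0_def using c ab(1) by simp
    have \<mu>: "c0 <= occupation_measure P \<Gamma> (X \<nu> t) J" if "\<nu> \<in> {0<..\<nu>max}" for \<nu>
      unfolding c0_def by (rule lower[OF that ab(1-4)]) (auto simp: R_def)
    define k where "k = diffusion_model.lc T C0 Kb * sqrt ((measure (diffusion_model.N \<Lambda>) (space (diffusion_model.N \<Lambda>)) + 1) * (2 + volterra.KK T C0 L * spde.gap T C0 L * T))"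
    show "((%\<nu>. measure P {om \<in> space P.
                 \<epsilon> < \<bar>occupation_time \<Gamma> (X \<nu> t) J om / occupation_measure P \<Gamma> (X \<nu> t) J - 1\<bar>}) \<longlongrightarrow> 0) (at_right 0)"
    proof (rule tendstoI)
      fix r :: real assume r: "0 < r"
      \<comment> \<open>Chosen so that the boundary layers contribute exactly
        \<open>r * \<epsilon> * c0 / 2\<close>; the other half is left to the term with the noise
        level, which vanishes in the limit.\<close>
      define \<eta> where "\<eta> = r * \<epsilon> * c0 * A0 / (8 * m\<Gamma>)"
      have \<eta>: "0 < \<eta>" using r \<epsilon> c0 A0 m\<Gamma> by (simp add: \<eta>_def)
      have "((%\<nu>. 3 * (1 / \<eta> * \<sigma> \<nu> * k)) \<longlongrightarrow> 3 * (1 / \<eta> * 0 * k)) (at_right 0)"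
        by (intro tendsto_intros \<sigma>0)
      then have "\<forall>\<^sub>F \<nu> in at_right 0. 3 * (1 / \<eta> * \<sigma> \<nu> * k) < r * \<epsilon> * c0 / 2"
        by (rule order_tendstoD) (use r \<epsilon> c0 in simp)
      moreover have "\<forall>\<^sub>F \<nu> in at_right 0. \<nu> \<in> {0<..\<nu>max}"
        using \<open>0 < \<nu>max\<close> unfolding eventually_at_right_field by (intro exI[of _ \<nu>max]) auto
      ultimately show "\<forall>\<^sub>F \<nu> in at_right 0. dist (measure P {om \<in> space P.
                 \<epsilon> < \<bar>occupation_time \<Gamma> (X \<nu> t) J om / occupation_measure P \<Gamma> (X \<nu> t) J - 1\<bar>}) 0 < r"
      proof eventually_elim
        case (elim \<nu>)
        define \<mu>\<nu> where "\<mu>\<nu> = occupation_measure P \<Gamma> (X \<nu> t) J"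
        have \<mu>\<nu>: "c0 <= \<mu>\<nu>" "0 < \<mu>\<nu>" using \<mu>[OF elim(2)] c0 by (auto simp: \<mu>\<nu>_def)
        have "measure P {om \<in> space P. \<epsilon> < \<bar>occupation_time \<Gamma> (X \<nu> t) J om / \<mu>\<nu> - 1\<bar>} <=
            (3 * (1 / \<eta> * \<sigma> \<nu> * k) + 2 * (m\<Gamma> * (2 * (\<eta> / A0)))) / (\<epsilon> * \<mu>\<nu>)"
          using diffusion_model.occupation_deviation[OF model[OF elim(2)] t \<delta> small ab(1-4) \<eta> \<epsilon> \<mu>\<nu>(2)[unfolded \<mu>\<nu>_def]]
          unfolding \<mu>\<nu>_def k_def m\<Gamma>_def A0_def by (simp only: mult.assoc)
        also have "... < r"
        proof -
          have "2 * (m\<Gamma> * (2 * (\<eta> / A0))) = r * \<epsilon> * c0 / 2" using m\<Gamma> A0 by (simp add: \<eta>_def field_simps)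
          moreover have "x + y < z" if "y = z / 2" "x < z / 2" for x y z :: real using that by simp
          ultimately have "3 * (1 / \<eta> * \<sigma> \<nu> * k) + 2 * (m\<Gamma> * (2 * (\<eta> / A0))) < r * \<epsilon> * c0" using elim(1) by blast
          also have "... <= r * \<epsilon> * \<mu>\<nu>" by (rule mult_left_mono[OF \<mu>\<nu>(1)]) (use r \<epsilon> in simp)
          also have "... = r * (\<epsilon> * \<mu>\<nu>)" by (rule mult.assoc)
          finally show ?thesis using \<epsilon> \<mu>\<nu>(2) by (subst pos_divide_less_eq) (rule mult_pos_pos)
        qed
        finally show ?case unfolding \<mu>\<nu>_def dist_real_def diff_0_right abs_of_nonneg[OF measure_nonneg] .
      qed
    qed
  qed
qed

end
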